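(* Let $I\subset\mathbb{R}$ be an interval and let $\mathbb{B}(x;\lambda)$, $x\in(0,1)$, $\lambda\in I$, satisfy Assumptions (A) (stated in the context). Let $\Theta\in\mathbb{C}^{2n\times4n}$ satisfy $\operatorname{rank}\Theta=2n$ and $\Theta\mathcal{J}_{4n}\Theta^*=0$. Fix $\lambda_1,\lambda_2\in I$, $\lambda_1<\lambda_2$. Let $\Phi(x;\lambda)$ be the $2n\times2n$ solution of $J\Phi'=\mathbb{B}(x;\lambda)\Phi$, $\Phi(0;\lambda)=I_{2n}$, with $n\times n$ blocks $\Phi_{ij}$, and set $$\mathbf{X}_3(x;\lambda)=\begin{pmatrix}I_n&0\\ \Phi_{11}(x;\lambda)&\Phi_{12}(x;\lambda)\\ 0&-I_n\\ \Phi_{21}(x;\lambda)&\Phi_{22}(x;\lambda)\end{pmatrix}.$$ Let $\mathbf{X}_4(x;\lambda_2)\in\mathbb{C}^{4n\times2n}$ solve $J_{4n}\mathbf{X}_4'=\mathcal{B}(x;\lambda_2)\mathbf{X}_4$, $\mathbf{X}_4(1;\lambda_2)=\mathcal{M}\mathcal{J}_{4n}\Theta^*$. Let $\ell_3(x;\lambda)$ and $\ell_4(x;\lambda_2)$ be the Lagrangian subspaces of $\mathbb{C}^{4n}$ with respective frames $\mathbf{X}_3(x;\lambda)$ and $\mathbf{X}_4(x;\lambda_2)$. Assume that for any $\lambda\in I$ the matrix $\int_0^1\Phi(x;\lambda)^*\,\mathbb{B}_\lambda(x;\lambda)\,\Phi(x;\lambda)\,dx$ is positive definite. Let $\mathcal{N}([\lambda_1,\lambda_2))$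 be the spectral count (number of eigenvalues in $[\lambda_1,\lambda_2)$, counted with geometric multiplicity) of $Jy'=\mathbb{B}(x;\lambda)y$ with boundary conditions $\Theta\binom{y(0;\lambda)}{y(1;\lambda)}=0$. Then $$\mathcal{N}([\lambda_1,\lambda_2))=\operatorname{Mas}(\ell_3(\cdot;\lambda_1),\ell_4(\cdot;\lambda_2);[0,1]).$$ Moreover, suppose additionally that $\mathbb{B}(x;\lambda_2)-\mathbb{B}(x;\lambda_1)$ is non-negative for a.e. $x\in(0,1)$, and that there is no interval $[a,b]\subset[0,1]$, $a<b$, such that $\dim(\ell_3(x;\lambda_1)\cap\ell_4(x;\lambda_2))\ne0$ for all $x\in[a,b]$. Then $$\mathcal{N}([\lambda_1,\lambda_2))=\sum_{x\in(0,1]}\dim\ker\big(\mathbf{X}_3(x;\lambda_1)^*J_{4n}\,\mathbf{X}_4(x;\lambda_2)\big).$$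
   Context: $n\in\{1,2,\dots\}$, $J=\begin{pmatrix}0_n&-I_n\\ I_n&0_n\end{pmatrix}$, $J_{4n}=\begin{pmatrix}0_{2n}&-I_{2n}\\ I_{2n}&0_{2n}\end{pmatrix}$, $\mathcal{J}_{4n}=\begin{pmatrix}-J&0\\ 0&J\end{pmatrix}$, $$\mathcal{M}=\begin{pmatrix}I_n&0&0&0\\ 0&0&I_n&0\\ 0&-I_n&0&0\\ 0&0&0&I_n\end{pmatrix},\qquad \mathcal{B}(x;\lambda)=\begin{pmatrix}0&0&0&0\\ 0&B_{11}&0&B_{12}\\ 0&0&0&0\\ 0&B_{21}&0&B_{22}\end{pmatrix}(x;\lambda),\qquad \mathbb{B}=\begin{pmatrix}B_{11}&B_{12}\\ B_{21}&B_{22}\end{pmatrix},$$ where all blocks are $n\times n$; $*$ denotes adjoint. The system is $Jy'=\mathbb{B}(x;\lambda)y$, $x\in(0,1)$, $y(x;\lambda)\in\mathbb{C}^{2n}$; solutions are absolutely continuous on $[0,1]$ and satisfy the equation a.e. "Non-negative" means positive semidefinite. $\mathbb{B}_\lambda=\partial_\lambda\mathbb{B}$. Assumptions (A): for each $\lambda\in I$, $\mathbb{B}(x;\lambda)\in\mathbb{C}^{2n\times2n}$ is a measurable function of $x$, self-adjoint for a.e. $x\in(0,1)$, and there is $b_0\in L^1((0,1),\mathbb{R})$ such that for each $\lambda\in I$, $\|\mathbb{B}(x;\lambda)\|\le b_0(x)$ for a.e. $x\in(0,1)$; moreover $\mathbb{B}$ is differentiable in $\lambda$ and there is $b_1\in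 L^1((0,1),\mathbb{R})$ such that for each $\lambda\in I$, $\|\mathbb{B}_\lambda(x;\lambda)\|\le b_1(x)$ for a.e. $x\in(0,1)$. Eigenvalues and spectral count: $\lambda\in I$ is an eigenvalue if there is a nonzero $y(\cdot;\lambda)\in AC([0,1],\mathbb{C}^{2n})$ solving the system and the boundary conditions. $\mathbb{E}(\lambda)$ is the linear space of all such solutions (together with $0$), and $\mathcal{N}([\lambda_1,\lambda_2))=\sum_{\lambda\in[\lambda_1,\lambda_2)}\dim\mathbb{E}(\lambda)$. Lagrangian subspaces: for a positive integer $N$, a subspace $\ell\subset\mathbb{C}^{2N}$ is Lagrangian if $\dim\ell=N$ and $(J_{(N)}u,v)=0$ for all $u,v\in\ell$, where $J_{(N)}=\begin{pmatrix}0_N&-I_N\\ I_N&0_N\end{pmatrix}$; $\Lambda(N)$ is the set of all Lagrangian subspaces of $\mathbb{C}^{2N}$, with metric $d(\ell,\ell')=\|\mathcal{P}-\mathcal{P}'\|$, where $\mathcal{P},\mathcal{P}'$ are the orthogonal projections onto $\ell,\ell'$. A frame for $\ell$ is a $2N\times N$ matrix $\mathbf{X}=\binom{X}{Y}$ ($X,Y\in\mathbb{C}^{N\times N}$) whose columns form a basis of $\ell$. Here $N=2n$. (The matrices $\mathbf{X}_3(x;\lambda)$, $\mathbf{X}_4(x;\lambda_2)$ are frames for Lagrangian subspaces of $\mathbb{C}^{4n}$ for every $x\in[0,1]$.) Maslov index: let $\ell,\ell':[a,b]\to\Lambda(N)$ be continuous with frames $\binom{X(t)}{Y(t)}$, $\binom{X'(t)}{Y'(t)}$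 (primes here are not derivatives), and set $$\tilde W(t)=-(X+iY)(X-iY)^{-1}(X'-iY')(X'+iY')^{-1},$$ a continuous path of unitary $N\times N$ matrices. Choose a partition $a=t_0<t_1<\dots<t_M=b$ and numbers $\epsilon_j\in(0,\pi)$, $j=1,\dots,M$, so that $e^{i(\pi\pm\epsilon_j)}\notin\sigma(\tilde W(t))$ for $t_{j-1}\le t\le t_j$. Put $k(t,\epsilon_j)=\sum_{0\le\theta<\epsilon_j}\dim\ker(\tilde W(t)-e^{i(\pi+\theta)}I)$. Then $\operatorname{Mas}(\ell,\ell';[a,b])=\sum_{j=1}^M\big(k(t_j,\epsilon_j)-k(t_{j-1},\epsilon_j)\big)$, which does not depend on the choices made. *)

theory Defs
  imports "HOL-Analysis.Analysis" "HOL-Library.Function_Algebras"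
begin

section \<open>Block matrices\<close>

text \<open>
  Vectors in \<open>\<complex>\<^bsup>2N\<^esup>\<close> are indexed by a sum type \<open>'m + 'm\<close> with \<open>CARD('m) = N\<close>, and vectors in
  \<open>\<complex>\<^bsup>4n\<^esup>\<close> by \<open>('n + 'n) + ('n + 'n)\<close>. A matrix is the vector of its rows, so \<open>stack\<close> puts one vector,
  or one matrix, on top of another.
\<close>

definition stack :: "'a ^ 'p \<Rightarrow> 'a ^ 'q \<Rightarrow> 'a ^ ('p::finite + 'q::finite)" where
  "stack u v = (\<chi> i. case i of Inl r \<Rightarrow> u $ r | Inr r \<Rightarrow> v $ r)"

definition upper :: "'a ^ ('p::finite + 'q::finite) \<Rightarrow> 'a ^ 'p" where
  "upper u = (\<chi> r. u $ Inl r)"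

definition lower :: "'a ^ ('p::finite + 'q::finite) \<Rightarrow> 'a ^ 'q" where
  "lower u = (\<chi> r. u $ Inr r)"

definition blockmat :: "'a ^ 'c ^ 'p \<Rightarrow> 'a ^ 'd ^ 'p \<Rightarrow> 'a ^ 'c ^ 'q \<Rightarrow> 'a ^ 'd ^ 'q \<Rightarrow>
    'a ^ ('c::finite + 'd::finite) ^ ('p::finite + 'q::finite)" where
  "blockmat A B C D = stack (\<chi> r. stack (A $ r) (B $ r)) (\<chi> r. stack (C $ r) (D $ r))"

definition blk11 :: "'a ^ ('c::finite + 'd::finite) ^ ('p::finite + 'q::finite) \<Rightarrow> 'a ^ 'c ^ 'p" where
  "blk11 A = (\<chi> i j. A $ Inl i $ Inl j)"

definition blk12 :: "'a ^ ('c::finite + 'd::finite) ^ ('p::finite + 'q::finite) \<Rightarrow> 'a ^ 'd ^ 'p" where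
  "blk12 A = (\<chi> i j. A $ Inl i $ Inr j)"

definition blk21 :: "'a ^ ('c::finite + 'd::finite) ^ ('p::finite + 'q::finite) \<Rightarrow> 'a ^ 'c ^ 'q" where
  "blk21 A = (\<chi> i j. A $ Inr i $ Inl j)"

definition blk22 :: "'a ^ ('c::finite + 'd::finite) ^ ('p::finite + 'q::finite) \<Rightarrow> 'a ^ 'd ^ 'q" where
  "blk22 A = (\<chi> i j. A $ Inr i $ Inr j)"


section \<open>Complex linear algebra\<close>

definition adj :: "complex ^ 'c ^ 'r \<Rightarrow> complex ^ 'r ^ 'c" where
  "adj A = (\<chi> i j. cnj (A $ j $ i))"

definition cdot :: "complex ^ 'm \<Rightarrow> complex ^ 'm \<Rightarrow> complex" where
  "cdot u v = (\<Sum>i\<in>UNIV. u $ i * cnj (v $ i))"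

definition self_adjoint :: "complex ^ 'm ^ 'm \<Rightarrow> bool" where
  "self_adjoint A \<longleftrightarrow> adj A = A"

definition pos_def :: "complex ^ 'm ^ 'm \<Rightarrow> bool" where
  "pos_def A \<longleftrightarrow> self_adjoint A \<and> (\<forall>v. v \<noteq> 0 \<longrightarrow> Re (cdot (A *v v) v) > 0)"

definition nonneg_def :: "complex ^ 'm ^ 'm \<Rightarrow> bool" where
  "nonneg_def A \<longleftrightarrow> self_adjoint A \<and> (\<forall>v. Re (cdot (A *v v) v) \<ge> 0)"

definition ker :: "complex ^ 'c ^ 'r \<Rightarrow> (complex ^ 'c) set" where
  "ker A = {v. A *v v = 0}"

definition spectrum_of :: "complex ^ 'm ^ 'm \<Rightarrow> complex set" where
  "spectrum_of A = {z. \<exists>v. v \<noteq> 0 \<and> A *v v = z *s v}"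

definition op_norm :: "complex ^ 'c ^ 'r \<Rightarrow> real" where
  "op_norm A = onorm ((*v) A)"

text \<open>
  On \<open>\<complex>\<^bsup>2N\<^esup>\<close> this is \<open>J\<^sub>(\<^sub>N\<^sub>)\<close>: it is \<open>J\<close> for \<open>'m = 'n\<close>, and \<open>J\<^sub>4\<^sub>n\<close> for \<open>'m = 'n + 'n\<close>.
\<close>

definition Jmat :: "complex ^ ('m::finite + 'm) ^ ('m + 'm)" where
  "Jmat = blockmat 0 (- mat 1) (mat 1) 0"

definition calJ :: "complex ^ (('n::finite + 'n) + ('n + 'n)) ^ (('n + 'n) + ('n + 'n))" where
  "calJ = blockmat (- Jmat) 0 0 Jmat"

definition calM :: "complex ^ (('n::finite + 'n) + ('n + 'n)) ^ (('n + 'n) + ('n + 'n))" where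
  "calM = blockmat
     (blockmat (mat 1) 0
               0       0)            (blockmat 0       0
                                               (mat 1) 0)
     (blockmat 0 (- mat 1)
               0 0)                  (blockmat 0 0
                                               0 (mat 1))"

definition calB :: "complex ^ ('n::finite + 'n) ^ ('n + 'n) \<Rightarrow>
    complex ^ (('n + 'n) + ('n + 'n)) ^ (('n + 'n) + ('n + 'n))" where
  "calB A = blockmat
     (blockmat 0 0
               0 (blk11 A))          (blockmat 0 0
                                               0 (blk12 A))
     (blockmat 0 0
               0 (blk21 A))          (blockmat 0 0
                                               0 (blk22 A))"

definition frame3 :: "complex ^ ('n::finite + 'n) ^ ('n + 'n) \<Rightarrow>
    complex ^ ('n + 'n) ^ (('n + 'n) + ('n + 'n))" where
  "frame3 P = stack
     (blockmat (mat 1)   0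
               (blk11 P) (blk12 P))
     (blockmat 0         (- mat 1)
               (blk21 P) (blk22 P))"


section \<open>The differential system\<close>

text \<open>
  Absolute continuity on \<open>[a,b]\<close>: a division of the (arbitrary) set \<open>\<Union>D\<close> is a finite family of
  non-overlapping compact intervals \<open>[Inf k, Sup k]\<close>.
\<close>

definition abs_continuous :: "real \<Rightarrow> real \<Rightarrow> (real \<Rightarrow> 'b::real_normed_vector) \<Rightarrow> bool" where
  "abs_continuous a b f \<longleftrightarrow>
     (\<forall>\<epsilon>>0. \<exists>\<delta>>0. \<forall>D. D division_of (\<Union>D) \<and> \<Union>D \<subseteq> {a..b} \<and> (\<Sum>k\<in>D. Sup k - Inf k) < \<delta>
        \<longrightarrow> (\<Sum>k\<in>D. norm (f (Sup k) - f (Inf k))) < \<epsilon>)"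

text \<open>Solutions of \<open>J Y' = A(x) Y\<close> on \<open>(0,1)\<close>, for vector-valued and for matrix-valued \<open>Y\<close>.\<close>

definition vec_solution :: "(real \<Rightarrow> complex ^ ('m::finite + 'm) ^ ('m + 'm)) \<Rightarrow>
    (real \<Rightarrow> complex ^ ('m + 'm)) \<Rightarrow> bool" where
  "vec_solution A y \<longleftrightarrow> abs_continuous 0 1 y \<and>
     (AE x in lebesgue_on {0<..<1}. \<exists>y'. (y has_vector_derivative y') (at x) \<and>
        Jmat *v y' = A x *v y x)"

definition mat_solution :: "(real \<Rightarrow> complex ^ ('m::finite + 'm) ^ ('m + 'm)) \<Rightarrow>
    (real \<Rightarrow> complex ^ 'c ^ ('m + 'm)) \<Rightarrow> bool" where
  "mat_solution A Y \<longleftrightarrow> abs_continuous 0 1 Y \<and>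
     (AE x in lebesgue_on {0<..<1}. \<exists>Y'. (Y has_vector_derivative Y') (at x) \<and>
        Jmat ** Y' = A x ** Y x)"

text \<open>
  Assumptions (A). The coefficient \<open>B\<close> is applied as \<open>B x \<lambda>\<close>. The matrix \<open>Bl x \<lambda>\<close> is the derivative
  of \<open>B x\<close> at \<open>\<lambda>\<close>, taken within \<open>I\<close>, so one-sided at an end point belonging to \<open>I\<close>. As is usual for
  coefficients defined up to null sets, differentiability in \<open>\<lambda>\<close> on all of \<open>I\<close> is only required for
  almost every \<open>x\<close>; the exceptional set for this clause is independent of \<open>\<lambda>\<close>.
\<close>

definition assumptions_A :: "real set \<Rightarrow>
    (real \<Rightarrow> real \<Rightarrow> complex ^ 'm ^ 'm) \<Rightarrow> (real \<Rightarrow> real \<Rightarrow> complex ^ 'm ^ 'm) \<Rightarrow> bool" where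
  "assumptions_A I B Bl \<longleftrightarrow>
     (\<forall>l\<in>I. (\<lambda>x. B x l) \<in> borel_measurable (lebesgue_on {0<..<1})) \<and>
     (\<forall>l\<in>I. AE x in lebesgue_on {0<..<1}. self_adjoint (B x l)) \<and>
     (\<exists>b0 :: real \<Rightarrow> real. integrable (lebesgue_on {0<..<1}) b0 \<and>
        (\<forall>l\<in>I. AE x in lebesgue_on {0<..<1}. op_norm (B x l) \<le> b0 x)) \<and>
     (AE x in lebesgue_on {0<..<1}. \<forall>l\<in>I. (B x has_vector_derivative Bl x l) (at l within I)) \<and>
     (\<exists>b1 :: real \<Rightarrow> real. integrable (lebesgue_on {0<..<1}) b1 \<and>
        (\<forall>l\<in>I. AE x in lebesgue_on {0<..<1}. op_norm (Bl x l) \<le> b1 x))"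

text \<open>
  An element of \<open>AC([0,1])\<close> is represented by its extension by zero to the real line; without this
  normalisation the values outside \<open>[0,1]\<close> would contribute to the dimension of the solution space.
\<close>

definition eigenspace :: "(real \<Rightarrow> real \<Rightarrow> complex ^ ('n::finite + 'n) ^ ('n + 'n)) \<Rightarrow>
    complex ^ (('n + 'n) + ('n + 'n)) ^ ('n + 'n) \<Rightarrow> real \<Rightarrow>
    (real \<Rightarrow> complex ^ ('n + 'n)) set" where
  "eigenspace B \<Theta> l =
     {y. (\<forall>x. x \<notin> {0..1} \<longrightarrow> y x = 0) \<and> vec_solution (\<lambda>x. B x l) y \<and> \<Theta> *v stack (y 0) (y 1) = 0}"

definition is_eigenvalue :: "(real \<Rightarrow> real \<Rightarrow> complex ^ ('n::finite + 'n) ^ ('n + 'n)) \<Rightarrow>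
    complex ^ (('n + 'n) + ('n + 'n)) ^ ('n + 'n) \<Rightarrow> real \<Rightarrow> bool" where
  "is_eigenvalue B \<Theta> l \<longleftrightarrow> (\<exists>y\<in>eigenspace B \<Theta> l. y \<noteq> 0)"

interpretation cfun: vector_space "\<lambda>(c::complex) (f::real \<Rightarrow> complex ^ 'm) x. c *s f x"
  by unfold_locales (simp_all add: fun_eq_iff vec_eq_iff algebra_simps)

text \<open>
  The terms with \<open>\<lambda>\<close> not an eigenvalue vanish. The sum has its intended meaning when there are finitely
  many eigenvalues in \<open>S\<close>; statements about it are to be accompanied by this finiteness.
\<close>

definition spectral_count :: "(real \<Rightarrow> real \<Rightarrow> complex ^ ('n::finite + 'n) ^ ('n + 'n)) \<Rightarrow>
    complex ^ (('n + 'n) + ('n + 'n)) ^ ('n + 'n) \<Rightarrow> real set \<Rightarrow> nat" where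
  "spectral_count B \<Theta> S = (\<Sum>l | l \<in> S \<and> is_eigenvalue B \<Theta> l. cfun.dim (eigenspace B \<Theta> l))"


section \<open>Lagrangian subspaces and the Maslov index\<close>

definition lagrangian :: "(complex ^ ('m::finite + 'm)) set \<Rightarrow> bool" where
  "lagrangian L \<longleftrightarrow> vec.subspace L \<and> vec.dim L = CARD('m) \<and>
     (\<forall>u\<in>L. \<forall>v\<in>L. cdot (Jmat *v u) v = 0)"

definition orth_proj :: "(complex ^ 'm) set \<Rightarrow> complex ^ 'm \<Rightarrow> complex ^ 'm" where
  "orth_proj L v = (THE p. p \<in> L \<and> (\<forall>w\<in>L. cdot (v - p) w = 0))"

definition lag_dist :: "(complex ^ ('m::finite + 'm)) set \<Rightarrow> (complex ^ ('m + 'm)) set \<Rightarrow> real" where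
  "lag_dist L L' = onorm (\<lambda>v. orth_proj L v - orth_proj L' v)"

definition lagrangian_path :: "real \<Rightarrow> real \<Rightarrow> (real \<Rightarrow> (complex ^ ('m::finite + 'm)) set) \<Rightarrow> bool" where
  "lagrangian_path a b L \<longleftrightarrow> (\<forall>t\<in>{a..b}. lagrangian (L t)) \<and>
     (\<forall>t\<in>{a..b}. ((\<lambda>s. lag_dist (L s) (L t)) \<longlongrightarrow> 0) (at t within {a..b}))"

definition is_frame :: "complex ^ 'm ^ ('m::finite + 'm) \<Rightarrow> (complex ^ ('m + 'm)) set \<Rightarrow> bool" where
  "is_frame F L \<longleftrightarrow> inj (\<lambda>j. column j F) \<and> vec.independent (columns F) \<and> vec.span (columns F) = L"

definition col_space :: "complex ^ 'm ^ ('m::finite + 'm) \<Rightarrow> (complex ^ ('m + 'm)) set" where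
  "col_space F = vec.span (columns F)"

text \<open>\<open>X + i Y\<close> and \<open>X - i Y\<close> for a frame with upper block \<open>X\<close> and lower block \<open>Y\<close>.\<close>

definition frame_plus :: "complex ^ 'm ^ ('m::finite + 'm) \<Rightarrow> complex ^ 'm ^ 'm" where
  "frame_plus F = upper F + map_matrix ((*) \<i>) (lower F)"

definition frame_minus :: "complex ^ 'm ^ ('m::finite + 'm) \<Rightarrow> complex ^ 'm ^ 'm" where
  "frame_minus F = upper F - map_matrix ((*) \<i>) (lower F)"

definition W_tilde :: "complex ^ 'm ^ ('m::finite + 'm) \<Rightarrow> complex ^ 'm ^ ('m + 'm) \<Rightarrow> complex ^ 'm ^ 'm" where
  "W_tilde F F' =
     - (frame_plus F ** matrix_inv (frame_minus F) ** frame_minus F' ** matrix_inv (frame_plus F'))"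

text \<open>
  \<open>k(t,\<epsilon>)\<close> as a function of \<open>W\<close>; since \<open>\<epsilon> < \<pi>\<close>, only finitely many \<open>\<theta>\<close> give a nontrivial kernel.
\<close>

definition k_count :: "complex ^ 'm ^ 'm \<Rightarrow> real \<Rightarrow> nat" where
  "k_count W \<epsilon> = (\<Sum>\<theta> | \<theta> \<in> {0..<\<epsilon>} \<and> ker (W - mat (cis (pi + \<theta>))) \<noteq> {0}.
     vec.dim (ker (W - mat (cis (pi + \<theta>)))))"

text \<open>
  \<open>m\<close> is the value obtained from some choice of frames, partition \<open>a = t\<^sub>0 < \<dots> < t\<^sub>M = b\<close> and
  \<open>\<epsilon>\<^sub>1, \<dots>, \<epsilon>\<^sub>M\<close>. Only pointwise frames are needed, since \<open>W_tilde\<close> is unchanged when a frame is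
  multiplied from the right by an invertible matrix.
\<close>

definition maslov_value :: "(real \<Rightarrow> (complex ^ ('m::finite + 'm)) set) \<Rightarrow>
    (real \<Rightarrow> (complex ^ ('m + 'm)) set) \<Rightarrow> real \<Rightarrow> real \<Rightarrow> int \<Rightarrow> bool" where
  "maslov_value L L' a b m \<longleftrightarrow> lagrangian_path a b L \<and> lagrangian_path a b L' \<and>
     (\<exists>(F :: real \<Rightarrow> complex ^ 'm ^ ('m + 'm)) F' (t :: nat \<Rightarrow> real) (\<epsilon> :: nat \<Rightarrow> real) M.
        (\<forall>s\<in>{a..b}. is_frame (F s) (L s) \<and> is_frame (F' s) (L' s)) \<and>
        t 0 = a \<and> t M = b \<and> (\<forall>j<M. t j < t (Suc j)) \<and>
        (\<forall>j\<in>{1..M}. 0 < \<epsilon> j \<and> \<epsilon> j < pi \<and>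
           (\<forall>s\<in>{t (j - 1)..t j}.
              cis (pi + \<epsilon> j) \<notin> spectrum_of (W_tilde (F s) (F' s)) \<and>
              cis (pi - \<epsilon> j) \<notin> spectrum_of (W_tilde (F s) (F' s)))) \<and>
        m = (\<Sum>j=1..M. int (k_count (W_tilde (F (t j)) (F' (t j))) (\<epsilon> j))
                      - int (k_count (W_tilde (F (t (j - 1))) (F' (t (j - 1)))) (\<epsilon> j))))"

definition maslov_index :: "(real \<Rightarrow> (complex ^ ('m::finite + 'm)) set) \<Rightarrow>
    (real \<Rightarrow> (complex ^ ('m + 'm)) set) \<Rightarrow> real \<Rightarrow> real \<Rightarrow> int" where
  "maslov_index L L' a b = (THE m. maslov_value L L' a b m)"

end

theory Submission
  imports Defs "HOL-Computational_Algebra.Fundamental_Theorem_Algebra"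
begin

text \<open>
  Two Lagrangian subspaces with frames \<open>F\<close>, \<open>G\<close> intersect where the unitary matrix \<open>V = Vmat F G\<close>, the negative of
  \<open>W_tilde F G\<close>, has the eigenvalue \<open>1\<close>. Indeed \<open>F\<^sup>* J G\<close> and \<open>1 - V\<close> differ only by invertible factors
  (\<open>symplectic_form_Vmat\<close>). In terms of \<open>V\<close> the Maslov index counts the eigenvalues passing through \<open>1\<close>: an
  eigenvalue that moves counterclockwise adds one when it arrives at \<open>1\<close>, and one that moves clockwise subtracts one
  when it leaves.

  Let \<open>V(x,\<lambda>)\<close> be the matrix of \<open>X\<^sub>3(x;\<lambda>)\<close> and \<open>X\<^sub>4(x;\<lambda>\<^sub>2)\<close>, a continuous function on the rectangle
  \<open>[0,1] \<times> [\<lambda>\<^sub>1,\<lambda>\<^sub>2]\<close>. A continuous logarithm of \<open>det V\<close> on the rectangle yields an integer valued function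
  \<open>m\<close> whose increment along every segment is the spectral flow of \<open>V\<close> through \<open>1\<close> (\<open>flow_function_exists\<close>). This
  replaces homotopy invariance: the index along the side \<open>\<lambda> = \<lambda>\<^sub>1\<close> is \<open>m(1,\<lambda>\<^sub>1) - m(0,\<lambda>\<^sub>1)\<close>
  (\<open>maslov_index_flow_fun\<close>), and it can be computed along the other three sides.

  On \<open>x = 0\<close> the matrix \<open>V\<close> is constant. On \<open>\<lambda> = \<lambda>\<^sub>2\<close> both frames come from the same system, so
  \<open>X\<^sub>3\<^sup>* J X\<^sub>4\<close> is constant and no eigenvalue enters or leaves \<open>1\<close>. Hence the index is
  \<open>m(1,\<lambda>\<^sub>1) - m(1,\<lambda>\<^sub>2)\<close>. On \<open>x = 1\<close> the intersections are the solutions of the boundary value problem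
  (\<open>boundary_frame_form\<close>, \<open>eigenspace_eq_extend\<close>). The \<open>\<lambda>\<close>-derivative of \<open>\<Phi>(1;\<lambda>)\<^sup>* J \<Phi>(1;\<lambda>\<^sub>0)\<close> at
  \<open>\<lambda>\<^sub>0\<close> is minus the positive definite Gram matrix (\<open>gram_limit\<close>), so every eigenvalue of \<open>V\<close> passes through \<open>1\<close>
  clockwise as \<open>\<lambda>\<close> grows (\<open>lambda_crossing\<close>). Each one is counted when it leaves, that is, at the points of
  \<open>[\<lambda>\<^sub>1,\<lambda>\<^sub>2)\<close>, with the dimension of the eigenspace.

  For the second formula the side \<open>\<lambda> = \<lambda>\<^sub>1\<close> is treated directly. The two frames solve systems whose coefficients
  differ by the non-negative matrix \<open>B(x;\<lambda>\<^sub>2) - B(x;\<lambda>\<^sub>1)\<close>, so the eigenvalues of \<open>V\<close> pass through \<open>1\<close>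
  counterclockwise as \<open>x\<close> grows and are counted when they arrive, at points of \<open>(0,1]\<close>. The coefficients are only
  integrable in \<open>x\<close> and the difference is only semidefinite, so there is no crossing form at a point. Instead the
  change of the form between \<open>x\<^sub>0\<close> and \<open>x\<close> is compared with the integral \<open>q\<close> of the non-negative form over that
  interval; Cauchy-Schwarz bounds the error by a small multiple of \<open>q\<close>, and \<open>q = 0\<close> would make the subspaces
  intersect on the whole interval (\<open>x_crossing\<close>).
\<close>

section \<open>Adjoints, inner products and norms\<close>

lemma adj_adj [simp]: "adj (adj A) = A"
  by (simp add: adj_def vec_eq_iff)

lemma adj_mult: "adj (A ** B) = adj B ** adj A"
  by (simp add: adj_def vec_eq_iff matrix_matrix_mult_def mult.commute)

lemma adj_add: "adj (A + B) = adj A + adj B"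
  by (simp add: adj_def vec_eq_iff)

lemma adj_minus: "adj (- A) = - adj A"
  by (simp add: adj_def vec_eq_iff)

lemma adj_mat: "adj (mat c) = mat (cnj c)"
  by (simp add: adj_def vec_eq_iff mat_def)

lemma adj_scaleR: "adj (r *\<^sub>R A) = r *\<^sub>R adj A"
  by (simp add: adj_def vec_eq_iff)

lemma mat_mult_diff_left: "(A - B) ** C = A ** C - B ** (C :: 'a::ring_1 ^ 'c ^ 'k)"
  by (simp add: vec_eq_iff matrix_matrix_mult_def sum_subtractf algebra_simps)

lemma mat_mult_diff_right: "A ** (B - C) = A ** B - A ** (C :: 'a::ring_1 ^ 'c ^ 'k)"
  by (simp add: vec_eq_iff matrix_matrix_mult_def sum_subtractf algebra_simps)

lemma mat_mult_add_left: "(A + B) ** C = A ** C + B ** (C :: 'a::ring_1 ^ 'c ^ 'k)"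
  by (simp add: vec_eq_iff matrix_matrix_mult_def sum.distrib algebra_simps)

lemma mat_mult_minus_left: "(- A) ** B = - (A ** (B :: 'a::ring_1 ^ 'c ^ 'k))"
  by (simp add: vec_eq_iff matrix_matrix_mult_def sum_negf)

lemma mat_mult_minus_right: "A ** (- B) = - (A ** (B :: 'a::ring_1 ^ 'c ^ 'k))"
  by (simp add: vec_eq_iff matrix_matrix_mult_def sum_negf)

lemma mat_vec_minus_left: "(- A) *v x = - (A *v (x :: 'a::ring_1 ^ 'k))"
  by (simp add: vec_eq_iff matrix_vector_mult_def sum_negf)

lemma mat_vec_minus_right: "A *v (- x) = - (A *v (x :: 'a::ring_1 ^ 'k))"
  by (simp add: vec_eq_iff matrix_vector_mult_def sum_negf)

lemmas mat_algebra = mat_mult_diff_left mat_mult_diff_right mat_mult_add_left matrix_add_ldistrib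
  mat_mult_minus_left mat_mult_minus_right

lemma mat_scalar_left: "mat c ** A = (\<chi> i j. c * A $ i $ j)"
  for A :: "'a::comm_ring_1 ^ 'c ^ 'r"
  by (simp add: vec_eq_iff matrix_matrix_mult_def mat_def if_distrib[of "\<lambda>u. u * _"] cong: if_cong)

lemma mat_scalar_right: "A ** mat c = (\<chi> i j. c * A $ i $ j)"
  for A :: "'a::comm_ring_1 ^ 'c ^ 'r"
  by (simp add: vec_eq_iff matrix_matrix_mult_def mat_def if_distrib[of "\<lambda>u. _ * u"] mult.commute cong: if_cong)

lemma mat_scalar_commute: "mat c ** A = A ** mat c"
  for A :: "'a::comm_ring_1 ^ 'c ^ 'r"
  by (simp add: mat_scalar_left mat_scalar_right)

lemma mat_scalar_vec: "mat c *v x = c *s x" for x :: "'a::comm_ring_1 ^ 'c"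
  by (simp add: vec_eq_iff matrix_vector_mult_def mat_def if_distrib[of "\<lambda>u. u * _"] cong: if_cong)

lemma mat_vec_scalar: "A *v (c *s x) = c *s (A *v x)" for x :: "'a::comm_ring_1 ^ 'c"
  by (simp add: vec_eq_iff matrix_vector_mult_def sum_distrib_left algebra_simps)

lemma matrix_eqI: "(\<And>x. A *v x = B *v x) \<Longrightarrow> A = B" for A B :: "complex ^ 'c ^ 'r"
  by (simp add: matrix_eq)

lemma cdot_add_left: "cdot (u + v) w = cdot u w + cdot v w"
  by (simp add: cdot_def algebra_simps sum.distrib)

lemma cdot_add_right: "cdot w (u + v) = cdot w u + cdot w v"
  by (simp add: cdot_def algebra_simps sum.distrib)

lemma cdot_diff_left: "cdot (u - v) w = cdot u w - cdot v w"
  by (simp add: cdot_def algebra_simps sum_subtractf)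

lemma cdot_diff_right: "cdot w (u - v) = cdot w u - cdot w v"
  by (simp add: cdot_def algebra_simps sum_subtractf)

lemma cdot_minus_left: "cdot (- u) w = - cdot u w"
  by (simp add: cdot_def sum_negf)

lemma cdot_minus_right: "cdot w (- u) = - cdot w u"
  by (simp add: cdot_def sum_negf)

lemma cdot_scale_left: "cdot (c *s u) w = c * cdot u w"
  by (simp add: cdot_def sum_distrib_left algebra_simps)

lemma cdot_scale_right: "cdot w (c *s u) = cnj c * cdot w u"
  by (simp add: cdot_def sum_distrib_left algebra_simps)

lemma cdot_0_left [simp]: "cdot 0 w = 0" and cdot_0_right [simp]: "cdot w 0 = 0"
  by (simp_all add: cdot_def)

lemma cdot_sum_left: "cdot (\<Sum>i\<in>A. f i) w = (\<Sum>i\<in>A. cdot (f i) w)"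
  by (induction A rule: infinite_finite_induct) (auto simp: cdot_add_left)

lemmas cdot_simps = cdot_add_left cdot_add_right cdot_diff_left cdot_diff_right
  cdot_minus_left cdot_minus_right cdot_scale_left cdot_scale_right

lemma cdot_commute: "cdot u v = cnj (cdot v u)"
  by (simp add: cdot_def mult.commute)

lemma cdot_mat_left: "cdot (A *v u) v = cdot u (adj A *v v)"
proof -
  have "cdot (A *v u) v = (\<Sum>i\<in>UNIV. \<Sum>j\<in>UNIV. A $ i $ j * u $ j * cnj (v $ i))"
    by (simp add: cdot_def matrix_vector_mult_def sum_distrib_right)
  also have "\<dots> = (\<Sum>j\<in>UNIV. \<Sum>i\<in>UNIV. A $ i $ j * u $ j * cnj (v $ i))"
    by (rule sum.swap)
  also have "\<dots> = cdot u (adj A *v v)"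
    by (simp add: cdot_def matrix_vector_mult_def sum_distrib_left adj_def algebra_simps)
  finally show ?thesis .
qed

lemma cdot_mat_right: "cdot u (A *v v) = cdot (adj A *v u) v"
  by (simp add: cdot_mat_left)

lemma cdot_self: "cdot v v = of_real ((norm v)\<^sup>2)"
proof -
  have "cdot v v = of_real (\<Sum>i\<in>UNIV. (norm (v $ i))\<^sup>2)"
    by (simp add: cdot_def complex_norm_square[symmetric])
  then show ?thesis by (simp add: norm_vec_def L2_set_def sum_nonneg)
qed

lemma Re_cdot_self: "Re (cdot v v) = (norm v)\<^sup>2"
  by (simp add: cdot_self)

lemma cdot_self_0 [simp]: "cdot v v = 0 \<longleftrightarrow> v = 0"
  by (simp add: cdot_self)

lemma norm_sum_mult_le:
  fixes f g :: "'i \<Rightarrow> complex"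
  assumes "finite A"
  shows "norm (\<Sum>i\<in>A. f i * g i) \<le> L2_set (\<lambda>i. norm (f i)) A * L2_set (\<lambda>i. norm (g i)) A"
proof -
  have "norm (\<Sum>i\<in>A. f i * g i) \<le> (\<Sum>i\<in>A. \<bar>norm (f i)\<bar> * \<bar>norm (g i)\<bar>)"
    by (rule order_trans[OF norm_sum]) (simp add: norm_mult)
  also have "\<dots> \<le> L2_set (\<lambda>i. norm (f i)) A * L2_set (\<lambda>i. norm (g i)) A"
    by (rule L2_set_mult_ineq)
  finally show ?thesis .
qed

lemma norm_cdot_le: "norm (cdot u v) \<le> norm u * norm v"
  using norm_sum_mult_le[of UNIV "\<lambda>i. u $ i" "\<lambda>i. cnj (v $ i)"]
  by (simp add: cdot_def norm_vec_def)

lemma norm_mat_vec_le: "norm (A *v x) \<le> norm A * norm (x :: complex ^ 'c)"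
proof -
  have "norm ((A *v x) $ i) \<le> norm x * norm (A $ i)" for i
    using norm_sum_mult_le[of UNIV "\<lambda>j. A $ i $ j" "\<lambda>j. x $ j"]
    by (simp add: matrix_vector_mult_def norm_vec_def mult.commute)
  then have "norm (A *v x) \<le> L2_set (\<lambda>i. norm x * norm (A $ i)) UNIV"
    unfolding norm_vec_def[of "A *v x"] by (intro L2_set_mono) auto
  also have "\<dots> = norm A * norm x"
    by (simp add: L2_set_right_distrib[symmetric] norm_vec_def[of A] mult.commute)
  finally show ?thesis .
qed

lemma norm_adj [simp]: "norm (adj A) = norm A"
proof -
  have "(norm (adj A))\<^sup>2 = (\<Sum>i\<in>UNIV. \<Sum>j\<in>UNIV. (norm (A $ j $ i))\<^sup>2)"
    by (simp add: norm_vec_def L2_set_def sum_nonneg adj_def)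
  also have "\<dots> = (\<Sum>j\<in>UNIV. \<Sum>i\<in>UNIV. (norm (A $ j $ i))\<^sup>2)" by (rule sum.swap)
  also have "\<dots> = (norm A)\<^sup>2"
    by (simp add: norm_vec_def L2_set_def sum_nonneg)
  finally show ?thesis by simp
qed

lemma norm_mat_sq_columns: "(norm A)\<^sup>2 = (\<Sum>j\<in>UNIV. (norm (column j A))\<^sup>2)"
proof -
  have "(norm A)\<^sup>2 = (\<Sum>j\<in>UNIV. \<Sum>i\<in>UNIV. (norm (A $ j $ i))\<^sup>2)"
    by (simp add: norm_vec_def L2_set_def sum_nonneg)
  also have "\<dots> = (\<Sum>i\<in>UNIV. \<Sum>j\<in>UNIV. (norm (A $ j $ i))\<^sup>2)" by (rule sum.swap)
  finally show ?thesis by (simp add: norm_vec_def L2_set_def sum_nonneg column_def)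
qed

lemma column_mat_mult: "column j (A ** B) = A *v column j B"
  by (simp add: column_def matrix_matrix_mult_def matrix_vector_mult_def vec_eq_iff)

lemma norm_mat_mult_le: "norm (A ** B) \<le> norm A * norm (B :: complex ^ 'c ^ 'k)"
proof -
  have "(norm (A ** B))\<^sup>2 = (\<Sum>j\<in>UNIV. (norm (A *v column j B))\<^sup>2)"
    by (simp add: norm_mat_sq_columns[of "A ** B"] column_mat_mult)
  also have "\<dots> \<le> (\<Sum>j\<in>UNIV. (norm A * norm (column j B))\<^sup>2)"
    by (intro sum_mono power_mono norm_mat_vec_le norm_ge_zero)
  also have "\<dots> = (norm A * norm B)\<^sup>2"
    by (simp add: power_mult_distrib norm_mat_sq_columns[of B] sum_distrib_left)
  finally show ?thesis by (rule power2_le_imp_le) simp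
qed

lemma mat_scaleR_left: "(r *\<^sub>R A) ** B = r *\<^sub>R (A ** (B :: complex ^ 'c ^ 'k))"
  by (simp add: vec_eq_iff matrix_matrix_mult_def scaleR_sum_right)

lemma mat_scaleR_right: "A ** (r *\<^sub>R B) = r *\<^sub>R (A ** (B :: complex ^ 'c ^ 'k))"
  by (simp add: vec_eq_iff matrix_matrix_mult_def scaleR_sum_right)

lemma mat_vec_scaleR_left: "(r *\<^sub>R A) *v x = r *\<^sub>R (A *v (x :: complex ^ 'k))"
  by (simp add: vec_eq_iff matrix_vector_mult_def scaleR_sum_right)

lemma mat_vec_scaleR_right: "A *v (r *\<^sub>R x) = r *\<^sub>R (A *v (x :: complex ^ 'k))"
  by (simp add: vec_eq_iff matrix_vector_mult_def scaleR_sum_right)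

lemma bounded_bilinear_mat_mult:
  "bounded_bilinear ((**) :: complex ^ 'k ^ 'r \<Rightarrow> complex ^ 'c ^ 'k \<Rightarrow> complex ^ 'c ^ 'r)"
  by (rule bounded_bilinear.intro)
     (auto simp: mat_algebra mat_scaleR_left mat_scaleR_right intro!: exI[of _ 1] norm_mat_mult_le)

lemma bounded_bilinear_mat_vec:
  "bounded_bilinear ((*v) :: complex ^ 'k ^ 'r \<Rightarrow> complex ^ 'k \<Rightarrow> complex ^ 'r)"
  by (rule bounded_bilinear.intro)
     (auto simp: algebra_simps mat_vec_scaleR_left mat_vec_scaleR_right
        intro!: exI[of _ 1] norm_mat_vec_le[THEN order_trans])

lemma bounded_linear_adj: "bounded_linear adj"
  by (rule bounded_linear_intro[of _ 1]) (auto simp: adj_add adj_scaleR)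

lemmas continuous_on_mat_mult [continuous_intros] = bounded_bilinear.continuous_on[OF bounded_bilinear_mat_mult]
lemmas continuous_on_mat_vec [continuous_intros] = bounded_bilinear.continuous_on[OF bounded_bilinear_mat_vec]
lemmas continuous_on_adj [continuous_intros] = bounded_linear.continuous_on[OF bounded_linear_adj]
lemmas tendsto_mat_mult [tendsto_intros] = bounded_bilinear.tendsto[OF bounded_bilinear_mat_mult]
lemmas tendsto_adj [tendsto_intros] = bounded_linear.tendsto[OF bounded_linear_adj]

lemma norm_mat_vec_le_op_norm: "norm (A *v x) \<le> op_norm A * norm x"
  unfolding op_norm_def
  by (rule onorm) (use bounded_bilinear.bounded_linear_right[OF bounded_bilinear_mat_vec] in blast)

lemma mat_vec_axis: "A *v axis j 1 = column j A" for A :: "'a::comm_ring_1 ^ 'c ^ 'r"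
  by (simp add: vec_eq_iff matrix_vector_mult_def column_def axis_def
      if_distrib[of "\<lambda>u. _ * u"] cong: if_cong)

text \<open>
  The assumptions on the coefficients bound operator norms, while \<open>norm\<close> on matrices is the Frobenius norm. Each column
  is the image of a unit vector; the resulting factor \<open>sqrt CARD('c)\<close> is enlarged to \<open>CARD('c)\<close>.
\<close>

lemma norm_le_op_norm: "norm A \<le> real CARD('c) * op_norm A" for A :: "complex ^ 'c ^ 'r"
proof -
  have nn: "0 \<le> op_norm A"
    using order_trans[OF norm_ge_zero norm_mat_vec_le_op_norm[of A "axis undefined 1"]]
    by (simp add: norm_axis_1)
  have c: "norm (column j A) \<le> op_norm A" for j
    using norm_mat_vec_le_op_norm[of A "axis j 1"]
    by (simp add: mat_vec_axis norm_axis_1)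
  have "(norm A)\<^sup>2 \<le> (\<Sum>j\<in>(UNIV::'c set). (op_norm A)\<^sup>2)"
    unfolding norm_mat_sq_columns[of A] by (intro sum_mono power_mono c norm_ge_zero)
  also have "\<dots> = real CARD('c) * (op_norm A)\<^sup>2" by simp
  also have "\<dots> \<le> (real CARD('c))\<^sup>2 * (op_norm A)\<^sup>2"
    by (intro mult_right_mono) (auto simp: power2_eq_square Suc_le_eq)
  also have "\<dots> = (real CARD('c) * op_norm A)\<^sup>2" by (simp add: power_mult_distrib)
  finally show ?thesis by (rule power2_le_imp_le) (simp add: nn)
qed

section \<open>Unitary matrices\<close>

definition unitary :: "complex ^ 'm ^ 'm \<Rightarrow> bool" where
  "unitary V \<longleftrightarrow> adj V ** V = mat 1"

lemma unitary_right: "unitary V \<Longrightarrow> V ** adj V = mat 1"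
  unfolding unitary_def by (simp add: matrix_left_right_inverse)

lemma unitary_adj: "unitary V \<Longrightarrow> unitary (adj V)"
  by (simp add: unitary_right unitary_def)

lemma unitary_adj_vec: "unitary V \<Longrightarrow> adj V *v (V *v x) = x"
  by (simp add: unitary_def matrix_vector_mul_assoc)

lemma unitary_vec_adj: "unitary V \<Longrightarrow> V *v (adj V *v x) = x"
  by (simp add: unitary_right matrix_vector_mul_assoc)

lemma unitary_mult: "unitary U \<Longrightarrow> unitary V \<Longrightarrow> unitary (U ** V)"
  unfolding unitary_def adj_mult
  by (metis matrix_mul_assoc matrix_mul_rid)

lemma mat_vec_sum: "A *v (\<Sum>i\<in>S. f i) = (\<Sum>i\<in>S. A *v f i)"
  for A :: "'a::comm_ring_1 ^ 'c ^ 'r"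
  by (induction S rule: infinite_finite_induct) (auto simp: matrix_vector_right_distrib)

definition poly_act :: "complex ^ 'm ^ 'm \<Rightarrow> complex poly \<Rightarrow> complex ^ 'm \<Rightarrow> complex ^ 'm" where
  "poly_act V p v = (\<Sum>i\<le>degree p. coeff p i *s ((\<lambda>u. V *v u) ^^ i) v)"

lemma poly_act_bound:
  assumes "degree p \<le> n"
  shows "poly_act V p v = (\<Sum>i\<le>n. coeff p i *s ((\<lambda>u. V *v u) ^^ i) v)"
  unfolding poly_act_def
  by (rule sum.mono_neutral_left) (use assms in \<open>auto simp: coeff_eq_0\<close>)

lemma poly_act_add: "poly_act V (p + q) v = poly_act V p v + poly_act V q v"
proof -
  define n where "n = max (degree p) (degree q)"
  have "degree p \<le> n" "degree q \<le> n" "degree (p + q) \<le> n"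
    by (auto simp: n_def intro: degree_add_le)
  then show ?thesis
    by (simp add: poly_act_bound[of _ n] sum.distrib[symmetric] vector_sadd_rdistrib)
qed

lemma poly_act_smult: "poly_act V (smult a p) v = a *s poly_act V p v"
proof -
  have "degree (smult a p) \<le> degree p" by (rule degree_smult_le)
  then show ?thesis
    by (simp add: poly_act_bound[of _ "degree p"] vec.scale_sum_right)
qed

lemma poly_act_pCons0: "poly_act V (pCons 0 p) v = V *v poly_act V p v"
proof -
  have "degree (pCons 0 p) \<le> Suc (degree p)" by (rule degree_pCons_le)
  then have "poly_act V (pCons 0 p) v =
      (\<Sum>i\<le>Suc (degree p). coeff (pCons 0 p) i *s ((\<lambda>u. V *v u) ^^ i) v)"
    by (rule poly_act_bound)
  also have "\<dots> = (\<Sum>i\<le>degree p. coeff p i *s (V *v ((\<lambda>u. V *v u) ^^ i) v))"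
    by (subst sum.atMost_Suc_shift) simp
  finally show ?thesis by (simp add: poly_act_def mat_vec_sum mat_vec_scalar)
qed

lemma poly_act_root_factor:
  "poly_act V ([:- z, 1:] * q) v = V *v poly_act V q v - z *s poly_act V q v"
proof -
  have "[:- z, 1:] * q = smult (- z) q + pCons 0 q" by simp
  then show ?thesis
    by (simp only: poly_act_add poly_act_smult poly_act_pCons0) (simp add: vec_eq_iff)
qed

lemma poly_act_in:
  assumes "vec.subspace S" "\<And>u. u \<in> S \<Longrightarrow> V *v u \<in> S" "v \<in> S"
  shows "poly_act V p v \<in> S"
proof -
  have "((\<lambda>u. V *v u) ^^ i) v \<in> S" for i by (induction i) (use assms in auto)
  then show ?thesis unfolding poly_act_def
    using assms(1) by (intro vec.subspace_sum vec.subspace_scale) auto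
qed

text \<open>
  The \<open>N + 1\<close> vectors \<open>v, V v, \<dots>, V\<^sup>N v\<close> in dimension \<open>N\<close> are linearly dependent. Dependence of a set does not see
  repeated members, so a coincidence \<open>V\<^sup>i v = V\<^sup>j v\<close> is treated separately.
\<close>

lemma annihilating_poly:
  fixes V :: "complex ^ 'm ^ 'm"
  shows "\<exists>p. p \<noteq> 0 \<and> poly_act V p v = 0"
proof -
  define f where "f i = ((\<lambda>u. V *v u) ^^ i) v" for i
  let ?n = "CARD('m)"
  show ?thesis
  proof (cases "inj_on f {..?n}")
    case False
    then obtain i j where ij: "f i = f j" "i \<noteq> j" by (auto simp: inj_on_def)
    define p where "p = monom 1 i - (monom 1 j :: complex poly)"
    have "coeff p i = 1" using ij by (simp add: p_def)
    then have "p \<noteq> 0" by auto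
    have "p = monom 1 i + smult (-1) (monom 1 j)" by (simp add: p_def)
    moreover have "poly_act V (monom 1 k) v = f k" for k
    proof -
      have "poly_act V (monom 1 k) v = (\<Sum>i\<le>k. if i = k then f i else 0)"
        unfolding poly_act_def by (rule sum.cong) (auto simp: degree_monom_eq f_def)
      then show ?thesis by simp
    qed
    ultimately have "poly_act V p v = 0" using ij by (simp only: poly_act_add poly_act_smult) simp
    with \<open>p \<noteq> 0\<close> show ?thesis by blast
  next
    case True
    then have "card (f ` {..?n}) = Suc ?n" by (simp add: card_image)
    then have "vec.dependent (f ` {..?n})"
      using vec.dim_subset[of "f ` {..?n}" UNIV]
      by (intro vec.dependent_biggerset_general) (simp add: card_cart_basis)
    then obtain u where u: "\<exists>w\<in>f ` {..?n}. u w \<noteq> 0" "(\<Sum>w\<in>f ` {..?n}. u w *s w) = 0"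
      by (auto simp: vec.dependent_finite)
    define p where "p = (\<Sum>i\<le>?n. monom (u (f i)) i)"
    have cp: "coeff p i = (if i \<le> ?n then u (f i) else 0)" for i
      by (simp add: p_def coeff_sum coeff_monom)
    from u(1) obtain i where "i \<le> ?n" "u (f i) \<noteq> 0" by auto
    then have "p \<noteq> 0" using cp[of i] by auto
    have "degree p \<le> ?n" by (rule degree_le) (simp add: cp)
    then have "poly_act V p v = (\<Sum>i\<le>?n. u (f i) *s f i)"
      by (simp add: poly_act_bound cp f_def)
    also have "\<dots> = 0" using u(2) by (simp add: sum.reindex[OF True])
    finally show ?thesis using \<open>p \<noteq> 0\<close> by blast
  qed
qed

text \<open>
  Let \<open>p\<close> be a polynomial of least degree with \<open>p(V) v = 0\<close>, and \<open>z\<close> a root of it, so \<open>p = (X - z) q\<close>. Then \<open>q(V) v\<close>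
  is nonzero by minimality and is an eigenvector. As a polynomial in \<open>V\<close> applied to \<open>v\<close> it stays in the invariant
  subspace, which an argument through the characteristic polynomial would not give.
\<close>

lemma invariant_subspace_eigenvector:
  fixes V :: "complex ^ 'm ^ 'm"
  assumes S: "vec.subspace S" "\<And>u. u \<in> S \<Longrightarrow> V *v u \<in> S" and v: "v \<in> S" "v \<noteq> 0"
  shows "\<exists>u z. u \<in> S \<and> u \<noteq> 0 \<and> V *v u = z *s u"
proof -
  define P where "P n \<longleftrightarrow> (\<exists>p. p \<noteq> 0 \<and> poly_act V p v = 0 \<and> degree p = n)" for n
  have "\<exists>n. P n" using annihilating_poly[of V v] by (auto simp: P_def)
  then obtain n where n: "P n" "\<And>k. k < n \<Longrightarrow> \<not> P k"
    using LeastI_ex[of P] not_less_Least[of _ P] by blast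
  from n(1) obtain p where p: "p \<noteq> 0" "poly_act V p v = 0" "degree p = n" by (auto simp: P_def)
  have "degree p \<noteq> 0"
  proof
    assume "degree p = 0"
    then obtain a where "p = [:a:]" by (rule degree_eq_zeroE)
    with p v show False by (auto simp: poly_act_def)
  qed
  then have "\<not> constant (poly p)" by (simp add: constant_degree)
  then obtain z where "poly p z = 0" using fundamental_theorem_of_algebra by blast
  then obtain q where q: "p = [:- z, 1:] * q" by (auto simp: poly_eq_0_iff_dvd)
  with p(1) have "q \<noteq> 0" by auto
  have "degree p = Suc (degree q)" using \<open>q \<noteq> 0\<close> unfolding q by (subst degree_mult_eq) auto
  with n(2)[of "degree q"] p(3) \<open>q \<noteq> 0\<close> have "poly_act V q v \<noteq> 0" by (auto simp: P_def)
  moreover have "V *v poly_act V q v = z *s poly_act V q v"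
    using p(2) unfolding q poly_act_root_factor by simp
  moreover have "poly_act V q v \<in> S" using poly_act_in S v by blast
  ultimately show ?thesis by blast
qed

definition orthonormal :: "(complex ^ 'm) set \<Rightarrow> bool" where
  "orthonormal B \<longleftrightarrow> (\<forall>u\<in>B. \<forall>v\<in>B. cdot u v = (if u = v then 1 else 0))"

lemma orthonormal_independent:
  assumes "orthonormal B"
  shows "vec.independent B"
  unfolding vec.independent_explicit_module
proof (intro allI impI)
  fix t u v assume h: "finite t" "t \<subseteq> B" "(\<Sum>v\<in>t. u v *s v) = 0" "v \<in> t"
  have "0 = cdot (\<Sum>w\<in>t. u w *s w) v" using h by simp
  also have "\<dots> = (\<Sum>w\<in>t. u w * (if w = v then 1 else 0))"
    unfolding cdot_sum_left cdot_scale_left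
    by (rule sum.cong) (use h assms in \<open>auto simp: orthonormal_def subset_iff\<close>)
  also have "\<dots> = u v" using h by (simp add: if_distrib cong: if_cong)
  finally show "u v = 0" by simp
qed

text \<open>
  One step of the Gram-Schmidt process.
\<close>

lemma orthonormal_complement:
  fixes B :: "(complex ^ 'm) set"
  assumes "orthonormal B" "vec.span B \<noteq> UNIV"
  shows "\<exists>v. v \<noteq> 0 \<and> (\<forall>b\<in>B. cdot v b = 0)"
proof -
  have fin: "finite B" using assms(1) orthonormal_independent vec.finiteI_independent by blast
  obtain v where v: "v \<notin> vec.span B" using assms(2) by blast
  define w where "w = v - (\<Sum>b\<in>B. cdot v b *s b)"
  have "(\<Sum>b\<in>B. cdot v b *s b) \<in> vec.span B"
    by (intro vec.span_sum vec.span_scale vec.span_base)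
  then have "w \<noteq> 0" using v by (auto simp: w_def)
  moreover have "cdot w b = 0" if b: "b \<in> B" for b
  proof -
    have "cdot (\<Sum>a\<in>B. cdot v a *s a) b = (\<Sum>a\<in>B. cdot v a * (if a = b then 1 else 0))"
      unfolding cdot_sum_left cdot_scale_left
      by (rule sum.cong) (use b assms in \<open>auto simp: orthonormal_def\<close>)
    also have "\<dots> = cdot v b" using fin b by (simp add: if_distrib cong: if_cong)
    finally show ?thesis by (simp add: w_def cdot_diff_left)
  qed
  ultimately show ?thesis by blast
qed

definition diagm :: "('m \<Rightarrow> complex) \<Rightarrow> complex ^ 'm ^ 'm" where
  "diagm w = (\<chi> i j. if i = j then w i else 0)"

definition unitary_diag :: "complex ^ 'm ^ 'm \<Rightarrow> complex ^ 'm ^ 'm \<Rightarrow> ('m \<Rightarrow> complex) \<Rightarrow> bool" where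
  "unitary_diag V Q w \<longleftrightarrow> unitary Q \<and> V = Q ** diagm w ** adj Q \<and> (\<forall>k. norm (w k) = 1)"

lemma diagm_vec: "(diagm w *v x) $ k = w k * x $ k"
  by (simp add: diagm_def matrix_vector_mult_def if_distrib[of "\<lambda>u. u * _"] cong: if_cong)

lemma unitary_eigenvalue_norm:
  assumes "unitary V" "V *v u = z *s u" "u \<noteq> 0"
  shows "norm z = 1"
proof -
  have "cdot (V *v u) (V *v u) = cdot u u"
    using assms(1) by (simp add: cdot_mat_left unitary_adj_vec)
  then have "z * cnj z * cdot u u = cdot u u" by (simp add: assms(2) cdot_simps mult_ac)
  then have "z * cnj z = 1" using assms(3) by simp
  then have "of_real ((norm z)\<^sup>2) = (1::complex)" by (simp only: complex_norm_square)
  then have "(norm z)\<^sup>2 = 1" using of_real_eq_1_iff by blast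
  then show ?thesis by (simp add: power2_eq_1_iff) (smt (verit) norm_ge_zero)
qed

lemma unitary_eigenvector_adj:
  assumes "unitary V" "V *v u = z *s u"
  shows "adj V *v u = cnj z *s u"
proof (cases "u = 0")
  case False
  have n: "norm z = 1" using unitary_eigenvalue_norm assms False by blast
  have "adj V *v (V *v u) = z *s (adj V *v u)" by (simp add: assms(2) mat_vec_scalar)
  then have "u = z *s (adj V *v u)" using assms(1) by (simp add: unitary_adj_vec)
  then have "cnj z *s u = (cnj z * z) *s (adj V *v u)"
    by (metis vector_smult_assoc)
  moreover have "cnj z * z = 1" using n by (metis complex_norm_square mult.commute of_real_1 one_power2)
  ultimately show ?thesis by simp
qed simp

text \<open>
  The spectral theorem: a maximal orthonormal set of eigenvectors is a basis, because its orthogonal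
  complement is invariant and would otherwise contain a further eigenvector.
\<close>

theorem unitary_diagonalizable:
  fixes V :: "complex ^ 'm ^ 'm"
  assumes V: "unitary V"
  shows "\<exists>Q w. unitary_diag V Q w"
proof -
  define P where "P B \<longleftrightarrow> orthonormal B \<and> (\<forall>b\<in>B. \<exists>z. V *v b = z *s b)" for B
  have bound: "finite B \<and> card B \<le> CARD('m)" if "P B" for B
  proof -
    have "vec.independent B" using that orthonormal_independent by (auto simp: P_def)
    then show ?thesis
      using vec.independent_card_le_dim[of B UNIV] vec.finiteI_independent[of B]
      by (simp add: card_cart_basis)
  qed
  have "P {}" by (simp add: P_def orthonormal_def)
  then have "\<exists>B. P B \<and> (\<forall>C. P C \<longrightarrow> card C \<le> card B)"
    using bound by (intro ex_has_greatest_nat[of P _ card "Suc CARD('m)"]) (auto simp: less_Suc_eq_le)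
  then obtain B where B: "P B" "\<And>C. P C \<Longrightarrow> card C \<le> card B" by blast
  have on: "orthonormal B" and fin: "finite B" using B(1) bound by (auto simp: P_def)
  have span: "vec.span B = UNIV"
  proof (rule ccontr)
    assume "vec.span B \<noteq> UNIV"
    then obtain v where v: "v \<noteq> 0" "\<forall>b\<in>B. cdot v b = 0" using orthonormal_complement on by blast
    define S where "S = {v. \<forall>b\<in>B. cdot v b = 0}"
    have "vec.subspace S"
      by (auto simp: S_def vec.subspace_def cdot_simps)
    moreover have "V *v u \<in> S" if u: "u \<in> S" for u
      unfolding S_def
    proof safe
      fix b assume b: "b \<in> B"
      with B(1) obtain z where "V *v b = z *s b" by (auto simp: P_def)
      then have "adj V *v b = cnj z *s b" using V unitary_eigenvector_adj by blast
      then have "cdot (V *v u) b = z * cdot u b" by (simp add: cdot_mat_left cdot_simps)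
      then show "cdot (V *v u) b = 0" using u b by (simp add: S_def)
    qed
    ultimately obtain u z where u: "u \<in> S" "u \<noteq> 0" "V *v u = z *s u"
      using invariant_subspace_eigenvector[of S V v] v by (auto simp: S_def)
    define e where "e = of_real (1 / norm u) *s u"
    have "cdot e e = 1" using u(2)
      by (simp only: e_def cdot_scale_left cdot_scale_right) (simp add: cdot_self[of u] power2_eq_square)
    have eS: "cdot e b = 0" "cdot b e = 0" if "b \<in> B" for b
      using u(1) that cdot_commute[of b e] by (auto simp: e_def S_def cdot_simps)
    have "V *v e = z *s e" by (simp add: e_def mat_vec_scalar u(3) vector_smult_assoc mult.commute)
    have "e \<notin> B" using \<open>cdot e e = 1\<close> eS by force
    have "P (insert e B)" unfolding P_def orthonormal_def
      using B(1) eS \<open>e \<notin> B\<close> \<open>cdot e e = 1\<close> \<open>V *v e = z *s e\<close>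
      by (auto simp: P_def orthonormal_def)
    from B(2)[OF this] fin \<open>e \<notin> B\<close> show False by simp
  qed
  have "card B = CARD('m)"
    using vec.dim_span_eq_card_independent[OF orthonormal_independent[OF on]] span
    by (simp add: card_cart_basis)
  then obtain f :: "'m \<Rightarrow> complex ^ 'm" where f: "bij_betw f UNIV B"
    using finite_same_card_bij[of "UNIV :: 'm set" B] fin by auto
  define Q :: "complex ^ 'm ^ 'm" where "Q = (\<chi> i j. f j $ i)"
  have fB: "f j \<in> B" for j using f by (auto simp: bij_betw_def)
  have finj: "f i = f j \<longleftrightarrow> i = j" for i j using f by (auto simp: bij_betw_def inj_on_def)
  have "\<forall>j. \<exists>z. V *v f j = z *s f j" using B(1) fB by (simp add: P_def)
  then obtain w where w: "V *v f j = w j *s f j" for j using choice[of "\<lambda>j z. V *v f j = z *s f j"] by blast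
  have entry: "(adj Q ** Q) $ i $ j = cdot (f j) (f i)" for i j
    by (simp add: matrix_matrix_mult_def adj_def Q_def cdot_def mult.commute)
  have QQ: "adj Q ** Q = mat 1"
    using on fB finj by (auto simp: vec_eq_iff entry mat_def orthonormal_def)
  then have uQ: "unitary Q" by (simp add: unitary_def)
  have col: "column j Q = f j" for j by (simp add: Q_def column_def vec_eq_iff)
  have "(V ** Q) $ i $ j = (Q ** diagm w) $ i $ j" for i j
  proof -
    have "(V ** Q) $ i $ j = (V *v f j) $ i"
      by (simp add: matrix_matrix_mult_def matrix_vector_mult_def Q_def)
    also have "\<dots> = w j * Q $ i $ j" by (simp add: w Q_def)
    also have "\<dots> = (Q ** diagm w) $ i $ j"
      by (simp add: matrix_matrix_mult_def diagm_def if_distrib[of "\<lambda>u. _ * u"] mult.commute cong: if_cong)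
    finally show ?thesis .
  qed
  then have "V ** Q = Q ** diagm w" by (simp add: vec_eq_iff)
  then have "V = Q ** diagm w ** adj Q"
    by (metis matrix_mul_assoc matrix_mul_rid uQ unitary_right)
  moreover have "norm (w k) = 1" for k
  proof (rule unitary_eigenvalue_norm[OF V w])
    show "f k \<noteq> 0" using on fB[of k] by (metis cdot_0_left orthonormal_def zero_neq_one)
  qed
  ultimately show ?thesis using uQ by (auto simp: unitary_diag_def)
qed

lemma orthonormal_columns:
  assumes "unitary Q"
  shows "orthonormal ((\<lambda>k. column k Q) ` K)" "inj (\<lambda>k. column k Q)"
proof -
  have c: "cdot (column j Q) (column i Q) = (if i = j then 1 else 0)" for i j
  proof -
    have "cdot (column j Q) (column i Q) = (adj Q ** Q) $ i $ j"
      by (simp add: matrix_matrix_mult_def adj_def column_def cdot_def mult.commute)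
    then show ?thesis using assms by (simp add: unitary_def mat_def)
  qed
  show i: "inj (\<lambda>k. column k Q)"
    by (rule injI) (metis c zero_neq_one)
  show "orthonormal ((\<lambda>k. column k Q) ` K)"
    unfolding orthonormal_def using c i by (auto simp: inj_def)
qed

lemma ker_subspace: "vec.subspace (ker A)"
  by (auto simp: ker_def vec.subspace_def matrix_vector_right_distrib mat_vec_scalar)

lemma unitary_diag_ker:
  assumes "unitary_diag V Q w"
  shows "V *v x = z *s x \<longleftrightarrow> (\<forall>k. w k \<noteq> z \<longrightarrow> (adj Q *v x) $ k = 0)"
proof -
  have Q: "unitary Q" and V: "V = Q ** diagm w ** adj Q" using assms by (auto simp: unitary_diag_def)
  have "V *v x = z *s x \<longleftrightarrow> adj Q *v (V *v x) = adj Q *v (z *s x)"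
    by (metis Q unitary_vec_adj)
  also have "adj Q *v (V *v x) = diagm w *v (adj Q *v x)"
    using Q by (simp add: V matrix_vector_mul_assoc[symmetric] unitary_adj_vec)
  finally show ?thesis
    by (auto simp: vec_eq_iff diagm_vec mat_vec_scalar)
qed

lemma mat_vec_sum_columns: "A *v x = (\<Sum>j\<in>UNIV. x $ j *s column j A)"
  for A :: "'a::comm_ring_1 ^ 'c ^ 'r"
  by (simp add: vec_eq_iff matrix_vector_mult_def column_def mult.commute)

text \<open>
  The columns of \<open>Q\<close> belonging to the eigenvalue \<open>z\<close> form a basis of the eigenspace.
\<close>

lemma unitary_diag_dim_ker:
  fixes V :: "complex ^ 'm ^ 'm"
  assumes d: "unitary_diag V Q w"
  shows "vec.dim (ker (V - mat z)) = card {k. w k = z}"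
proof -
  have Q: "unitary Q" using assms by (auto simp: unitary_diag_def)
  let ?B = "(\<lambda>k. column k Q) ` {k. w k = z}"
  have ker: "ker (V - mat z) = {x. \<forall>k. w k \<noteq> z \<longrightarrow> (adj Q *v x) $ k = 0}"
    by (auto simp: ker_def algebra_simps mat_scalar_vec unitary_diag_ker[OF d, symmetric])
  have "ker (V - mat z) = vec.span ?B"
  proof (rule equalityI; rule subsetI)
    fix x assume "x \<in> ker (V - mat z)"
    then have z0: "(adj Q *v x) $ k = 0" if "w k \<noteq> z" for k using that by (auto simp: ker)
    have "x = Q *v (adj Q *v x)" using Q by (simp add: unitary_vec_adj)
    also have "\<dots> = (\<Sum>k\<in>UNIV. (adj Q *v x) $ k *s column k Q)" by (rule mat_vec_sum_columns)
    also have "\<dots> = (\<Sum>k | w k = z. (adj Q *v x) $ k *s column k Q)"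
      by (rule sum.mono_neutral_right) (auto simp: z0)
    also have "\<dots> \<in> vec.span ?B"
      by (intro vec.span_sum vec.span_scale vec.span_base) auto
    finally show "x \<in> vec.span ?B" .
  next
    have "?B \<subseteq> ker (V - mat z)"
    proof safe
      fix k
      have "adj Q *v column k Q = axis k 1"
        using Q by (simp add: mat_vec_axis[symmetric] unitary_adj_vec)
      then show "column k Q \<in> ker (V - mat (w k))"
        by (auto simp: ker_def algebra_simps mat_scalar_vec unitary_diag_ker[OF d] axis_def)
    qed
    then show "x \<in> ker (V - mat z)" if "x \<in> vec.span ?B" for x
      using vec.span_minimal[OF _ ker_subspace] that by blast
  qed
  moreover have "vec.independent ?B" using orthonormal_columns(1)[OF Q] orthonormal_independent by blast
  ultimately have "vec.dim (ker (V - mat z)) = card ?B"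
    using vec.dim_span_eq_card_independent by metis
  also have "\<dots> = card {k. w k = z}"
    using orthonormal_columns(2)[OF Q] by (intro card_image) (auto simp: inj_on_def inj_def)
  finally show ?thesis .
qed

section \<open>Counting eigenvalues on arcs of the unit circle\<close>

text \<open>
  Used for \<open>A \<subseteq> {0..<2 * pi}\<close> only, where an eigenvalue on the unit circle has exactly one argument and is therefore
  not counted twice.
\<close>

definition eigcount :: "complex ^ 'm ^ 'm \<Rightarrow> real set \<Rightarrow> nat" where
  "eigcount V A = (\<Sum>\<theta> | \<theta> \<in> A \<and> ker (V - mat (cis \<theta>)) \<noteq> {0}. vec.dim (ker (V - mat (cis \<theta>))))"

lemma ker_minus: "ker (- A) = ker A"
  by (simp add: ker_def mat_vec_minus_left)

lemma mat_uminus: "mat (- c) = - (mat c :: 'a::ring_1 ^ 'm ^ 'm)"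
  by (simp add: vec_eq_iff mat_def)

text \<open>
  Passing from \<open>W\<close> to \<open>- W\<close> moves the point at which the spectral flow is measured from \<open>-1\<close> to \<open>1\<close>.
\<close>

lemma k_count_eigcount: "k_count W \<epsilon> = eigcount (- W) {0..<\<epsilon>}"
proof -
  have "ker (W - mat (cis (pi + \<theta>))) = ker (- W - mat (cis \<theta>))" for \<theta>
  proof -
    have "cis (pi + \<theta>) = - cis \<theta>" by (simp add: cis.ctr complex_eq_iff)
    then have "W - mat (cis (pi + \<theta>)) = - (- W - mat (cis \<theta>))" by (simp add: mat_uminus)
    then show ?thesis by (simp only: ker_minus)
  qed
  then show ?thesis by (simp add: k_count_def eigcount_def)
qed

lemma cis_Arg2pi: "norm z = 1 \<Longrightarrow> cis (Arg2pi z) = z"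
  using Arg2pi[of z] by (simp add: is_Arg_def cis_conv_exp)

lemma Arg2pi_cis: "0 \<le> \<theta> \<Longrightarrow> \<theta> < 2 * pi \<Longrightarrow> Arg2pi (cis \<theta>) = \<theta>"
  by (rule Arg2pi_unique[of 1]) (auto simp: cis_conv_exp)

lemma ker_eq_0_iff_dim: "ker A = {0} \<longleftrightarrow> vec.dim (ker A) = 0"
proof -
  have "0 \<in> ker A" by (simp add: ker_def)
  then show ?thesis by auto
qed

lemma eigcount_card:
  fixes V :: "complex ^ 'm ^ 'm"
  assumes d: "unitary_diag V Q w" and A: "A \<subseteq> {0..<2 * pi}"
  shows "eigcount V A = card {k. Arg2pi (w k) \<in> A}"
proof -
  have n: "norm (w k) = 1" for k using d by (simp add: unitary_diag_def)
  let ?T = "{\<theta>. \<theta> \<in> A \<and> ker (V - mat (cis \<theta>)) \<noteq> {0}}"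
  have T: "?T = {\<theta>\<in>A. \<exists>k. w k = cis \<theta>}"
    by (auto simp: ker_eq_0_iff_dim unitary_diag_dim_ker[OF d] card_eq_0_iff)
  have T2: "?T \<subseteq> (\<lambda>k. Arg2pi (w k)) ` UNIV"
  proof
    fix \<theta> assume "\<theta> \<in> ?T"
    then obtain k where "\<theta> \<in> A" "w k = cis \<theta>" unfolding T by blast
    with A have "\<theta> = Arg2pi (w k)" by (auto simp: Arg2pi_cis)
    then show "\<theta> \<in> (\<lambda>k. Arg2pi (w k)) ` UNIV" by blast
  qed
  have "eigcount V A = (\<Sum>\<theta>\<in>?T. card {k. w k = cis \<theta>})"
    by (simp add: eigcount_def unitary_diag_dim_ker[OF d])
  also have "\<dots> = card (\<Union>\<theta>\<in>?T. {k. w k = cis \<theta>})"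
  proof (rule card_UN_disjoint[symmetric])
    show "finite ?T" by (rule finite_subset[OF T2]) simp
    show "\<forall>i\<in>?T. \<forall>j\<in>?T. i \<noteq> j \<longrightarrow> {k. w k = cis i} \<inter> {k. w k = cis j} = {}"
    proof (intro ballI impI)
      fix i j assume "i \<in> ?T" "j \<in> ?T" "i \<noteq> j"
      then have "Arg2pi (cis i) = i" "Arg2pi (cis j) = j" using A by (auto intro!: Arg2pi_cis)
      with \<open>i \<noteq> j\<close> have "cis i \<noteq> cis j" by metis
      then show "{k. w k = cis i} \<inter> {k. w k = cis j} = {}" by auto
    qed
  qed auto
  also have "(\<Union>\<theta>\<in>?T. {k. w k = cis \<theta>}) = {k. Arg2pi (w k) \<in> A}"
  proof
    show "{k. Arg2pi (w k) \<in> A} \<subseteq> (\<Union>\<theta>\<in>?T. {k. w k = cis \<theta>})"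
    proof
      fix k assume "k \<in> {k. Arg2pi (w k) \<in> A}"
      then have "Arg2pi (w k) \<in> A" "w k = cis (Arg2pi (w k))" using n by (auto simp: cis_Arg2pi)
      then show "k \<in> (\<Union>\<theta>\<in>?T. {k. w k = cis \<theta>})" unfolding T by blast
    qed
    show "(\<Union>\<theta>\<in>?T. {k. w k = cis \<theta>}) \<subseteq> {k. Arg2pi (w k) \<in> A}"
      unfolding T using A by (auto simp: Arg2pi_cis subset_iff)
  qed
  finally show ?thesis .
qed

lemma eigcount_Un:
  assumes "unitary V" "A \<union> B \<subseteq> {0..<2 * pi}" "A \<inter> B = {}"
  shows "eigcount V (A \<union> B) = eigcount V A + eigcount V B"
proof -
  obtain Q w where d: "unitary_diag V Q w" using unitary_diagonalizable assms(1) by blast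
  have "{k. Arg2pi (w k) \<in> A \<union> B} = {k. Arg2pi (w k) \<in> A} \<union> {k. Arg2pi (w k) \<in> B}" by auto
  moreover have "{k. Arg2pi (w k) \<in> A} \<inter> {k. Arg2pi (w k) \<in> B} = {}" using assms(3) by auto
  ultimately show ?thesis using assms(2) by (simp add: eigcount_card[OF d] card_Un_disjoint)
qed

lemma eigcount_all:
  fixes V :: "complex ^ 'm ^ 'm"
  assumes "unitary V"
  shows "eigcount V {0..<2 * pi} = CARD('m)"
proof -
  obtain Q w where d: "unitary_diag V Q w" using unitary_diagonalizable assms(1) by blast
  have "Arg2pi (w k) \<in> {0..<2*pi}" for k using Arg2pi by auto
  then show ?thesis by (subst eigcount_card[OF d]) auto
qed

lemma eigcount_0:
  assumes "unitary V"
  shows "eigcount V {0} = vec.dim (ker (V - mat 1))"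
  by (cases "ker (V - mat 1) = {0}") (auto simp: eigcount_def ker_eq_0_iff_dim conj_commute cong: conj_cong)

lemma eigcount_mono:
  assumes "unitary V" "A \<subseteq> B" "B \<subseteq> {0..<2 * pi}"
  shows "eigcount V A \<le> eigcount V B"
  using eigcount_Un[OF assms(1), of A "B - A"] assms(2,3)
  by (metis Diff_disjoint Un_Diff_cancel le_add1 sup.absorb2)

lemma spectrum_of_unitary_diag:
  assumes d: "unitary_diag V Q w"
  shows "spectrum_of V = range w"
proof -
  have "z \<in> spectrum_of V \<longleftrightarrow> ker (V - mat z) \<noteq> {0}" for z
    by (auto simp: spectrum_of_def ker_def algebra_simps mat_scalar_vec)
  then show ?thesis
    by (auto simp: ker_eq_0_iff_dim unitary_diag_dim_ker[OF d] card_eq_0_iff)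
qed

lemma det_unitary_diag:
  assumes d: "unitary_diag V Q w"
  shows "det (mat 1 - mat c ** V) = (\<Prod>k\<in>UNIV. 1 - c * w k)" "det V = (\<Prod>k\<in>UNIV. w k)"
proof -
  have Q: "unitary Q" and V: "V = Q ** diagm w ** adj Q" using d by (auto simp: unitary_diag_def)
  have conj: "det (Q ** D ** adj Q) = det D" for D
  proof -
    have "det Q * det (adj Q) = 1" using unitary_right[OF Q] by (metis det_I det_mul)
    then show ?thesis by (simp add: det_mul)
  qed
  have dd: "det (diagm f) = (\<Prod>k\<in>UNIV. f k)" for f :: "'a \<Rightarrow> complex"
    by (subst det_diagonal) (auto simp: diagm_def)
  show "det V = (\<Prod>k\<in>UNIV. w k)" by (simp add: V conj dd)
  have "mat c ** V = Q ** (mat c ** diagm w) ** adj Q"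
    unfolding V by (metis matrix_mul_assoc mat_scalar_commute)
  moreover have "mat 1 = Q ** mat 1 ** adj Q" by (simp add: unitary_right[OF Q])
  ultimately have "mat 1 - mat c ** V = Q ** (mat 1 - mat c ** diagm w) ** adj Q"
    by (simp only: mat_mult_diff_left mat_mult_diff_right)
  moreover have "mat 1 - mat c ** diagm w = diagm (\<lambda>k. 1 - c * w k)"
    unfolding mat_scalar_left by (simp add: vec_eq_iff diagm_def mat_def)
  ultimately show "det (mat 1 - mat c ** V) = (\<Prod>k\<in>UNIV. 1 - c * w k)" by (simp add: conj dd)
qed

text \<open>
  Since \<open>z - V = z (1 - cnj z V)\<close>, avoiding the eigenvalue \<open>z\<close> is the non-vanishing of a continuous function of \<open>V\<close>.
\<close>

lemma notin_spectrum_det: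
  assumes "unitary V" "norm z = 1"
  shows "z \<notin> spectrum_of V \<longleftrightarrow> det (mat 1 - mat (cnj z) ** V) \<noteq> 0"
proof -
  obtain Q w where d: "unitary_diag V Q w" using unitary_diagonalizable assms(1) by blast
  have zz: "z * cnj z = 1" using assms(2) by (metis complex_norm_square of_real_1 one_power2)
  have "1 - cnj z * w k = 0 \<longleftrightarrow> w k = z" for k
  proof
    assume "1 - cnj z * w k = 0"
    then have "z * (cnj z * w k) = z" by simp
    then show "w k = z" using zz by (simp add: mult.assoc[symmetric])
  qed (use zz in \<open>simp add: mult.commute\<close>)
  then show ?thesis
    by (simp add: spectrum_of_unitary_diag[OF d] det_unitary_diag[OF d] image_iff) metis
qed

lemma continuous_on_det [continuous_intros]:
  fixes V :: "'a::topological_space \<Rightarrow> complex ^ 'm ^ 'm"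
  assumes "continuous_on S V"
  shows "continuous_on S (\<lambda>t. det (V t))"
  unfolding det_def by (intro continuous_intros assms)

subsection \<open>Lower bounds by quadratic forms\<close>

text \<open>
  The matrix \<open>P\<close> gives the coordinates of a vector along the eigenvectors with argument in \<open>A\<close>. It is injective on \<open>K\<close>:
  on a vector without such components the form is a combination, with non-negative weights, of its values
  \<open>c (cis \<theta> - 1)\<close> at the other eigenvalues, hence has real part at most \<open>0\<close>.
\<close>

lemma eigcount_ge_form:
  fixes V :: "complex ^ 'm ^ 'm"
  assumes V: "unitary V" and K: "vec.subspace K" and A: "A \<subseteq> {0..<2 * pi}"
    and neg: "\<And>\<theta>. \<theta> \<in> {0..<2 * pi} - A \<Longrightarrow> Re (c * (cis \<theta> - 1)) \<le> 0"
    and pos: "\<And>v. v \<in> K \<Longrightarrow> v \<noteq> 0 \<Longrightarrow> 0 < Re (c * cdot (V *v v - v) v)"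
  shows "vec.dim K \<le> eigcount V A"
proof -
  obtain Q w where d: "unitary_diag V Q w" using unitary_diagonalizable V by blast
  have Q: "unitary Q" and VQ: "V = Q ** diagm w ** adj Q" using d by (auto simp: unitary_diag_def)
  have n: "norm (w k) = 1" for k using d by (simp add: unitary_diag_def)
  define G where "G = {k. Arg2pi (w k) \<in> A}"
  define P where "P = diagm (\<lambda>k. if k \<in> G then 1 else 0) ** adj Q"
  have Pk: "(P *v v) $ k = (if k \<in> G then (adj Q *v v) $ k else 0)" for v k
    by (simp add: P_def matrix_vector_mul_assoc[symmetric] diagm_vec)
  have inj: "v = 0" if "v \<in> K" "P *v v = 0" for v
  proof (rule ccontr)
    assume "v \<noteq> 0"
    define y where "y = adj Q *v v"
    have vy: "v = Q *v y" using Q by (simp add: y_def unitary_vec_adj)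
    have y0: "y $ k = 0" if "k \<in> G" for k using Pk[of v k] that \<open>P *v v = 0\<close> by (simp add: y_def)
    have "V *v v = Q *v (diagm w *v y)"
      by (simp add: VQ y_def matrix_vector_mul_assoc matrix_mul_assoc)
    then have "cdot (V *v v - v) v = cdot (diagm w *v y) y - cdot y y"
      using Q unfolding vy by (simp add: cdot_diff_left cdot_mat_left[of Q] unitary_adj_vec)
    also have "\<dots> = (\<Sum>k\<in>UNIV. (w k - 1) * (y $ k * cnj (y $ k)))"
      by (simp add: cdot_def diagm_vec sum_subtractf[symmetric] algebra_simps)
    finally have "Re (c * cdot (V *v v - v) v) = (\<Sum>k\<in>UNIV. Re (c * (w k - 1)) * (norm (y $ k))\<^sup>2)"
      by (simp add: complex_norm_square[symmetric] sum_distrib_left mult.assoc[symmetric] cong: sum.cong)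
    also have "\<dots> \<le> 0"
    proof (rule sum_nonpos)
      fix k :: 'm
      show "Re (c * (w k - 1)) * (norm (y $ k))\<^sup>2 \<le> 0"
      proof (cases "k \<in> G")
        case False
        then have "Arg2pi (w k) \<in> {0..<2*pi} - A" using Arg2pi by (auto simp: G_def)
        from neg[OF this] n show ?thesis by (simp add: cis_Arg2pi mult_nonpos_nonneg)
      qed (simp add: y0)
    qed
    finally show False using pos[OF that(1) \<open>v \<noteq> 0\<close>] by simp
  qed
  have lin: "Vector_Spaces.linear (*s) (*s) ((*v) P)" by simp
  have "inj_on ((*v) P) K"
  proof (rule inj_onI)
    fix x y assume h: "x \<in> K" "y \<in> K" "P *v x = P *v y"
    then have "x - y \<in> K" "P *v (x - y) = 0" using K by (auto intro: vec.subspace_diff simp: algebra_simps)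
    then show "x = y" using inj[of "x - y"] by simp
  qed
  then have "inj_on ((*v) P) (vec.span K)" using K vec.span_eq_iff by metis
  from vec.dim_image_eq[OF lin this] have "vec.dim K = vec.dim ((*v) P ` K)" by simp
  also have "\<dots> \<le> card ((\<lambda>k. axis k (1::complex)) ` G)"
  proof (rule vec.dim_le_card)
    show "(*v) P ` K \<subseteq> vec.span ((\<lambda>k. axis k 1) ` G)"
    proof safe
      fix x
      have "P *v x = (\<Sum>k\<in>UNIV. (P *v x) $ k *s axis k 1)"
        by (simp add: vec_eq_iff axis_def if_distrib[of "\<lambda>u. _ * u"] cong: if_cong)
      also have "\<dots> = (\<Sum>k\<in>G. (P *v x) $ k *s axis k 1)"
        by (rule sum.mono_neutral_right) (auto simp: Pk)
      also have "\<dots> \<in> vec.span ((\<lambda>k. axis k 1) ` G)"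
        by (intro vec.span_sum vec.span_scale vec.span_base) auto
      finally show "P *v x \<in> vec.span ((\<lambda>k. axis k 1) ` G)" .
    qed
  qed simp
  also have "\<dots> \<le> card G" by (rule card_image_le) simp
  also have "\<dots> = eigcount V A" by (simp add: eigcount_card[OF d A] G_def)
  finally show ?thesis .
qed

lemma cos_le_cos_arc: "0 \<le> a \<Longrightarrow> a \<le> x \<Longrightarrow> x \<le> 2 * pi - a \<Longrightarrow> cos x \<le> cos a"
proof (cases "x \<le> pi")
  case False
  assume h: "0 \<le> a" "a \<le> x" "x \<le> 2 * pi - a"
  have "cos x = cos (2 * pi - x)" by simp
  also have "\<dots> \<le> cos a" using h False by (intro cos_monotone_0_pi_le) auto
  finally show ?thesis .
qed (auto intro: cos_monotone_0_pi_le)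

lemma Re_cis_arc:
  "Re (cis a * (cis \<theta> - 1)) = cos (\<theta> + a) - cos a"
  by (simp add: right_diff_distrib cis_mult add.commute)

text \<open>
  The value \<open>cis \<theta> - 1\<close>, rotated back by half the length of the arc, has real part
  \<open>cos (\<theta> - \<epsilon> / 2) - cos (\<epsilon> / 2)\<close>. This is positive exactly on the open arc from \<open>0\<close> to \<open>\<epsilon>\<close>.
\<close>

lemma eigcount_ge_form_ccw:
  fixes V :: "complex ^ 'm ^ 'm"
  assumes V: "unitary V" and K: "vec.subspace K" and e: "0 < \<epsilon>" "\<epsilon> < 2 * pi"
    and pos: "\<And>v. v \<in> K \<Longrightarrow> v \<noteq> 0 \<Longrightarrow> 0 < Re (cis (- (\<epsilon> / 2)) * cdot (V *v v - v) v)"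
  shows "vec.dim K \<le> eigcount V {0<..<\<epsilon>}"
proof (rule eigcount_ge_form[OF V K _ _ pos])
  fix \<theta> assume "\<theta> \<in> {0..<2 * pi} - {0<..<\<epsilon>}"
  then consider "\<theta> = 0" | "\<epsilon> \<le> \<theta>" "\<theta> < 2 * pi" by fastforce
  then show "Re (cis (- (\<epsilon> / 2)) * (cis \<theta> - 1)) \<le> 0"
    unfolding Re_cis_arc using e cos_le_cos_arc[of "\<epsilon> / 2" "\<theta> - \<epsilon> / 2"] by cases auto
qed (use e in auto)

lemma eigcount_ge_form_cw:
  fixes V :: "complex ^ 'm ^ 'm"
  assumes V: "unitary V" and K: "vec.subspace K" and e: "0 < \<epsilon>" "\<epsilon> < 2 * pi"
    and pos: "\<And>v. v \<in> K \<Longrightarrow> v \<noteq> 0 \<Longrightarrow> 0 < Re (cis (\<epsilon> / 2) * cdot (V *v v - v) v)"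
  shows "vec.dim K \<le> eigcount V {2 * pi - \<epsilon><..<2 * pi}"
proof (rule eigcount_ge_form[OF V K _ _ pos])
  fix \<theta> assume "\<theta> \<in> {0..<2 * pi} - {2 * pi - \<epsilon><..<2 * pi}"
  then have "0 \<le> \<theta>" "\<theta> \<le> 2 * pi - \<epsilon>" by fastforce+
  then show "Re (cis (\<epsilon> / 2) * (cis \<theta> - 1)) \<le> 0"
    unfolding Re_cis_arc using e cos_le_cos_arc[of "\<epsilon> / 2" "\<theta> + \<epsilon> / 2"] by auto
qed (use e in auto)

section \<open>The spectral flow as a difference of values of one function\<close>

lemma int_valued_continuous_constant:
  fixes n :: "'a::topological_space \<Rightarrow> int"
  assumes "connected T" "continuous_on T (\<lambda>x. real_of_int (n x))" "x \<in> T" "y \<in> T"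
  shows "n x = n y"
proof -
  have "(\<lambda>x. real_of_int (n x)) constant_on T"
  proof (rule continuous_discrete_range_constant[OF assms(1,2)])
    fix x assume "x \<in> T"
    have "1 \<le> norm (real_of_int (n y) - real_of_int (n x))"
      if "real_of_int (n y) \<noteq> real_of_int (n x)" for y
      using that by simp
    then show "\<exists>e>0. \<forall>y. y \<in> T \<and> real_of_int (n y) \<noteq> real_of_int (n x) \<longrightarrow>
        e \<le> norm (real_of_int (n y) - real_of_int (n x))"
      by (intro exI[of _ 1]) auto
  qed
  with assms(3,4) show ?thesis unfolding constant_on_def by (metis of_int_eq_iff)
qed

text \<open>
  Because \<open>1 - cis \<alpha> = 2 sin (\<alpha> / 2) cis ((\<alpha> - pi) / 2)\<close>.
\<close>

lemma Im_Ln_one_minus_cis: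
  assumes "0 < \<alpha>" "\<alpha> < 2 * pi"
  shows "Im (Ln (1 - cis \<alpha>)) = (\<alpha> - pi) / 2"
proof -
  have s: "0 < sin (\<alpha> / 2)" using assms by (intro sin_gt_zero) auto
  have "cos \<alpha> = 1 - 2 * (sin (\<alpha> / 2))\<^sup>2" using cos_double_sin[of "\<alpha> / 2"] by simp
  moreover have "sin \<alpha> = 2 * sin (\<alpha> / 2) * cos (\<alpha> / 2)" using sin_double[of "\<alpha> / 2"] by simp
  moreover have "cos ((\<alpha> - pi) / 2) = sin (\<alpha> / 2)" "sin ((\<alpha> - pi) / 2) = - cos (\<alpha> / 2)"
    by (simp_all add: diff_divide_distrib cos_diff sin_diff)
  ultimately have "of_real (2 * sin (\<alpha> / 2)) * exp (\<i> * of_real ((\<alpha> - pi) / 2)) = 1 - cis \<alpha>"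
    unfolding cis_conv_exp[symmetric] by (simp add: complex_eq_iff power2_eq_square)
  then have "Arg (1 - cis \<alpha>) = (\<alpha> - pi) / 2"
    using assms s by (intro Arg_unique[of "2 * sin (\<alpha> / 2)"]) auto
  moreover have "1 - cis \<alpha> \<noteq> 0"
    using s \<open>of_real _ * exp _ = _\<close> by (metis exp_not_eq_zero mult_eq_0_iff of_real_eq_0_iff order_less_irrefl zero_neq_numeral)
  ultimately show ?thesis by (simp add: Arg_eq_Im_Ln)
qed

text \<open>
  Up to a constant, \<open>2 Im (Ln (1 - cis (- \<epsilon>) w))\<close> is the argument of \<open>w\<close> with its jump placed at \<open>cis \<epsilon>\<close>, whereas
  \<open>Arg2pi\<close> jumps at \<open>1\<close>. The two branches differ by \<open>2 pi\<close> for the points with argument in \<open>[0,\<epsilon>)\<close>, so the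
  difference counts these points.
\<close>

lemma Im_sum_Ln_cut:
  fixes w :: "'m::finite \<Rightarrow> complex"
  assumes n: "\<And>k. norm (w k) = 1" and e: "0 < \<epsilon>" "\<epsilon> < 2 * pi" and ne: "\<And>k. w k \<noteq> cis \<epsilon>"
  shows "2 * Im (\<Sum>k\<in>UNIV. Ln (1 - cis (- \<epsilon>) * w k)) =
    (\<Sum>k\<in>UNIV. Arg2pi (w k)) + 2 * pi * card {k. Arg2pi (w k) \<in> {0..<\<epsilon>}} - CARD('m) * (\<epsilon> + pi)"
proof -
  have "2 * Im (Ln (1 - cis (- \<epsilon>) * w k)) =
      Arg2pi (w k) + 2 * pi * (if Arg2pi (w k) < \<epsilon> then 1 else 0) - (\<epsilon> + pi)" for k
  proof -
    define \<theta> where "\<theta> = Arg2pi (w k)"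
    have t: "0 \<le> \<theta>" "\<theta> < 2 * pi" "cis \<theta> = w k" using Arg2pi n by (auto simp: \<theta>_def cis_Arg2pi)
    have "\<theta> \<noteq> \<epsilon>" using ne[of k] t(3) by auto
    define \<alpha> where "\<alpha> = \<theta> - \<epsilon> + 2 * pi * (if \<theta> < \<epsilon> then 1 else 0)"
    have a: "0 < \<alpha>" "\<alpha> < 2 * pi" using t e \<open>\<theta> \<noteq> \<epsilon>\<close> by (auto simp: \<alpha>_def)
    have "cis (- \<epsilon>) * w k = cis (\<theta> - \<epsilon>)" using t(3) by (metis add.commute cis_mult diff_conv_add_uminus)
    also have "\<dots> = cis \<alpha>" by (simp add: \<alpha>_def complex_eq_iff)
    finally show ?thesis using Im_Ln_one_minus_cis[OF a] by (simp add: \<alpha>_def \<theta>_def)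
  qed
  then have "2 * Im (\<Sum>k\<in>UNIV. Ln (1 - cis (- \<epsilon>) * w k)) =
      (\<Sum>k\<in>UNIV. Arg2pi (w k)) + 2 * pi * (\<Sum>k\<in>UNIV. if Arg2pi (w k) < \<epsilon> then 1 else 0) - CARD('m) * (\<epsilon> + pi)"
    by (simp add: sum_distrib_left sum.distrib sum_subtractf)
  also have "(\<Sum>k\<in>UNIV. if Arg2pi (w k) < \<epsilon> then 1 else 0 :: real) = card {k. Arg2pi (w k) \<in> {0..<\<epsilon>}}"
    using Arg2pi by (subst sum.If_cases) (auto simp: )
  finally show ?thesis .
qed

text \<open>
  Hence \<open>1 - s z\<close> stays away from the branch cut of \<open>Ln\<close> while \<open>s\<close> runs from \<open>0\<close> to \<open>1\<close>.
\<close>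

lemma Re_one_minus_pos: "norm z = 1 \<Longrightarrow> z \<noteq> 1 \<Longrightarrow> 0 \<le> s \<Longrightarrow> s \<le> 1 \<Longrightarrow> 0 < Re (1 - of_real s * z)"
proof -
  assume h: "norm z = 1" "z \<noteq> 1" "0 \<le> s" "s \<le> 1"
  have "Re z < 1"
  proof (rule ccontr)
    assume "\<not> Re z < 1"
    moreover have "(Re z)\<^sup>2 + (Im z)\<^sup>2 = 1" using h(1) by (simp add: cmod_def)
    moreover have "Re z \<le> 1" using complex_Re_le_cmod[of z] h(1) by simp
    ultimately have "z = 1" by (simp add: complex_eq_iff)
    with h(2) show False by simp
  qed
  then have "s * Re z < 1" using h(3,4)
    by (metis less_eq_real_def mult_left_mono mult.right_neutral mult_zero_left order_le_less_trans zero_less_one mult_less_cancel_left2 linorder_not_le)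
  then show ?thesis by simp
qed

text \<open>
  If \<open>L\<close> is a continuous logarithm of \<open>det V\<close>, then \<open>Im L\<close> and the sum of the arguments of the eigenvalues differ by
  \<open>2 pi m\<close> with \<open>m\<close> integer valued. On a set \<open>S\<close> where the eigenvalue \<open>cis \<epsilon>\<close> is avoided, the sum of the arguments
  with the jump at \<open>cis \<epsilon>\<close> is continuous. By \<open>Im_sum_Ln_cut\<close> it differs from the former sum by \<open>2 pi\<close> times the number
  of eigenvalues in \<open>[0,\<epsilon>)\<close>. So \<open>m\<close> minus that number is continuous on \<open>S\<close>, and constant.

  No continuous choice of the individual eigenvalues is needed: only determinants, which are symmetric in them,
  enter the argument.
\<close>

theorem flow_function_exists:
  fixes V :: "'a::real_normed_vector \<Rightarrow> complex ^ 'm ^ 'm"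
  assumes Q: "convex Q" and cont: "continuous_on Q V" and uni: "\<And>p. p \<in> Q \<Longrightarrow> unitary (V p)"
  shows "\<exists>m :: 'a \<Rightarrow> int. \<forall>S \<epsilon>. S \<subseteq> Q \<and> convex S \<and> 0 < \<epsilon> \<and> \<epsilon> < 2 * pi \<and>
      (\<forall>p\<in>S. cis \<epsilon> \<notin> spectrum_of (V p)) \<longrightarrow>
      (\<forall>p\<in>S. \<forall>q\<in>S. m p - int (eigcount (V p) {0..<\<epsilon>}) = m q - int (eigcount (V q) {0..<\<epsilon>}))"
proof -
  have "\<forall>p\<in>Q. \<exists>U w. unitary_diag (V p) U w" using unitary_diagonalizable uni by blast
  then obtain U w where d: "\<And>p. p \<in> Q \<Longrightarrow> unitary_diag (V p) (U p) (w p)" by metis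
  have nw: "norm (w p k) = 1" if "p \<in> Q" for p k using d[OF that] by (simp add: unitary_diag_def)
  define \<Theta> where "\<Theta> p = (\<Sum>k\<in>UNIV. Arg2pi (w p k))" for p
  have det: "det (V p) = exp (\<i> * of_real (\<Theta> p))" if "p \<in> Q" for p
  proof -
    have "exp (\<i> * of_real (\<Theta> p)) = (\<Prod>k\<in>UNIV. cis (Arg2pi (w p k)))"
      by (simp add: \<Theta>_def sum_distrib_left exp_sum cis_conv_exp)
    then show ?thesis using nw[OF that] by (simp add: det_unitary_diag(2)[OF d[OF that]] cis_Arg2pi)
  qed
  have "contractible Q" using Q convex_imp_contractible by blast
  moreover have "continuous_on Q (\<lambda>p. det (V p))" by (intro continuous_intros cont)
  ultimately obtain L where L: "continuous_on Q L" "\<And>p. p \<in> Q \<Longrightarrow> det (V p) = exp (L p)"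
    using continuous_logarithm_on_contractible[of Q "\<lambda>p. det (V p)"] det by (metis exp_not_eq_zero)
  have "\<forall>p\<in>Q. \<exists>n::int. Im (L p) = \<Theta> p + 2 * pi * n"
  proof
    fix p assume "p \<in> Q"
    then have "exp (L p) = exp (\<i> * of_real (\<Theta> p))" using L(2) det by metis
    then obtain n :: int where "L p = \<i> * of_real (\<Theta> p) + (of_int (2 * n) * of_real pi) * \<i>"
      by (auto simp: exp_eq)
    then have "Im (L p) = \<Theta> p + 2 * pi * n" by simp
    then show "\<exists>n::int. Im (L p) = \<Theta> p + 2 * pi * n" by blast
  qed
  then obtain m :: "'a \<Rightarrow> int" where m: "\<And>p. p \<in> Q \<Longrightarrow> Im (L p) = \<Theta> p + 2 * pi * m p" by metis
  show ?thesis
  proof (intro exI[of _ m] allI impI ballI; elim conjE)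
    fix S :: "'a set" and \<epsilon> p q
    assume S: "S \<subseteq> Q" "convex S" and e: "0 < \<epsilon>" "\<epsilon> < 2 * pi"
      and ne: "\<forall>p\<in>S. cis \<epsilon> \<notin> spectrum_of (V p)" and pq: "p \<in> S" "q \<in> S"
    have wne: "w p k \<noteq> cis \<epsilon>" if "p \<in> S" for p k
    proof -
      have "p \<in> Q" using that S by blast
      then have "spectrum_of (V p) = range (w p)" using spectrum_of_unitary_diag[OF d] by blast
      moreover have "w p k \<in> range (w p)" by simp
      ultimately show ?thesis using ne that by metis
    qed
    define z where "z p k = cis (- \<epsilon>) * w p k" for p k
    have z1: "norm (z p k) = 1" "z p k \<noteq> 1" if "p \<in> S" for p k
    proof -
      show "norm (z p k) = 1" using nw that S by (auto simp: z_def norm_mult)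
      show "z p k \<noteq> 1"
      proof
        assume "z p k = 1"
        then have "cis \<epsilon> * (cis (- \<epsilon>) * w p k) = cis \<epsilon>" by (simp add: z_def)
        then show False using wne[OF that] by (simp add: mult.assoc[symmetric] cis_mult)
      qed
    qed
    have Rpos: "0 < Re (1 - of_real s * z p k)" if "s \<in> {0..1}" "p \<in> S" for s p k
      using that z1 Re_one_minus_pos by simp
    \<comment> \<open>The sum of logarithms \<open>H 1 p\<close> is continuous in \<open>p\<close>, although its summands depend on an arbitrary numbering of the
      eigenvalues: scaling \<open>V p\<close> by \<open>s\<close> connects it with \<open>H 0 p = 0\<close>, and \<open>exp (H s p)\<close> is the continuous determinant \<open>G\<close>.\<close>
    define G where "G r = det (mat 1 - mat (of_real (fst r) * cis (- \<epsilon>)) ** V (snd r))" for r :: "real \<times> 'a"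
    have G: "G (s, p) = (\<Prod>k\<in>UNIV. 1 - of_real s * z p k)" if "p \<in> S" for s p
      using that S det_unitary_diag(1)[OF d, of p] by (auto simp: G_def z_def mult.assoc)
    define H where "H s p = (\<Sum>k\<in>UNIV. Ln (1 - of_real s * z p k))" for s p
    have expH: "exp (H s p) = G (s, p)" if "s \<in> {0..1}" "p \<in> S" for s p
    proof -
      have "1 - of_real s * z p k \<noteq> 0" for k using Rpos[OF that, of k] by force
      then show ?thesis using that by (simp add: G H_def exp_sum)
    qed
    have cm: "continuous_on ({0..1} \<times> S) (\<lambda>r. mat (of_real (fst r) * cis (- \<epsilon>)) :: complex ^ 'm ^ 'm)"
      unfolding mat_def
    proof (intro continuous_on_vec_lambda)
      fix i j :: 'm
      show "continuous_on ({0..1} \<times> S) (\<lambda>r. if i = j then of_real (fst r) * cis (- \<epsilon>) else 0)"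
        by (cases "i = j") (auto intro!: continuous_intros)
    qed
    have cV: "continuous_on ({0..1} \<times> S) (\<lambda>r. V (snd r))"
      by (rule continuous_on_compose2[OF cont]) (use S in \<open>auto intro!: continuous_intros\<close>)
    have cG: "continuous_on ({0..1} \<times> S) G"
      unfolding G_def by (intro continuous_intros cm cV)
    have "contractible ({0..1::real} \<times> S)" using S by (intro convex_imp_contractible convex_Times) auto
    moreover have "G r \<noteq> 0" if "r \<in> {0..1} \<times> S" for r
      using expH[of "fst r" "snd r"] that by (metis exp_not_eq_zero mem_Times_iff prod.collapse)
    ultimately obtain g where g: "continuous_on ({0..1} \<times> S) g" "\<And>r. r \<in> {0..1} \<times> S \<Longrightarrow> G r = exp (g r)"
      using continuous_logarithm_on_contractible[OF cG] by metis
    \<comment> \<open>For fixed \<open>p\<close> the logarithms \<open>g\<close> and \<open>H\<close> of \<open>G\<close> are both continuous in \<open>s\<close>, so their imaginary parts differ by a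
      constant multiple of \<open>2 pi\<close>.\<close>
    have Im_H: "Im (H 1 p) = Im (g (1, p)) - Im (g (0, p))" if p: "p \<in> S" for p
    proof -
      have "\<forall>s\<in>{0..1}. \<exists>n::int. Im (g (s, p)) = Im (H s p) + 2 * pi * n"
      proof
        fix s :: real assume s: "s \<in> {0..1}"
        then have "exp (g (s, p)) = exp (H s p)" using expH[OF s p] g(2)[of "(s, p)"] p by simp
        then obtain n :: int where "g (s, p) = H s p + (of_int (2 * n) * of_real pi) * \<i>"
          by (auto simp: exp_eq)
        then have "Im (g (s, p)) = Im (H s p) + 2 * pi * n" by simp
        then show "\<exists>n::int. Im (g (s, p)) = Im (H s p) + 2 * pi * n" by blast
      qed
      then obtain n :: "real \<Rightarrow> int" where n: "\<And>s. s \<in> {0..1} \<Longrightarrow> Im (g (s, p)) = Im (H s p) + 2 * pi * n s"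
        by metis
      have cg: "continuous_on {0..1} (\<lambda>s. g (s, p))"
        by (rule continuous_on_compose2[OF g(1)]) (use p in \<open>auto intro!: continuous_intros\<close>)
      have cH: "continuous_on {0..1} (\<lambda>s. H s p)"
        unfolding H_def
      proof (intro continuous_intros)
        fix s :: real and k assume "s \<in> {0..1}"
        then show "1 - of_real s * z p k \<notin> \<real>\<^sub>\<le>\<^sub>0"
          using Rpos[of s p k] p by (auto simp: complex_nonpos_Reals_iff)
      qed
      have "continuous_on {0..1} (\<lambda>s. (Im (g (s, p)) - Im (H s p)) / (2 * pi))"
        by (intro continuous_intros cg cH) auto
      moreover have "(Im (g (s, p)) - Im (H s p)) / (2 * pi) = real_of_int (n s)" if "s \<in> {0..1}" for s
        using n[OF that] by simp
      ultimately have "continuous_on {0..1} (\<lambda>s. real_of_int (n s))"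
        by (rule continuous_on_eq)
      then have "n 0 = n 1" by (rule int_valued_continuous_constant[rotated]) auto
      moreover have "H 0 p = 0" by (simp add: H_def)
      ultimately show ?thesis using n[of 0] n[of 1] by simp
    qed
    have c: "continuous_on S (\<lambda>p. g (1, p))" "continuous_on S (\<lambda>p. g (0, p))"
      by (rule continuous_on_compose2[OF g(1)]; auto intro!: continuous_intros)+
    have cL: "continuous_on S L" using L(1) S(1) continuous_on_subset by blast
    have "continuous_on S (\<lambda>p. (Im (L p) - 2 * (Im (g (1, p)) - Im (g (0, p))) - CARD('m) * (\<epsilon> + pi)) / (2 * pi))"
      by (intro continuous_intros c cL) auto
    moreover have "(Im (L p) - 2 * (Im (g (1, p)) - Im (g (0, p))) - CARD('m) * (\<epsilon> + pi)) / (2 * pi) =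
        real_of_int (m p - int (eigcount (V p) {0..<\<epsilon>}))" if p: "p \<in> S" for p
    proof -
      have pQ: "p \<in> Q" using p S by blast
      have "eigcount (V p) {0..<\<epsilon>} = card {k. Arg2pi (w p k) \<in> {0..<\<epsilon>}}"
        using e by (intro eigcount_card[OF d[OF pQ]]) auto
      moreover have "2 * Im (H 1 p) = \<Theta> p + 2 * pi * card {k. Arg2pi (w p k) \<in> {0..<\<epsilon>}} - CARD('m) * (\<epsilon> + pi)"
        using Im_sum_Ln_cut[of "w p" \<epsilon>, OF nw[OF pQ] e wne[OF p]] by (simp add: H_def z_def \<Theta>_def)
      ultimately show ?thesis using Im_H[OF p] m[OF pQ] by (simp add: field_simps)
    qed
    ultimately have "continuous_on S (\<lambda>p. real_of_int (m p - int (eigcount (V p) {0..<\<epsilon>})))"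
      by (metis (mono_tags, lifting) continuous_on_cong)
    then show "m p - int (eigcount (V p) {0..<\<epsilon>}) = m q - int (eigcount (V q) {0..<\<epsilon>})"
      using int_valued_continuous_constant[of S "\<lambda>p. m p - int (eigcount (V p) {0..<\<epsilon>})"]
        convex_connected[OF S(2)] pq by blast
  qed
qed

section \<open>Flow functions along a path\<close>

text \<open>
  The increments of \<open>f\<close> are the spectral flow of \<open>V\<close> through \<open>1\<close>. As long as no eigenvalue passes the end point
  \<open>cis \<epsilon>\<close> of the arc, the number of eigenvalues on it changes only at the other end, at \<open>1\<close>. In this form no partition
  occurs, and the Maslov index becomes a telescoping sum.
\<close>

definition flow_fun :: "(real \<Rightarrow> complex ^ 'm ^ 'm) \<Rightarrow> real \<Rightarrow> real \<Rightarrow> (real \<Rightarrow> int) \<Rightarrow> bool" where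
  "flow_fun V a b f \<longleftrightarrow> (\<forall>c d \<epsilon>. a \<le> c \<and> c \<le> d \<and> d \<le> b \<and> 0 < \<epsilon> \<and> \<epsilon> < 2 * pi \<and>
     (\<forall>t\<in>{c..d}. cis \<epsilon> \<notin> spectrum_of (V t)) \<longrightarrow>
     f d - f c = int (eigcount (V d) {0..<\<epsilon>}) - int (eigcount (V c) {0..<\<epsilon>}))"

lemma flow_funD:
  assumes "flow_fun V a b f" "c \<in> {a..b}" "d \<in> {a..b}" "0 < \<epsilon>" "\<epsilon> < 2 * pi"
    and "\<And>t. t \<in> closed_segment c d \<Longrightarrow> cis \<epsilon> \<notin> spectrum_of (V t)"
  shows "f d - f c = int (eigcount (V d) {0..<\<epsilon>}) - int (eigcount (V c) {0..<\<epsilon>})"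
proof (cases "c \<le> d")
  case True
  then have "\<forall>t\<in>{c..d}. cis \<epsilon> \<notin> spectrum_of (V t)" using assms(6) by (auto simp: closed_segment_eq_real_ivl)
  with True assms(1-5) show ?thesis unfolding flow_fun_def by auto
next
  case False
  then have "\<forall>t\<in>{d..c}. cis \<epsilon> \<notin> spectrum_of (V t)" using assms(6) by (auto simp: closed_segment_eq_real_ivl)
  with False assms(1-5) have "f c - f d = int (eigcount (V c) {0..<\<epsilon>}) - int (eigcount (V d) {0..<\<epsilon>})"
    unfolding flow_fun_def by auto
  then show ?thesis by simp
qed

lemma notin_spectrum_open:
  fixes V :: "real \<Rightarrow> complex ^ 'm ^ 'm"
  assumes cont: "continuous_on S V" and uni: "\<And>t. t \<in> S \<Longrightarrow> unitary (V t)"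
    and t0: "t0 \<in> S" and z: "norm z = 1" "z \<notin> spectrum_of (V t0)"
  shows "\<exists>\<eta>>0. \<forall>t\<in>S. \<bar>t - t0\<bar> < \<eta> \<longrightarrow> z \<notin> spectrum_of (V t)"
proof -
  define F where "F t = det (mat 1 - mat (cnj z) ** V t)" for t
  have "continuous_on S F" unfolding F_def by (intro continuous_intros cont)
  moreover have "F t0 \<noteq> 0" using notin_spectrum_det[OF uni[OF t0] z(1)] z(2) by (simp add: F_def)
  ultimately obtain \<eta> where "\<eta> > 0" "\<And>t. t \<in> S \<Longrightarrow> dist t t0 < \<eta> \<Longrightarrow> dist (F t) (F t0) < norm (F t0)"
    using t0 unfolding continuous_on_iff by (metis zero_less_norm_iff)
  moreover have "z \<notin> spectrum_of (V t)" if "t \<in> S" "dist (F t) (F t0) < norm (F t0)" for t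
    using notin_spectrum_det[OF uni[OF that(1)] z(1)] that(2) by (auto simp: F_def[symmetric] dist_norm)
  ultimately show ?thesis by (intro exI[of _ \<eta>]) (auto simp: dist_real_def)
qed

lemma small_arc_around_1:
  fixes V :: "complex ^ 'm ^ 'm"
  assumes "unitary V"
  shows "\<exists>\<epsilon>>0. \<epsilon> < pi \<and> cis \<epsilon> \<notin> spectrum_of V \<and> cis (2 * pi - \<epsilon>) \<notin> spectrum_of V \<and>
     eigcount V {0<..<\<epsilon>} = 0 \<and> eigcount V {2 * pi - \<epsilon>..<2 * pi} = 0"
proof -
  obtain Q w where d: "unitary_diag V Q w" using unitary_diagonalizable assms by blast
  have n: "norm (w k) = 1" for k using d by (simp add: unitary_diag_def)
  define T where "T = insert pi ((\<lambda>k. Arg2pi (w k)) ` {k. 0 < Arg2pi (w k)} \<union> range (\<lambda>k. 2 * pi - Arg2pi (w k)))"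
  define \<epsilon> where "\<epsilon> = Min T / 2"
  have fin: "finite T" "T \<noteq> {}" by (auto simp: T_def)
  have "0 < x" if "x \<in> T" for x using that Arg2pi by (auto simp: T_def)
  then have e0: "0 < \<epsilon>" using fin by (auto simp: \<epsilon>_def)
  have le: "2 * \<epsilon> \<le> x" if "x \<in> T" for x using that fin by (simp add: \<epsilon>_def)
  have epi: "\<epsilon> < pi" using le[of pi] e0 by (simp add: T_def)
  have a: "\<epsilon> < Arg2pi (w k)" if "0 < Arg2pi (w k)" for k using le[of "Arg2pi (w k)"] that e0 by (auto simp: T_def)
  have b: "Arg2pi (w k) < 2 * pi - \<epsilon>" for k using le[of "2 * pi - Arg2pi (w k)"] e0 by (auto simp: T_def)
  have z: "{k. Arg2pi (w k) \<in> {0<..<\<epsilon>}} = {}" "{k. Arg2pi (w k) \<in> {2 * pi - \<epsilon>..<2 * pi}} = {}"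
    using a by fastforce (use b in \<open>auto simp: linorder_not_le[symmetric]\<close>)
  have "w k \<noteq> cis \<epsilon>" for k using a[of k] e0 epi Arg2pi_cis[of \<epsilon>] by force
  moreover have "w k \<noteq> cis (2 * pi - \<epsilon>)" for k using b[of k] e0 epi Arg2pi_cis[of "2 * pi - \<epsilon>"] by force
  ultimately have "cis \<epsilon> \<notin> spectrum_of V" "cis (2 * pi - \<epsilon>) \<notin> spectrum_of V"
    unfolding spectrum_of_unitary_diag[OF d] by (metis rangeE)+
  moreover have "eigcount V {0<..<\<epsilon>} = 0" "eigcount V {2 * pi - \<epsilon>..<2 * pi} = 0"
    using e0 epi by (subst eigcount_card[OF d]; auto simp only: z card.empty; auto)+
  ultimately show ?thesis using e0 epi by blast
qed

lemma eigcount_kernel_split: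
  assumes "unitary V" "0 < \<epsilon>" "\<epsilon> < 2 * pi"
  shows "vec.dim (ker (V - mat 1)) + eigcount V {0<..<\<epsilon>} = eigcount V {0..<\<epsilon>}"
proof -
  have "{0..<\<epsilon>} = {0} \<union> {0<..<\<epsilon>}" "{0<..<\<epsilon>} \<subseteq> {0..<2 * pi}" using assms by auto
  then show ?thesis using eigcount_Un[OF assms(1), of "{0}" "{0<..<\<epsilon>}"] assms by (simp add: eigcount_0)
qed

text \<open>
  Near \<open>t\<^sub>0\<close> the eigenvalues that come from the eigenvalue \<open>1\<close> of \<open>V(t\<^sub>0)\<close> stay on the arc between the angles
  \<open>-\<epsilon>\<close> and \<open>\<epsilon>\<close>, and those with angle in \<open>[0,\<epsilon>)\<close> determine \<open>f\<close>. To see that the number on this arc is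
  constant, the flow is computed twice, with end points \<open>\<epsilon>\<close> and \<open>2 pi - \<epsilon>\<close>: the complementary arc in between keeps
  its number of eigenvalues.
\<close>

lemma flow_fun_local:
  fixes V :: "real \<Rightarrow> complex ^ 'm ^ 'm"
  assumes flow: "flow_fun V a b f" and cont: "continuous_on {a..b} V"
    and uni: "\<And>t. t \<in> {a..b} \<Longrightarrow> unitary (V t)" and t0: "t0 \<in> {a..b}"
  shows "\<exists>\<epsilon> \<eta>. 0 < \<epsilon> \<and> \<epsilon> < pi \<and> 0 < \<eta> \<and> (\<forall>t\<in>{a..b}. \<bar>t - t0\<bar> < \<eta> \<longrightarrow>
     cis \<epsilon> \<notin> spectrum_of (V t) \<and> cis (2 * pi - \<epsilon>) \<notin> spectrum_of (V t) \<and>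
     eigcount (V t) {0..<\<epsilon>} + eigcount (V t) {2 * pi - \<epsilon>..<2 * pi} = vec.dim (ker (V t0 - mat 1)) \<and>
     f t - f t0 = int (eigcount (V t) {0..<\<epsilon>}) - int (vec.dim (ker (V t0 - mat 1))))"
proof -
  obtain \<epsilon> where e: "0 < \<epsilon>" "\<epsilon> < pi" "cis \<epsilon> \<notin> spectrum_of (V t0)" "cis (2 * pi - \<epsilon>) \<notin> spectrum_of (V t0)"
    and z: "eigcount (V t0) {0<..<\<epsilon>} = 0" "eigcount (V t0) {2 * pi - \<epsilon>..<2 * pi} = 0"
    using small_arc_around_1[OF uni[OF t0]] by blast
  obtain \<eta>1 where h1: "\<eta>1 > 0" "\<And>t. t \<in> {a..b} \<Longrightarrow> \<bar>t - t0\<bar> < \<eta>1 \<Longrightarrow> cis \<epsilon> \<notin> spectrum_of (V t)"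
    using notin_spectrum_open[OF cont uni t0 _ e(3)] by auto
  obtain \<eta>2 where h2: "\<eta>2 > 0" "\<And>t. t \<in> {a..b} \<Longrightarrow> \<bar>t - t0\<bar> < \<eta>2 \<Longrightarrow> cis (2 * pi - \<epsilon>) \<notin> spectrum_of (V t)"
    using notin_spectrum_open[OF cont uni t0 _ e(4)] by auto
  have split0: "eigcount (V t) {0..<\<epsilon>} = vec.dim (ker (V t - mat 1)) + eigcount (V t) {0<..<\<epsilon>}"
    if "t \<in> {a..b}" for t
    using eigcount_kernel_split[OF uni[OF that], of \<epsilon>] e by simp
  have split1: "eigcount (V t) {0..<2 * pi - \<epsilon>} = eigcount (V t) {0..<\<epsilon>} + eigcount (V t) {\<epsilon>..<2 * pi - \<epsilon>}"
    and split2: "CARD('m) = eigcount (V t) {0..<2 * pi - \<epsilon>} + eigcount (V t) {2 * pi - \<epsilon>..<2 * pi}"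
    if "t \<in> {a..b}" for t
  proof -
    have "{0..<2 * pi - \<epsilon>} = {0..<\<epsilon>} \<union> {\<epsilon>..<2 * pi - \<epsilon>}" "{0..<2 * pi} = {0..<2 * pi - \<epsilon>} \<union> {2 * pi - \<epsilon>..<2 * pi}"
      using e by auto
    then show "eigcount (V t) {0..<2 * pi - \<epsilon>} = eigcount (V t) {0..<\<epsilon>} + eigcount (V t) {\<epsilon>..<2 * pi - \<epsilon>}"
      "CARD('m) = eigcount (V t) {0..<2 * pi - \<epsilon>} + eigcount (V t) {2 * pi - \<epsilon>..<2 * pi}"
      using eigcount_Un[OF uni[OF that], of "{0..<\<epsilon>}" "{\<epsilon>..<2 * pi - \<epsilon>}"]
        eigcount_Un[OF uni[OF that], of "{0..<2 * pi - \<epsilon>}" "{2 * pi - \<epsilon>..<2 * pi}"]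
        eigcount_all[OF uni[OF that]] e
      by (auto simp: disjoint_iff)
  qed
  show ?thesis
  proof (rule exI[of _ \<epsilon>], rule exI[of _ "min \<eta>1 \<eta>2"], intro conjI ballI impI)
    fix t assume t: "t \<in> {a..b}" "\<bar>t - t0\<bar> < min \<eta>1 \<eta>2"
    have seg: "s \<in> {a..b}" "\<bar>s - t0\<bar> < \<eta>1" "\<bar>s - t0\<bar> < \<eta>2" if "s \<in> closed_segment t0 t" for s
      using that t t0 by (auto simp: closed_segment_eq_real_ivl split: if_splits)
    show "cis \<epsilon> \<notin> spectrum_of (V t)" "cis (2 * pi - \<epsilon>) \<notin> spectrum_of (V t)"
      using h1(2) h2(2) t by auto
    have f1: "f t - f t0 = int (eigcount (V t) {0..<\<epsilon>}) - int (eigcount (V t0) {0..<\<epsilon>})"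
      using e by (intro flow_funD[OF flow t0 t(1)] h1(2) seg) auto
    have f2: "f t - f t0 = int (eigcount (V t) {0..<2 * pi - \<epsilon>}) - int (eigcount (V t0) {0..<2 * pi - \<epsilon>})"
      using e by (intro flow_funD[OF flow t0 t(1)] h2(2) seg) auto
    show "f t - f t0 = int (eigcount (V t) {0..<\<epsilon>}) - int (vec.dim (ker (V t0 - mat 1)))"
      using f1 split0[OF t0] z by simp
    show "eigcount (V t) {0..<\<epsilon>} + eigcount (V t) {2 * pi - \<epsilon>..<2 * pi} = vec.dim (ker (V t0 - mat 1))"
      using f1 f2 split0[OF t0] split1[OF t(1)] split1[OF t0] split2[OF t(1)] split2[OF t0] z by linarith
  qed (use e h1 h2 in auto)
qed

lemma locally_constant_int:
  fixes f :: "real \<Rightarrow> int"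
  assumes "\<And>t0. t0 \<in> {a..b} \<Longrightarrow> \<exists>\<eta>>0. \<forall>t\<in>{a..b}. \<bar>t - t0\<bar> < \<eta> \<longrightarrow> f t = f t0"
    and "x \<in> {a..b}" "y \<in> {a..b}"
  shows "f x = f y"
proof (rule int_valued_continuous_constant[of "{a..b}"])
  show "continuous_on {a..b} (\<lambda>x. real_of_int (f x))"
    unfolding continuous_on_iff
  proof (intro ballI allI impI)
    fix t0 and e :: real assume "t0 \<in> {a..b}" "0 < e"
    then obtain \<eta> where "\<eta> > 0" "\<forall>t\<in>{a..b}. \<bar>t - t0\<bar> < \<eta> \<longrightarrow> f t = f t0" using assms(1) by blast
    then show "\<exists>d>0. \<forall>t\<in>{a..b}. dist t t0 < d \<longrightarrow> dist (real_of_int (f t)) (real_of_int (f t0)) < e"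
      using \<open>0 < e\<close> by (intro exI[of _ \<eta>]) (auto simp: dist_real_def)
  qed
qed (use assms in auto)

text \<open>
  If the eigenvalue \<open>1\<close> keeps its multiplicity, it uses up all eigenvalues near \<open>1\<close>, and none enters or leaves.
\<close>

lemma flow_fun_constant_kernel:
  fixes V :: "real \<Rightarrow> complex ^ 'm ^ 'm"
  assumes flow: "flow_fun V a b f" and cont: "continuous_on {a..b} V"
    and uni: "\<And>t. t \<in> {a..b} \<Longrightarrow> unitary (V t)"
    and dim: "\<And>t. t \<in> {a..b} \<Longrightarrow> vec.dim (ker (V t - mat 1)) = d"
    and xy: "x \<in> {a..b}" "y \<in> {a..b}"
  shows "f x = f y"
proof (rule locally_constant_int[OF _ xy])
  fix t0 assume t0: "t0 \<in> {a..b}"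
  obtain \<epsilon> \<eta> where h: "0 < \<epsilon>" "\<epsilon> < pi" "0 < \<eta>" "\<And>t. t \<in> {a..b} \<Longrightarrow> \<bar>t - t0\<bar> < \<eta> \<Longrightarrow>
     eigcount (V t) {0..<\<epsilon>} + eigcount (V t) {2 * pi - \<epsilon>..<2 * pi} = vec.dim (ker (V t0 - mat 1)) \<and>
     f t - f t0 = int (eigcount (V t) {0..<\<epsilon>}) - int (vec.dim (ker (V t0 - mat 1)))"
    using flow_fun_local[OF flow cont uni t0] by blast
  have "f t = f t0" if t: "t \<in> {a..b}" "\<bar>t - t0\<bar> < \<eta>" for t
    using h(4)[OF t] eigcount_kernel_split[OF uni[OF t(1)], of \<epsilon>] h(1,2) dim[OF t0] dim[OF t(1)] by simp
  then show "\<exists>\<eta>>0. \<forall>t\<in>{a..b}. \<bar>t - t0\<bar> < \<eta> \<longrightarrow> f t = f t0" using h(3) by blast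
qed

text \<open>
  The number \<open>\<i> z\<close> points nearly in the direction \<open>\<i>\<close>. Turning it clockwise by \<open>\<epsilon> / 2 < pi / 2\<close> gives a positive
  real part if the relative error \<open>\<eta>\<close> is small in terms of \<open>\<epsilon>\<close>.
\<close>

lemma form_ccw:
  assumes "0 < \<epsilon>" "\<epsilon> < pi" "norm (z - of_real q) \<le> \<eta> * q" "0 < q" "\<eta> * (1 + cos (\<epsilon> / 2)) < sin (\<epsilon> / 2)" "0 < k"
  shows "0 < Re (cis (- (\<epsilon> / 2)) * (of_real k * \<i> * z))"
proof -
  have s: "0 < sin (\<epsilon> / 2)" "0 < cos (\<epsilon> / 2)" using assms(1,2) by (auto intro!: sin_gt_zero cos_gt_zero_pi)
  have r: "Re z \<ge> q - \<eta> * q" "Im z \<le> \<eta> * q"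
    using abs_Re_le_cmod[of "z - of_real q"] abs_Im_le_cmod[of "z - of_real q"] assms(3) by auto
  have eta: "0 \<le> \<eta>" using assms(3,4) by (metis norm_ge_zero order_trans zero_le_mult_iff linorder_not_le)
  have "sin (\<epsilon> / 2) * Re z - cos (\<epsilon> / 2) * Im z \<ge> sin (\<epsilon> / 2) * (q - \<eta> * q) - cos (\<epsilon> / 2) * (\<eta> * q)"
    using r s by (intro diff_mono mult_left_mono) auto
  also have "sin (\<epsilon> / 2) * (q - \<eta> * q) - cos (\<epsilon> / 2) * (\<eta> * q) \<ge> q * (sin (\<epsilon> / 2) - \<eta> * (1 + cos (\<epsilon> / 2)))"
  proof -
    have "\<eta> * q * sin (\<epsilon> / 2) \<le> \<eta> * q * 1" using eta assms(4) by (intro mult_left_mono) auto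
    then show ?thesis by (simp add: algebra_simps)
  qed
  finally have "0 < sin (\<epsilon> / 2) * Re z - cos (\<epsilon> / 2) * Im z"
    using assms(4,5) by (smt (verit) mult_pos_pos)
  then have "0 < k * (sin (\<epsilon> / 2) * Re z - cos (\<epsilon> / 2) * Im z)" using assms(6) by simp
  then show ?thesis by (simp add: algebra_simps)
qed

lemma form_cw:
  assumes "0 < \<epsilon>" "\<epsilon> < pi" "norm (z + of_real q) \<le> \<eta> * q" "0 < q" "\<eta> * (1 + cos (\<epsilon> / 2)) < sin (\<epsilon> / 2)" "0 < k"
  shows "0 < Re (cis (\<epsilon> / 2) * (of_real k * \<i> * z))"
proof -
  have "norm (- cnj z - of_real q) \<le> \<eta> * q"
    using assms(3) complex_mod_cnj[of "z + of_real q"] norm_minus_cancel[of "cnj z + of_real q"]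
    by (metis (no_types, lifting) complex_cnj_add complex_cnj_complex_of_real minus_add_distrib uminus_add_conv_diff add.commute)
  from form_ccw[OF assms(1,2) this assms(4,5,6)] show ?thesis by (simp add: algebra_simps)
qed

text \<open>
  If the form \<open>v\<^sup>* (V(t) - 1) v\<close> is close to \<open>\<i>\<close> times a positive number on a space as large as the kernel at \<open>t\<^sub>0\<close>,
  then \<open>eigcount_ge_form_ccw\<close> finds that many eigenvalues just counterclockwise of \<open>1\<close>. By \<open>flow_fun_local\<close> there are no
  others nearby, so the kernel has moved counterclockwise as a whole; likewise clockwise with \<open>-\<i>\<close>. The space \<open>K\<close>
  may depend on \<open>t\<close>, and only relative closeness is required, so the form may degenerate as \<open>t\<close> tends to \<open>t\<^sub>0\<close>.
\<close>

lemma flow_fun_crossing: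
  fixes V :: "real \<Rightarrow> complex ^ 'm ^ 'm"
  assumes flow: "flow_fun V a b f" and cont: "continuous_on {a..b} V"
    and uni: "\<And>t. t \<in> {a..b} \<Longrightarrow> unitary (V t)" and t0: "t0 \<in> {a..b}"
  shows "\<exists>\<kappa>>0. \<exists>\<eta>>0. \<forall>t\<in>{a..b}. \<bar>t - t0\<bar> < \<eta> \<longrightarrow>
     (\<forall>K. vec.subspace K \<and> vec.dim K = vec.dim (ker (V t0 - mat 1)) \<longrightarrow>
       ((\<forall>v\<in>K. v \<noteq> 0 \<longrightarrow> (\<exists>q>0. \<exists>k>0. \<exists>z. cdot (V t *v v - v) v = of_real k * \<i> * z \<and> norm (z - of_real q) \<le> \<kappa> * q)) \<longrightarrow>
          ker (V t - mat 1) = {0} \<and> f t = f t0) \<and>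
       ((\<forall>v\<in>K. v \<noteq> 0 \<longrightarrow> (\<exists>q>0. \<exists>k>0. \<exists>z. cdot (V t *v v - v) v = of_real k * \<i> * z \<and> norm (z + of_real q) \<le> \<kappa> * q)) \<longrightarrow>
          ker (V t - mat 1) = {0} \<and> f t = f t0 - int (vec.dim (ker (V t0 - mat 1)))))"
proof -
  let ?d = "vec.dim (ker (V t0 - mat 1))"
  obtain \<epsilon> \<eta> where h: "0 < \<epsilon>" "\<epsilon> < pi" "0 < \<eta>" "\<And>t. t \<in> {a..b} \<Longrightarrow> \<bar>t - t0\<bar> < \<eta> \<Longrightarrow>
     eigcount (V t) {0..<\<epsilon>} + eigcount (V t) {2 * pi - \<epsilon>..<2 * pi} = vec.dim (ker (V t0 - mat 1)) \<and>
     f t - f t0 = int (eigcount (V t) {0..<\<epsilon>}) - int (vec.dim (ker (V t0 - mat 1)))"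
    using flow_fun_local[OF flow cont uni t0] by blast
  have s: "0 < sin (\<epsilon> / 2)" "0 < cos (\<epsilon> / 2)" using h(1,2) by (auto intro!: sin_gt_zero cos_gt_zero_pi)
  \<comment> \<open>Half of the bound on the relative error in \<open>form_ccw\<close>.\<close>
  define \<kappa> where "\<kappa> = sin (\<epsilon> / 2) / (2 * (1 + cos (\<epsilon> / 2)))"
  have k: "0 < \<kappa>" "\<kappa> * (1 + cos (\<epsilon> / 2)) < sin (\<epsilon> / 2)" using s by (auto simp: \<kappa>_def field_simps intro!: add_pos_pos)
  show ?thesis
  proof (rule exI[of _ \<kappa>], rule conjI[OF k(1)], rule exI[of _ \<eta>], intro conjI ballI allI impI; (elim conjE)?)
    fix t K
    assume t: "t \<in> {a..b}" "\<bar>t - t0\<bar> < \<eta>" and K: "vec.subspace K" "vec.dim K = ?d"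
      and pos: "\<forall>v\<in>K. v \<noteq> 0 \<longrightarrow> (\<exists>q>0. \<exists>k>0. \<exists>z. cdot (V t *v v - v) v = of_real k * \<i> * z \<and> norm (z - of_real q) \<le> \<kappa> * q)"
    have "vec.dim K \<le> eigcount (V t) {0<..<\<epsilon>}"
    proof (rule eigcount_ge_form_ccw[OF uni[OF t(1)] K(1) h(1)])
      fix v assume "v \<in> K" "v \<noteq> 0"
      then obtain q k z where "q > 0" "k > 0" "cdot (V t *v v - v) v = of_real k * \<i> * z" "norm (z - of_real q) \<le> \<kappa> * q"
        using pos by blast
      then show "0 < Re (cis (- (\<epsilon> / 2)) * cdot (V t *v v - v) v)"
        using form_ccw[OF h(1,2)] k(2) by metis
    qed (use h in auto)
    moreover have "vec.dim (ker (V t - mat 1)) + eigcount (V t) {0<..<\<epsilon>} = eigcount (V t) {0..<\<epsilon>}"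
      using h(1,2) by (intro eigcount_kernel_split[OF uni[OF t(1)]]) auto
    moreover note h(4)[OF t, THEN conjunct1] h(4)[OF t, THEN conjunct2] K(2)
    ultimately have "vec.dim (ker (V t - mat 1)) = 0" "f t = f t0" by linarith+
    then show "ker (V t - mat 1) = {0}" "f t = f t0" unfolding ker_eq_0_iff_dim by blast+
  next
    fix t K
    assume t: "t \<in> {a..b}" "\<bar>t - t0\<bar> < \<eta>" and K: "vec.subspace K" "vec.dim K = ?d"
      and pos: "\<forall>v\<in>K. v \<noteq> 0 \<longrightarrow> (\<exists>q>0. \<exists>k>0. \<exists>z. cdot (V t *v v - v) v = of_real k * \<i> * z \<and> norm (z + of_real q) \<le> \<kappa> * q)"
    have "vec.dim K \<le> eigcount (V t) {2 * pi - \<epsilon><..<2 * pi}"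
    proof (rule eigcount_ge_form_cw[OF uni[OF t(1)] K(1) h(1)])
      fix v assume "v \<in> K" "v \<noteq> 0"
      then obtain q k z where "q > 0" "k > 0" "cdot (V t *v v - v) v = of_real k * \<i> * z" "norm (z + of_real q) \<le> \<kappa> * q"
        using pos by blast
      then show "0 < Re (cis (\<epsilon> / 2) * cdot (V t *v v - v) v)"
        using form_cw[OF h(1,2)] k(2) by metis
    qed (use h in auto)
    also have "\<dots> \<le> eigcount (V t) {2 * pi - \<epsilon>..<2 * pi}"
      using h by (intro eigcount_mono[OF uni[OF t(1)]]) auto
    finally have "vec.dim K \<le> eigcount (V t) {2 * pi - \<epsilon>..<2 * pi}" .
    moreover have "vec.dim (ker (V t - mat 1)) + eigcount (V t) {0<..<\<epsilon>} = eigcount (V t) {0..<\<epsilon>}"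
      using h(1,2) by (intro eigcount_kernel_split[OF uni[OF t(1)]]) auto
    moreover note h(4)[OF t, THEN conjunct1] h(4)[OF t, THEN conjunct2] K(2)
    ultimately have "vec.dim (ker (V t - mat 1)) = 0" "f t = f t0 - int ?d" by linarith+
    then show "ker (V t - mat 1) = {0}" "f t = f t0 - int ?d" unfolding ker_eq_0_iff_dim by blast+
  qed (use h k in auto)
qed

section \<open>Summing isolated jumps\<close>

lemma finite_isolated:
  fixes T :: "real set"
  assumes "T \<subseteq> {a..b}" "\<And>t0. t0 \<in> {a..b} \<Longrightarrow> \<exists>\<eta>>0. \<forall>t\<in>T. \<bar>t - t0\<bar> < \<eta> \<longrightarrow> t = t0"
  shows "finite T"
proof (rule ccontr)
  assume "infinite T"
  then obtain l where l: "l \<in> {a..b}" "l islimpt T"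
    using assms(1) compact_eq_Bolzano_Weierstrass[of "{a..b}"] by auto
  obtain \<eta> where "\<eta> > 0" "\<forall>t\<in>T. \<bar>t - l\<bar> < \<eta> \<longrightarrow> t = l" using assms(2)[OF l(1)] by blast
  with l(2) show False by (auto simp: islimpt_approachable dist_real_def)
qed

text \<open>
  An eigenvalue that leaves at \<open>t\<close> changes \<open>f\<close> just after \<open>t\<close>. Hence \<open>f(t)\<close> plus the jumps at the points of \<open>[a,t)\<close> is
  locally constant, and the jump at \<open>b\<close> does not contribute.
\<close>

lemma sum_jumps_left:
  fixes f :: "real \<Rightarrow> int" and d :: "real \<Rightarrow> nat"
  assumes ab: "a \<le> b" and J: "\<And>t0. t0 \<in> {a..b} \<Longrightarrow> \<exists>\<eta>>0. \<forall>t\<in>{a..b}. \<bar>t - t0\<bar> < \<eta> \<longrightarrow>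
     (t0 < t \<longrightarrow> d t = 0 \<and> f t = f t0 - int (d t0)) \<and> (t < t0 \<longrightarrow> d t = 0 \<and> f t = f t0)"
  shows "finite {t\<in>{a..b}. d t \<noteq> 0}"
    and "f a - f b = int (\<Sum>t | t \<in> {a..<b} \<and> d t \<noteq> 0. d t)"
proof -
  show fin: "finite {t\<in>{a..b}. d t \<noteq> 0}"
  proof (rule finite_isolated[of _ a b])
    fix t0 assume "t0 \<in> {a..b}"
    from J[OF this] obtain \<eta> where h: "\<eta> > 0" "\<forall>t\<in>{a..b}. \<bar>t - t0\<bar> < \<eta> \<longrightarrow>
       (t0 < t \<longrightarrow> d t = 0 \<and> f t = f t0 - int (d t0)) \<and> (t < t0 \<longrightarrow> d t = 0 \<and> f t = f t0)" by blast
    have "t = t0" if "t \<in> {a..b}" "d t \<noteq> 0" "\<bar>t - t0\<bar> < \<eta>" for t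
      using h(2)[rule_format, of t] that by (cases t t0 rule: linorder_cases) auto
    with h(1) show "\<exists>\<eta>>0. \<forall>t\<in>{t\<in>{a..b}. d t \<noteq> 0}. \<bar>t - t0\<bar> < \<eta> \<longrightarrow> t = t0" by blast
  qed auto
  define g where "g t = f t + int (\<Sum>s | s \<in> {a..<t} \<and> d s \<noteq> 0. d s)" for t
  have "g a = g b"
  proof (rule locally_constant_int[of a b])
    fix t0 assume t0: "t0 \<in> {a..b}"
    obtain \<eta> where h: "\<eta> > 0" "\<And>t. t \<in> {a..b} \<Longrightarrow> \<bar>t - t0\<bar> < \<eta> \<Longrightarrow> t0 < t \<Longrightarrow> d t = 0 \<and> f t = f t0 - int (d t0)"
      "\<And>t. t \<in> {a..b} \<Longrightarrow> \<bar>t - t0\<bar> < \<eta> \<Longrightarrow> t < t0 \<Longrightarrow> d t = 0 \<and> f t = f t0"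
      using J[OF t0] by blast
    have "g t = g t0" if t: "t \<in> {a..b}" "\<bar>t - t0\<bar> < \<eta>" for t
    proof -
      consider "t = t0" | "t0 < t" | "t < t0" by linarith
      then show ?thesis
      proof cases
        case 2
        have sub: "d s = 0" if "s \<in> {t0<..<t}" for s using h(2)[of s] that t t0 by auto
        have "(\<Sum>s | s \<in> {a..<t} \<and> d s \<noteq> 0. d s) = (\<Sum>s\<in>insert t0 {s. s \<in> {a..<t0} \<and> d s \<noteq> 0}. d s)"
        proof (rule sum.mono_neutral_left)
          show "finite (insert t0 {s \<in> {a..<t0}. d s \<noteq> 0})"
            using t0 by (auto intro!: finite_subset[OF _ fin])
        next
          show "{s \<in> {a..<t}. d s \<noteq> 0} \<subseteq> insert t0 {s \<in> {a..<t0}. d s \<noteq> 0}"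
          proof
            fix s assume s: "s \<in> {s \<in> {a..<t}. d s \<noteq> 0}"
            then have "s \<notin> {t0<..<t}" using sub by auto
            with s show "s \<in> insert t0 {s \<in> {a..<t0}. d s \<noteq> 0}" by auto
          qed
        qed (use 2 t0 in auto)
        also have "\<dots> = d t0 + (\<Sum>s | s \<in> {a..<t0} \<and> d s \<noteq> 0. d s)"
          using t0 by (subst sum.insert) (auto intro!: finite_subset[OF _ fin])
        finally show ?thesis using h(2)[OF t 2] by (simp add: g_def)
      next
        case 3
        have sub: "d s = 0" if "s \<in> {t..<t0}" for s using h(3)[of s] that t t0 by auto
        have "{s \<in> {a..<t0}. d s \<noteq> 0} = {s \<in> {a..<t}. d s \<noteq> 0}"
        proof
          show "{s \<in> {a..<t0}. d s \<noteq> 0} \<subseteq> {s \<in> {a..<t}. d s \<noteq> 0}"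
          proof
            fix s assume s: "s \<in> {s \<in> {a..<t0}. d s \<noteq> 0}"
            then have "s \<notin> {t..<t0}" using sub by auto
            with s show "s \<in> {s \<in> {a..<t}. d s \<noteq> 0}" by auto
          qed
        qed (use 3 in auto)
        then show ?thesis using h(3)[OF t 3] by (simp add: g_def)
      qed simp
    qed
    then show "\<exists>\<eta>>0. \<forall>t\<in>{a..b}. \<bar>t - t0\<bar> < \<eta> \<longrightarrow> g t = g t0" using h(1) by blast
  qed (use ab in auto)
  then show "f a - f b = int (\<Sum>t | t \<in> {a..<b} \<and> d t \<noteq> 0. d t)" by (simp add: g_def)
qed

lemma sum_jumps_right:
  fixes f :: "real \<Rightarrow> int" and d :: "real \<Rightarrow> nat"
  assumes ab: "a \<le> b" and J: "\<And>t0. t0 \<in> {a..b} \<Longrightarrow> \<exists>\<eta>>0. \<forall>t\<in>{a..b}. \<bar>t - t0\<bar> < \<eta> \<longrightarrow>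
     (t0 < t \<longrightarrow> d t = 0 \<and> f t = f t0) \<and> (t < t0 \<longrightarrow> d t = 0 \<and> f t = f t0 - int (d t0))"
  shows "finite {t\<in>{a..b}. d t \<noteq> 0}"
    and "f b - f a = int (\<Sum>t | t \<in> {a<..b} \<and> d t \<noteq> 0. d t)"
proof -
  \<comment> \<open>Reflecting the interval exchanges arrivals and departures.\<close>
  let ?r = "\<lambda>t. a + b - t"
  have J': "\<exists>\<eta>>0. \<forall>t\<in>{a..b}. \<bar>t - t0\<bar> < \<eta> \<longrightarrow>
     (t0 < t \<longrightarrow> d (?r t) = 0 \<and> f (?r t) = f (?r t0) - int (d (?r t0))) \<and> (t < t0 \<longrightarrow> d (?r t) = 0 \<and> f (?r t) = f (?r t0))"
    if "t0 \<in> {a..b}" for t0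
  proof -
    have "?r t0 \<in> {a..b}" using that by auto
    from J[OF this] obtain \<eta> where h: "\<eta> > 0" "\<forall>t\<in>{a..b}. \<bar>t - ?r t0\<bar> < \<eta> \<longrightarrow>
     (?r t0 < t \<longrightarrow> d t = 0 \<and> f t = f (?r t0)) \<and> (t < ?r t0 \<longrightarrow> d t = 0 \<and> f t = f (?r t0) - int (d (?r t0)))"
      by blast
    have "(t0 < t \<longrightarrow> d (?r t) = 0 \<and> f (?r t) = f (?r t0) - int (d (?r t0))) \<and> (t < t0 \<longrightarrow> d (?r t) = 0 \<and> f (?r t) = f (?r t0))"
      if "t \<in> {a..b}" "\<bar>t - t0\<bar> < \<eta>" for t
      using h(2)[rule_format, of "?r t"] that by auto
    with h(1) show ?thesis by blast
  qed
  note S = sum_jumps_left[where f = "\<lambda>t. f (?r t)" and d = "\<lambda>t. d (?r t)", OF ab J']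
  have "{t\<in>{a..b}. d t \<noteq> 0} \<subseteq> ?r ` {t\<in>{a..b}. d (?r t) \<noteq> 0}"
  proof
    fix t assume "t \<in> {t\<in>{a..b}. d t \<noteq> 0}"
    then have "t = ?r (?r t)" "?r t \<in> {t\<in>{a..b}. d (?r t) \<noteq> 0}" by auto
    then show "t \<in> ?r ` {t\<in>{a..b}. d (?r t) \<noteq> 0}" by blast
  qed
  then show "finite {t\<in>{a..b}. d t \<noteq> 0}" using S(1) finite_subset by blast
  have "(\<Sum>t | t \<in> {a..<b} \<and> d (?r t) \<noteq> 0. d (?r t)) = (\<Sum>t | t \<in> {a<..b} \<and> d t \<noteq> 0. d t)"
    by (rule sum.reindex_bij_witness[of _ ?r ?r]) auto
  then show "f b - f a = int (\<Sum>t | t \<in> {a<..b} \<and> d t \<noteq> 0. d t)" using S(2) by simp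
qed

section \<open>Absolutely continuous functions\<close>

lemma AE_lebesgue_on_negligible:
  assumes "S \<in> sets lebesgue"
  shows "(AE x in lebesgue_on S. P x) \<longleftrightarrow> negligible {x\<in>S. \<not> P x}"
proof -
  have "(AE x in lebesgue_on S. P x) \<longleftrightarrow> (AE x in lebesgue. x \<in> S \<longrightarrow> P x)"
    using assms by (intro AE_restrict_space_iff) auto
  also have "\<dots> \<longleftrightarrow> negligible {x\<in>S. \<not> P x}"
  proof
    assume "AE x in lebesgue. x \<in> S \<longrightarrow> P x"
    then obtain N where "N \<in> null_sets lebesgue" "{x\<in>S. \<not> P x} \<subseteq> N"
      by (auto elim!: AE_E simp: null_sets_def simp del: emeasure_completion)
    then show "negligible {x\<in>S. \<not> P x}" by (meson negligible_iff_null_sets negligible_subset)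
  next
    assume "negligible {x\<in>S. \<not> P x}"
    then have "{x\<in>S. \<not> P x} \<in> null_sets lebesgue" by (simp add: negligible_iff_null_sets)
    then show "AE x in lebesgue. x \<in> S \<longrightarrow> P x" by (rule AE_I') auto
  qed
  finally show ?thesis .
qed

lemma abs_continuousD:
  assumes "abs_continuous a b f" "0 < \<epsilon>"
  shows "\<exists>\<delta>>0. \<forall>D. D division_of (\<Union>D) \<longrightarrow> \<Union>D \<subseteq> {a..b} \<longrightarrow>
     (\<Sum>k\<in>D. Sup k - Inf k) < \<delta> \<longrightarrow> (\<Sum>k\<in>D. norm (f (Sup k) - f (Inf k))) < \<epsilon>"
  using assms unfolding abs_continuous_def imp_conjL by meson

lemma abs_continuous_imp_continuous_on:
  assumes "abs_continuous a b f"
  shows "continuous_on {a..b} f"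
  unfolding continuous_on_iff
proof (intro ballI allI impI)
  fix x e :: real assume x: "x \<in> {a..b}" and "0 < e"
  obtain \<delta> where d: "0 < \<delta>" "\<forall>D. D division_of (\<Union>D) \<longrightarrow> \<Union>D \<subseteq> {a..b} \<longrightarrow>
       (\<Sum>k\<in>D. Sup k - Inf k) < \<delta> \<longrightarrow> (\<Sum>k\<in>D. norm (f (Sup k) - f (Inf k))) < e"
    using abs_continuousD[OF assms \<open>0 < e\<close>] by blast
  have "dist (f y) (f x) < e" if y: "y \<in> {a..b}" "dist y x < \<delta>" for y
  proof -
    define u v where "u = min x y" and "v = max x y"
    have uv: "u \<le> v" "{u..v} \<subseteq> {a..b}" "v - u < \<delta>" using x y by (auto simp: u_def v_def dist_real_def)
    have "{{u..v}} division_of \<Union>{{u..v}}"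
      using division_of_self[of u v] uv by simp
    from d(2)[rule_format, OF this] uv have "norm (f v - f u) < e" by simp
    then show ?thesis by (auto simp: u_def v_def dist_norm norm_minus_commute min_def max_def split: if_splits)
  qed
  then show "\<exists>d>0. \<forall>x'\<in>{a..b}. dist x' x < d \<longrightarrow> dist (f x') (f x) < e" using d(1) by blast
qed

text \<open>
  The fundamental theorem of calculus for absolutely continuous functions. In Henstock's sense it is
  nearly immediate: away from the exceptional null set \<open>N\<close> the gauge is chosen by differentiability, and
  the intervals tagged in \<open>N\<close> lie in an open set of small measure, where absolute continuity applies.
\<close>

theorem abs_continuous_has_integral:
  fixes f :: "real \<Rightarrow> 'b::euclidean_space"
  assumes ac: "abs_continuous 0 1 f"
    and der: "AE x in lebesgue_on {0<..<1}. (f has_vector_derivative f' x) (at x)"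
    and ab: "0 \<le> a" "a \<le> b" "b \<le> 1"
  shows "(f' has_integral (f b - f a)) {a..b}"
proof (cases "a = b")
  case False
  with ab have "a < b" by simp
  define N where "N = {x\<in>{a..b}. \<not> (f has_vector_derivative f' x) (at x)}"
  have "negligible ({x\<in>{0<..<1}. \<not> (f has_vector_derivative f' x) (at x)} \<union> {0, 1})"
    using der by (intro negligible_Un) (auto simp: AE_lebesgue_on_negligible)
  then have N: "negligible N"
    by (rule negligible_subset) (use ab in \<open>auto simp: N_def\<close>)
  define g where "g x = (if x \<in> N then 0 else f' x)" for x
  have "(g has_integral (f b - f a)) {a..b}"
    unfolding has_integral_real
  proof (intro allI impI)
    fix e :: real assume "0 < e"
    obtain \<delta> where d: "0 < \<delta>" "\<forall>D. D division_of (\<Union>D) \<longrightarrow> \<Union>D \<subseteq> {0..1} \<longrightarrow>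
       (\<Sum>k\<in>D. Sup k - Inf k) < \<delta> \<longrightarrow> (\<Sum>k\<in>D. norm (f (Sup k) - f (Inf k))) < e / 2"
      using abs_continuousD[OF ac half_gt_zero[OF \<open>0 < e\<close>]] by blast
    have "N \<in> sets lebesgue" using N by (simp add: negligible_imp_sets)
    then obtain T where T: "open T" "N \<subseteq> T" "T - N \<in> lmeasurable" "emeasure lebesgue (T - N) < ennreal \<delta>"
      using sets_lebesgue_outer_open[OF _ d(1)] by metis
    have TN: "T = (T - N) \<union> N" using T(2) by blast
    have Tm: "T \<in> lmeasurable"
      by (subst TN) (intro fmeasurable.Un T(3) negligible_imp_measurable N)
    have "measure lebesgue T \<le> measure lebesgue (T - N) + measure lebesgue N"
      by (subst TN) (rule measure_Un_le; use T(3) N negligible_imp_sets in \<open>auto\<close>)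
    also have "\<dots> = measure lebesgue (T - N)" using N by (simp add: negligible_imp_measure0)
    also have "\<dots> < \<delta>" using T(3,4) d(1) by (simp add: emeasure_eq_measure2 ennreal_less_iff)
    finally have mT: "measure lebesgue T < \<delta>" .
    define c where "c = e / (2 * (b - a))"
    have c: "0 < c" "c * (b - a) = e / 2" using \<open>0 < e\<close> \<open>a < b\<close> by (simp_all add: c_def divide_simps)
    have "\<exists>r>0. \<forall>y. \<bar>y - x\<bar> < r \<longrightarrow> norm (f y - f x - (y - x) *\<^sub>R f' x) \<le> c * \<bar>y - x\<bar>"
      if "x \<in> {a..b} - N" for x
    proof -
      have "(f has_derivative (\<lambda>h. h *\<^sub>R f' x)) (at x)" using that by (auto simp: N_def has_vector_derivative_def)
      then show ?thesis unfolding has_derivative_at_alt using c(1) by auto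
    qed
    then obtain r where r: "\<And>x. x \<in> {a..b} - N \<Longrightarrow> r x > 0"
      "\<And>x y. x \<in> {a..b} - N \<Longrightarrow> \<bar>y - x\<bar> < r x \<Longrightarrow> norm (f y - f x - (y - x) *\<^sub>R f' x) \<le> c * \<bar>y - x\<bar>"
      by metis
    define \<gamma> where "\<gamma> x = (if x \<in> N then T else if x \<in> {a..b} then ball x (r x) else UNIV)" for x
    have gauge: "gauge \<gamma>"
      unfolding gauge_def \<gamma>_def using T(1,2) r(1) by auto
    have "norm ((\<Sum>(x, k)\<in>p. measure lborel k *\<^sub>R g x) - (f b - f a)) < e"
      if p: "p tagged_division_of {a..b}" and fine: "\<gamma> fine p" for p
    proof -
      note tag = tagged_division_ofD[OF p]
      have fin: "finite p" by (rule tag(1))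
      define F where "F k = f (Sup k) - f (Inf k)" for k
      have intv: "\<exists>u v. k = {u..v} \<and> u \<le> v \<and> u \<le> x \<and> x \<le> v \<and> a \<le> u \<and> v \<le> b" if xk: "(x, k) \<in> p" for x k
      proof -
        obtain u v where "k = {u..v}" using tag(4)[OF xk] by auto
        moreover have "x \<in> k" "k \<subseteq> {a..b}" using tag(2,3) xk by auto
        ultimately show ?thesis by auto
      qed
      define p1 where "p1 = {(x, k) \<in> p. x \<in> N}"
      define p2 where "p2 = {(x, k) \<in> p. x \<notin> N}"
      have pp: "p1 \<union> p2 = p" "p1 \<inter> p2 = {}" "finite p1" "finite p2"
        using fin by (auto simp: p1_def p2_def intro: finite_subset[OF _ fin])
      have "(\<Sum>(x, k)\<in>p. measure lborel k *\<^sub>R g x) - (f b - f a) = (\<Sum>(x, k)\<in>p. measure lborel k *\<^sub>R g x - F k)"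
        using additive_tagged_division_1[OF \<open>a \<le> b\<close> p, of f] by (simp add: sum_subtractf case_prod_beta' F_def)
      also have "\<dots> = (\<Sum>(x, k)\<in>p1. measure lborel k *\<^sub>R g x - F k) + (\<Sum>(x, k)\<in>p2. measure lborel k *\<^sub>R g x - F k)"
        by (subst pp(1)[symmetric], rule sum.union_disjoint[OF pp(3,4,2)])
      finally have split: "norm ((\<Sum>(x, k)\<in>p. measure lborel k *\<^sub>R g x) - (f b - f a)) \<le>
          norm (\<Sum>(x, k)\<in>p1. measure lborel k *\<^sub>R g x - F k) + norm (\<Sum>(x, k)\<in>p2. measure lborel k *\<^sub>R g x - F k)"
        by (simp add: norm_triangle_ineq)
      have "norm (\<Sum>(x, k)\<in>p2. measure lborel k *\<^sub>R g x - F k) \<le> (\<Sum>(x, k)\<in>p2. c * measure lborel k)"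
      proof (rule sum_norm_le, safe)
        fix x k assume xk: "(x, k) \<in> p2"
        then have xkp: "(x, k) \<in> p" and xN: "x \<notin> N" by (auto simp: p2_def)
        obtain u v where k: "k = {u..v}" "u \<le> v" "u \<le> x" "x \<le> v" "a \<le> u" "v \<le> b" using intv[OF xkp] by blast
        then have x: "x \<in> {a..b} - N" using xN by auto
        have kb: "k \<subseteq> ball x (r x)" using fineD[OF fine xkp] x xN by (simp add: \<gamma>_def)
        have "u \<in> k" "v \<in> k" using k(1,2) by auto
        then have "u \<in> ball x (r x)" "v \<in> ball x (r x)" using kb by blast+
        then have uv: "\<bar>u - x\<bar> < r x" "\<bar>v - x\<bar> < r x" by (auto simp: dist_real_def)
        have "measure lborel k *\<^sub>R g x - F k = (f u - f x - (u - x) *\<^sub>R f' x) - (f v - f x - (v - x) *\<^sub>R f' x)"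
          using k xN by (simp add: F_def g_def algebra_simps)
        then have "norm (measure lborel k *\<^sub>R g x - F k) \<le> c * \<bar>u - x\<bar> + c * \<bar>v - x\<bar>"
          by (simp only:) (intro norm_triangle_le_diff add_mono r(2)[OF x uv(1)] r(2)[OF x uv(2)])
        also have "\<dots> = c * measure lborel k" using k by (simp add: algebra_simps)
        finally show "norm (measure lborel k *\<^sub>R g x - F k) \<le> c * measure lborel k" .
      qed
      also have "\<dots> \<le> (\<Sum>(x, k)\<in>p. c * measure lborel k)"
        using fin c by (intro sum_mono2) (auto simp: p2_def)
      also have "\<dots> = c * (\<Sum>(x, k)\<in>p. measure lborel k)" by (simp add: sum_distrib_left case_prod_beta')
      also have "\<dots> = e / 2"
        using additive_content_tagged_division[of p a b] p c \<open>a < b\<close> by simp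
      finally have b2: "norm (\<Sum>(x, k)\<in>p2. measure lborel k *\<^sub>R g x - F k) \<le> e / 2" .
      define D where "D = snd ` p1"
      have p1t: "p1 tagged_division_of (\<Union>D)"
        unfolding D_def
        by (rule tagged_partial_division_of_Union_self, rule tagged_partial_division_subset)
           (use p in \<open>auto simp: tagged_division_of_def p1_def\<close>)
      have Dd: "D division_of (\<Union>D)" using division_of_tagged_division[OF p1t] by (simp add: D_def)
      have Dk: "\<exists>u v. k = {u..v} \<and> u \<le> v \<and> a \<le> u \<and> v \<le> b \<and> k \<subseteq> T" if "k \<in> D" for k
      proof -
        from that obtain x where x: "(x, k) \<in> p" "x \<in> N" by (auto simp: D_def p1_def)
        then have "k \<subseteq> T" using fineD[OF fine x(1)] by (simp add: \<gamma>_def)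
        with intv[OF x(1)] show ?thesis by blast
      qed
      have "(\<Sum>k\<in>D. Sup k - Inf k) = (\<Sum>k\<in>D. measure lebesgue k)"
      proof (rule sum.cong)
        fix k assume "k \<in> D"
        then obtain u v where "k = {u..v}" "u \<le> v" using Dk by blast
        then show "Sup k - Inf k = measure lebesgue k" by simp
      qed simp
      also have "\<dots> = measure lebesgue (\<Union>D)" by (rule content_division[OF Dd])
      also have "\<dots> \<le> measure lebesgue T"
        using Dk lmeasurable_division[OF Dd] Tm by (intro measure_mono_fmeasurable) (auto simp: fmeasurableD)
      finally have "(\<Sum>k\<in>D. Sup k - Inf k) < \<delta>" using mT by simp
      moreover have "\<Union>D \<subseteq> {0..1}" using Dk ab by fastforce
      ultimately have bD: "(\<Sum>k\<in>D. norm (F k)) < e / 2" using d(2)[rule_format, OF Dd] by (simp add: F_def)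
      have "norm (\<Sum>(x, k)\<in>p1. measure lborel k *\<^sub>R g x - F k) \<le> (\<Sum>(x, k)\<in>p1. norm (F k))"
        by (rule sum_norm_le) (auto simp: p1_def g_def)
      \<comment> \<open>Tags with the same interval can occur only if it has empty interior, where \<open>F\<close> vanishes. So the sum may be taken
        over the intervals themselves.\<close>
      also have "\<dots> = (\<Sum>(x, k)\<in>p1. if k = {} then 0 else norm (F k))"
      proof (rule sum.cong, simp, safe)
        fix x k assume "(x, k) \<in> p1"
        then have "k \<noteq> {}" using tag(2) by (auto simp: p1_def)
        then show "norm (F k) = (if k = {} then 0 else norm (F k))" by simp
      qed
      also have "\<dots> = (\<Sum>k\<in>D. if k = {} then 0 else norm (F k))"
        unfolding D_def
      proof (rule sum.over_tagged_division_lemma[OF p1t])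
        fix u v :: real assume "box u v = {}"
        then show "(if cbox u v = {} then 0 else norm (F (cbox u v))) = 0"
          by (cases "u = v") (auto simp: F_def)
      qed
      also have "\<dots> = (\<Sum>k\<in>D. norm (F k))"
        using division_ofD(3)[OF Dd] by (intro sum.cong) auto
      finally show ?thesis using split b2 bD by linarith
    qed
    then show "\<exists>\<gamma>. gauge \<gamma> \<and> (\<forall>\<D>. \<D> tagged_division_of {a..b} \<and> \<gamma> fine \<D> \<longrightarrow>
        norm ((\<Sum>(x, k)\<in>\<D>. measure lborel k *\<^sub>R g x) - (f b - f a)) < e)"
      using gauge by blast
  qed
  then show ?thesis
    by (rule has_integral_spike[OF N, rotated]) (auto simp: g_def)
qed (simp add: has_integral_refl)

lemma abs_continuous_bilinear:
  assumes h: "bounded_bilinear h" and f: "abs_continuous a b f" and g: "abs_continuous a b g"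
  shows "abs_continuous a b (\<lambda>x. h (f x) (g x))"
proof -
  interpret bounded_bilinear h by (rule h)
  obtain K where K: "0 < K" "\<And>u v. norm (h u v) \<le> norm u * norm v * K" using pos_bounded by blast
  have bd: "\<exists>C>0. \<forall>x\<in>{a..b}. norm (u x) \<le> C" if "abs_continuous a b u" for u :: "real \<Rightarrow> 'z::real_normed_vector"
  proof -
    have "bounded (u ` {a..b})"
      by (intro compact_imp_bounded compact_continuous_image abs_continuous_imp_continuous_on that) simp
    then show ?thesis by (auto simp: bounded_pos)
  qed
  obtain A where A: "0 < A" "\<And>x. x \<in> {a..b} \<Longrightarrow> norm (f x) \<le> A" using bd[OF f] by blast
  obtain B where B: "0 < B" "\<And>x. x \<in> {a..b} \<Longrightarrow> norm (g x) \<le> B" using bd[OF g] by blast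
  show ?thesis
    unfolding abs_continuous_def
  proof (intro allI impI)
    fix \<epsilon> :: real assume e: "0 < \<epsilon>"
    have e1: "0 < \<epsilon> / (2 * B * K)" and e2: "0 < \<epsilon> / (2 * A * K)" using e A B K by auto
    obtain \<delta>1 where d1: "0 < \<delta>1" "\<forall>D. D division_of (\<Union>D) \<longrightarrow> \<Union>D \<subseteq> {a..b} \<longrightarrow>
       (\<Sum>k\<in>D. Sup k - Inf k) < \<delta>1 \<longrightarrow> (\<Sum>k\<in>D. norm (f (Sup k) - f (Inf k))) < \<epsilon> / (2 * B * K)"
      using abs_continuousD[OF f e1] by blast
    obtain \<delta>2 where d2: "0 < \<delta>2" "\<forall>D. D division_of (\<Union>D) \<longrightarrow> \<Union>D \<subseteq> {a..b} \<longrightarrow>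
       (\<Sum>k\<in>D. Sup k - Inf k) < \<delta>2 \<longrightarrow> (\<Sum>k\<in>D. norm (g (Sup k) - g (Inf k))) < \<epsilon> / (2 * A * K)"
      using abs_continuousD[OF g e2] by blast
    show "\<exists>\<delta>>0. \<forall>D. D division_of \<Union>D \<and> \<Union>D \<subseteq> {a..b} \<and> (\<Sum>k\<in>D. Sup k - Inf k) < \<delta> \<longrightarrow>
        (\<Sum>k\<in>D. norm (h (f (Sup k)) (g (Sup k)) - h (f (Inf k)) (g (Inf k)))) < \<epsilon>"
    proof (intro exI[of _ "min \<delta>1 \<delta>2"] conjI allI impI; (elim conjE)?)
      fix D :: "real set set" assume D: "D division_of \<Union>D" "\<Union>D \<subseteq> {a..b}" "(\<Sum>k\<in>D. Sup k - Inf k) < min \<delta>1 \<delta>2"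
      have "norm (h (f (Sup k)) (g (Sup k)) - h (f (Inf k)) (g (Inf k)))
          \<le> B * K * norm (f (Sup k) - f (Inf k)) + A * K * norm (g (Sup k) - g (Inf k))" if kD: "k \<in> D" for k
      proof -
        obtain u v where k: "k = {u..v}" "k \<noteq> {}" using division_ofD(4)[OF D(1) kD] division_ofD(3)[OF D(1) kD] by auto
        then have "u \<in> k" "v \<in> k" "Sup k = v" "Inf k = u" by auto
        then have uv: "u \<in> {a..b}" "v \<in> {a..b}" "Sup k = v" "Inf k = u" using D(2) kD by blast+
        have "h (f v) (g v) - h (f u) (g u) = h (f v - f u) (g v) + h (f u) (g v - g u)"
          by (simp add: diff_left diff_right)
        then have "norm (h (f v) (g v) - h (f u) (g u)) \<le> norm (f v - f u) * norm (g v) * K + norm (f u) * norm (g v - g u) * K"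
          by (simp only:) (intro norm_triangle_le add_mono K(2))
        also have "\<dots> \<le> norm (f v - f u) * B * K + A * norm (g v - g u) * K"
          using A(2)[OF uv(1)] B(2)[OF uv(2)] K(1) by (intro add_mono mult_right_mono mult_left_mono) auto
        finally show ?thesis using uv by (simp add: mult_ac)
      qed
      then have "(\<Sum>k\<in>D. norm (h (f (Sup k)) (g (Sup k)) - h (f (Inf k)) (g (Inf k))))
          \<le> B * K * (\<Sum>k\<in>D. norm (f (Sup k) - f (Inf k))) + A * K * (\<Sum>k\<in>D. norm (g (Sup k) - g (Inf k)))"
        by (simp add: sum_distrib_left sum.distrib[symmetric] sum_mono)
      also have "\<dots> < B * K * (\<epsilon> / (2 * B * K)) + A * K * (\<epsilon> / (2 * A * K))"
        using d1(2)[rule_format, OF D(1,2)] d2(2)[rule_format, OF D(1,2)] D(3) A B K by (intro add_strict_mono mult_strict_left_mono) auto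
      also have "\<dots> = \<epsilon>" using A B K by simp
      finally show "(\<Sum>k\<in>D. norm (h (f (Sup k)) (g (Sup k)) - h (f (Inf k)) (g (Inf k)))) < \<epsilon>" .
    qed (use d1 d2 in auto)
  qed
qed

lemma abs_continuous_linear:
  assumes h: "bounded_linear h" and f: "abs_continuous a b f"
  shows "abs_continuous a b (\<lambda>x. h (f x))"
proof -
  interpret bounded_linear h by (rule h)
  obtain K where K: "0 < K" "\<And>u. norm (h u) \<le> norm u * K" using pos_bounded by blast
  show ?thesis
    unfolding abs_continuous_def
  proof (intro allI impI)
    fix \<epsilon> :: real assume e: "0 < \<epsilon>"
    obtain \<delta> where d: "0 < \<delta>" "\<forall>D. D division_of (\<Union>D) \<longrightarrow> \<Union>D \<subseteq> {a..b} \<longrightarrow>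
       (\<Sum>k\<in>D. Sup k - Inf k) < \<delta> \<longrightarrow> (\<Sum>k\<in>D. norm (f (Sup k) - f (Inf k))) < \<epsilon> / K"
      using abs_continuousD[OF f divide_pos_pos[OF e K(1)]] by blast
    have "(\<Sum>k\<in>D. norm (h (f (Sup k)) - h (f (Inf k)))) < \<epsilon>"
      if "D division_of (\<Union>D)" "\<Union>D \<subseteq> {a..b}" "(\<Sum>k\<in>D. Sup k - Inf k) < \<delta>" for D
    proof -
      have "(\<Sum>k\<in>D. norm (h (f (Sup k)) - h (f (Inf k)))) \<le> (\<Sum>k\<in>D. norm (f (Sup k) - f (Inf k))) * K"
        by (simp add: diff[symmetric] sum_distrib_right K(2) sum_mono)
      also have "\<dots> < \<epsilon> / K * K" using d(2)[rule_format, OF that] K by (intro mult_strict_right_mono) auto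
      finally show ?thesis using K by simp
    qed
    with d(1) show "\<exists>\<delta>>0. \<forall>D. D division_of \<Union>D \<and> \<Union>D \<subseteq> {a..b} \<and> (\<Sum>k\<in>D. Sup k - Inf k) < \<delta> \<longrightarrow>
        (\<Sum>k\<in>D. norm (h (f (Sup k)) - h (f (Inf k)))) < \<epsilon>" by blast
  qed
qed

lemma abs_continuous_product_integral:
  fixes h :: "'u::real_normed_vector \<Rightarrow> 'v::real_normed_vector \<Rightarrow> 'b::euclidean_space"
  assumes h: "bounded_bilinear h" and f: "abs_continuous 0 1 f" and g: "abs_continuous 0 1 g"
    and df: "AE x in lebesgue_on {0<..<1}. \<exists>f' g'. (f has_vector_derivative f') (at x) \<and>
       (g has_vector_derivative g') (at x) \<and> h (f x) g' + h f' (g x) = k x"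
    and ab: "0 \<le> a" "a \<le> b" "b \<le> 1"
  shows "(k has_integral (h (f b) (g b) - h (f a) (g a))) {a..b}"
proof (rule abs_continuous_has_integral[OF abs_continuous_bilinear[OF h f g] _ ab])
  show "AE x in lebesgue_on {0<..<1}. ((\<lambda>x. h (f x) (g x)) has_vector_derivative k x) (at x)"
    using df
  proof eventually_elim
    case (elim x)
    then show ?case using bounded_bilinear.has_vector_derivative[OF h] by metis
  qed
qed

section \<open>Block matrices and symplectic identities\<close>

lemma sum_UNIV_Plus: "(\<Sum>i\<in>(UNIV :: ('a::finite + 'b::finite) set). f i) = (\<Sum>i\<in>UNIV. f (Inl i)) + (\<Sum>i\<in>UNIV. f (Inr i))"
  unfolding UNIV_Plus_UNIV[symmetric] by (subst sum.Plus) auto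

lemma stack_simps [simp]: "stack u v $ Inl i = u $ i" "stack u v $ Inr j = v $ j"
  by (simp_all add: stack_def)

lemma blockmat_simps [simp]:
  "blockmat A B C D $ Inl i $ Inl k = A $ i $ k" "blockmat A B C D $ Inl i $ Inr l = B $ i $ l"
  "blockmat A B C D $ Inr j $ Inl k = C $ j $ k" "blockmat A B C D $ Inr j $ Inr l = D $ j $ l"
  by (simp_all add: blockmat_def)

lemmas block_eq = vec_eq_iff split_sum_all

lemma Jmat_apply: "(Jmat ** A) $ Inl i = - (A $ Inr i)" "(Jmat ** A) $ Inr i = A $ Inl i"
  for A :: "complex ^ 'c ^ ('m::finite + 'm)"
  by (simp_all add: vec_eq_iff Jmat_def matrix_matrix_mult_def sum_UNIV_Plus mat_def
      if_distrib[of "\<lambda>u. u * _"] if_distrib[of uminus] cong: if_cong)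

lemma Jmat_sq: "Jmat ** Jmat = - mat 1"
  by (simp add: block_eq Jmat_apply) (simp add: Jmat_def mat_def)

lemma adj_Jmat: "adj Jmat = - Jmat"
  by (simp add: block_eq adj_def Jmat_def mat_def)

lemma Jmat_left_cancel: "Jmat ** (Jmat ** A) = - A"
  by (simp add: matrix_mul_assoc Jmat_sq mat_mult_minus_left)

text \<open>
  The coordinates of \<open>\<complex>\<^bsup>4n\<^esup>\<close> split into those on which \<open>calB\<close> acts, embedded by \<open>emb1\<close>, and those on which it
  vanishes, embedded by \<open>emb0\<close>. Both embeddings intertwine the symplectic matrices.
\<close>

definition emb1 :: "complex ^ ('n::finite + 'n) ^ (('n + 'n) + ('n + 'n))" where
  "emb1 = stack (blockmat 0 0 (mat 1) 0) (blockmat 0 0 0 (mat 1))"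

definition emb0 :: "complex ^ ('n::finite + 'n) ^ (('n + 'n) + ('n + 'n))" where
  "emb0 = stack (blockmat (mat 1) 0 0 0) (blockmat 0 (mat 1) 0 0)"

text \<open>
  It carries the minus sign in the block row \<open>(0, -I)\<close> of \<open>frame3\<close>. Conjugation by it reverses the sign of \<open>Jmat\<close>, and
  this is what makes the span of \<open>frame3 P\<close> isotropic for symplectic \<open>P\<close>.
\<close>

definition sgnmat :: "complex ^ ('n::finite + 'n) ^ ('n + 'n)" where
  "sgnmat = blockmat (mat 1) 0 0 (- mat 1)"

lemma emb1_apply: "(emb1 ** A) $ Inl (Inl i) = 0" "(emb1 ** A) $ Inl (Inr i) = A $ Inl i"
  "(emb1 ** A) $ Inr (Inl i) = 0" "(emb1 ** A) $ Inr (Inr i) = A $ Inr i"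
  for A :: "complex ^ 'c ^ ('n::finite + 'n)"
  by (simp_all add: vec_eq_iff emb1_def matrix_matrix_mult_def sum_UNIV_Plus mat_def
      if_distrib[of "\<lambda>u. u * _"] cong: if_cong)

lemma emb0_apply: "(emb0 ** A) $ Inl (Inr i) = 0" "(emb0 ** A) $ Inl (Inl i) = A $ Inl i"
  "(emb0 ** A) $ Inr (Inr i) = 0" "(emb0 ** A) $ Inr (Inl i) = A $ Inr i"
  for A :: "complex ^ 'c ^ ('n::finite + 'n)"
  by (simp_all add: vec_eq_iff emb0_def matrix_matrix_mult_def sum_UNIV_Plus mat_def
      if_distrib[of "\<lambda>u. u * _"] cong: if_cong)

lemma adj_emb_apply:
  "(adj emb1 ** A) $ Inl i = A $ Inl (Inr i)" "(adj emb1 ** A) $ Inr i = A $ Inr (Inr i)"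
  "(adj emb0 ** A) $ Inl i = A $ Inl (Inl i)" "(adj emb0 ** A) $ Inr i = A $ Inr (Inl i)"
  for A :: "complex ^ 'c ^ (('n::finite + 'n) + ('n + 'n))"
  by (simp_all add: vec_eq_iff emb1_def emb0_def adj_def matrix_matrix_mult_def sum_UNIV_Plus mat_def
      if_distrib[of "\<lambda>u. u * _"] if_distrib[of cnj] cong: if_cong)

lemma sgnmat_apply: "(sgnmat ** A) $ Inl i = A $ Inl i" "(sgnmat ** A) $ Inr i = - (A $ Inr i)"
  for A :: "complex ^ 'c ^ ('n::finite + 'n)"
  by (simp_all add: vec_eq_iff sgnmat_def matrix_matrix_mult_def sum_UNIV_Plus mat_def
      if_distrib[of "\<lambda>u. u * _"] if_distrib[of uminus] cong: if_cong)

lemma emb_orthogonal: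
  "adj emb1 ** (emb1 ** A) = A" "adj emb0 ** (emb0 ** A) = A"
  "adj emb1 ** (emb0 ** A) = 0" "adj emb0 ** (emb1 ** A) = 0"
  by (simp_all add: block_eq adj_emb_apply emb1_apply emb0_apply)

lemma emb_complete: "emb1 ** (adj emb1 ** A) + emb0 ** (adj emb0 ** A) = A"
  by (simp add: block_eq adj_emb_apply emb1_apply emb0_apply)

lemma Jmat_emb: "Jmat ** (emb1 ** A) = emb1 ** (Jmat ** A)" "Jmat ** (emb0 ** A) = emb0 ** (Jmat ** A)"
  by (simp_all add: block_eq Jmat_apply emb1_apply emb0_apply)

lemma frame3_emb: "frame3 P = emb1 ** P + emb0 ** sgnmat"
proof -
  have *: "emb0 ** sgnmat = stack (blockmat (mat 1) 0 0 0) (blockmat 0 (- mat 1) 0 0)"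
    by (simp add: block_eq emb0_apply) (simp add: sgnmat_def mat_def)
  show ?thesis
    unfolding * by (simp add: block_eq frame3_def emb1_apply blk11_def blk12_def blk21_def blk22_def mat_def)
qed

lemma calB_emb: "calB A ** X = emb1 ** (A ** (adj emb1 ** X))"
proof -
  define Y where "Y = adj emb1 ** X"
  have Y: "Y $ Inl i = X $ Inl (Inr i)" "Y $ Inr i = X $ Inr (Inr i)" for i
    by (simp_all add: Y_def adj_emb_apply)
  show ?thesis
    unfolding Y_def[symmetric]
    by (simp add: block_eq emb1_apply)
       (simp add: calB_def matrix_matrix_mult_def sum_UNIV_Plus blk11_def blk12_def blk21_def blk22_def Y)
qed

lemma sgnmat_sq: "sgnmat ** (sgnmat ** A) = A"
  by (simp add: block_eq sgnmat_apply)

lemma adj_sgnmat: "adj sgnmat = sgnmat"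
  by (simp add: block_eq adj_def sgnmat_def mat_def)

lemma sgnmat_Jmat: "sgnmat ** (Jmat ** (sgnmat ** A)) = - (Jmat ** A)"
  by (simp add: block_eq sgnmat_apply Jmat_apply)

definition lblock :: "complex ^ ('c::finite + 'd::finite) ^ 'r \<Rightarrow> complex ^ 'c ^ 'r" where
  "lblock A = (\<chi> i j. A $ i $ Inl j)"

definition rblock :: "complex ^ ('c::finite + 'd::finite) ^ 'r \<Rightarrow> complex ^ 'd ^ 'r" where
  "rblock A = (\<chi> i j. A $ i $ Inr j)"

lemma mat_vec_stack: "A *v stack u v = lblock A *v u + rblock A *v v"
  by (simp add: vec_eq_iff matrix_vector_mult_def lblock_def rblock_def sum_UNIV_Plus)

lemma calJ_adj:
  fixes \<Theta> :: "complex ^ (('n::finite + 'n) + ('n + 'n)) ^ 'r"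
  shows "calJ ** adj \<Theta> = stack (- (Jmat ** adj (lblock \<Theta>))) (Jmat ** adj (rblock \<Theta>))"
proof -
  have "calJ ** A = stack (- (Jmat ** upper A)) (Jmat ** lower A)" for A :: "complex ^ 'r ^ (('n + 'n) + ('n + 'n))"
    by (simp add: block_eq Jmat_apply upper_def lower_def)
       (simp add: calJ_def Jmat_def matrix_matrix_mult_def sum_UNIV_Plus mat_def
        if_distrib[of "\<lambda>u. u * _"] if_distrib[of uminus] cong: if_cong)
  moreover have "upper (adj \<Theta>) = adj (lblock \<Theta>)" "lower (adj \<Theta>) = adj (rblock \<Theta>)"
    by (simp_all add: vec_eq_iff upper_def lower_def adj_def lblock_def rblock_def)
  ultimately show ?thesis by simp
qed

lemma calM_calJ_adj:
  fixes \<Theta> :: "complex ^ (('n::finite + 'n) + ('n + 'n)) ^ 'r"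
  shows "calM ** calJ ** adj \<Theta> = emb1 ** (Jmat ** adj (rblock \<Theta>)) - emb0 ** (sgnmat ** (Jmat ** adj (lblock \<Theta>)))"
proof -
  have M: "calM ** stack U L = emb0 ** (sgnmat ** U) + emb1 ** L" for U L :: "complex ^ 'c ^ ('n + 'n)"
    by (simp add: block_eq emb1_apply emb0_apply sgnmat_apply)
       (simp add: calM_def matrix_matrix_mult_def sum_UNIV_Plus mat_def
        if_distrib[of "\<lambda>u. u * _"] if_distrib[of uminus] cong: if_cong)
  show ?thesis
    by (simp only: matrix_mul_assoc[symmetric] calJ_adj M) (simp add: mat_mult_minus_right)
qed

lemma calJ_form:
  fixes \<Theta> :: "complex ^ (('n::finite + 'n) + ('n + 'n)) ^ 'r"
  shows "\<Theta> ** calJ ** adj \<Theta> = rblock \<Theta> ** Jmat ** adj (rblock \<Theta>) - lblock \<Theta> ** Jmat ** adj (lblock \<Theta>)"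
proof -
  have M: "\<Theta> ** stack U L = lblock \<Theta> ** U + rblock \<Theta> ** L" for U L :: "complex ^ 'c ^ ('n + 'n)"
    by (simp add: vec_eq_iff matrix_matrix_mult_def sum_UNIV_Plus lblock_def rblock_def)
  show ?thesis
    by (simp only: matrix_mul_assoc[symmetric] calJ_adj M) (simp add: mat_mult_minus_right)
qed

section \<open>Frames of Lagrangian subspaces\<close>

lemma vec_dim_image_inj:
  fixes A :: "complex ^ 'c ^ 'r"
  assumes "\<And>x. A *v x = 0 \<Longrightarrow> x = 0"
  shows "vec.dim ((*v) A ` S) = vec.dim S"
proof -
  have "inj ((*v) A)"
    by (rule injI) (metis assms eq_iff_diff_eq_0 matrix_vector_mult_diff_distrib)
  moreover have lin: "Vector_Spaces.linear (*s) (*s) ((*v) A)" by simp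
  ultimately show ?thesis using vec.dim_image_eq[OF lin, of S] inj_on_subset by blast
qed

lemma span_columns: "vec.span (columns A) = range ((*v) A)" for A :: "complex ^ 'c ^ 'r"
proof
  have sub: "vec.subspace (range ((*v) A))"
    unfolding vec.subspace_def
    by (auto simp: image_iff) (metis matrix_vector_mult_0_right, metis matrix_vector_right_distrib, metis mat_vec_scalar)
  have "columns A \<subseteq> range ((*v) A)"
    by (auto simp: columns_def mat_vec_axis[symmetric])
  then show "vec.span (columns A) \<subseteq> range ((*v) A)" using vec.span_minimal sub by blast
  show "range ((*v) A) \<subseteq> vec.span (columns A)"
  proof safe
    fix x show "A *v x \<in> vec.span (columns A)"
      unfolding mat_vec_sum_columns[of A x]
      by (intro vec.span_sum vec.span_scale vec.span_base) (auto simp: columns_def)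
  qed
qed

definition lagrangian_frame :: "complex ^ 'm ^ ('m::finite + 'm) \<Rightarrow> bool" where
  "lagrangian_frame F \<longleftrightarrow> adj F ** Jmat ** F = 0 \<and> (\<forall>c. F *v c = 0 \<longrightarrow> c = 0)"

lemma lagrangian_frame_is_frame:
  assumes "lagrangian_frame F"
  shows "is_frame F (col_space F)"
proof -
  have inj: "inj ((*v) F)"
    by (rule injI) (metis assms eq_iff_diff_eq_0 matrix_vector_mult_diff_distrib lagrangian_frame_def)
  have "inj (\<lambda>j. column j F)"
    by (rule injI) (metis mat_vec_axis axis_eq_axis inj injD zero_neq_one)
  moreover have "columns F = (*v) F ` cart_basis"
    by (auto simp: columns_def cart_basis_def mat_vec_axis image_iff) (metis mat_vec_axis)+
  moreover have "vec.independent ((*v) F ` cart_basis)"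
  proof -
    have lin: "Vector_Spaces.linear (*s) (*s) ((*v) F)" by simp
    show ?thesis
      using vec.linear_independent_injective_image[OF lin independent_cart_basis inj_on_subset[OF inj subset_UNIV]] .
  qed
  ultimately show ?thesis by (simp add: is_frame_def col_space_def)
qed

lemma lagrangian_frame_lagrangian:
  fixes F :: "complex ^ 'm ^ ('m::finite + 'm)"
  assumes "lagrangian_frame F"
  shows "lagrangian (col_space F)"
  unfolding lagrangian_def
proof (intro conjI ballI)
  have fr: "inj (\<lambda>j. column j F)" "vec.independent (columns F)"
    using lagrangian_frame_is_frame[OF assms] by (auto simp: is_frame_def)
  show "vec.subspace (col_space F)" by (simp add: col_space_def)
  have "columns F = range (\<lambda>j. column j F)" by (auto simp: columns_def)
  then have "card (columns F) = CARD('m)" using fr(1) by (simp add: card_image)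
  then show "vec.dim (col_space F) = CARD('m)"
    unfolding col_space_def using vec.dim_span_eq_card_independent[OF fr(2)] by simp
  fix u v assume "u \<in> col_space F" "v \<in> col_space F"
  then obtain c d where "u = F *v c" "v = F *v d" by (auto simp: col_space_def span_columns)
  then have "cdot (Jmat *v u) v = cdot ((adj F ** Jmat ** F) *v c) d"
    by (simp add: cdot_mat_right matrix_vector_mul_assoc matrix_mul_assoc)
  then show "cdot (Jmat *v u) v = 0" using assms by (simp add: lagrangian_frame_def)
qed

lemma is_frame_change:
  fixes F G :: "complex ^ 'm ^ ('m::finite + 'm)"
  assumes "is_frame F L" "is_frame G L"
  shows "\<exists>A. invertible A \<and> G = F ** A"
proof -
  have LF: "L = range ((*v) F)" and LG: "L = range ((*v) G)"
    using assms by (auto simp: is_frame_def span_columns)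
  have "\<exists>A. G = F ** A" if "range ((*v) G) \<subseteq> range ((*v) F)" for F G :: "complex ^ 'm ^ ('m + 'm)"
  proof -
    have "\<forall>j. \<exists>c. column j G = F *v c"
      using that by (auto simp: mat_vec_axis[symmetric])
    then obtain c where c: "\<And>j. column j G = F *v c j" by metis
    have "column j G = column j (F ** (\<chi> i j. c j $ i))" for j
      by (simp add: column_mat_mult c) (simp add: column_def)
    then have "G = F ** (\<chi> i j. c j $ i)"
      by (simp add: vec_eq_iff column_def)
    then show ?thesis by blast
  qed
  then obtain A A' where A: "G = F ** A" "F = G ** A'" using LF LG by (metis order_refl)
  have inj: "c = 0" if "F *v c = 0" for c
  proof -
    have cs: "columns F = range (\<lambda>j. column j F)" by (auto simp: columns_def)
    have invc: "inv (\<lambda>j. column j F) (column x F) = x" for x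
      using assms(1) inv_f_f[of "\<lambda>j. column j F" x] by (simp add: is_frame_def)
    have z: "(\<Sum>j\<in>UNIV. c $ j *s column j F) = 0" using that by (simp add: mat_vec_sum_columns)
    have r: "(\<Sum>j\<in>UNIV. c $ j *s column j F) = (\<Sum>v\<in>columns F. c $ (inv (\<lambda>j. column j F) v) *s v)"
      unfolding cs using assms(1) by (subst sum.reindex) (auto simp: is_frame_def invc)
    have fin: "finite (columns F)" by (simp add: cs)
    have ind: "vec.independent (columns F)" using assms(1) by (simp add: is_frame_def)
    have "c $ j = 0" for j
    proof -
      have "column j F \<in> columns F" by (simp add: cs)
      from vec.independentD[OF ind fin order_refl _ this, of "\<lambda>v. c $ (inv (\<lambda>j. column j F) v)"] z r
      show ?thesis by (simp add: invc)
    qed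
    then show ?thesis by (simp add: vec_eq_iff)
  qed
  have "F ** (A ** A') = F" using A by (simp add: matrix_mul_assoc)
  then have "F *v ((A ** A' - mat 1) *v x) = 0" for x
    by (simp add: matrix_vector_mul_assoc mat_mult_diff_right)
  then have "A ** A' - mat 1 = 0" using inj by (intro matrix_eqI) simp
  then have "A ** A' = mat 1" by simp
  then have "invertible A" using invertible_right_inverse by blast
  with A(1) show ?thesis by blast
qed

lemma frame_plus_mult: "frame_plus (F ** A) = frame_plus F ** A"
  and frame_minus_mult: "frame_minus (F ** A) = frame_minus F ** A"
  by (simp_all add: vec_eq_iff frame_plus_def frame_minus_def matrix_matrix_mult_def upper_def lower_def
      map_matrix_def sum_distrib_left sum.distrib[symmetric] sum_subtractf[symmetric] algebra_simps)

lemma matrix_inv_right: "invertible A \<Longrightarrow> A ** matrix_inv A = mat 1"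
  and matrix_inv_left: "invertible A \<Longrightarrow> matrix_inv A ** A = mat 1"
  for A :: "complex ^ 'm ^ 'm"
proof -
  assume "invertible A"
  then have "A ** matrix_inv A = mat 1 \<and> matrix_inv A ** A = mat 1"
    unfolding invertible_def matrix_inv_def by (rule someI_ex)
  then show "A ** matrix_inv A = mat 1" "matrix_inv A ** A = mat 1" by auto
qed

lemma matrix_inv_cancel:
  fixes A :: "complex ^ 'm ^ 'm"
  assumes "invertible A"
  shows "A ** (matrix_inv A ** X) = X" "matrix_inv A ** (A ** X) = X"
  by (simp_all add: matrix_mul_assoc matrix_inv_right[OF assms] matrix_inv_left[OF assms])

lemma matrix_inv_mult:
  fixes A B :: "complex ^ 'm ^ 'm"
  assumes "invertible A" "invertible B"
  shows "matrix_inv (A ** B) = matrix_inv B ** matrix_inv A"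
proof -
  have "(A ** B) ** (matrix_inv B ** matrix_inv A) = mat 1"
    using assms by (metis matrix_inv_right matrix_mul_assoc matrix_mul_rid)
  moreover have "invertible (A ** B)" using assms by (rule invertible_mult)
  ultimately show ?thesis by (metis matrix_inv_left matrix_mul_assoc matrix_mul_lid matrix_mul_rid)
qed

text \<open>
  Polarization in each pair of coordinates:
  \<open>cnj (a + \<i> c) (b + \<i> d) - cnj (a - \<i> c) (b - \<i> d) = 2 \<i> (cnj a d - cnj c b)\<close>.
\<close>

lemma symplectic_form_frames:
  fixes F G :: "complex ^ 'm ^ ('m::finite + 'm)"
  shows "adj F ** Jmat ** G = mat (\<i> / 2) ** (adj (frame_plus F) ** frame_plus G - adj (frame_minus F) ** frame_minus G)"
proof -
  have "(adj F ** (Jmat ** G)) $ a $ b = (mat (\<i> / 2) ** (adj (frame_plus F) ** frame_plus G - adj (frame_minus F) ** frame_minus G)) $ a $ b" for a b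
  proof -
    have "(adj F ** (Jmat ** G)) $ a $ b = (\<Sum>r\<in>UNIV. cnj (F $ Inl r $ a) * - (G $ Inr r $ b) + cnj (F $ Inr r $ a) * G $ Inl r $ b)"
      by (subst matrix_matrix_mult_def) (simp add: adj_def sum_UNIV_Plus Jmat_apply sum.distrib sum_negf sum_subtractf)
    also have "\<dots> = (\<Sum>r\<in>UNIV. \<i> / 2 * ((cnj (F $ Inl r $ a + \<i> * F $ Inr r $ a)) * (G $ Inl r $ b + \<i> * G $ Inr r $ b)
        - (cnj (F $ Inl r $ a - \<i> * F $ Inr r $ a)) * (G $ Inl r $ b - \<i> * G $ Inr r $ b)))"
      by (rule sum.cong) (auto simp: field_simps)
    also have "\<dots> = \<i> / 2 * (\<Sum>r\<in>UNIV. (cnj (F $ Inl r $ a + \<i> * F $ Inr r $ a)) * (G $ Inl r $ b + \<i> * G $ Inr r $ b)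
        - (cnj (F $ Inl r $ a - \<i> * F $ Inr r $ a)) * (G $ Inl r $ b - \<i> * G $ Inr r $ b))"
      by (simp only: sum_distrib_left)
    also have "\<dots> = (mat (\<i> / 2) ** (adj (frame_plus F) ** frame_plus G - adj (frame_minus F) ** frame_minus G)) $ a $ b"
      unfolding mat_scalar_left
      by (simp add: matrix_matrix_mult_def adj_def frame_plus_def frame_minus_def upper_def lower_def map_matrix_def
          sum_subtractf[symmetric])
    finally show ?thesis .
  qed
  then show ?thesis by (simp add: vec_eq_iff matrix_mul_assoc)
qed

lemma mat_scalar_eq_0: "c \<noteq> 0 \<Longrightarrow> mat c ** A = 0 \<longleftrightarrow> A = 0" for A :: "complex ^ 'c ^ 'r"
  unfolding mat_scalar_left by (simp add: vec_eq_iff)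

lemma frame_pm_vec:
  "(frame_plus F *v c) $ i = (F *v c) $ Inl i + \<i> * (F *v c) $ Inr i"
  "(frame_minus F *v c) $ i = (F *v c) $ Inl i - \<i> * (F *v c) $ Inr i"
  by (simp_all add: matrix_vector_mult_def frame_plus_def frame_minus_def upper_def lower_def map_matrix_def
          sum_distrib_left sum_subtractf[symmetric] sum.distrib[symmetric] algebra_simps)

text \<open>
  Isotropy says that \<open>X + \<i> Y\<close> and \<open>X - \<i> Y\<close> have the same Gram matrix, hence the same kernel, and a vector in both
  kernels is annihilated by \<open>X\<close> and \<open>Y\<close>.
\<close>

lemma lagrangian_frame_pm:
  assumes "lagrangian_frame F"
  shows "adj (frame_plus F) ** frame_plus F = adj (frame_minus F) ** frame_minus F"
    and "invertible (frame_plus F)" and "invertible (frame_minus F)"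
proof -
  show eq: "adj (frame_plus F) ** frame_plus F = adj (frame_minus F) ** frame_minus F"
    using assms symplectic_form_frames[of F F] by (simp add: lagrangian_frame_def mat_scalar_eq_0)
  have cd: "cdot (A *v c) (A *v c) = cdot ((adj A ** A) *v c) c" for A :: "complex ^ 'x ^ 'x" and c
    by (simp add: cdot_mat_right matrix_vector_mul_assoc)
  have n: "frame_plus F *v c = 0 \<longleftrightarrow> frame_minus F *v c = 0" for c
    using cd[of "frame_plus F" c] cd[of "frame_minus F" c] eq by (metis cdot_self_0)
  have z: "c = 0" if "frame_plus F *v c = 0" for c
  proof -
    have "frame_minus F *v c = 0" using that n by blast
    then have pm: "(frame_plus F *v c) $ i = 0" "(frame_minus F *v c) $ i = 0" for i using that by simp_all
    have "(F *v c) $ Inl i = 0 \<and> (F *v c) $ Inr i = 0" for i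
    proof -
      have "2 * (F *v c) $ Inl i = 0" using pm[of i] frame_pm_vec[of F c i] by (simp add: algebra_simps)
      then show ?thesis using pm(1)[of i] frame_pm_vec(1)[of F c i] by simp
    qed
    then have "F *v c = 0" by (simp add: block_eq)
    then show ?thesis using assms by (simp add: lagrangian_frame_def)
  qed
  show "invertible (frame_plus F)"
    using z matrix_left_invertible_ker[of "frame_plus F"] invertible_left_inverse by blast
  show "invertible (frame_minus F)"
    using z n matrix_left_invertible_ker[of "frame_minus F"] invertible_left_inverse by blast
qed

text \<open>The unitary matrix whose eigenvalue \<open>1\<close> detects intersections.\<close>

definition Vmat :: "complex ^ 'm ^ ('m::finite + 'm) \<Rightarrow> complex ^ 'm ^ ('m + 'm) \<Rightarrow> complex ^ 'm ^ 'm" where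
  "Vmat F G = frame_plus F ** matrix_inv (frame_minus F) ** frame_minus G ** matrix_inv (frame_plus G)"

lemma W_tilde_Vmat: "W_tilde F G = - Vmat F G"
  by (simp add: W_tilde_def Vmat_def)

lemma Vmat_change_frame:
  assumes "lagrangian_frame F" "lagrangian_frame G" "invertible A" "invertible B"
  shows "Vmat (F ** A) (G ** B) = Vmat F G"
proof -
  note pF = lagrangian_frame_pm[OF assms(1)] and pG = lagrangian_frame_pm[OF assms(2)]
  have "frame_plus F ** A ** (matrix_inv A ** matrix_inv (frame_minus F)) = frame_plus F ** matrix_inv (frame_minus F)"
    using assms(3) by (metis matrix_inv_right matrix_mul_assoc matrix_mul_rid)
  moreover have "frame_minus G ** B ** (matrix_inv B ** matrix_inv (frame_plus G)) = frame_minus G ** matrix_inv (frame_plus G)"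
    using assms(4) by (metis matrix_inv_right matrix_mul_assoc matrix_mul_rid)
  ultimately show ?thesis
    unfolding Vmat_def frame_plus_mult frame_minus_mult
    by (simp add: matrix_inv_mult pF pG assms) (metis matrix_mul_assoc)
qed

lemma unitary_frame_quotient:
  assumes "lagrangian_frame F"
  shows "unitary (frame_plus F ** matrix_inv (frame_minus F))"
proof -
  note p = lagrangian_frame_pm[OF assms]
  let ?M = "frame_minus F" and ?P = "frame_plus F"
  have "adj (?P ** matrix_inv ?M) ** (?P ** matrix_inv ?M) = adj (matrix_inv ?M) ** (adj ?P ** ?P) ** matrix_inv ?M"
    by (simp add: adj_mult matrix_mul_assoc)
  also have "\<dots> = adj (?M ** matrix_inv ?M) ** (?M ** matrix_inv ?M)"
    unfolding p(1) by (simp add: adj_mult matrix_mul_assoc)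
  also have "\<dots> = mat 1" using p(3) by (simp add: matrix_inv_right adj_mat)
  finally show ?thesis by (simp add: unitary_def)
qed

lemma unitary_Vmat:
  assumes "lagrangian_frame F" "lagrangian_frame G"
  shows "unitary (Vmat F G)"
proof -
  note p = lagrangian_frame_pm[OF assms(2)]
  let ?U = "frame_plus G ** matrix_inv (frame_minus G)" and ?U' = "frame_minus G ** matrix_inv (frame_plus G)"
  have "?U ** ?U' = mat 1"
    using p(2,3) by (metis matrix_inv_left matrix_inv_right matrix_mul_assoc matrix_mul_rid)
  then have "?U' = adj ?U"
    using unitary_frame_quotient[OF assms(2)]
    by (metis matrix_mul_assoc matrix_mul_lid matrix_mul_rid unitary_def)
  then have "unitary ?U'" using unitary_frame_quotient[OF assms(2)] unitary_adj by metis
  then show ?thesis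
    using unitary_mult[OF unitary_frame_quotient[OF assms(1)], of ?U'] by (simp add: Vmat_def matrix_mul_assoc)
qed

text \<open>
  Write \<open>P\<^sub>\<plusminus> = X \<plusminus> \<i> Y\<close> for \<open>F\<close> and \<open>P'\<^sub>\<plusminus>\<close> for \<open>G\<close>. Since \<open>P\<^sub>+\<close> and \<open>P\<^sub>-\<close> have the same Gram
  matrix, \<open>P\<^sub>+\<^sup>* V P'\<^sub>+ = P\<^sub>-\<^sup>* P'\<^sub>-\<close>.
\<close>

lemma symplectic_form_Vmat:
  assumes "lagrangian_frame F" "lagrangian_frame G"
  shows "adj F ** Jmat ** G = mat (\<i> / 2) ** (adj (frame_plus F) ** (mat 1 - Vmat F G) ** frame_plus G)"
proof -
  note pF = lagrangian_frame_pm[OF assms(1)] and pG = lagrangian_frame_pm[OF assms(2)]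
  have "adj (frame_plus F) ** Vmat F G ** frame_plus G =
      (adj (frame_plus F) ** frame_plus F) ** matrix_inv (frame_minus F) ** frame_minus G ** (matrix_inv (frame_plus G) ** frame_plus G)"
    by (simp add: Vmat_def matrix_mul_assoc)
  also have "\<dots> = adj (frame_minus F) ** (frame_minus F ** matrix_inv (frame_minus F)) ** frame_minus G"
    unfolding pF(1) using pG(2) by (simp add: matrix_inv_left matrix_mul_assoc)
  also have "\<dots> = adj (frame_minus F) ** frame_minus G" using pF(3) by (simp add: matrix_inv_right)
  finally show ?thesis
    unfolding symplectic_form_frames by (simp add: mat_mult_diff_left mat_mult_diff_right)
qed

lemma ker_Vmat:
  assumes "lagrangian_frame F" "lagrangian_frame G"
  shows "ker (Vmat F G - mat 1) = (*v) (frame_plus G) ` ker (adj F ** Jmat ** G)"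
    and "vec.dim (ker (Vmat F G - mat 1)) = vec.dim (ker (adj F ** Jmat ** G))"
proof -
  note pF = lagrangian_frame_pm[OF assms(1)] and pG = lagrangian_frame_pm[OF assms(2)]
  have injF: "x = 0" if "adj (frame_plus F) *v x = 0" for x
  proof -
    have "adj (matrix_inv (frame_plus F)) ** adj (frame_plus F) = mat 1"
      using pF(2) by (simp add: adj_mult[symmetric] matrix_inv_right adj_mat)
    then have "x = adj (matrix_inv (frame_plus F)) *v (adj (frame_plus F) *v x)"
      by (simp add: matrix_vector_mul_assoc)
    then show ?thesis by (simp add: that)
  qed
  have injG: "x = 0" if "frame_plus G *v x = 0" for x
  proof -
    have "x = matrix_inv (frame_plus G) *v (frame_plus G *v x)"
      using pG(2) by (simp add: matrix_vector_mul_assoc matrix_inv_left)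
    then show ?thesis by (simp add: that)
  qed
  have k: "h \<in> ker (adj F ** Jmat ** G) \<longleftrightarrow> frame_plus G *v h \<in> ker (Vmat F G - mat 1)" for h
  proof -
    have "(adj F ** Jmat ** G) *v h = (\<i> / 2) *s (adj (frame_plus F) *v ((mat 1 - Vmat F G) *v (frame_plus G *v h)))"
      unfolding symplectic_form_Vmat[OF assms]
      by (simp add: matrix_vector_mul_assoc[symmetric] mat_scalar_vec)
    then have "h \<in> ker (adj F ** Jmat ** G) \<longleftrightarrow> (mat 1 - Vmat F G) *v (frame_plus G *v h) = 0"
      using injF by (auto simp: ker_def)
    also have "\<dots> \<longleftrightarrow> frame_plus G *v h \<in> ker (Vmat F G - mat 1)"
      by (auto simp: ker_def algebra_simps)
    finally show ?thesis .
  qed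
  show eq: "ker (Vmat F G - mat 1) = (*v) (frame_plus G) ` ker (adj F ** Jmat ** G)"
  proof
    show "(*v) (frame_plus G) ` ker (adj F ** Jmat ** G) \<subseteq> ker (Vmat F G - mat 1)" using k by blast
    show "ker (Vmat F G - mat 1) \<subseteq> (*v) (frame_plus G) ` ker (adj F ** Jmat ** G)"
    proof
      fix v assume v: "v \<in> ker (Vmat F G - mat 1)"
      have "v = frame_plus G *v (matrix_inv (frame_plus G) *v v)"
        using pG(2) by (simp add: matrix_vector_mul_assoc matrix_inv_right)
      then show "v \<in> (*v) (frame_plus G) ` ker (adj F ** Jmat ** G)" using k v by (metis imageI)
    qed
  qed
  show "vec.dim (ker (Vmat F G - mat 1)) = vec.dim (ker (adj F ** Jmat ** G))"
    unfolding eq using injG by (rule vec_dim_image_inj)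
qed

text \<open>
  Exchanging the frames replaces \<open>F\<^sup>* J G\<close> by the negative of its adjoint and \<open>V\<close> by its inverse, which has the same
  fixed vectors.
\<close>

lemma ker_adj_symplectic_form:
  assumes "lagrangian_frame F" "lagrangian_frame G"
  shows "vec.dim (ker (adj (adj F ** Jmat ** G))) = vec.dim (ker (adj F ** Jmat ** G))"
proof -
  note pG = lagrangian_frame_pm[OF assms(2)] and pF = lagrangian_frame_pm[OF assms(1)]
  have s: "adj (adj F ** Jmat ** G) = - (adj G ** Jmat ** F)"
    by (simp add: adj_mult adj_Jmat matrix_mul_assoc mat_mult_minus_left mat_mult_minus_right)
  have "Vmat G F ** Vmat F G = mat 1"
    unfolding Vmat_def
    by (simp add: matrix_mul_assoc[symmetric] matrix_inv_cancel pF(2,3) pG(2,3) matrix_inv_right)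
  then have inv: "Vmat G F *v (Vmat F G *v x) = x" for x by (simp add: matrix_vector_mul_assoc)
  have "Vmat F G ** Vmat G F = mat 1"
    using \<open>Vmat G F ** Vmat F G = mat 1\<close> matrix_left_right_inverse by blast
  then have inv2: "Vmat F G *v (Vmat G F *v x) = x" for x by (simp add: matrix_vector_mul_assoc)
  have kfix: "x \<in> ker (A - mat 1) \<longleftrightarrow> A *v x = x" for A :: "complex ^ 'a ^ 'a" and x
    by (auto simp: ker_def matrix_vector_mult_diff_rdistrib)
  have "ker (Vmat G F - mat 1) = ker (Vmat F G - mat 1)"
  proof (rule set_eqI)
    fix x
    show "x \<in> ker (Vmat G F - mat 1) \<longleftrightarrow> x \<in> ker (Vmat F G - mat 1)"
      unfolding kfix using inv[of x] inv2[of x] by metis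
  qed
  then show ?thesis
    unfolding s ker_minus using ker_Vmat(2)[OF assms] ker_Vmat(2)[OF assms(2,1)] by simp
qed

text \<open>
  Crossings are governed by the form of \<open>V - 1\<close>, while the differential equation controls \<open>F\<^sup>* J G\<close>. This identity
  translates one into the other exactly, also away from intersections.
\<close>

lemma Vmat_form:
  assumes "lagrangian_frame F" "lagrangian_frame G"
  shows "cdot (Vmat F G *v (frame_plus G *v h) - frame_plus G *v h) (frame_plus G *v h) =
     of_real 2 * \<i> * cdot ((adj F ** Jmat ** G) *v h) (matrix_inv (frame_plus F) *v (frame_plus G *v h))"
proof -
  note pF = lagrangian_frame_pm[OF assms(1)]
  let ?v = "frame_plus G *v h"
  have v: "?v = frame_plus F *v (matrix_inv (frame_plus F) *v ?v)"
    using pF(2) by (simp add: matrix_vector_mul_assoc matrix_mul_assoc matrix_inv_right)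
  have "(adj F ** Jmat ** G) *v h = (\<i> / 2) *s (adj (frame_plus F) *v (?v - Vmat F G *v ?v))"
    unfolding symplectic_form_Vmat[OF assms]
    by (simp add: matrix_vector_mul_assoc[symmetric] mat_scalar_vec matrix_vector_mult_diff_rdistrib)
  then have "cdot ((adj F ** Jmat ** G) *v h) (matrix_inv (frame_plus F) *v ?v) =
      \<i> / 2 * cdot (?v - Vmat F G *v ?v) (frame_plus F *v (matrix_inv (frame_plus F) *v ?v))"
    by (simp add: cdot_scale_left cdot_mat_left)
  also have "\<dots> = \<i> / 2 * cdot (?v - Vmat F G *v ?v) ?v" using v by simp
  finally have e: "cdot ((adj F ** Jmat ** G) *v h) (matrix_inv (frame_plus F) *v ?v) = \<i> / 2 * cdot (?v - Vmat F G *v ?v) ?v" .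
  have i: "of_real 2 * \<i> * (\<i> / 2 * w) = - w" for w by (simp add: complex_eq_iff)
  show ?thesis unfolding e i by (simp add: cdot_diff_left)
qed

section \<open>Continuity and the Maslov index of a pair of frames\<close>

lemma continuous_on_matrix_inv [continuous_intros]:
  fixes A :: "'a::topological_space \<Rightarrow> complex ^ 'm ^ 'm"
  assumes "continuous_on S A" "\<And>x. x \<in> S \<Longrightarrow> invertible (A x)"
  shows "continuous_on S (\<lambda>x. matrix_inv (A x))"
proof -
  \<comment> \<open>Cramer's rule\<close>
  define C where "C x k j = det (\<chi> i l. if l = k then axis j 1 $ i else A x $ i $ l) / det (A x)" for x k j
  have "matrix_inv (A x) = (\<chi> k j. C x k j)" if x: "x \<in> S" for x
  proof -
    have d: "det (A x) \<noteq> 0" using assms(2)[OF x] invertible_det_nz by blast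
    have "A x *v (matrix_inv (A x) *v axis j 1) = axis j 1" for j
      using matrix_inv_right[OF assms(2)[OF x]] by (simp add: matrix_vector_mul_assoc)
    then have "matrix_inv (A x) *v axis j 1 = (\<chi> k. C x k j)" for j
      using cramer[OF d, of "matrix_inv (A x) *v axis j 1" "axis j 1"] by (simp add: C_def)
    then have "column j (matrix_inv (A x)) = (\<chi> k. C x k j)" for j by (simp add: mat_vec_axis)
    then show ?thesis by (simp add: vec_eq_iff column_def)
  qed
  moreover have "continuous_on S (\<lambda>x. \<chi> k j. C x k j)"
    unfolding C_def
  proof (intro continuous_on_vec_lambda continuous_intros)
    fix k j i l :: 'm
    show "continuous_on S (\<lambda>x. if l = k then axis j 1 $ i else A x $ i $ l)"
      by (cases "l = k") (auto intro!: continuous_intros assms(1))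
  qed (use assms invertible_det_nz in auto)
  ultimately show ?thesis by (simp cong: continuous_on_cong)
qed

lemma continuous_on_frame_pm [continuous_intros]:
  fixes F :: "'a::topological_space \<Rightarrow> complex ^ 'm ^ ('m::finite + 'm)"
  assumes "continuous_on S F"
  shows "continuous_on S (\<lambda>x. frame_plus (F x))" "continuous_on S (\<lambda>x. frame_minus (F x))"
  unfolding frame_plus_def frame_minus_def upper_def lower_def map_matrix_def
  by (auto intro!: continuous_intros continuous_on_vec_lambda assms)

lemma continuous_on_Vmat:
  fixes F :: "'a::topological_space \<Rightarrow> complex ^ 'm ^ ('m::finite + 'm)"
  assumes "continuous_on S F" "continuous_on S G"
    and "\<And>x. x \<in> S \<Longrightarrow> lagrangian_frame (F x)" "\<And>x. x \<in> S \<Longrightarrow> lagrangian_frame (G x)"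
  shows "continuous_on S (\<lambda>x. Vmat (F x) (G x))"
  unfolding Vmat_def
  by (intro continuous_intros assms lagrangian_frame_pm) (auto intro: assms)

text \<open>
  The normal equations; the formula shows that the projection depends continuously on the frame.
\<close>

lemma orth_proj_col_space:
  fixes F :: "complex ^ 'm ^ ('m::finite + 'm)"
  assumes "lagrangian_frame F"
  shows "invertible (adj F ** F)"
    and "orth_proj (col_space F) v = (F ** matrix_inv (adj F ** F) ** adj F) *v v"
proof -
  have F: "\<And>c. F *v c = 0 \<Longrightarrow> c = 0" using assms by (simp add: lagrangian_frame_def)
  have "c = 0" if "(adj F ** F) *v c = 0" for c
  proof -
    have "cdot (F *v c) (F *v c) = cdot ((adj F ** F) *v c) c"
      by (simp add: cdot_mat_right matrix_vector_mul_assoc)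
    then show ?thesis using that F by simp
  qed
  then show inv: "invertible (adj F ** F)"
    using matrix_left_invertible_ker[of "adj F ** F"] invertible_left_inverse by blast
  define p where "p = (F ** matrix_inv (adj F ** F) ** adj F) *v v"
  have L: "col_space F = range ((*v) F)" by (simp add: col_space_def span_columns)
  have sub: "vec.subspace (col_space F)" by (simp add: col_space_def)
  have pL: "p \<in> col_space F" by (auto simp: p_def L matrix_vector_mul_assoc[symmetric])
  have "adj F *v p = ((adj F ** F) ** matrix_inv (adj F ** F)) *v (adj F *v v)"
    by (simp add: p_def matrix_vector_mul_assoc matrix_mul_assoc)
  then have ap: "adj F *v p = adj F *v v"
    unfolding matrix_inv_right[OF inv] by simp
  have orth: "cdot (v - p) w = 0" if "w \<in> col_space F" for w
    using that ap by (auto simp: L cdot_mat_right matrix_vector_mult_diff_distrib)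
  show "orth_proj (col_space F) v = (F ** matrix_inv (adj F ** F) ** adj F) *v v"
    unfolding orth_proj_def p_def[symmetric]
  proof (rule the_equality)
    fix q assume q: "q \<in> col_space F \<and> (\<forall>w\<in>col_space F. cdot (v - q) w = 0)"
    then have d: "p - q \<in> col_space F" using vec.subspace_diff[OF sub pL] by blast
    have "cdot (v - q) (p - q) = 0" "cdot (v - p) (p - q) = 0" using q d orth by blast+
    then have "cdot (p - q) (p - q) = 0" by (simp add: cdot_diff_left)
    then show "q = p" by simp
  qed (use pL orth in blast)
qed

lemma lagrangian_path_frames:
  fixes F :: "real \<Rightarrow> complex ^ 'm ^ ('m::finite + 'm)"
  assumes cont: "continuous_on {a..b} F" and fr: "\<And>t. t \<in> {a..b} \<Longrightarrow> lagrangian_frame (F t)"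
  shows "lagrangian_path a b (\<lambda>t. col_space (F t))"
  unfolding lagrangian_path_def
proof (intro conjI ballI)
  fix t assume t: "t \<in> {a..b}"
  define P where "P t = F t ** matrix_inv (adj (F t) ** F t) ** adj (F t)" for t
  have "continuous_on {a..b} P"
    unfolding P_def by (intro continuous_intros cont orth_proj_col_space(1) fr)
  then have "(P \<longlongrightarrow> P t) (at t within {a..b})" using t by (simp add: continuous_on_def)
  then have lim: "((\<lambda>s. norm (P s - P t)) \<longlongrightarrow> 0) (at t within {a..b})"
    by (intro tendsto_norm_zero) (simp add: LIM_zero)
  have bd: "norm (lag_dist (col_space (F s)) (col_space (F t))) \<le> norm (P s - P t)" if s: "s \<in> {a..b}" for s
  proof -
    have eq: "(\<lambda>v. orth_proj (col_space (F s)) v - orth_proj (col_space (F t)) v) = (*v) (P s - P t)"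
      by (simp add: fun_eq_iff orth_proj_col_space(2)[OF fr[OF s]] orth_proj_col_space(2)[OF fr[OF t]] P_def
          matrix_vector_mult_diff_rdistrib)
    have "0 \<le> onorm ((*v) (P s - P t))"
      by (rule onorm_pos_le) (use bounded_bilinear.bounded_linear_right[OF bounded_bilinear_mat_vec] in blast)
    moreover have "onorm ((*v) (P s - P t)) \<le> norm (P s - P t)"
      by (rule onorm_bound) (auto simp: norm_mat_vec_le)
    ultimately show ?thesis by (simp add: lag_dist_def eq)
  qed
  show "((\<lambda>s. lag_dist (col_space (F s)) (col_space (F t))) \<longlongrightarrow> 0) (at t within {a..b})"
    by (rule Lim_null_comparison[OF _ lim]) (use bd in \<open>auto simp: eventually_at_filter intro!: always_eventually\<close>)
  show "lagrangian (col_space (F t))" using fr[OF t] by (rule lagrangian_frame_lagrangian)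
qed

lemma spectrum_of_minus: "z \<in> spectrum_of (- V) \<longleftrightarrow> - z \<in> spectrum_of V"
proof -
  have "(- V) *v v = z *s v \<longleftrightarrow> V *v v = (- z) *s v" for v
    unfolding mat_vec_minus_left by (metis minus_minus vector_sneg_minus1 vector_smult_assoc mult_minus1)
  then show ?thesis by (simp add: spectrum_of_def)
qed

lemma sum_telescope_nat: "(\<Sum>j=1..M. g j - g (j - 1)) = g M - (g 0 :: int)" for M :: nat
  by (induction M) auto

text \<open>
  With a flow function every admissible sum telescopes to \<open>f b - f a\<close>, whatever the partition and the frames. An
  admissible partition exists because around each point some pair of arc ends is avoided, and finitely many of these
  neighbourhoods suffice (Lebesgue number \<open>r\<close>).
\<close>

theorem maslov_index_flow_fun:
  fixes F G :: "real \<Rightarrow> complex ^ 'm ^ ('m::finite + 'm)"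
  assumes ab: "a < b" and cF: "continuous_on {a..b} F" and cG: "continuous_on {a..b} G"
    and F: "\<And>t. t \<in> {a..b} \<Longrightarrow> lagrangian_frame (F t)" and G: "\<And>t. t \<in> {a..b} \<Longrightarrow> lagrangian_frame (G t)"
    and flow: "flow_fun (\<lambda>t. Vmat (F t) (G t)) a b f"
  shows "maslov_index (\<lambda>t. col_space (F t)) (\<lambda>t. col_space (G t)) a b = f b - f a"
proof -
  define V where "V t = Vmat (F t) (G t)" for t
  have flow: "flow_fun V a b f" using flow by (simp add: V_def[abs_def])
  have uni: "unitary (V t)" if "t \<in> {a..b}" for t using that F G by (simp add: V_def unitary_Vmat)
  have cV: "continuous_on {a..b} V" unfolding V_def by (intro continuous_on_Vmat cF cG F G)
  have W: "W_tilde F' G' = - V t"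
    if t: "t \<in> {a..b}" and F': "is_frame F' (col_space (F t))" and G': "is_frame G' (col_space (G t))" for t F' G'
  proof -
    obtain A where A: "invertible A" "F' = F t ** A"
      using is_frame_change[OF lagrangian_frame_is_frame[OF F[OF t]] F'] by blast
    obtain B where B: "invertible B" "G' = G t ** B"
      using is_frame_change[OF lagrangian_frame_is_frame[OF G[OF t]] G'] by blast
    show ?thesis
      using Vmat_change_frame[OF F[OF t] G[OF t] A(1) B(1)] by (simp add: W_tilde_Vmat A B V_def)
  qed
  have sp: "cis (pi + \<epsilon>) \<in> spectrum_of (- U) \<longleftrightarrow> cis \<epsilon> \<in> spectrum_of U"
    "cis (pi - \<epsilon>) \<in> spectrum_of (- U) \<longleftrightarrow> cis (2 * pi - \<epsilon>) \<in> spectrum_of U" for U :: "complex ^ 'm ^ 'm" and \<epsilon>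
  proof -
    have "- cis (pi + \<epsilon>) = cis \<epsilon>" "- cis (pi - \<epsilon>) = cis (2 * pi - \<epsilon>)"
      by (simp_all add: complex_eq_iff)
    then show "cis (pi + \<epsilon>) \<in> spectrum_of (- U) \<longleftrightarrow> cis \<epsilon> \<in> spectrum_of U"
      "cis (pi - \<epsilon>) \<in> spectrum_of (- U) \<longleftrightarrow> cis (2 * pi - \<epsilon>) \<in> spectrum_of U"
      by (simp_all only: spectrum_of_minus)
  qed
  let ?L = "\<lambda>t. col_space (F t)" and ?L' = "\<lambda>t. col_space (G t)"
  have "m = f b - f a" if mv: "maslov_value ?L ?L' a b m" for m
  proof -
    obtain F' G' :: "real \<Rightarrow> complex ^ 'm ^ ('m + 'm)" and t \<epsilon> :: "nat \<Rightarrow> real" and M where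
      fr: "\<forall>s\<in>{a..b}. is_frame (F' s) (?L s) \<and> is_frame (G' s) (?L' s)" and
      t: "t 0 = a" "t M = b" "\<forall>j<M. t j < t (Suc j)" and
      e: "\<forall>j\<in>{1..M}. 0 < \<epsilon> j \<and> \<epsilon> j < pi \<and> (\<forall>s\<in>{t (j - 1)..t j}.
              cis (pi + \<epsilon> j) \<notin> spectrum_of (W_tilde (F' s) (G' s)) \<and>
              cis (pi - \<epsilon> j) \<notin> spectrum_of (W_tilde (F' s) (G' s)))" and
      m: "m = (\<Sum>j=1..M. int (k_count (W_tilde (F' (t j)) (G' (t j))) (\<epsilon> j))
                      - int (k_count (W_tilde (F' (t (j - 1))) (G' (t (j - 1)))) (\<epsilon> j)))"
      using mv unfolding maslov_value_def by blast
    have mono: "t i \<le> t j" if "i \<le> j" "j \<le> M" for i j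
      using that
    proof (induction j)
      case (Suc j)
      then have "t j < t (Suc j)" using t(3) by simp
      then show ?case using Suc by (cases "i = Suc j") force+
    qed simp
    have tab: "t j \<in> {a..b}" if "j \<le> M" for j using mono[of 0 j] mono[of j M] that t by auto
    have W': "W_tilde (F' s) (G' s) = - V s" if "s \<in> {a..b}" for s using W[OF that] fr that by blast
    have "m = (\<Sum>j=1..M. f (t j) - f (t (j - 1)))"
      unfolding m
    proof (rule sum.cong)
      fix j assume j: "j \<in> {1..M}"
      have ends: "t (j - 1) \<in> {a..b}" "t j \<in> {a..b}" "t (j - 1) \<le> t j" using j tab mono by auto
      have "0 < \<epsilon> j" "\<epsilon> j < pi" using e j by auto
      then have ej: "0 < \<epsilon> j" "\<epsilon> j < 2 * pi" using pi_gt_zero by linarith+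
      have ns: "cis (\<epsilon> j) \<notin> spectrum_of (V s)" if "s \<in> closed_segment (t (j - 1)) (t j)" for s
      proof -
        have s: "s \<in> {t (j - 1)..t j}" using that ends(3) by (simp add: closed_segment_eq_real_ivl)
        then have "s \<in> {a..b}" using ends by auto
        then show ?thesis using e j s W' sp(1) by metis
      qed
      show "int (k_count (W_tilde (F' (t j)) (G' (t j))) (\<epsilon> j))
                      - int (k_count (W_tilde (F' (t (j - 1))) (G' (t (j - 1)))) (\<epsilon> j)) = f (t j) - f (t (j - 1))"
        unfolding W'[OF ends(1)] W'[OF ends(2)] k_count_eigcount minus_minus
        by (rule flow_funD[OF flow ends(1,2) ej ns, symmetric])
    qed simp
    then show ?thesis using sum_telescope_nat[of "\<lambda>j. f (t j)" M] t by simp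
  qed
  moreover have "\<exists>m. maslov_value ?L ?L' a b m"
  proof -
    have "\<forall>s\<in>{a..b}. \<exists>\<epsilon> \<eta>. 0 < \<epsilon> \<and> \<epsilon> < pi \<and> 0 < \<eta> \<and> (\<forall>t\<in>{a..b}. \<bar>t - s\<bar> < \<eta> \<longrightarrow>
       cis \<epsilon> \<notin> spectrum_of (V t) \<and> cis (2 * pi - \<epsilon>) \<notin> spectrum_of (V t))"
      using flow_fun_local[OF flow cV uni] by meson
    then obtain \<epsilon> \<eta> where e: "\<And>s. s \<in> {a..b} \<Longrightarrow> 0 < \<epsilon> s \<and> \<epsilon> s < pi \<and> 0 < \<eta> s"
      and ns: "\<And>s t. s \<in> {a..b} \<Longrightarrow> t \<in> {a..b} \<Longrightarrow> \<bar>t - s\<bar> < \<eta> s \<Longrightarrow>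
         cis (\<epsilon> s) \<notin> spectrum_of (V t) \<and> cis (2 * pi - \<epsilon> s) \<notin> spectrum_of (V t)"
      by metis
    have "{a..b} \<subseteq> \<Union>((\<lambda>s. ball s (\<eta> s)) ` {a..b})" using e by force
    moreover have "\<And>B. B \<in> (\<lambda>s. ball s (\<eta> s)) ` {a..b} \<Longrightarrow> open B" by auto
    ultimately obtain r where r: "r > 0" "\<And>x. x \<in> {a..b} \<Longrightarrow> \<exists>B\<in>(\<lambda>s. ball s (\<eta> s)) ` {a..b}. ball x r \<subseteq> B"
      using Heine_Borel_lemma[of "{a..b}" "(\<lambda>s. ball s (\<eta> s)) ` {a..b}"] by (metis compact_Icc)
    obtain M :: nat where M: "(b - a) / r < real M" using reals_Archimedean2 by blast
    have M0: "0 < real M" using M r ab by (metis divide_pos_pos diff_gt_0_iff_gt order_less_trans)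
    define \<delta> where "\<delta> = (b - a) / real M"
    have d: "0 < \<delta>" "\<delta> < r" using M M0 r ab by (auto simp: \<delta>_def field_simps)
    define t where "t j = a + real j * \<delta>" for j
    have tM: "t M = b" using M0 by (simp add: t_def \<delta>_def)
    have tab: "t j \<in> {a..b}" if "j \<le> M" for j
    proof -
      have "real j * \<delta> \<le> real M * \<delta>" using that d by (intro mult_right_mono) auto
      then show ?thesis using tM d by (auto simp: t_def)
    qed
    have "\<forall>j. \<exists>s. j \<le> M \<longrightarrow> s \<in> {a..b} \<and> ball (t j) r \<subseteq> ball s (\<eta> s)"
      using r(2) tab by blast
    then obtain s where s: "\<And>j. j \<le> M \<Longrightarrow> s j \<in> {a..b} \<and> ball (t j) r \<subseteq> ball (s j) (\<eta> (s j))" by metis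
    have avoid: "\<forall>j\<in>{1..M}. 0 < \<epsilon> (s j) \<and> \<epsilon> (s j) < pi \<and> (\<forall>x\<in>{t (j - 1)..t j}.
        cis (pi + \<epsilon> (s j)) \<notin> spectrum_of (W_tilde (F x) (G x)) \<and>
        cis (pi - \<epsilon> (s j)) \<notin> spectrum_of (W_tilde (F x) (G x)))"
    proof (intro ballI conjI)
      fix j assume j: "j \<in> {1..M}"
      then have jM: "j - 1 \<le> M" "j \<le> M" by auto
      have sj: "s j \<in> {a..b}" "ball (t j) r \<subseteq> ball (s j) (\<eta> (s j))" using s[OF jM(2)] by auto
      show "0 < \<epsilon> (s j)" "\<epsilon> (s j) < pi" using e[OF sj(1)] by auto
      fix x assume x: "x \<in> {t (j - 1)..t j}"
      have "t (j - 1) \<in> {a..b}" "t j \<in> {a..b}" using tab jM by blast+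
      then have xab: "x \<in> {a..b}" using x by auto
      have "t j - t (j - 1) = \<delta>" using j by (simp add: t_def of_nat_diff algebra_simps)
      then have "x \<in> ball (t j) r" using x d by (auto simp: dist_real_def)
      then have "x \<in> ball (s j) (\<eta> (s j))" using sj(2) by blast
      then have "\<bar>x - s j\<bar> < \<eta> (s j)" by (simp add: dist_real_def abs_minus_commute)
      from ns[OF sj(1) xab this]
      show "cis (pi + \<epsilon> (s j)) \<notin> spectrum_of (W_tilde (F x) (G x))"
        "cis (pi - \<epsilon> (s j)) \<notin> spectrum_of (W_tilde (F x) (G x))"
        using sp[of "\<epsilon> (s j)" "V x"] by (auto simp: W_tilde_Vmat V_def)
    qed
    have frames: "\<forall>x\<in>{a..b}. is_frame (F x) (?L x) \<and> is_frame (G x) (?L' x)"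
      using F G lagrangian_frame_is_frame by blast
    have inc: "t 0 = a" "\<forall>j<M. t j < t (Suc j)" using d by (auto simp: t_def algebra_simps)
    have "\<exists>m. maslov_value ?L ?L' a b m"
      unfolding maslov_value_def
      by (rule exI, intro conjI lagrangian_path_frames cF cG F G, assumption, assumption,
          rule exI[of _ F], rule exI[of _ G], rule exI[of _ t], rule exI[of _ "\<lambda>j. \<epsilon> (s j)"], rule exI[of _ M])
         (use frames inc tM avoid in blast)
    then show ?thesis by blast
  qed
  ultimately show ?thesis unfolding maslov_index_def by (metis (mono_tags, lifting) the_equality)
qed

section \<open>Solutions of the differential system\<close>

lemma mat_solution_continuous: "mat_solution A Y \<Longrightarrow> continuous_on {0..1} Y"
  by (simp add: mat_solution_def abs_continuous_imp_continuous_on)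

text \<open>
  The Lagrange identity: in \<open>(Y\<^sup>* J Z)' = Y\<^sup>* J Z' - (J Y')\<^sup>* Z\<close> the equations turn the terms into
  \<open>Y\<^sup>* C Z - Y\<^sup>* A Z\<close>.
\<close>

lemma mat_solution_wronskian:
  fixes A C :: "real \<Rightarrow> complex ^ ('m::finite + 'm) ^ ('m + 'm)"
    and Y :: "real \<Rightarrow> complex ^ 'c ^ ('m + 'm)" and Z :: "real \<Rightarrow> complex ^ 'd ^ ('m + 'm)"
  assumes Y: "mat_solution A Y" and Z: "mat_solution C Z"
    and sa: "AE x in lebesgue_on {0<..<1}. self_adjoint (A x)"
    and ab: "0 \<le> a" "a \<le> b" "b \<le> 1"
  shows "((\<lambda>x. adj (Y x) ** (C x - A x) ** Z x) has_integral
     (adj (Y b) ** Jmat ** Z b - adj (Y a) ** Jmat ** Z a)) {a..b}"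
proof -
  let ?h = "\<lambda>(P :: complex ^ 'c ^ ('m + 'm)) (Q :: complex ^ 'd ^ ('m + 'm)). (adj P ** Jmat) ** Q"
  have "bounded_linear (\<lambda>P :: complex ^ 'c ^ ('m + 'm). adj P ** Jmat)"
    using bounded_linear_compose[OF bounded_bilinear.bounded_linear_left[OF bounded_bilinear_mat_mult] bounded_linear_adj] .
  from bounded_bilinear.comp1[OF bounded_bilinear_mat_mult this] have h: "bounded_bilinear ?h" .
  show ?thesis
  proof (rule abs_continuous_product_integral[OF h _ _ _ ab])
    show "abs_continuous 0 1 Y" "abs_continuous 0 1 Z" using Y Z by (auto simp: mat_solution_def)
    have "AE x in lebesgue_on {0<..<1}. \<exists>Y'. (Y has_vector_derivative Y') (at x) \<and> Jmat ** Y' = A x ** Y x"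
      "AE x in lebesgue_on {0<..<1}. \<exists>Z'. (Z has_vector_derivative Z') (at x) \<and> Jmat ** Z' = C x ** Z x"
      using Y Z by (auto simp: mat_solution_def)
    then show "AE x in lebesgue_on {0<..<1}. \<exists>Y' Z'. (Y has_vector_derivative Y') (at x) \<and>
        (Z has_vector_derivative Z') (at x) \<and>
        adj (Y x) ** Jmat ** Z' + adj Y' ** Jmat ** Z x = adj (Y x) ** (C x - A x) ** Z x"
      using sa
    proof eventually_elim
      case (elim x)
      then obtain Y' Z' where d: "(Y has_vector_derivative Y') (at x)" "Jmat ** Y' = A x ** Y x"
        "(Z has_vector_derivative Z') (at x)" "Jmat ** Z' = C x ** Z x" by blast
      have "adj (Jmat ** Y') = adj (Y x) ** A x"
        unfolding d(2) using elim(3) by (simp add: adj_mult self_adjoint_def)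
      then have "adj Y' ** Jmat = - (adj (Y x) ** A x)"
        by (metis adj_Jmat adj_mult mat_mult_minus_right minus_minus)
      moreover have "adj (Y x) ** Jmat ** Z' = adj (Y x) ** C x ** Z x"
        using d(4) by (metis matrix_mul_assoc)
      ultimately have "adj (Y x) ** Jmat ** Z' + adj Y' ** Jmat ** Z x = adj (Y x) ** (C x - A x) ** Z x"
        by (simp add: mat_algebra)
      then show ?case using d by blast
    qed
  qed
qed

lemma mat_solution_wronskian_const:
  assumes Y: "mat_solution A Y" and Z: "mat_solution A Z"
    and sa: "AE x in lebesgue_on {0<..<1}. self_adjoint (A x)" and x: "x \<in> {0..1}"
  shows "adj (Y x) ** Jmat ** Z x = adj (Y 0) ** Jmat ** Z 0"
proof -
  have "((\<lambda>x. 0) has_integral (adj (Y x) ** Jmat ** Z x - adj (Y 0) ** Jmat ** Z 0)) {0..x}"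
    using mat_solution_wronskian[OF Y Z sa, of 0 x] x by simp
  then show ?thesis using has_integral_unique[OF _ has_integral_0] by force
qed

lemma symplectic_inverse:
  fixes P :: "complex ^ ('m::finite + 'm) ^ ('m + 'm)"
  assumes "adj P ** Jmat ** P = Jmat"
  shows "P ** (- (Jmat ** adj P ** Jmat)) = mat 1" "(- (Jmat ** adj P ** Jmat)) ** P = mat 1"
proof -
  have "(Jmat ** adj P ** Jmat) ** P = Jmat ** (adj P ** Jmat ** P)" by (simp add: matrix_mul_assoc)
  then show "(- (Jmat ** adj P ** Jmat)) ** P = mat 1"
    by (simp add: assms mat_mult_minus_left Jmat_sq)
  then show "P ** (- (Jmat ** adj P ** Jmat)) = mat 1" by (rule matrix_left_right_inverse[THEN iffD1])
qed

locale fundamental_solution =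
  fixes A :: "real \<Rightarrow> complex ^ ('m::finite + 'm) ^ ('m + 'm)" and P
  assumes sol: "mat_solution A P" and init: "P 0 = mat 1"
    and sa: "AE x in lebesgue_on {0<..<1}. self_adjoint (A x)"
begin

lemma symplectic: "x \<in> {0..1} \<Longrightarrow> adj (P x) ** Jmat ** P x = Jmat"
  using mat_solution_wronskian_const[OF sol sol sa, of x] by (simp add: init adj_mat)

text \<open>
  Uniqueness for the initial value problem: \<open>P\<^sup>* J Y\<close> is constant and \<open>P\<^sup>-\<^sup>1 = - J P\<^sup>* J\<close>. This takes
  the place of a Gronwall estimate.
\<close>

lemma solution_eq:
  fixes Y :: "real \<Rightarrow> complex ^ 'c ^ ('m + 'm)"
  assumes Y: "mat_solution A Y" and x: "x \<in> {0..1}"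
  shows "Y x = P x ** Y 0"
proof -
  have w: "adj (P x) ** Jmat ** Y x = Jmat ** Y 0"
    using mat_solution_wronskian_const[OF sol Y sa x] by (simp add: init adj_mat)
  have "Y x = (P x ** (- (Jmat ** adj (P x) ** Jmat))) ** Y x"
    using symplectic_inverse(1)[OF symplectic[OF x]] by simp
  also have "\<dots> = - (P x ** (Jmat ** (adj (P x) ** Jmat ** Y x)))"
    by (simp add: mat_mult_minus_left mat_mult_minus_right matrix_mul_assoc)
  also have "\<dots> = P x ** Y 0" unfolding w by (simp add: Jmat_left_cancel mat_mult_minus_right)
  finally show ?thesis .
qed

end

subsection \<open>Vector solutions\<close>

text \<open>
  It lets statements about matrix solutions apply to vector solutions.
\<close>

definition colmat :: "complex ^ 'r \<Rightarrow> complex ^ 1 ^ 'r" where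
  "colmat v = (\<chi> i j. v $ i)"

lemma colmat_mult: "A ** colmat v = colmat (A *v v)"
  by (simp add: vec_eq_iff colmat_def matrix_matrix_mult_def matrix_vector_mult_def)

lemma colmat_inject: "colmat u = colmat v \<longleftrightarrow> u = v"
  by (auto simp: vec_eq_iff colmat_def)

lemma bounded_linear_colmat: "bounded_linear colmat"
proof -
  have "linear colmat" by (rule linearI) (simp_all add: vec_eq_iff colmat_def)
  then show ?thesis by (simp add: linear_conv_bounded_linear)
qed

lemma vec_solution_imp_mat_solution:
  assumes "vec_solution A y"
  shows "mat_solution A (\<lambda>x. colmat (y x))"
  unfolding mat_solution_def
proof
  show "abs_continuous 0 1 (\<lambda>x. colmat (y x))"
    using assms by (auto simp: vec_solution_def intro: abs_continuous_linear[OF bounded_linear_colmat])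
  have "AE x in lebesgue_on {0<..<1}. \<exists>y'. (y has_vector_derivative y') (at x) \<and> Jmat *v y' = A x *v y x"
    using assms by (simp add: vec_solution_def)
  then show "AE x in lebesgue_on {0<..<1}. \<exists>Y'. ((\<lambda>x. colmat (y x)) has_vector_derivative Y') (at x) \<and>
      Jmat ** Y' = A x ** colmat (y x)"
  proof eventually_elim
    case (elim x)
    then obtain y' where y': "(y has_vector_derivative y') (at x)" "Jmat *v y' = A x *v y x" by blast
    have "((\<lambda>x. colmat (y x)) has_vector_derivative colmat y') (at x)"
      by (rule bounded_linear.has_vector_derivative[OF bounded_linear_colmat y'(1)])
    moreover have "Jmat ** colmat y' = A x ** colmat (y x)" by (simp add: colmat_mult y'(2))
    ultimately show ?case by blast
  qed
qed

lemma mat_solution_vec: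
  assumes "mat_solution A Y"
  shows "vec_solution A (\<lambda>x. Y x *v c)"
  unfolding vec_solution_def
proof
  note bl = bounded_bilinear.bounded_linear_left[OF bounded_bilinear_mat_vec, of c]
  show "abs_continuous 0 1 (\<lambda>x. Y x *v c)"
    using assms by (auto simp: mat_solution_def intro: abs_continuous_linear[OF bl])
  have "AE x in lebesgue_on {0<..<1}. \<exists>Y'. (Y has_vector_derivative Y') (at x) \<and> Jmat ** Y' = A x ** Y x"
    using assms by (simp add: mat_solution_def)
  then show "AE x in lebesgue_on {0<..<1}. \<exists>y'. ((\<lambda>x. Y x *v c) has_vector_derivative y') (at x) \<and>
      Jmat *v y' = A x *v (Y x *v c)"
  proof eventually_elim
    case (elim x)
    then obtain Y' where Y': "(Y has_vector_derivative Y') (at x)" "Jmat ** Y' = A x ** Y x" by blast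
    have "((\<lambda>x. Y x *v c) has_vector_derivative Y' *v c) (at x)"
      by (rule bounded_linear.has_vector_derivative[OF bl Y'(1)])
    moreover have "Jmat *v (Y' *v c) = A x *v (Y x *v c)" by (simp add: matrix_vector_mul_assoc Y'(2))
    ultimately show ?case by blast
  qed
qed

text \<open>
  Eigenfunctions are represented by their extensions by zero; changing values outside \<open>[0,1]\<close> affects neither absolute
  continuity there nor derivatives at interior points.
\<close>

lemma vec_solution_cong:
  assumes "\<And>x. x \<in> {0..1} \<Longrightarrow> y x = z x" "vec_solution A y"
  shows "vec_solution A z"
  unfolding vec_solution_def
proof
  have k: "Sup k \<in> {0..1} \<and> Inf k \<in> {0..1}" if D: "D division_of \<Union>D" "\<Union>D \<subseteq> {0..1}" "k \<in> D" for D and k :: "real set"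
  proof -
    obtain u v where k: "k = {u..v}" "k \<noteq> {}" using division_ofD(3,4)[OF D(1)] D(3) by (metis box_real(2))
    then have "u \<in> k" "v \<in> k" "Sup k = v" "Inf k = u" by auto
    then show ?thesis using D(2,3) by blast
  qed
  have "(\<Sum>k\<in>D. norm (z (Sup k) - z (Inf k))) = (\<Sum>k\<in>D. norm (y (Sup k) - y (Inf k)))"
    if "D division_of \<Union>D" "\<Union>D \<subseteq> {0..1}" for D
    using k[OF that] assms(1) by (intro sum.cong) auto
  moreover have "abs_continuous 0 1 y" using assms(2) by (simp add: vec_solution_def)
  ultimately show "abs_continuous 0 1 z"
    unfolding abs_continuous_def by (simp cong: conj_cong)
  have "AE x in lebesgue_on {0<..<1}. \<exists>y'. (y has_vector_derivative y') (at x) \<and> Jmat *v y' = A x *v y x"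
    using assms(2) by (simp add: vec_solution_def)
  moreover have "AE x in lebesgue_on {0<..<1}. x \<in> {0<..<1::real}" by (metis AE_space space_lebesgue_on)
  ultimately show "AE x in lebesgue_on {0<..<1}. \<exists>z'. (z has_vector_derivative z') (at x) \<and> Jmat *v z' = A x *v z x"
  proof eventually_elim
    case (elim x)
    then obtain y' where y': "(y has_vector_derivative y') (at x)" "Jmat *v y' = A x *v y x" by blast
    have "(z has_vector_derivative y') (at x)"
      by (rule has_vector_derivative_transform_within_open[OF y'(1), of "{0<..<1}"]) (use elim assms(1) in auto)
    moreover have "y x = z x" using elim assms(1) by auto
    ultimately show ?case using y'(2) by auto
  qed
qed

subsection \<open>The doubled system\<close>

lemma calB_eq: "calB A = emb1 ** A ** adj emb1"
  using calB_emb[of A "mat 1"] by (simp add: matrix_mul_assoc)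

lemma self_adjoint_calB: "self_adjoint A \<Longrightarrow> self_adjoint (calB A)"
  by (simp add: self_adjoint_def calB_eq adj_mult matrix_mul_assoc)

lemma abs_continuous_add_const: "abs_continuous a b f \<Longrightarrow> abs_continuous a b (\<lambda>x. f x + c)"
  by (simp add: abs_continuous_def)

text \<open>
  The doubled system is the original one on the coordinates embedded by \<open>emb1\<close>, and it is \<open>J Y' = 0\<close> on those
  embedded by \<open>emb0\<close>.
\<close>

lemma fundamental_solution_calB:
  fixes A :: "real \<Rightarrow> complex ^ ('n::finite + 'n) ^ ('n + 'n)"
  assumes "fundamental_solution A P"
  shows "fundamental_solution (\<lambda>x. calB (A x)) (\<lambda>x. emb1 ** (P x ** adj emb1) + emb0 ** adj emb0)"
proof -
  interpret fundamental_solution A P by fact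
  have bl: "bounded_linear (\<lambda>Q. emb1 ** (Q ** adj (emb1 :: complex ^ ('n + 'n) ^ (('n + 'n) + ('n + 'n)))))"
    using bounded_linear_compose[OF bounded_bilinear.bounded_linear_right[OF bounded_bilinear_mat_mult]
      bounded_bilinear.bounded_linear_left[OF bounded_bilinear_mat_mult]] .
  show ?thesis
  proof
    show "mat_solution (\<lambda>x. calB (A x)) (\<lambda>x. emb1 ** (P x ** adj emb1) + emb0 ** adj emb0)"
      unfolding mat_solution_def
    proof
      show "abs_continuous 0 1 (\<lambda>x. emb1 ** (P x ** adj emb1) + emb0 ** adj emb0)"
        using sol by (auto simp: mat_solution_def intro: abs_continuous_add_const abs_continuous_linear[OF bl])
      have "AE x in lebesgue_on {0<..<1}. \<exists>P'. (P has_vector_derivative P') (at x) \<and> Jmat ** P' = A x ** P x"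
        using sol by (simp add: mat_solution_def)
      then show "AE x in lebesgue_on {0<..<1}. \<exists>Y'. ((\<lambda>x. emb1 ** (P x ** adj emb1) + emb0 ** adj emb0) has_vector_derivative Y') (at x) \<and>
          Jmat ** Y' = calB (A x) ** (emb1 ** (P x ** adj emb1) + emb0 ** adj emb0)"
      proof eventually_elim
        case (elim x)
        then obtain P' where P': "(P has_vector_derivative P') (at x)" "Jmat ** P' = A x ** P x" by blast
        have "((\<lambda>x. emb1 ** (P x ** adj emb1) + emb0 ** adj emb0) has_vector_derivative emb1 ** (P' ** adj emb1) + 0) (at x)"
          by (intro has_vector_derivative_add bounded_linear.has_vector_derivative[OF bl] P' has_vector_derivative_const)
        moreover have "Jmat ** (emb1 ** (P' ** adj emb1) + 0) = calB (A x) ** (emb1 ** (P x ** adj emb1) + emb0 ** adj emb0)"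
        proof -
          have "Jmat ** (emb1 ** (P' ** adj emb1) + 0) = emb1 ** ((Jmat ** P') ** adj emb1)"
            by (simp add: Jmat_emb matrix_mul_assoc[symmetric])
          also have "\<dots> = calB (A x) ** (emb1 ** (P x ** adj emb1) + emb0 ** adj emb0)"
            unfolding P'(2) calB_emb by (simp add: matrix_add_ldistrib emb_orthogonal matrix_mul_assoc[symmetric])
          finally show ?thesis .
        qed
        ultimately show ?case by blast
      qed
    qed
    show "emb1 ** (P 0 ** adj emb1) + emb0 ** adj emb0 = mat 1"
      using emb_complete[of "mat 1"] by (simp add: init)
    show "AE x in lebesgue_on {0<..<1}. self_adjoint (calB (A x))"
      using sa by eventually_elim (rule self_adjoint_calB)
  qed
qed

lemma calB_solution_eq:
  fixes A :: "real \<Rightarrow> complex ^ ('n::finite + 'n) ^ ('n + 'n)"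
  assumes P: "fundamental_solution A P" and X: "mat_solution (\<lambda>x. calB (A x)) X" and x: "x \<in> {0..1}"
  shows "X x = emb1 ** (P x ** (adj emb1 ** X 0)) + emb0 ** (adj emb0 ** X 0)"
  using fundamental_solution.solution_eq[OF fundamental_solution_calB[OF P] X x]
  by (simp add: mat_mult_add_left matrix_mul_assoc)

section \<open>Lipschitz dependence of the coefficient on the parameter\<close>

text \<open>
  The function is the limit of functions that depend on the second variable through the integer
  \<open>\<lfloor>(n + 1) s\<rfloor>\<close> only, so each of them is pieced together from countably many measurable functions.
\<close>

lemma caratheodory_measurable:
  fixes C :: "'a \<Rightarrow> real \<Rightarrow> 'b::{metric_space, second_countable_topology, banach}"
  assumes meas: "\<And>l. (\<lambda>x. C x l) \<in> borel_measurable M" and cont: "\<And>x. x \<in> space M \<Longrightarrow> continuous_on UNIV (C x)"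
  shows "(\<lambda>p. C (fst p) (snd p)) \<in> borel_measurable (M \<Otimes>\<^sub>M lborel)"
proof (rule borel_measurable_LIMSEQ_metric)
  fix n :: nat
  have "(\<lambda>p. C (fst p) (of_int i / real (Suc n))) \<in> borel_measurable (M \<Otimes>\<^sub>M lborel)" for i
    by (rule measurable_compose[OF measurable_fst meas])
  moreover have "(\<lambda>p. \<lfloor>real (Suc n) * snd p\<rfloor>) \<in> measurable (M \<Otimes>\<^sub>M lborel) (count_space UNIV)"
    by measurable
  ultimately show "(\<lambda>p. C (fst p) (of_int \<lfloor>real (Suc n) * snd p\<rfloor> / real (Suc n))) \<in> borel_measurable (M \<Otimes>\<^sub>M lborel)"
    by (rule measurable_compose_countable)
next
  fix p :: "'a \<times> real" assume p: "p \<in> space (M \<Otimes>\<^sub>M lborel)"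
  have "(\<lambda>n. of_int \<lfloor>real (Suc n) * s\<rfloor> / real (Suc n)) \<longlonglongrightarrow> s" for s :: real
  proof (rule tendsto_sandwich)
    have "(\<lambda>n. s - inverse (real (Suc n))) \<longlonglongrightarrow> s - 0"
      by (intro tendsto_diff tendsto_const LIMSEQ_inverse_real_of_nat)
    then show "(\<lambda>n. s - inverse (real (Suc n))) \<longlonglongrightarrow> s" by simp
    show "\<forall>\<^sub>F n in sequentially. s - inverse (real (Suc n)) \<le> of_int \<lfloor>real (Suc n) * s\<rfloor> / real (Suc n)"
    proof (rule always_eventually, rule allI)
      fix n
      have "real (Suc n) * s - 1 \<le> of_int \<lfloor>real (Suc n) * s\<rfloor>" by linarith
      then have "(real (Suc n) * s - 1) / real (Suc n) \<le> of_int \<lfloor>real (Suc n) * s\<rfloor> / real (Suc n)"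
        by (intro divide_right_mono) auto
      then show "s - inverse (real (Suc n)) \<le> of_int \<lfloor>real (Suc n) * s\<rfloor> / real (Suc n)"
        by (simp add: diff_divide_distrib inverse_eq_divide del: of_nat_Suc)
    qed
    show "\<forall>\<^sub>F n in sequentially. of_int \<lfloor>real (Suc n) * s\<rfloor> / real (Suc n) \<le> s"
      by (rule always_eventually) (simp add: divide_le_eq mult.commute del: of_nat_Suc)
  qed simp
  moreover have "isCont (C (fst p)) (snd p)"
    using cont[of "fst p"] p by (auto simp: space_pair_measure continuous_on_eq_continuous_at)
  ultimately show "(\<lambda>n. C (fst p) (of_int \<lfloor>real (Suc n) * snd p\<rfloor> / real (Suc n))) \<longlonglongrightarrow> C (fst p) (snd p)"
    using isCont_tendsto_compose by blast
qed

lemma has_vector_derivative_quotient: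
  assumes "(f has_vector_derivative D) (at x within S)"
  shows "((\<lambda>y. (1 / (y - x)) *\<^sub>R (f y - f x)) \<longlongrightarrow> D) (at x within S)"
proof -
  have "((\<lambda>y. norm ((f y - f x) - (y - x) *\<^sub>R D) / norm (y - x)) \<longlongrightarrow> 0) (at x within S)"
    using assms unfolding has_vector_derivative_def has_derivative_iff_norm by blast
  moreover have "norm ((f y - f x) - (y - x) *\<^sub>R D) / norm (y - x) = norm ((1 / (y - x)) *\<^sub>R (f y - f x) - D)"
    if "y \<noteq> x" for y
  proof -
    have "(1 / (y - x)) *\<^sub>R (f y - f x) - D = (1 / (y - x)) *\<^sub>R ((f y - f x) - (y - x) *\<^sub>R D)"
      using that by (simp add: scaleR_diff_right)
    then show ?thesis by (simp only: norm_scaleR) simp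
  qed
  then have "\<forall>\<^sub>F y in at x within S. norm ((f y - f x) - (y - x) *\<^sub>R D) / norm (y - x) =
      norm ((1 / (y - x)) *\<^sub>R (f y - f x) - D)"
    by (simp add: eventually_at_filter)
  ultimately have "((\<lambda>y. norm ((1 / (y - x)) *\<^sub>R (f y - f x) - D)) \<longlongrightarrow> 0) (at x within S)"
    by (rule Lim_transform_eventually)
  then show ?thesis by (simp add: tendsto_norm_zero_iff LIM_zero_iff)
qed

text \<open>
  For each parameter the bound on the derivative holds off a null set depending on the parameter. By
  Fubini's theorem, for almost every \<open>x\<close> it holds for almost every parameter; since the function is
  differentiable everywhere, its increments are Henstock integrals of the derivative and obey the bound
  without exception.
\<close>

theorem ae_lipschitz:
  fixes B Bl :: "'a \<Rightarrow> real \<Rightarrow> 'b::euclidean_space"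
  assumes sf: "sigma_finite_measure M" and ab: "a < b"
    and meas: "\<And>l. l \<in> {a..b} \<Longrightarrow> (\<lambda>x. B x l) \<in> borel_measurable M"
    and der: "AE x in M. \<forall>l\<in>{a..b}. (B x has_vector_derivative Bl x l) (at l within {a..b})"
    and c: "c \<in> borel_measurable M" "\<And>x. 0 \<le> c x"
    and bd: "\<And>l. l \<in> {a..b} \<Longrightarrow> AE x in M. norm (Bl x l) \<le> c x"
  shows "AE x in M. \<forall>l\<in>{a..b}. \<forall>m\<in>{a..b}. norm (B x l - B x m) \<le> c x * \<bar>l - m\<bar>"
proof -
  interpret M: sigma_finite_measure M by fact
  interpret pair_sigma_finite M lborel ..
  obtain N where N: "N \<in> null_sets M"
    "\<And>x. x \<in> space M - N \<Longrightarrow> \<forall>l\<in>{a..b}. (B x has_vector_derivative Bl x l) (at l within {a..b})"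
    using der by (rule AE_E3) blast
  \<comment> \<open>Clamping the parameter to \<open>[a,b]\<close> makes the difference quotients below available on the whole real line.\<close>
  define cl where "cl l = max a (min b l)" for l
  have cl: "cl l \<in> {a..b}" "l \<in> {a..b} \<Longrightarrow> cl l = l" for l using ab by (auto simp: cl_def)
  define C where "C x l = (if x \<in> N then 0 else B x (cl l))" for x l
  have "(\<lambda>x. C x l) \<in> borel_measurable M" for l
    unfolding C_def using N(1) by (intro measurable_If_set meas cl) auto
  moreover have "continuous_on UNIV (C x)" if x: "x \<in> space M" for x
  proof (cases "x \<in> N")
    case False
    have "continuous_on {a..b} (B x)"
      using N(2)[of x] x False by (auto simp: continuous_on_eq_continuous_within intro: has_vector_derivative_continuous)
    then have "continuous_on UNIV (\<lambda>l. B x (cl l))"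
      by (rule continuous_on_compose2) (use cl in \<open>auto simp: cl_def intro!: continuous_intros\<close>)
    then show ?thesis using False by (simp add: C_def[abs_def])
  qed (simp add: C_def[abs_def])
  ultimately have CM: "(\<lambda>p. C (fst p) (snd p)) \<in> borel_measurable (M \<Otimes>\<^sub>M lborel)"
    by (rule caratheodory_measurable)
  \<comment> \<open>Fubini's theorem requires joint measurability, which the limit of difference quotients of \<open>C\<close> provides.\<close>
  define D where "D p = lim (\<lambda>n. real (Suc n) *\<^sub>R (C (fst p) (snd p + inverse (real (Suc n))) - C (fst p) (snd p)))" for p
  have shift: "(\<lambda>p. C (fst p) (snd p + h)) \<in> borel_measurable (M \<Otimes>\<^sub>M lborel)" for h
  proof -
    have "(\<lambda>p. (fst p, snd p + h)) \<in> measurable (M \<Otimes>\<^sub>M lborel) (M \<Otimes>\<^sub>M lborel)" by measurable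
    from measurable_compose[OF this CM] show ?thesis by simp
  qed
  have DM: "D \<in> borel_measurable (M \<Otimes>\<^sub>M lborel)"
    unfolding D_def by (intro borel_measurable_lim_metric borel_measurable_scaleR borel_measurable_diff shift CM borel_measurable_const)
  have D: "D (x, s) = Bl x s" if x: "x \<in> space M - N" and s: "s \<in> {a<..<b}" for x s
  proof -
    have "(B x has_vector_derivative Bl x s) (at s within {a..b})" using N(2)[OF x] s by auto
    then have "(B x has_vector_derivative Bl x s) (at s)"
      using s at_within_Icc_at[of a s b] by simp
    then have "((\<lambda>y. (1 / (y - s)) *\<^sub>R (B x y - B x s)) \<longlongrightarrow> Bl x s) (at s)"
      by (rule has_vector_derivative_quotient)
    moreover have "filterlim (\<lambda>n. s + inverse (real (Suc n))) (at s) sequentially"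
    proof (intro filterlim_atI)
      show "(\<lambda>n. s + inverse (real (Suc n))) \<longlonglongrightarrow> s"
        using tendsto_add[OF tendsto_const LIMSEQ_inverse_real_of_nat, of s] by simp
      show "\<forall>\<^sub>F n in sequentially. s + inverse (real (Suc n)) \<noteq> s"
        by (rule always_eventually) (simp del: of_nat_Suc)
    qed
    ultimately have "(\<lambda>n. (1 / (s + inverse (real (Suc n)) - s)) *\<^sub>R (B x (s + inverse (real (Suc n))) - B x s)) \<longlonglongrightarrow> Bl x s"
      by (rule filterlim_compose)
    then have lim: "(\<lambda>n. (1 / inverse (real (Suc n))) *\<^sub>R (B x (s + inverse (real (Suc n))) - B x s)) \<longlonglongrightarrow> Bl x s"
      by simp
    have "\<forall>\<^sub>F n in sequentially. inverse (real (Suc n)) < b - s"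
      using order_tendstoD(2)[OF LIMSEQ_inverse_real_of_nat, of "b - s"] s by simp
    then have "\<forall>\<^sub>F n in sequentially. (1 / inverse (real (Suc n))) *\<^sub>R (B x (s + inverse (real (Suc n))) - B x s)
        = real (Suc n) *\<^sub>R (C x (s + inverse (real (Suc n))) - C x s)"
    proof eventually_elim
      case (elim n)
      have pos: "0 < inverse (real (Suc n))" by simp
      have ends: "a < s" "s < b" using s by auto
      have "a \<le> s + inverse (real (Suc n))" "s + inverse (real (Suc n)) \<le> b" using pos ends elim by linarith+
      then have "s + inverse (real (Suc n)) \<in> {a..b}" "s \<in> {a..b}" using ends by auto
      then show ?case using x by (simp add: C_def cl inverse_eq_divide)
    qed
    from Lim_transform_eventually[OF lim this]
    have "(\<lambda>n. real (Suc n) *\<^sub>R (C x (s + inverse (real (Suc n))) - C x s)) \<longlonglongrightarrow> Bl x s" .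
    then show ?thesis by (simp add: D_def limI)
  qed
  define P where "P x s \<longleftrightarrow> (s \<in> {a<..<b} \<longrightarrow> norm (D (x, s)) \<le> c x)" for x s
  have "AE s in lborel. AE x in M. P x s"
  proof (rule AE_I2)
    fix s
    show "AE x in M. P x s"
    proof (cases "s \<in> {a<..<b}")
      case True
      then have "AE x in M. norm (Bl x s) \<le> c x" by (intro bd) auto
      moreover have "AE x in M. x \<in> space M - N" using AE_not_in[OF N(1)] AE_space by eventually_elim simp
      ultimately show ?thesis by eventually_elim (simp add: P_def D True)
    next
      case False
      then have "P x s" for x unfolding P_def by blast
      then show ?thesis by simp
    qed
  qed
  moreover have "{p\<in>space (M \<Otimes>\<^sub>M lborel). P (fst p) (snd p)} \<in> sets (M \<Otimes>\<^sub>M lborel)"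
    unfolding P_def prod.collapse using DM c(1) by measurable
  ultimately have "AE x in M. AE s in lborel. P x s" using AE_commute by blast
  moreover have "AE x in M. x \<in> space M - N" using AE_not_in[OF N(1)] AE_space by eventually_elim simp
  ultimately show ?thesis
  proof eventually_elim
    case (elim x)
    then obtain Z where Z: "Z \<in> null_sets lborel" "\<And>s. s \<in> space lborel - Z \<Longrightarrow> P x s" by (auto elim!: AE_E3)
    then have "Z \<in> null_sets lebesgue" by (simp add: null_sets_completionI)
    then have "negligible (Z \<union> {a, b})" by (intro negligible_Un) (auto simp: negligible_iff_null_sets)
    have le: "norm (B x l - B x m) \<le> c x * (l - m)" if lm: "m \<le> l" "l \<in> {a..b}" "m \<in> {a..b}" for l m
    proof -
      have "(Bl x has_integral (B x l - B x m)) {m..l}"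
      proof (rule fundamental_theorem_of_calculus[OF lm(1)])
        fix s assume "s \<in> {m..l}"
        then have "s \<in> {a..b}" "{m..l} \<subseteq> {a..b}" using lm by auto
        then show "(B x has_vector_derivative Bl x s) (at s within {m..l})"
          using N(2)[OF elim(2)] has_vector_derivative_within_subset by blast
      qed
      then have "((\<lambda>s. if s \<in> Z \<union> {a, b} then 0 else Bl x s) has_integral (B x l - B x m)) (cbox m l)"
        unfolding box_real by (rule has_integral_spike[OF \<open>negligible _\<close>, rotated]) auto
      moreover have "norm (if s \<in> Z \<union> {a, b} then 0 else Bl x s) \<le> c x" if "s \<in> cbox m l" for s
      proof (cases "s \<in> Z \<union> {a, b}")
        case False
        then have "s \<in> {a<..<b}" using that lm by auto
        moreover have "P x s" using Z(2) False by auto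
        ultimately show ?thesis using False D[OF elim(2)] by (simp add: P_def)
      qed (simp add: c)
      ultimately have "norm (B x l - B x m) \<le> c x * measure lborel (cbox m l)"
        by (intro has_integral_bound c)
      then show ?thesis using lm by simp
    qed
    show ?case
    proof (intro ballI)
      fix l m assume "l \<in> {a..b}" "m \<in> {a..b}"
      then show "norm (B x l - B x m) \<le> c x * \<bar>l - m\<bar>"
        using le[of m l] le[of l m] by (cases "m \<le> l") (auto simp: norm_minus_commute)
    qed
  qed
qed

section \<open>Crossings in terms of frames\<close>

definition sform :: "complex ^ 'm ^ ('m::finite + 'm) \<Rightarrow> complex ^ 'm ^ ('m + 'm) \<Rightarrow> complex ^ 'm ^ 'm" where
  "sform F G = adj F ** Jmat ** G"

text \<open>
  The right-hand side of \<open>Vmat_form\<close> up to the factor \<open>2 \<i>\<close>. The second argument of the inner product is the coordinate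
  vector with respect to \<open>F\<close> that agrees with \<open>h\<close> under the maps \<open>X + \<i> Y\<close> of the two frames; at an intersection
  \<open>G h = F c\<close> it equals \<open>c\<close>.
\<close>

definition cross_form :: "complex ^ 'm ^ ('m::finite + 'm) \<Rightarrow> complex ^ 'm ^ ('m + 'm) \<Rightarrow> complex ^ 'm \<Rightarrow> complex" where
  "cross_form F G h = cdot (sform F G *v h) (matrix_inv (frame_plus F) *v (frame_plus G *v h))"

text \<open>
  At a fixed vector of \<open>V\<close> the maps \<open>X + \<i> Y\<close> and also the maps \<open>X - \<i> Y\<close> of the two frames agree, hence so do their
  upper and lower halves.
\<close>

lemma ker_sform_intersection:
  assumes "lagrangian_frame F" "lagrangian_frame G" "h \<in> ker (sform F G)"
  shows "F *v (matrix_inv (frame_plus F) *v (frame_plus G *v h)) = G *v h"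
proof -
  note pF = lagrangian_frame_pm[OF assms(1)] and pG = lagrangian_frame_pm[OF assms(2)]
  let ?c = "matrix_inv (frame_plus F) *v (frame_plus G *v h)"
  have P: "frame_plus F *v ?c = frame_plus G *v h"
    using pF(2) by (simp add: matrix_vector_mul_assoc matrix_mul_assoc matrix_inv_right)
  have "frame_plus G *v h \<in> ker (Vmat F G - mat 1)"
    using ker_Vmat(1)[OF assms(1,2)] assms(3) by (simp add: sform_def)
  then have "Vmat F G *v (frame_plus G *v h) = frame_plus G *v h"
    by (simp add: ker_def matrix_vector_mult_diff_rdistrib)
  moreover have "Vmat F G *v (frame_plus G *v h) = frame_plus F *v (matrix_inv (frame_minus F) *v (frame_minus G *v h))"
    unfolding Vmat_def matrix_vector_mul_assoc
    by (simp add: matrix_mul_assoc[symmetric] matrix_inv_left pG)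
  ultimately have "frame_plus F *v ?c = frame_plus F *v (matrix_inv (frame_minus F) *v (frame_minus G *v h))"
    using P by simp
  then have "matrix_inv (frame_plus F) *v (frame_plus F *v ?c) =
      matrix_inv (frame_plus F) *v (frame_plus F *v (matrix_inv (frame_minus F) *v (frame_minus G *v h)))" by simp
  then have c: "?c = matrix_inv (frame_minus F) *v (frame_minus G *v h)"
    by (simp add: matrix_vector_mul_assoc matrix_inv_cancel pF matrix_mul_assoc matrix_inv_left)
  have M: "frame_minus F *v ?c = frame_minus G *v h"
    unfolding c using pF(3) by (simp add: matrix_vector_mul_assoc matrix_mul_assoc matrix_inv_right)
  have "(F *v ?c) $ Inl i = (G *v h) $ Inl i \<and> (F *v ?c) $ Inr i = (G *v h) $ Inr i" for i
  proof -
    have p: "(F *v ?c) $ Inl i + \<i> * (F *v ?c) $ Inr i = (G *v h) $ Inl i + \<i> * (G *v h) $ Inr i"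
      using P by (simp only: frame_pm_vec(1)[symmetric])
    have m: "(F *v ?c) $ Inl i - \<i> * (F *v ?c) $ Inr i = (G *v h) $ Inl i - \<i> * (G *v h) $ Inr i"
      using M by (simp only: frame_pm_vec(2)[symmetric])
    have l: "(F *v ?c) $ Inl i = (G *v h) $ Inl i"
      using arg_cong2[OF p m, of "(+)"] by (simp add: algebra_simps)
    then show ?thesis using p by simp
  qed
  then show ?thesis by (simp add: block_eq)
qed

text \<open>
  The test space for \<open>V(t)\<close> is the image, under the map \<open>X + \<i> Y\<close> of \<open>G(t)\<close>, of the kernel at \<open>t\<^sub>0\<close>. It has the
  dimension of that kernel for every \<open>t\<close>.
\<close>

lemma flow_fun_crossing_frames:
  fixes F G :: "real \<Rightarrow> complex ^ 'm ^ ('m::finite + 'm)"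
  assumes cF: "continuous_on {a..b} F" and cG: "continuous_on {a..b} G"
    and F: "\<And>t. t \<in> {a..b} \<Longrightarrow> lagrangian_frame (F t)" and G: "\<And>t. t \<in> {a..b} \<Longrightarrow> lagrangian_frame (G t)"
    and flow: "flow_fun (\<lambda>t. Vmat (F t) (G t)) a b f" and t0: "t0 \<in> {a..b}"
  shows "\<exists>\<kappa>>0. \<exists>\<eta>>0. \<forall>t\<in>{a..b}. \<bar>t - t0\<bar> < \<eta> \<longrightarrow>
     ((\<forall>h\<in>ker (sform (F t0) (G t0)). h \<noteq> 0 \<longrightarrow> (\<exists>q>0. norm (cross_form (F t) (G t) h - of_real q) \<le> \<kappa> * q)) \<longrightarrow>
        ker (sform (F t) (G t)) = {0} \<and> f t = f t0) \<and>
     ((\<forall>h\<in>ker (sform (F t0) (G t0)). h \<noteq> 0 \<longrightarrow> (\<exists>q>0. norm (cross_form (F t) (G t) h + of_real q) \<le> \<kappa> * q)) \<longrightarrow>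
        ker (sform (F t) (G t)) = {0} \<and> f t = f t0 - int (vec.dim (ker (sform (F t0) (G t0)))))"
proof -
  define V where "V t = Vmat (F t) (G t)" for t
  have uni: "unitary (V t)" if "t \<in> {a..b}" for t using that F G by (simp add: V_def unitary_Vmat)
  have cV: "continuous_on {a..b} V" unfolding V_def by (intro continuous_on_Vmat cF cG F G)
  have flow: "flow_fun V a b f" using flow by (simp add: V_def[abs_def])
  have dim: "vec.dim (ker (V t - mat 1)) = vec.dim (ker (sform (F t) (G t)))" if "t \<in> {a..b}" for t
    using ker_Vmat(2)[OF F[OF that] G[OF that]] by (simp add: V_def sform_def)
  from flow_fun_crossing[OF flow cV uni t0] obtain \<kappa> \<eta> where k: "\<kappa> > 0" "\<eta> > 0"
    and cr: "\<forall>t\<in>{a..b}. \<bar>t - t0\<bar> < \<eta> \<longrightarrow> (\<forall>K. vec.subspace K \<and> vec.dim K = vec.dim (ker (V t0 - mat 1)) \<longrightarrow>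
       ((\<forall>v\<in>K. v \<noteq> 0 \<longrightarrow> (\<exists>q>0. \<exists>k>0. \<exists>z. cdot (V t *v v - v) v = of_real k * \<i> * z \<and> norm (z - of_real q) \<le> \<kappa> * q)) \<longrightarrow>
          ker (V t - mat 1) = {0} \<and> f t = f t0) \<and>
       ((\<forall>v\<in>K. v \<noteq> 0 \<longrightarrow> (\<exists>q>0. \<exists>k>0. \<exists>z. cdot (V t *v v - v) v = of_real k * \<i> * z \<and> norm (z + of_real q) \<le> \<kappa> * q)) \<longrightarrow>
          ker (V t - mat 1) = {0} \<and> f t = f t0 - int (vec.dim (ker (V t0 - mat 1)))))"
    by - (drule meta_mp, assumption, elim exE conjE, rule that; assumption)
  have "((\<forall>h\<in>ker (sform (F t0) (G t0)). h \<noteq> 0 \<longrightarrow> (\<exists>q>0. norm (cross_form (F t) (G t) h - of_real q) \<le> \<kappa> * q)) \<longrightarrow>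
        ker (sform (F t) (G t)) = {0} \<and> f t = f t0) \<and>
     ((\<forall>h\<in>ker (sform (F t0) (G t0)). h \<noteq> 0 \<longrightarrow> (\<exists>q>0. norm (cross_form (F t) (G t) h + of_real q) \<le> \<kappa> * q)) \<longrightarrow>
        ker (sform (F t) (G t)) = {0} \<and> f t = f t0 - int (vec.dim (ker (sform (F t0) (G t0)))))"
    if t: "t \<in> {a..b}" "\<bar>t - t0\<bar> < \<eta>" for t
  proof -
    let ?S0 = "ker (sform (F t0) (G t0))"
    define K where "K = (*v) (frame_plus (G t)) ` ?S0"
    have inj: "x = 0" if "frame_plus (G t) *v x = 0" for x
    proof -
      have "x = matrix_inv (frame_plus (G t)) *v (frame_plus (G t) *v x)"
        using lagrangian_frame_pm(2)[OF G[OF t(1)]] by (simp add: matrix_vector_mul_assoc matrix_inv_left)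
      then show ?thesis by (simp add: that)
    qed
    have lin: "Vector_Spaces.linear (*s) (*s) ((*v) (frame_plus (G t)))" by simp
    have subK: "vec.subspace K" unfolding K_def using vec.linear_subspace_image[OF lin ker_subspace] .
    have dimK: "vec.dim K = vec.dim (ker (V t0 - mat 1))"
      unfolding K_def using vec_dim_image_inj[OF inj, where S = ?S0] dim[OF t0] by simp
    have form: "cdot (V t *v (frame_plus (G t) *v h) - frame_plus (G t) *v h) (frame_plus (G t) *v h) =
        of_real 2 * \<i> * cross_form (F t) (G t) h" for h
      using Vmat_form[OF F[OF t(1)] G[OF t(1)]] by (simp add: V_def cross_form_def sform_def)
    have kz: "ker (V t - mat 1) = {0} \<longleftrightarrow> ker (sform (F t) (G t)) = {0}"
      unfolding ker_eq_0_iff_dim dim[OF t(1)] ..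
    have two: "(0::real) < 2" by simp
    note C = cr[THEN bspec, OF t(1), THEN mp, OF t(2), THEN spec, THEN mp, OF conjI[OF subK dimK], unfolded kz dim[OF t0]]
    show ?thesis
    proof (intro conjI impI)
      assume "\<forall>h\<in>?S0. h \<noteq> 0 \<longrightarrow> (\<exists>q>0. norm (cross_form (F t) (G t) h - of_real q) \<le> \<kappa> * q)"
      then have "\<forall>v\<in>K. v \<noteq> 0 \<longrightarrow> (\<exists>q>0. \<exists>k>0. \<exists>z. cdot (V t *v v - v) v = of_real k * \<i> * z \<and> norm (z - of_real q) \<le> \<kappa> * q)"
        unfolding K_def using form two by fastforce
      with C show "ker (sform (F t) (G t)) = {0}" "f t = f t0" by blast+
    next
      assume "\<forall>h\<in>?S0. h \<noteq> 0 \<longrightarrow> (\<exists>q>0. norm (cross_form (F t) (G t) h + of_real q) \<le> \<kappa> * q)"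
      then have "\<forall>v\<in>K. v \<noteq> 0 \<longrightarrow> (\<exists>q>0. \<exists>k>0. \<exists>z. cdot (V t *v v - v) v = of_real k * \<i> * z \<and> norm (z + of_real q) \<le> \<kappa> * q)"
        unfolding K_def using form two by fastforce
      with C show "ker (sform (F t) (G t)) = {0}" "f t = f t0 - int (vec.dim ?S0)" by blast+
    qed
  qed
  then show ?thesis using k by blast
qed

text \<open>
  Eigenvalues moving counterclockwise raise \<open>f\<close> when they arrive at \<open>1\<close>, so a crossing at the left end point is not
  counted; for clockwise motion it is the right end point.
\<close>

lemma flow_fun_ccw_crossings:
  fixes F G :: "real \<Rightarrow> complex ^ 'm ^ ('m::finite + 'm)"
  assumes ab: "a \<le> b" and cF: "continuous_on {a..b} F" and cG: "continuous_on {a..b} G"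
    and F: "\<And>t. t \<in> {a..b} \<Longrightarrow> lagrangian_frame (F t)" and G: "\<And>t. t \<in> {a..b} \<Longrightarrow> lagrangian_frame (G t)"
    and flow: "flow_fun (\<lambda>t. Vmat (F t) (G t)) a b f"
    and cr: "\<And>t0 \<kappa>. t0 \<in> {a..b} \<Longrightarrow> 0 < \<kappa> \<Longrightarrow> \<exists>\<eta>>0. \<forall>t\<in>{a..b}. \<bar>t - t0\<bar> < \<eta> \<longrightarrow>
       (\<forall>h\<in>ker (sform (F t0) (G t0)). h \<noteq> 0 \<longrightarrow>
         (t0 < t \<longrightarrow> (\<exists>q>0. norm (cross_form (F t) (G t) h - of_real q) \<le> \<kappa> * q)) \<and>
         (t < t0 \<longrightarrow> (\<exists>q>0. norm (cross_form (F t) (G t) h + of_real q) \<le> \<kappa> * q)))"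
  shows "finite {t\<in>{a..b}. vec.dim (ker (sform (F t) (G t))) \<noteq> 0}"
    and "f b - f a = int (\<Sum>t | t \<in> {a<..b} \<and> vec.dim (ker (sform (F t) (G t))) \<noteq> 0. vec.dim (ker (sform (F t) (G t))))"
proof -
  let ?d = "\<lambda>t. vec.dim (ker (sform (F t) (G t)))"
  have J: "\<exists>\<eta>>0. \<forall>t\<in>{a..b}. \<bar>t - t0\<bar> < \<eta> \<longrightarrow>
     (t0 < t \<longrightarrow> ?d t = 0 \<and> f t = f t0) \<and> (t < t0 \<longrightarrow> ?d t = 0 \<and> f t = f t0 - int (?d t0))" if t0: "t0 \<in> {a..b}" for t0
  proof -
    obtain \<kappa> \<eta>1 where k: "\<kappa> > 0" "\<eta>1 > 0" and c1: "\<forall>t\<in>{a..b}. \<bar>t - t0\<bar> < \<eta>1 \<longrightarrow>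
     ((\<forall>h\<in>ker (sform (F t0) (G t0)). h \<noteq> 0 \<longrightarrow> (\<exists>q>0. norm (cross_form (F t) (G t) h - of_real q) \<le> \<kappa> * q)) \<longrightarrow>
        ker (sform (F t) (G t)) = {0} \<and> f t = f t0) \<and>
     ((\<forall>h\<in>ker (sform (F t0) (G t0)). h \<noteq> 0 \<longrightarrow> (\<exists>q>0. norm (cross_form (F t) (G t) h + of_real q) \<le> \<kappa> * q)) \<longrightarrow>
        ker (sform (F t) (G t)) = {0} \<and> f t = f t0 - int (?d t0))"
      using flow_fun_crossing_frames[OF cF cG F G flow t0] by blast
    obtain \<eta>2 where h2: "\<eta>2 > 0" and c2: "\<forall>t\<in>{a..b}. \<bar>t - t0\<bar> < \<eta>2 \<longrightarrow>
       (\<forall>h\<in>ker (sform (F t0) (G t0)). h \<noteq> 0 \<longrightarrow>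
         (t0 < t \<longrightarrow> (\<exists>q>0. norm (cross_form (F t) (G t) h - of_real q) \<le> \<kappa> * q)) \<and>
         (t < t0 \<longrightarrow> (\<exists>q>0. norm (cross_form (F t) (G t) h + of_real q) \<le> \<kappa> * q)))"
      using cr[OF t0 k(1)] by blast
    have "(t0 < t \<longrightarrow> ker (sform (F t) (G t)) = {0} \<and> f t = f t0) \<and>
        (t < t0 \<longrightarrow> ker (sform (F t) (G t)) = {0} \<and> f t = f t0 - int (?d t0))"
      if "t \<in> {a..b}" "\<bar>t - t0\<bar> < min \<eta>1 \<eta>2" for t
      using c1[rule_format, OF that(1)] c2[rule_format, OF that(1)] that(2) by simp
    moreover have "0 < min \<eta>1 \<eta>2" using k h2 by simp
    ultimately show ?thesis unfolding ker_eq_0_iff_dim by blast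
  qed
  show "finite {t\<in>{a..b}. ?d t \<noteq> 0}" "f b - f a = int (\<Sum>t | t \<in> {a<..b} \<and> ?d t \<noteq> 0. ?d t)"
    by (rule sum_jumps_right[where f = f and d = ?d, OF ab J]; assumption)+
qed

lemma flow_fun_cw_crossings:
  fixes F G :: "real \<Rightarrow> complex ^ 'm ^ ('m::finite + 'm)"
  assumes ab: "a \<le> b" and cF: "continuous_on {a..b} F" and cG: "continuous_on {a..b} G"
    and F: "\<And>t. t \<in> {a..b} \<Longrightarrow> lagrangian_frame (F t)" and G: "\<And>t. t \<in> {a..b} \<Longrightarrow> lagrangian_frame (G t)"
    and flow: "flow_fun (\<lambda>t. Vmat (F t) (G t)) a b f"
    and cr: "\<And>t0 \<kappa>. t0 \<in> {a..b} \<Longrightarrow> 0 < \<kappa> \<Longrightarrow> \<exists>\<eta>>0. \<forall>t\<in>{a..b}. \<bar>t - t0\<bar> < \<eta> \<longrightarrow>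
       (\<forall>h\<in>ker (sform (F t0) (G t0)). h \<noteq> 0 \<longrightarrow>
         (t0 < t \<longrightarrow> (\<exists>q>0. norm (cross_form (F t) (G t) h + of_real q) \<le> \<kappa> * q)) \<and>
         (t < t0 \<longrightarrow> (\<exists>q>0. norm (cross_form (F t) (G t) h - of_real q) \<le> \<kappa> * q)))"
  shows "finite {t\<in>{a..b}. vec.dim (ker (sform (F t) (G t))) \<noteq> 0}"
    and "f a - f b = int (\<Sum>t | t \<in> {a..<b} \<and> vec.dim (ker (sform (F t) (G t))) \<noteq> 0. vec.dim (ker (sform (F t) (G t))))"
proof -
  let ?d = "\<lambda>t. vec.dim (ker (sform (F t) (G t)))"
  have J: "\<exists>\<eta>>0. \<forall>t\<in>{a..b}. \<bar>t - t0\<bar> < \<eta> \<longrightarrow>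
     (t0 < t \<longrightarrow> ?d t = 0 \<and> f t = f t0 - int (?d t0)) \<and> (t < t0 \<longrightarrow> ?d t = 0 \<and> f t = f t0)" if t0: "t0 \<in> {a..b}" for t0
  proof -
    obtain \<kappa> \<eta>1 where k: "\<kappa> > 0" "\<eta>1 > 0" and c1: "\<forall>t\<in>{a..b}. \<bar>t - t0\<bar> < \<eta>1 \<longrightarrow>
     ((\<forall>h\<in>ker (sform (F t0) (G t0)). h \<noteq> 0 \<longrightarrow> (\<exists>q>0. norm (cross_form (F t) (G t) h - of_real q) \<le> \<kappa> * q)) \<longrightarrow>
        ker (sform (F t) (G t)) = {0} \<and> f t = f t0) \<and>
     ((\<forall>h\<in>ker (sform (F t0) (G t0)). h \<noteq> 0 \<longrightarrow> (\<exists>q>0. norm (cross_form (F t) (G t) h + of_real q) \<le> \<kappa> * q)) \<longrightarrow>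
        ker (sform (F t) (G t)) = {0} \<and> f t = f t0 - int (?d t0))"
      using flow_fun_crossing_frames[OF cF cG F G flow t0] by blast
    obtain \<eta>2 where h2: "\<eta>2 > 0" and c2: "\<forall>t\<in>{a..b}. \<bar>t - t0\<bar> < \<eta>2 \<longrightarrow>
       (\<forall>h\<in>ker (sform (F t0) (G t0)). h \<noteq> 0 \<longrightarrow>
         (t0 < t \<longrightarrow> (\<exists>q>0. norm (cross_form (F t) (G t) h + of_real q) \<le> \<kappa> * q)) \<and>
         (t < t0 \<longrightarrow> (\<exists>q>0. norm (cross_form (F t) (G t) h - of_real q) \<le> \<kappa> * q)))"
      using cr[OF t0 k(1)] by blast
    have "(t0 < t \<longrightarrow> ker (sform (F t) (G t)) = {0} \<and> f t = f t0 - int (?d t0)) \<and>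
        (t < t0 \<longrightarrow> ker (sform (F t) (G t)) = {0} \<and> f t = f t0)"
      if "t \<in> {a..b}" "\<bar>t - t0\<bar> < min \<eta>1 \<eta>2" for t
      using c1[rule_format, OF that(1)] c2[rule_format, OF that(1)] that(2) by simp
    moreover have "0 < min \<eta>1 \<eta>2" using k h2 by simp
    ultimately show ?thesis unfolding ker_eq_0_iff_dim by blast
  qed
  show "finite {t\<in>{a..b}. ?d t \<noteq> 0}" "f a - f b = int (\<Sum>t | t \<in> {a..<b} \<and> ?d t \<noteq> 0. ?d t)"
    by (rule sum_jumps_left[where f = f and d = ?d, OF ab J]; assumption)+
qed

section \<open>Families of Hamiltonian systems\<close>

lemma has_integral_norm_le_ae:
  fixes f :: "real \<Rightarrow> 'b::euclidean_space"
  assumes f: "(f has_integral i) {a..b}" and g: "(g has_integral j) {a..b}" and ab: "0 \<le> a" "b \<le> 1"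
    and le: "AE x in lebesgue_on {0<..<1}. norm (f x) \<le> g x"
  shows "norm i \<le> j"
proof -
  define Z where "Z = {x\<in>{0<..<1}. \<not> norm (f x) \<le> g x} \<union> {0, 1}"
  have Z: "negligible Z" unfolding Z_def using le by (intro negligible_Un) (auto simp: AE_lebesgue_on_negligible)
  have f': "((\<lambda>x. if x \<in> Z then 0 else f x) has_integral i) {a..b}"
    by (rule has_integral_spike[OF Z _ f]) auto
  have g': "((\<lambda>x. if x \<in> Z then 0 else g x) has_integral j) {a..b}"
    by (rule has_integral_spike[OF Z _ g]) auto
  have "norm (integral {a..b} (\<lambda>x. if x \<in> Z then 0 else f x)) \<le> integral {a..b} (\<lambda>x. if x \<in> Z then 0 else g x)"
    by (rule integral_norm_bound_integral) (use f' g' ab in \<open>auto simp: Z_def\<close>)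
  then show ?thesis using f' g' by (simp add: integral_unique)
qed

lemma integrable_lebesgue_on_unit:
  fixes f :: "real \<Rightarrow> 'b::euclidean_space"
  assumes "integrable (lebesgue_on {0<..<1}) f" "0 \<le> a" "b \<le> 1"
  shows "f integrable_on {a..b}"
proof -
  have "f integrable_on {0<..<1}" using assms(1) by (rule integrable_on_lebesgue_on) simp
  then have "f integrable_on {0..1}" by (simp add: integrable_on_Icc_iff_Ioo)
  then show ?thesis by (rule integrable_on_subinterval) (use assms in auto)
qed

lemma lagrangian_frame_frame3:
  fixes P :: "complex ^ ('n::finite + 'n) ^ ('n + 'n)"
  assumes "adj P ** Jmat ** P = Jmat"
  shows "lagrangian_frame (frame3 P)"
proof -
  have "adj (frame3 P) ** Jmat ** frame3 P = adj P ** (Jmat ** P) + sgnmat ** (Jmat ** sgnmat)"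
    unfolding frame3_emb
    by (simp add: adj_add adj_mult mat_algebra matrix_mul_assoc[symmetric] Jmat_emb emb_orthogonal adj_sgnmat)
  moreover have "sgnmat ** (Jmat ** sgnmat) = - (Jmat :: complex ^ ('n + 'n) ^ ('n + 'n))" using sgnmat_Jmat[of "mat 1"] by simp
  ultimately have "adj (frame3 P) ** Jmat ** frame3 P = 0" using assms by (simp add: matrix_mul_assoc)
  moreover have "v = 0" if "frame3 P *v v = 0" for v
  proof -
    have "(sgnmat ** (adj emb0 ** frame3 P)) *v v = 0" using that by (simp add: matrix_vector_mul_assoc[symmetric])
    moreover have "sgnmat ** (adj emb0 ** frame3 P) = mat 1"
      using sgnmat_sq[of "mat 1"] by (simp add: frame3_emb matrix_add_ldistrib emb_orthogonal)
    ultimately show ?thesis by simp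
  qed
  ultimately show ?thesis by (simp add: lagrangian_frame_def)
qed

lemma sform_frame3: "sform (frame3 P) (emb1 ** R + emb0 ** K) = adj P ** Jmat ** R + sgnmat ** Jmat ** K"
  unfolding frame3_emb sform_def
  by (simp add: adj_add adj_mult mat_algebra matrix_mul_assoc[symmetric] Jmat_emb emb_orthogonal adj_sgnmat)

lemma continuous_on_frame3 [continuous_intros]:
  "continuous_on S P \<Longrightarrow> continuous_on S (\<lambda>x. frame3 (P x))"
  unfolding frame3_emb by (intro continuous_intros)

text \<open>
  The function \<open>c\<close> is the Lipschitz bound from \<open>ae_lipschitz\<close>; unlike the bounds on the derivative it holds for all
  parameters outside one null set.
\<close>

locale hamiltonian_family =
  fixes B \<Phi> :: "real \<Rightarrow> real \<Rightarrow> complex ^ ('n::finite + 'n) ^ ('n + 'n)" and l1 l2 :: real and c :: "real \<Rightarrow> real"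
  assumes l12: "l1 < l2"
    and fund: "\<And>l. l \<in> {l1..l2} \<Longrightarrow> fundamental_solution (\<lambda>x. B x l) (\<lambda>x. \<Phi> x l)"
    and meas: "\<And>l. l \<in> {l1..l2} \<Longrightarrow> (\<lambda>x. B x l) \<in> borel_measurable (lebesgue_on {0<..<1})"
    and c_int: "integrable (lebesgue_on {0<..<1}) c" and c_nonneg: "\<And>x. 0 \<le> c x"
    and lip: "AE x in lebesgue_on {0<..<1}. \<forall>l\<in>{l1..l2}. \<forall>m\<in>{l1..l2}. norm (B x l - B x m) \<le> c x * \<bar>l - m\<bar>"
begin

lemma symplectic: "l \<in> {l1..l2} \<Longrightarrow> x \<in> {0..1} \<Longrightarrow> adj (\<Phi> x l) ** Jmat ** \<Phi> x l = Jmat"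
  using fundamental_solution.symplectic[OF fund] by blast

lemma init: "l \<in> {l1..l2} \<Longrightarrow> \<Phi> 0 l = mat 1"
  using fund by (simp add: fundamental_solution_def)

lemma cont_x: "l \<in> {l1..l2} \<Longrightarrow> continuous_on {0..1} (\<lambda>x. \<Phi> x l)"
  using fund mat_solution_continuous unfolding fundamental_solution_def by blast

lemma wronskian:
  assumes "l \<in> {l1..l2}" "m \<in> {l1..l2}" "0 \<le> a" "a \<le> b" "b \<le> 1"
  shows "((\<lambda>x. adj (\<Phi> x l) ** (B x m - B x l) ** \<Phi> x m) has_integral
     (adj (\<Phi> b l) ** Jmat ** \<Phi> b m - adj (\<Phi> a l) ** Jmat ** \<Phi> a m)) {a..b}"
  using fund[OF assms(1)] fund[OF assms(2)] mat_solution_wronskian assms(3-5)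
  unfolding fundamental_solution_def by blast

lemma c_integral: "0 \<le> a \<Longrightarrow> b \<le> 1 \<Longrightarrow> c integrable_on {a..b}"
  using integrable_lebesgue_on_unit[OF c_int] by blast

lemma lip_pair:
  assumes "l \<in> {l1..l2}" "m \<in> {l1..l2}"
  shows "AE x in lebesgue_on {0<..<1}. norm (B x m - B x l) \<le> c x * \<bar>m - l\<bar>"
  using lip by eventually_elim (use assms in blast)

text \<open>
  For symplectic \<open>\<Phi>\<close> the inverse is \<open>- J \<Phi>\<^sup>* J\<close>. So the difference of two matrices is controlled by
  the difference of forms to which the Lagrange identity applies.
\<close>

lemma diff_formula:
  assumes "l \<in> {l1..l2}" "x \<in> {0..1}"
  shows "\<Phi> x l - R = \<Phi> x l ** (Jmat ** (adj (\<Phi> x l) ** Jmat ** R - Jmat))"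
proof -
  have "\<Phi> x l ** (Jmat ** (adj (\<Phi> x l) ** Jmat)) = - mat 1"
    using symplectic_inverse(1)[OF symplectic[OF assms]]
    by (simp add: mat_mult_minus_right matrix_mul_assoc) (metis minus_minus)
  then have "\<Phi> x l ** (Jmat ** (adj (\<Phi> x l) ** Jmat)) ** R = - R" by (simp add: mat_mult_minus_left)
  moreover have "\<Phi> x l ** (Jmat ** Jmat) = - \<Phi> x l" by (simp add: Jmat_sq mat_mult_minus_right)
  ultimately show ?thesis by (simp add: mat_mult_diff_right matrix_mul_assoc)
qed

text \<open>
  With \<open>u\<close> the maximum of \<open>|\<Phi>(x;m)|\<close> over \<open>x\<close>, the Lagrange identity gives \<open>|\<Phi>(x;m) - \<Phi>(x;l)| \<le> \<kappa> u |m - l|\<close>.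
  For \<open>|m - l| < 1 / (2 \<kappa>)\<close> this bounds \<open>u\<close> itself by twice the bound \<open>C\<close> for \<open>\<Phi>(x;l)\<close>.
\<close>

lemma lipschitz_at:
  assumes l: "l \<in> {l1..l2}"
  shows "\<exists>K>0. \<exists>\<delta>>0. \<forall>m\<in>{l1..l2}. \<bar>m - l\<bar> < \<delta> \<longrightarrow> (\<forall>x\<in>{0..1}. norm (\<Phi> x m - \<Phi> x l) \<le> K * \<bar>m - l\<bar>)"
proof -
  have att: "\<exists>y\<in>{0..1}. \<forall>x\<in>{0..1}. norm (\<Phi> x m) \<le> norm (\<Phi> y m)" if "m \<in> {l1..l2}" for m
    using continuous_attains_sup[OF _ _ continuous_on_norm[OF cont_x[OF that]]] by simp
  obtain C where C: "C > 0" "\<And>x. x \<in> {0..1} \<Longrightarrow> norm (\<Phi> x l) \<le> C"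
  proof -
    obtain y where "\<forall>x\<in>{0..1}. norm (\<Phi> x l) \<le> norm (\<Phi> y l)" using att[OF l] by blast
    then show ?thesis using that[of "norm (\<Phi> y l) + 1"] by (smt (verit) norm_ge_zero)
  qed
  define c0 where "c0 = integral {0..1} c"
  have c0: "0 \<le> c0" unfolding c0_def by (intro integral_nonneg c_integral) (auto simp: c_nonneg)
  define \<kappa> where "\<kappa> = C * norm (Jmat :: complex ^ ('n + 'n) ^ ('n + 'n)) * C * c0 + 1"
  have k: "\<kappa> > 0" using C(1) c0 by (auto simp: \<kappa>_def intro!: add_nonneg_pos mult_nonneg_nonneg)
  have est: "norm (\<Phi> x m - \<Phi> x l) \<le> \<kappa> * u * \<bar>m - l\<bar>"
    if m: "m \<in> {l1..l2}" and x: "x \<in> {0..1}" and u: "\<And>x. x \<in> {0..1} \<Longrightarrow> norm (\<Phi> x m) \<le> u" for m x u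
  proof -
    have u0: "0 \<le> u" using u[OF x] norm_ge_zero order_trans by blast
    let ?I = "adj (\<Phi> x l) ** Jmat ** \<Phi> x m - Jmat"
    have hi: "((\<lambda>x. adj (\<Phi> x l) ** (B x m - B x l) ** \<Phi> x m) has_integral ?I) {0..x}"
      using wronskian[OF l m, of 0 x] x init[OF l] init[OF m] by (simp add: adj_mat)
    have cx: "c integrable_on {0..x}" using c_integral x by simp
    have "((\<lambda>x. C * u * \<bar>m - l\<bar> * c x) has_integral (C * u * \<bar>m - l\<bar> * integral {0..x} c)) {0..x}"
      using cx by (intro has_integral_mult_right integrable_integral)
    then have "norm ?I \<le> C * u * \<bar>m - l\<bar> * integral {0..x} c"
    proof (rule has_integral_norm_le_ae[OF hi])
      have "AE x in lebesgue_on {0<..<1}. x \<in> {0<..<1::real}" by (metis AE_space space_lebesgue_on)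
      with lip_pair[OF l m] show "AE x in lebesgue_on {0<..<1}. norm (adj (\<Phi> x l) ** (B x m - B x l) ** \<Phi> x m) \<le> C * u * \<bar>m - l\<bar> * c x"
      proof eventually_elim
        case (elim x)
        have x: "x \<in> {0..1}" using elim by auto
        have "norm (adj (\<Phi> x l) ** (B x m - B x l) ** \<Phi> x m) \<le> norm (adj (\<Phi> x l) ** (B x m - B x l)) * norm (\<Phi> x m)"
          by (rule norm_mat_mult_le)
        also have "\<dots> \<le> (norm (adj (\<Phi> x l)) * norm (B x m - B x l)) * norm (\<Phi> x m)"
          by (intro mult_right_mono norm_mat_mult_le norm_ge_zero)
        also have "\<dots> \<le> (C * (c x * \<bar>m - l\<bar>)) * u"
          using C u[OF x] C(2)[OF x] elim u0 c_nonneg by (intro mult_mono) auto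
        finally show ?case by (simp add: mult_ac)
      qed
    qed (use x in auto)
    also have "\<dots> \<le> C * u * \<bar>m - l\<bar> * c0"
      unfolding c0_def using C u0 x
      by (intro mult_left_mono integral_subset_le cx c_integral) (auto simp: c_nonneg)
    finally have I: "norm ?I \<le> C * u * \<bar>m - l\<bar> * c0" .
    have "norm (\<Phi> x m - \<Phi> x l) = norm (\<Phi> x l ** (Jmat ** ?I))"
      using diff_formula[OF l x, of "\<Phi> x m"] by (simp add: norm_minus_commute)
    also have "\<dots> \<le> norm (\<Phi> x l) * (norm (Jmat :: complex ^ ('n + 'n) ^ ('n + 'n)) * norm ?I)"
      by (rule order_trans[OF norm_mat_mult_le]) (intro mult_left_mono norm_mat_mult_le norm_ge_zero)
    also have "\<dots> \<le> C * (norm (Jmat :: complex ^ ('n + 'n) ^ ('n + 'n)) * (C * u * \<bar>m - l\<bar> * c0))"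
      using C(1) C(2)[OF x] I by (intro mult_mono) auto
    also have "\<dots> = (\<kappa> - 1) * u * \<bar>m - l\<bar>" by (simp add: \<kappa>_def mult_ac)
    also have "\<dots> \<le> \<kappa> * u * \<bar>m - l\<bar>" using u0 by (intro mult_right_mono) auto
    finally show ?thesis .
  qed
  have "norm (\<Phi> x m - \<Phi> x l) \<le> (2 * C * \<kappa>) * \<bar>m - l\<bar>"
    if m: "m \<in> {l1..l2}" "\<bar>m - l\<bar> < 1 / (2 * \<kappa>)" and x: "x \<in> {0..1}" for m x
  proof -
    obtain y where y: "y \<in> {0..1}" "\<And>x. x \<in> {0..1} \<Longrightarrow> norm (\<Phi> x m) \<le> norm (\<Phi> y m)" using att[OF m(1)] by blast
    define u where "u = norm (\<Phi> y m)"
    have "u \<le> norm (\<Phi> y l) + norm (\<Phi> y m - \<Phi> y l)" unfolding u_def using norm_triangle_sub by blast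
    also have "\<dots> \<le> C + \<kappa> * u * \<bar>m - l\<bar>" unfolding u_def by (intro add_mono C est m y)
    also have "\<kappa> * u * \<bar>m - l\<bar> \<le> u / 2"
    proof -
      have "\<kappa> * \<bar>m - l\<bar> \<le> 1 / 2" using m(2) k by (simp add: field_simps)
      then have "u * (\<kappa> * \<bar>m - l\<bar>) \<le> u * (1 / 2)" by (intro mult_left_mono) (auto simp: u_def)
      then show ?thesis by (simp add: mult_ac)
    qed
    finally have u: "u \<le> 2 * C" by simp
    have "norm (\<Phi> x m - \<Phi> x l) \<le> \<kappa> * u * \<bar>m - l\<bar>" unfolding u_def by (intro est m x y)
    also have "\<dots> \<le> \<kappa> * (2 * C) * \<bar>m - l\<bar>" using u k by (intro mult_right_mono mult_left_mono) auto
    finally show ?thesis by (simp add: mult_ac)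
  qed
  then show ?thesis
    using C k by (intro exI[of _ "2 * C * \<kappa>"] conjI exI[of _ "1 / (2 * \<kappa>)"]) auto
qed

lemma joint_continuous: "continuous_on ({0..1} \<times> {l1..l2}) (\<lambda>p. \<Phi> (fst p) (snd p))"
  unfolding continuous_on_iff
proof (intro ballI allI impI)
  fix p :: "real \<times> real" and e :: real assume p: "p \<in> {0..1} \<times> {l1..l2}" and e: "0 < e"
  obtain x l where pxl: "p = (x, l)" "x \<in> {0..1}" "l \<in> {l1..l2}" using p by auto
  obtain K \<delta>1 where K: "K > 0" "\<delta>1 > 0" "\<And>m y. m \<in> {l1..l2} \<Longrightarrow> \<bar>m - l\<bar> < \<delta>1 \<Longrightarrow> y \<in> {0..1} \<Longrightarrow> norm (\<Phi> y m - \<Phi> y l) \<le> K * \<bar>m - l\<bar>"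
    using lipschitz_at[OF pxl(3)] by blast
  obtain \<delta>2 where d2: "\<delta>2 > 0" "\<And>y. y \<in> {0..1} \<Longrightarrow> \<bar>y - x\<bar> < \<delta>2 \<Longrightarrow> norm (\<Phi> y l - \<Phi> x l) < e / 2"
    using cont_x[OF pxl(3)] pxl(2) e unfolding continuous_on_iff dist_norm real_norm_def by (metis half_gt_zero)
  define d where "d = min \<delta>1 (min \<delta>2 (e / (2 * K)))"
  have d: "d > 0" using K d2 e by (simp add: d_def)
  have "dist (\<Phi> (fst q) (snd q)) (\<Phi> (fst p) (snd p)) < e" if q: "q \<in> {0..1} \<times> {l1..l2}" "dist q p < d" for q
  proof -
    obtain y m where qym: "q = (y, m)" "y \<in> {0..1}" "m \<in> {l1..l2}" using q by auto
    have "dist y x < d" "dist m l < d"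
      using q(2) dist_fst_le[of q p] dist_snd_le[of q p] by (auto simp: qym pxl)
    then have ym: "\<bar>y - x\<bar> < \<delta>2" "\<bar>m - l\<bar> < \<delta>1" "\<bar>m - l\<bar> < e / (2 * K)" by (auto simp: d_def dist_real_def)
    have "norm (\<Phi> y m - \<Phi> x l) \<le> norm (\<Phi> y m - \<Phi> y l) + norm (\<Phi> y l - \<Phi> x l)"
      using norm_triangle_ineq[of "\<Phi> y m - \<Phi> y l" "\<Phi> y l - \<Phi> x l"] by simp
    also have "\<dots> < e / 2 + e / 2"
    proof (rule add_le_less_mono)
      have "norm (\<Phi> y m - \<Phi> y l) \<le> K * \<bar>m - l\<bar>" using K qym ym by blast
      also have "\<dots> \<le> e / 2" using ym(3) K(1) by (simp add: field_simps)
      finally show "norm (\<Phi> y m - \<Phi> y l) \<le> e / 2" .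
    qed (use d2 qym ym in blast)
    finally show ?thesis by (simp add: qym pxl dist_norm)
  qed
  then show "\<exists>d>0. \<forall>q\<in>{0..1} \<times> {l1..l2}. dist q p < d \<longrightarrow> dist (\<Phi> (fst q) (snd q)) (\<Phi> (fst p) (snd p)) < e"
    using d by blast
qed

lemma bounded: "\<exists>U>0. \<forall>x\<in>{0..1}. \<forall>l\<in>{l1..l2}. norm (\<Phi> x l) \<le> U"
proof -
  have "compact ((\<lambda>p. \<Phi> (fst p) (snd p)) ` ({0..1} \<times> {l1..l2}))"
    by (intro compact_continuous_image joint_continuous compact_Times) auto
  then show ?thesis by (force dest!: compact_imp_bounded simp: bounded_pos)
qed

end

lemma has_integral_norm_le_ae_on:
  fixes f :: "real \<Rightarrow> 'b::euclidean_space"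
  assumes f: "(f has_integral i) {a..b}" and g: "(g has_integral j) {a..b}" and ab: "0 \<le> a" "b \<le> 1"
    and le: "AE x in lebesgue_on {0<..<1}. x \<in> {a..b} \<longrightarrow> norm (f x) \<le> g x"
  shows "norm i \<le> j"
proof (rule has_integral_norm_le_ae[OF _ _ ab])
  show "((\<lambda>x. if x \<in> {a..b} then f x else 0) has_integral i) {a..b}"
    by (rule has_integral_eq[OF _ f]) simp
  show "((\<lambda>x. if x \<in> {a..b} then g x else 0) has_integral j) {a..b}"
    by (rule has_integral_eq[OF _ g]) simp
  show "AE x in lebesgue_on {0<..<1}. norm (if x \<in> {a..b} then f x else 0) \<le> (if x \<in> {a..b} then g x else 0)"
    using le by eventually_elim simp
qed

text \<open>
  The right-hand side is smallest at \<open>\<tau> = sqrt (q / \<delta>)\<close>; for \<open>q = 0\<close> the infimum is not attained. The lemma takes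
  the place of the Cauchy-Schwarz inequality for integrals: a pointwise bound with the parameter \<open>\<tau>\<close> is integrated
  and only then optimized.
\<close>

lemma geometric_mean_le:
  fixes q \<delta> M a :: real
  assumes "0 \<le> q" "0 < \<delta>" "0 \<le> M" and le: "\<And>\<tau>. 0 < \<tau> \<Longrightarrow> a \<le> M * ((\<tau> * \<delta> + q / \<tau>) / 2)"
  shows "a \<le> M * sqrt (q * \<delta>)"
proof (cases "q = 0")
  case True
  have "a \<le> 0"
  proof (rule ccontr)
    assume "\<not> a \<le> 0"
    then have a: "0 < a" by simp
    define \<tau> where "\<tau> = a / (M * \<delta> + 1)"
    have p: "0 < M * \<delta> + 1" using assms by (intro add_nonneg_pos mult_nonneg_nonneg) auto
    have t: "0 < \<tau>" using a p by (simp add: \<tau>_def)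
    have "a \<le> M * \<delta> * \<tau> / 2" using le[OF t] True by (simp add: mult_ac)
    also have "\<dots> < a"
    proof -
      have "M * \<delta> * \<tau> \<le> (M * \<delta> + 1) * \<tau>" using t by (intro mult_right_mono) auto
      also have "\<dots> = a" using p by (simp add: \<tau>_def)
      finally show ?thesis using a by linarith
    qed
    finally show False by simp
  qed
  then show ?thesis using True by simp
next
  case False
  then have q: "0 < q" using assms by simp
  define \<tau> where "\<tau> = sqrt q / sqrt \<delta>"
  have "sqrt q * sqrt q = q" "sqrt \<delta> * sqrt \<delta> = \<delta>" using q assms by simp_all
  then have "\<tau> * \<delta> = sqrt q * sqrt \<delta>" "q / \<tau> = sqrt q * sqrt \<delta>"
    using q assms by (simp_all add: \<tau>_def field_simps)
  moreover have "0 < \<tau>" using q assms by (simp add: \<tau>_def)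
  ultimately show ?thesis using le[of \<tau>] by (simp add: real_sqrt_mult mult.commute)
qed

lemma cdot_scaleR_left: "cdot (r *\<^sub>R u) w = of_real r * cdot u w"
  by (simp add: cdot_def sum_distrib_left) (simp add: scaleR_conv_of_real mult.assoc)

lemma norm_complex_combination_le:
  fixes w :: "complex ^ 'm" and d :: "complex ^ ('m::finite + 'm)"
  assumes "\<And>i. w $ i = d $ Inl i + \<i> * d $ Inr i"
  shows "norm w \<le> 2 * norm d"
proof -
  have s: "(norm d)\<^sup>2 = (\<Sum>i\<in>UNIV. (norm (d $ Inl i))\<^sup>2) + (\<Sum>i\<in>UNIV. (norm (d $ Inr i))\<^sup>2)"
    by (simp add: norm_vec_def L2_set_def sum_nonneg sum_UNIV_Plus)
  have l: "L2_set (\<lambda>i. norm (d $ Inl i)) UNIV \<le> norm d" "L2_set (\<lambda>i. norm (d $ Inr i)) UNIV \<le> norm d"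
    by (rule power2_le_imp_le; simp add: s L2_set_def sum_nonneg)+
  have "norm w \<le> L2_set (\<lambda>i. norm (d $ Inl i) + norm (d $ Inr i)) UNIV"
    unfolding norm_vec_def[of w] assms
    by (intro L2_set_mono) (auto intro: order_trans[OF norm_triangle_ineq] simp: norm_mult)
  also have "\<dots> \<le> L2_set (\<lambda>i. norm (d $ Inl i)) UNIV + L2_set (\<lambda>i. norm (d $ Inr i)) UNIV"
    by (rule L2_set_triangle_ineq)
  finally show ?thesis using l by linarith
qed

text \<open>
  Expanding \<open>(T (y - s T y), y - s T y) \<ge> 0\<close> at \<open>s = 1 / b\<close> gives \<open>|T y|\<^sup>2 \<le> b (T y, y)\<close>. The last claim is its
  version with a parameter, which can be integrated.
\<close>

lemma nonneg_def_bound: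
  fixes T :: "complex ^ 'm ^ 'm"
  assumes T: "nonneg_def T" and b: "norm T \<le> b" "0 < b"
  shows "0 \<le> Re (cdot (T *v y) y)" "cdot (T *v y) y = of_real (Re (cdot (T *v y) y))"
    and "0 < \<tau> \<Longrightarrow> norm (T *v y) \<le> (\<tau> * b + Re (cdot (T *v y) y) / \<tau>) / 2"
proof -
  have sa: "adj T = T" and pos: "\<And>v. 0 \<le> Re (cdot (T *v v) v)" using T by (auto simp: nonneg_def_def self_adjoint_def)
  show "0 \<le> Re (cdot (T *v y) y)" by (rule pos)
  have "cdot (T *v y) y = cnj (cdot (T *v y) y)"
    using cdot_mat_left[of T y y] cdot_commute[of y "T *v y"] sa by simp
  then have "Im (cdot (T *v y) y) = 0" by (metis Im_complex_of_real Reals_cases cnj_in_Ints_iff complex_is_Real_iff Reals_cnj_iff)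
  then show real: "cdot (T *v y) y = of_real (Re (cdot (T *v y) y))" by (simp add: complex_eq_iff)
  define g n where "g = Re (cdot (T *v y) y)" and "n = norm (T *v y)"
  have "0 \<le> g - 2 * s * n\<^sup>2 + s\<^sup>2 * (b * n\<^sup>2)" if s: "0 \<le> s" for s
  proof -
    let ?w = "T *v y"
    have 1: "Re (cdot (T *v ?w) y) = n\<^sup>2" using cdot_mat_left[of T ?w y] sa by (simp add: Re_cdot_self n_def)
    have 2: "Re (cdot ?w ?w) = n\<^sup>2" by (simp add: Re_cdot_self n_def)
    have "Re (cdot (T *v ?w) ?w) \<le> norm (T *v ?w) * norm ?w"
      using complex_Re_le_cmod norm_cdot_le order_trans by blast
    also have "\<dots> \<le> (b * n) * n"
      unfolding n_def using norm_mat_vec_le[of T ?w] b by (intro mult_right_mono order_trans[OF norm_mat_vec_le]) auto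
    finally have 3: "Re (cdot (T *v ?w) ?w) \<le> b * n\<^sup>2" by (simp add: power2_eq_square mult_ac)
    have "0 \<le> Re (cdot (T *v (y - of_real s *s ?w)) (y - of_real s *s ?w))" by (rule pos)
    also have "\<dots> = g - s * Re (cdot (T *v ?w) y) - s * Re (cdot ?w ?w) + s * s * Re (cdot (T *v ?w) ?w)"
      by (simp add: matrix_vector_mult_diff_distrib mat_vec_scalar cdot_simps g_def algebra_simps)
    also have "\<dots> \<le> g - 2 * s * n\<^sup>2 + s\<^sup>2 * (b * n\<^sup>2)"
      using 1 2 mult_left_mono[OF 3, of "s * s"] by (simp add: power2_eq_square)
    finally show ?thesis .
  qed
  from this[of "1 / b"] b(2) have "n\<^sup>2 \<le> b * g" by (simp add: field_simps power2_eq_square)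
  assume t: "0 < \<tau>"
  have "n\<^sup>2 \<le> ((\<tau> * b + g / \<tau>) / 2)\<^sup>2"
  proof -
    have "b * g = (\<tau> * b) * (g / \<tau>)" using t by simp
    also have "\<dots> \<le> ((\<tau> * b + g / \<tau>) / 2)\<^sup>2"
      using zero_le_power2[of "\<tau> * b - g / \<tau>"] by (simp add: power2_eq_square algebra_simps)
    finally show ?thesis using \<open>n\<^sup>2 \<le> b * g\<close> by linarith
  qed
  then show "norm (T *v y) \<le> (\<tau> * b + Re (cdot (T *v y) y) / \<tau>) / 2"
    unfolding n_def[symmetric] g_def[symmetric]
    by (rule power2_le_imp_le) (use t b pos[of y] in \<open>simp add: g_def\<close>)
qed

lemma pos_def_lower_bound:
  fixes T :: "complex ^ 'm ^ 'm"
  assumes "pos_def T"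
  shows "\<exists>\<gamma>>0. \<forall>v. \<gamma> * (norm v)\<^sup>2 \<le> Re (cdot (T *v v) v)"
    and "cdot (T *v v) v = of_real (Re (cdot (T *v v) v))"
proof -
  have sa: "adj T = T" and pos: "\<And>v. v \<noteq> 0 \<Longrightarrow> 0 < Re (cdot (T *v v) v)"
    using assms by (auto simp: pos_def_def self_adjoint_def)
  have "nonneg_def T" unfolding nonneg_def_def self_adjoint_def using sa pos by (metis cdot_0_right less_eq_real_def zero_complex.sel(1))
  from nonneg_def_bound(2)[OF this, of "norm T + 1"]
  show "cdot (T *v v) v = of_real (Re (cdot (T *v v) v))" by (smt (verit) norm_ge_zero)
  let ?S = "sphere (0 :: complex ^ 'm) 1"
  have cont: "continuous_on ?S (\<lambda>v. Re (cdot (T *v v) v))"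
    unfolding cdot_def by (intro continuous_intros continuous_on_cnj)
  have "axis undefined 1 \<in> ?S" by (simp add: norm_axis_1)
  then have "?S \<noteq> {}" by blast
  then obtain x where x: "x \<in> ?S" "\<And>y. y \<in> ?S \<Longrightarrow> Re (cdot (T *v x) x) \<le> Re (cdot (T *v y) y)"
    using continuous_attains_inf[OF compact_sphere _ cont] by blast
  have "Re (cdot (T *v x) x) * (norm v)\<^sup>2 \<le> Re (cdot (T *v v) v)" for v
  proof (cases "v = 0")
    case False
    define u where "u = of_real (1 / norm v) *s v"
    have nu: "norm u = 1"
    proof -
      have "u = (1 / norm v) *\<^sub>R v" by (simp add: u_def vec_eq_iff) (simp add: scaleR_conv_of_real)
      then show ?thesis using False by simp
    qed
    have "v = of_real (norm v) *s u" using False by (simp add: u_def vector_smult_assoc)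
    then have "cdot (T *v v) v = of_real (norm v) * of_real (norm v) * cdot (T *v u) u"
      by (metis (no_types, lifting) cdot_scale_left cdot_scale_right complex_cnj_complex_of_real mat_vec_scalar mult.assoc)
    then have "Re (cdot (T *v v) v) = (norm v)\<^sup>2 * Re (cdot (T *v u) u)" by (simp add: power2_eq_square)
    moreover have "Re (cdot (T *v x) x) \<le> Re (cdot (T *v u) u)" using x(2)[of u] nu by simp
    ultimately show ?thesis by (metis mult.commute mult_left_mono zero_le_power2)
  qed simp
  moreover have "0 < Re (cdot (T *v x) x)" using x(1) by (intro pos) auto
  ultimately show "\<exists>\<gamma>>0. \<forall>v. \<gamma> * (norm v)\<^sup>2 \<le> Re (cdot (T *v v) v)" by blast
qed

text \<open>
  A Lagrangian frame moving with the doubled system at the parameter \<open>l2\<close>: it follows the fundamental solution on the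
  coordinates embedded by \<open>emb1\<close> and is constant on those embedded by \<open>emb0\<close>.
\<close>

locale boundary_frame = hamiltonian_family +
  fixes A1 K0 :: "complex ^ ('n::finite + 'n) ^ ('n + 'n)"
    and G :: "real \<Rightarrow> complex ^ ('n + 'n) ^ (('n + 'n) + ('n + 'n))"
  assumes G_eq: "\<And>x. x \<in> {0..1} \<Longrightarrow> G x = emb1 ** (\<Phi> x l2 ** A1) + emb0 ** K0"
    and G_lagr: "\<And>x. x \<in> {0..1} \<Longrightarrow> lagrangian_frame (G x)"
begin

definition F where "F x l = frame3 (\<Phi> x l)"

lemma l1_in: "l1 \<in> {l1..l2}" and l2_in: "l2 \<in> {l1..l2}" using l12 by auto

lemma F_lagr: "l \<in> {l1..l2} \<Longrightarrow> x \<in> {0..1} \<Longrightarrow> lagrangian_frame (F x l)"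
  unfolding F_def by (intro lagrangian_frame_frame3 symplectic)

lemma G_cont: "continuous_on {0..1} G"
proof -
  have "continuous_on {0..1} (\<lambda>x. emb1 ** (\<Phi> x l2 ** A1) + emb0 ** K0)"
    by (intro continuous_intros cont_x l2_in)
  then show ?thesis by (rule continuous_on_eq) (simp add: G_eq)
qed

lemma F_joint_continuous: "continuous_on ({0..1} \<times> {l1..l2}) (\<lambda>p. F (fst p) (snd p))"
  unfolding F_def by (intro continuous_intros joint_continuous)

lemma F_cont_x: "l \<in> {l1..l2} \<Longrightarrow> continuous_on {0..1} (\<lambda>x. F x l)"
  unfolding F_def by (intro continuous_intros cont_x)

lemma cont_l: "x \<in> {0..1} \<Longrightarrow> continuous_on {l1..l2} (\<lambda>l. \<Phi> x l)"
  by (rule continuous_on_compose2[OF joint_continuous, of _ "\<lambda>l. (x, l)", simplified]) (auto intro!: continuous_intros)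

lemma F_cont_l: "x \<in> {0..1} \<Longrightarrow> continuous_on {l1..l2} (\<lambda>l. F x l)"
  unfolding F_def by (intro continuous_intros cont_l)

lemma sform_eq: "x \<in> {0..1} \<Longrightarrow> sform (F x l) (G x) = adj (\<Phi> x l) ** Jmat ** (\<Phi> x l2 ** A1) + sgnmat ** Jmat ** K0"
  by (simp add: F_def G_eq sform_frame3)

lemma sform_l2_const: "x \<in> {0..1} \<Longrightarrow> sform (F x l2) (G x) = Jmat ** A1 + sgnmat ** Jmat ** K0"
  using sform_eq[of x l2] symplectic[OF l2_in, of x] by (simp add: matrix_mul_assoc)

lemma intersection_components:
  assumes "F x l *v c0 = G x *v h" "x \<in> {0..1}"
  shows "\<Phi> x l *v c0 = \<Phi> x l2 *v (A1 *v h)" "sgnmat *v c0 = K0 *v h"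
proof -
  have "adj emb1 ** F x l = \<Phi> x l" "adj emb0 ** F x l = sgnmat"
    by (simp_all add: F_def frame3_emb matrix_add_ldistrib emb_orthogonal)
  moreover have "adj emb1 ** G x = \<Phi> x l2 ** A1" "adj emb0 ** G x = K0"
    using assms(2) by (simp_all add: G_eq matrix_add_ldistrib emb_orthogonal)
  ultimately show "\<Phi> x l *v c0 = \<Phi> x l2 *v (A1 *v h)" "sgnmat *v c0 = K0 *v h"
    using assms(1) by (metis matrix_vector_mul_assoc)+
qed

subsection \<open>Crossings in the parameter\<close>

text \<open>
  The Lagrange identity divided by \<open>l - l0\<close>. The integrand converges almost everywhere by differentiability at \<open>l0\<close>, and
  the Lipschitz bound dominates it by a multiple of \<open>c\<close>.
\<close>

lemma gram_limit:
  fixes Bl :: "real \<Rightarrow> complex ^ ('n + 'n) ^ ('n + 'n)"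
  assumes l0: "l0 \<in> {l1..l2}"
    and der: "AE x in lebesgue_on {0<..<1}. (B x has_vector_derivative Bl x) (at l0 within {l1..l2})"
    and int: "integrable (lebesgue_on {0<..<1}) (\<lambda>x. adj (\<Phi> x l0) ** Bl x ** \<Phi> x l0)"
  shows "((\<lambda>l. (1 / (l - l0)) *\<^sub>R (adj (\<Phi> 1 l) ** Jmat ** \<Phi> 1 l0 - Jmat)) \<longlongrightarrow>
     - integral\<^sup>L (lebesgue_on {0<..<1}) (\<lambda>x. adj (\<Phi> x l0) ** Bl x ** \<Phi> x l0)) (at l0 within {l1..l2})"
  unfolding tendsto_at_iff_sequentially
proof (intro allI impI)
  fix X :: "nat \<Rightarrow> real" assume X: "\<forall>i. X i \<in> {l1..l2} - {l0}" and Xl: "X \<longlonglongrightarrow> l0"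
  obtain U where U: "U > 0" "\<And>x l. x \<in> {0..1} \<Longrightarrow> l \<in> {l1..l2} \<Longrightarrow> norm (\<Phi> x l) \<le> U" using bounded by blast
  define Z where "Z = {x\<in>{0<..<1}. \<not> ((B x has_vector_derivative Bl x) (at l0 within {l1..l2}) \<and>
     (\<forall>l\<in>{l1..l2}. \<forall>m\<in>{l1..l2}. norm (B x l - B x m) \<le> c x * \<bar>l - m\<bar>))} \<union> {0, 1}"
  have "AE x in lebesgue_on {0<..<1}. (B x has_vector_derivative Bl x) (at l0 within {l1..l2}) \<and>
     (\<forall>l\<in>{l1..l2}. \<forall>m\<in>{l1..l2}. norm (B x l - B x m) \<le> c x * \<bar>l - m\<bar>)"
    using der lip by eventually_elim blast
  then have Z: "negligible Z"
    unfolding Z_def by (intro negligible_Un AE_lebesgue_on_negligible[THEN iffD1]) auto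
  define k where "k x = adj (\<Phi> x l0) ** Bl x ** \<Phi> x l0" for x
  define f where "f n x = (1 / (X n - l0)) *\<^sub>R (adj (\<Phi> x (X n)) ** (B x l0 - B x (X n)) ** \<Phi> x l0)" for n x
  let ?I = "\<lambda>n. (1 / (X n - l0)) *\<^sub>R (adj (\<Phi> 1 (X n)) ** Jmat ** \<Phi> 1 l0 - Jmat)"
  have fI: "(f n has_integral ?I n) {0..1}" for n
  proof -
    have Xn: "X n \<in> {l1..l2}" using X by blast
    have "((\<lambda>x. adj (\<Phi> x (X n)) ** (B x l0 - B x (X n)) ** \<Phi> x l0) has_integral
        (adj (\<Phi> 1 (X n)) ** Jmat ** \<Phi> 1 l0 - Jmat)) {0..1}"
      using wronskian[OF Xn l0, of 0 1] init[OF Xn] init[OF l0] by (simp add: adj_mat)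
    then show ?thesis unfolding f_def by (rule has_integral_cmul)
  qed
  define f' where "f' n x = (if x \<in> Z then 0 else f n x)" for n x
  have f'I: "(f' n has_integral ?I n) {0..1}" for n
    by (rule has_integral_spike[OF Z _ fI]) (simp add: f'_def)
  have good: "(B x has_vector_derivative Bl x) (at l0 within {l1..l2})"
    "\<And>l m. l \<in> {l1..l2} \<Longrightarrow> m \<in> {l1..l2} \<Longrightarrow> norm (B x l - B x m) \<le> c x * \<bar>l - m\<bar>" "x \<in> {0..1}"
    if "x \<in> {0..1}" "x \<notin> Z" for x using that by (auto simp: Z_def)
  have lim: "(\<lambda>n. f' n x) \<longlonglongrightarrow> (if x \<in> Z then 0 else - k x)" if x: "x \<in> {0..1}" for x
  proof (cases "x \<in> Z")
    case False
    have q: "(\<lambda>n. (1 / (X n - l0)) *\<^sub>R (B x (X n) - B x l0)) \<longlonglongrightarrow> Bl x"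
      using has_vector_derivative_quotient[OF good(1)[OF x False]] X Xl
      unfolding tendsto_at_iff_sequentially o_def by blast
    have p: "(\<lambda>n. \<Phi> x (X n)) \<longlonglongrightarrow> \<Phi> x l0"
      using cont_l[OF x] X Xl l0 unfolding continuous_on_sequentially by (auto simp: o_def)
    have "(\<lambda>n. adj (\<Phi> x (X n)) ** (- ((1 / (X n - l0)) *\<^sub>R (B x (X n) - B x l0))) ** \<Phi> x l0) \<longlonglongrightarrow>
        adj (\<Phi> x l0) ** (- Bl x) ** \<Phi> x l0"
      by (intro tendsto_mat_mult tendsto_adj tendsto_minus tendsto_const p q)
    moreover have "adj (\<Phi> x (X n)) ** (- ((1 / (X n - l0)) *\<^sub>R (B x (X n) - B x l0))) ** \<Phi> x l0 = f' n x" for n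
    proof -
      have "- ((1 / (X n - l0)) *\<^sub>R (B x (X n) - B x l0)) = (1 / (X n - l0)) *\<^sub>R (B x l0 - B x (X n))"
        by (metis minus_diff_eq scaleR_minus_right)
      then show ?thesis using False by (simp add: f'_def f_def mat_scaleR_left mat_scaleR_right)
    qed
    ultimately show ?thesis using False by (simp add: k_def mat_mult_minus_left mat_mult_minus_right)
  qed (simp add: f'_def)
  have bd: "norm (f' n x) \<le> U * U * c x" if x: "x \<in> {0..1}" for n x
  proof (cases "x \<in> Z")
    case False
    have Xn: "X n \<in> {l1..l2}" "X n \<noteq> l0" using X by auto
    have "norm (adj (\<Phi> x (X n)) ** (B x l0 - B x (X n)) ** \<Phi> x l0) \<le> (norm (adj (\<Phi> x (X n))) * norm (B x l0 - B x (X n))) * norm (\<Phi> x l0)"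
      by (rule order_trans[OF norm_mat_mult_le]) (intro mult_right_mono norm_mat_mult_le norm_ge_zero)
    also have "\<dots> \<le> (U * (c x * \<bar>l0 - X n\<bar>)) * U"
      using U(1) U(2)[OF x Xn(1)] U(2)[OF x l0] good(2)[OF x False l0 Xn(1)] c_nonneg
      by (intro mult_mono) auto
    finally have "norm (f' n x) \<le> (1 / \<bar>X n - l0\<bar>) * ((U * (c x * \<bar>l0 - X n\<bar>)) * U)"
      using False Xn(2) by (simp add: f'_def f_def divide_right_mono)
    also have "\<dots> = U * U * c x" using Xn(2) by (simp add: abs_minus_commute field_simps)
    finally show ?thesis .
  qed (use U c_nonneg in \<open>simp add: f'_def\<close>)
  have cI: "(\<lambda>x. U * U * c x) integrable_on {0..1}"
    using c_integral[of 0 1] by (intro integrable_on_mult_right) auto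
  have dc: "(\<lambda>n. integral {0..1} (f' n)) \<longlonglongrightarrow> integral {0..1} (\<lambda>x. if x \<in> Z then 0 else - k x)"
    by (rule dominated_convergence(2)[OF has_integral_integrable[OF f'I] cI bd lim])
  have "(k has_integral integral\<^sup>L (lebesgue_on {0<..<1}) k) {0<..<1}"
    using int unfolding k_def by (intro has_integral_integral_lebesgue_on) auto
  then have "(k has_integral integral\<^sup>L (lebesgue_on {0<..<1}) k) {0..1}"
    by (simp add: has_integral_Icc_iff_Ioo)
  then have "((\<lambda>x. - k x) has_integral - integral\<^sup>L (lebesgue_on {0<..<1}) k) {0..1}" by (rule has_integral_neg)
  then have "((\<lambda>x. if x \<in> Z then 0 else - k x) has_integral - integral\<^sup>L (lebesgue_on {0<..<1}) k) {0..1}"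
    by (rule has_integral_spike[OF Z, rotated]) auto
  then have "integral {0..1} (\<lambda>x. if x \<in> Z then 0 else - k x) = - integral\<^sup>L (lebesgue_on {0<..<1}) k"
    by (rule integral_unique)
  with dc have "?I \<longlonglongrightarrow> - integral\<^sup>L (lebesgue_on {0<..<1}) k" by (simp add: integral_unique[OF f'I])
  then show "((\<lambda>l. (1 / (l - l0)) *\<^sub>R (adj (\<Phi> 1 l) ** Jmat ** \<Phi> 1 l0 - Jmat)) \<circ> X) \<longlonglongrightarrow>
     - integral\<^sup>L (lebesgue_on {0<..<1}) (\<lambda>x. adj (\<Phi> x l0) ** Bl x ** \<Phi> x l0)"
    by (simp add: o_def k_def[abs_def])
qed

text \<open>
  If \<open>G h = F(l\<^sub>0) c\<^sub>0\<close> is an intersection vector, then \<open>F(l)\<^sup>* J G h = F(l)\<^sup>* J F(l\<^sub>0) c\<^sub>0 = E(l) c\<^sub>0\<close>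
  with \<open>E(l) = \<Phi>(1;l)\<^sup>* J \<Phi>(1;l\<^sub>0) - J\<close>. By \<open>gram_limit\<close> this is close to \<open>- (l - l\<^sub>0) \<Gamma> c\<^sub>0\<close>, where
  \<open>\<Gamma>\<close> is positive definite. The factor \<open>Q(l)\<close> accounts for the second argument of \<open>cross_form\<close> and tends to \<open>1\<close>.
\<close>

lemma lambda_crossing:
  fixes Bl :: "real \<Rightarrow> complex ^ ('n + 'n) ^ ('n + 'n)"
  assumes l0: "l0 \<in> {l1..l2}"
    and der: "AE x in lebesgue_on {0<..<1}. (B x has_vector_derivative Bl x) (at l0 within {l1..l2})"
    and pd: "pos_def (integral\<^sup>L (lebesgue_on {0<..<1}) (\<lambda>x. adj (\<Phi> x l0) ** Bl x ** \<Phi> x l0))"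
    and k: "0 < \<kappa>"
  shows "\<exists>\<eta>>0. \<forall>l\<in>{l1..l2}. \<bar>l - l0\<bar> < \<eta> \<longrightarrow>
       (\<forall>h\<in>ker (sform (F 1 l0) (G 1)). h \<noteq> 0 \<longrightarrow>
         (l0 < l \<longrightarrow> (\<exists>q>0. norm (cross_form (F 1 l) (G 1) h + of_real q) \<le> \<kappa> * q)) \<and>
         (l < l0 \<longrightarrow> (\<exists>q>0. norm (cross_form (F 1 l) (G 1) h - of_real q) \<le> \<kappa> * q)))"
proof -
  define \<Gamma> where "\<Gamma> = integral\<^sup>L (lebesgue_on {0<..<1}) (\<lambda>x. adj (\<Phi> x l0) ** Bl x ** \<Phi> x l0)"
  have one: "(1::real) \<in> {0..1}" by simp
  \<comment> \<open>The integral of a non-integrable function is \<open>0\<close>, so the positive definiteness of \<open>\<Gamma>\<close> provides integrability.\<close>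
  have "\<Gamma> \<noteq> 0"
  proof
    assume "\<Gamma> = 0"
    have "axis undefined 1 \<noteq> (0 :: complex ^ ('n + 'n))" by (simp add: axis_eq_0_iff)
    then show False using pd unfolding \<Gamma>_def[symmetric] \<open>\<Gamma> = 0\<close> pos_def_def by fastforce
  qed
  then have int: "integrable (lebesgue_on {0<..<1}) (\<lambda>x. adj (\<Phi> x l0) ** Bl x ** \<Phi> x l0)"
    unfolding \<Gamma>_def using not_integrable_integral_eq by blast
  define E where "E l = adj (\<Phi> 1 l) ** Jmat ** \<Phi> 1 l0 - Jmat" for l
  define Q where "Q l = matrix_inv (frame_plus (F 1 l)) ** frame_plus (F 1 l0)" for l
  define T where "T l = adj (Q l) ** ((1 / (l - l0)) *\<^sub>R E l)" for l
  have Elim: "((\<lambda>l. (1 / (l - l0)) *\<^sub>R E l) \<longlongrightarrow> - \<Gamma>) (at l0 within {l1..l2})"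
    unfolding E_def \<Gamma>_def by (rule gram_limit[OF l0 der int])
  have "continuous_on {l1..l2} Q"
    unfolding Q_def by (intro continuous_intros F_cont_l one lagrangian_frame_pm(2) F_lagr)
  then have "(Q \<longlongrightarrow> Q l0) (at l0 within {l1..l2})" using l0 by (simp add: continuous_on_def)
  moreover have "Q l0 = mat 1" unfolding Q_def by (intro matrix_inv_left lagrangian_frame_pm(2) F_lagr l0 one)
  ultimately have "(T \<longlongrightarrow> adj (mat 1) ** (- \<Gamma>)) (at l0 within {l1..l2})"
    unfolding T_def by (intro tendsto_mat_mult tendsto_adj Elim) simp
  then have Tlim: "(T \<longlongrightarrow> - \<Gamma>) (at l0 within {l1..l2})" by (simp add: adj_mat)
  obtain \<gamma> where g: "\<gamma> > 0" "\<And>v. \<gamma> * (norm v)\<^sup>2 \<le> Re (cdot (\<Gamma> *v v) v)"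
    using pos_def_lower_bound(1)[OF pd] unfolding \<Gamma>_def by blast
  have "0 < \<kappa> * \<gamma>" using k g by simp
  from tendstoD[OF Tlim this] obtain \<eta> where h: "\<eta> > 0"
    "\<And>l. l \<in> {l1..l2} \<Longrightarrow> l \<noteq> l0 \<Longrightarrow> dist l l0 < \<eta> \<Longrightarrow> dist (T l) (- \<Gamma>) < \<kappa> * \<gamma>"
    unfolding eventually_at by blast
  have main: "\<exists>q>0. norm (of_real (sgn (l - l0)) * cross_form (F 1 l) (G 1) x + of_real q) \<le> \<kappa> * q"
    if l: "l \<in> {l1..l2}" "\<bar>l - l0\<bar> < \<eta>" "l \<noteq> l0" and x: "x \<in> ker (sform (F 1 l0) (G 1))" "x \<noteq> 0" for l x
  proof -
    note FL = F_lagr[OF l(1) one] and F0 = F_lagr[OF l0 one] and GL = G_lagr[OF one]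
    define c0 where "c0 = matrix_inv (frame_plus (F 1 l0)) *v (frame_plus (G 1) *v x)"
    have Fc: "F 1 l0 *v c0 = G 1 *v x" unfolding c0_def by (rule ker_sform_intersection[OF F0 GL x(1)])
    have "G 1 *v x \<noteq> 0" using GL x(2) by (auto simp: lagrangian_frame_def)
    then have c0: "c0 \<noteq> 0" using Fc by auto
    have Pc: "frame_plus (G 1) *v x = frame_plus (F 1 l0) *v c0"
      unfolding c0_def using lagrangian_frame_pm(2)[OF F0]
      by (simp add: matrix_vector_mul_assoc matrix_mul_assoc matrix_inv_right)
    have "sform (F 1 l) (G 1) *v x = sform (F 1 l) (F 1 l0) *v c0"
      unfolding sform_def using Fc by (metis matrix_vector_mul_assoc)
    also have "sform (F 1 l) (F 1 l0) = E l"
    proof -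
      have "sgnmat ** Jmat ** sgnmat = - (Jmat :: complex ^ ('n + 'n) ^ ('n + 'n))"
        using sgnmat_Jmat[of "mat 1"] by (simp add: matrix_mul_assoc)
      then show ?thesis by (simp add: F_def frame3_emb[of "\<Phi> 1 l0"] sform_frame3 E_def)
    qed
    finally have S: "sform (F 1 l) (G 1) *v x = E l *v c0" .
    have "cross_form (F 1 l) (G 1) x = cdot (E l *v c0) (Q l *v c0)"
      by (simp add: cross_form_def S Pc Q_def matrix_vector_mul_assoc)
    also have "\<dots> = cdot ((adj (Q l) ** E l) *v c0) c0"
      by (simp add: cdot_mat_right matrix_vector_mul_assoc)
    also have "adj (Q l) ** E l = (l - l0) *\<^sub>R T l" using l(3) by (simp add: T_def mat_scaleR_right)
    finally have z: "cross_form (F 1 l) (G 1) x = of_real (l - l0) * cdot (T l *v c0) c0"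
      by (simp add: mat_vec_scaleR_left cdot_scaleR_left)
    define \<gamma>0 where "\<gamma>0 = Re (cdot (\<Gamma> *v c0) c0)"
    have g0: "cdot (\<Gamma> *v c0) c0 = of_real \<gamma>0"
      unfolding \<gamma>0_def \<Gamma>_def by (rule pos_def_lower_bound(2)[OF pd])
    have gpos: "\<gamma> * (norm c0)\<^sup>2 \<le> \<gamma>0" unfolding \<gamma>0_def by (rule g(2))
    have "0 < \<gamma> * (norm c0)\<^sup>2" using g(1) c0 by simp
    then have gp: "0 < \<gamma>0" using gpos by linarith
    have sg: "sgn (l - l0) * (l - l0) = \<bar>l - l0\<bar>" by (simp add: sgn_mult_self_eq abs_sgn mult.commute)
    have "of_real (sgn (l - l0)) * cross_form (F 1 l) (G 1) x + of_real (\<bar>l - l0\<bar> * \<gamma>0) =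
        of_real \<bar>l - l0\<bar> * cdot ((T l + \<Gamma>) *v c0) c0"
      unfolding z sg[symmetric] using g0
      by (simp add: matrix_vector_mult_add_rdistrib cdot_add_left algebra_simps)
    then have "norm (of_real (sgn (l - l0)) * cross_form (F 1 l) (G 1) x + of_real (\<bar>l - l0\<bar> * \<gamma>0)) =
        \<bar>l - l0\<bar> * norm (cdot ((T l + \<Gamma>) *v c0) c0)" by (simp add: norm_mult)
    also have "\<dots> \<le> \<bar>l - l0\<bar> * ((\<kappa> * \<gamma>) * norm c0 * norm c0)"
    proof (rule mult_left_mono)
      have "norm (T l + \<Gamma>) \<le> \<kappa> * \<gamma>" using h(2)[OF l(1,3)] l(2) by (simp add: dist_real_def dist_norm)
      then have "norm (T l + \<Gamma>) * norm c0 * norm c0 \<le> \<kappa> * \<gamma> * norm c0 * norm c0" by (intro mult_right_mono) auto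
      moreover have "norm (cdot ((T l + \<Gamma>) *v c0) c0) \<le> norm (T l + \<Gamma>) * norm c0 * norm c0"
        by (rule order_trans[OF norm_cdot_le]) (intro mult_right_mono norm_mat_vec_le norm_ge_zero)
      ultimately show "norm (cdot ((T l + \<Gamma>) *v c0) c0) \<le> (\<kappa> * \<gamma>) * norm c0 * norm c0" by linarith
    qed simp
    also have "\<dots> = \<kappa> * (\<bar>l - l0\<bar> * (\<gamma> * (norm c0)\<^sup>2))" by (simp add: power2_eq_square mult_ac)
    also have "\<dots> \<le> \<kappa> * (\<bar>l - l0\<bar> * \<gamma>0)" using k gpos by (intro mult_left_mono) auto
    finally show ?thesis using gp l(3) by (intro exI[of _ "\<bar>l - l0\<bar> * \<gamma>0"]) auto
  qed
  have "(l0 < l \<longrightarrow> (\<exists>q>0. norm (cross_form (F 1 l) (G 1) x + of_real q) \<le> \<kappa> * q)) \<and>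
         (l < l0 \<longrightarrow> (\<exists>q>0. norm (cross_form (F 1 l) (G 1) x - of_real q) \<le> \<kappa> * q))"
    if l: "l \<in> {l1..l2}" "\<bar>l - l0\<bar> < \<eta>" and x: "x \<in> ker (sform (F 1 l0) (G 1))" "x \<noteq> 0" for l x
  proof (intro conjI impI)
    assume "l0 < l"
    then show "\<exists>q>0. norm (cross_form (F 1 l) (G 1) x + of_real q) \<le> \<kappa> * q" using main[OF l _ x] by simp
  next
    assume "l < l0"
    then obtain q where "q > 0" "norm (- cross_form (F 1 l) (G 1) x + of_real q) \<le> \<kappa> * q" using main[OF l _ x] by auto
    moreover have "norm (- cross_form (F 1 l) (G 1) x + of_real q) = norm (cross_form (F 1 l) (G 1) x - of_real q)"
      by (metis minus_diff_eq norm_minus_cancel uminus_add_conv_diff)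
    ultimately show "\<exists>q>0. norm (cross_form (F 1 l) (G 1) x - of_real q) \<le> \<kappa> * q" by auto
  qed
  then show ?thesis using h(1) by blast
qed

subsection \<open>Crossings in the independent variable\<close>

text \<open>
  Let \<open>G(x\<^sub>0) h = F(x\<^sub>0) c\<^sub>0\<close>, let \<open>y\<close> be the solution at \<open>l2\<close> that describes \<open>G h\<close>, and let \<open>\<Delta>B\<close> be the
  difference of the coefficients, with \<open>g = (\<Delta>B y, y) \<ge> 0\<close>. The vector \<open>W(s) = F(s)\<^sup>* J G(s) h\<close> vanishes at
  \<open>x\<^sub>0\<close>, has the derivative \<open>\<Phi>\<^sup>* \<Delta>B y\<close>, and measures the distance \<open>D(s)\<close> between \<open>\<Phi> c\<^sub>0\<close> and \<open>y\<close>, because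
  \<open>D = \<Phi> J W\<close>. On the interval between \<open>x\<^sub>0\<close> and \<open>x\<close> let \<open>q\<close> be the integral of \<open>g\<close>, and \<open>\<delta>\<close> that of the
  bound \<open>\<beta>\<close> for \<open>\<Delta>B\<close>. As \<open>|\<Delta>B y|\<^sup>2 \<le> \<beta> g\<close>, both \<open>W\<close> and \<open>D\<close> are of the order \<open>sqrt (q \<delta>)\<close>. Therefore
  \<open>(W, c\<^sub>0)\<close>, the integral of \<open>(\<Delta>B y, y + D)\<close>, is \<open>q\<close> up to an error of the order \<open>q \<delta>\<close>, with the sign of
  \<open>x - x\<^sub>0\<close>. If \<open>q\<close> were \<open>0\<close>, then \<open>D = 0\<close>, and \<open>G(s) h\<close> would lie in both subspaces throughout the interval.
\<close>

lemma x_crossing: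
  assumes nn: "AE x in lebesgue_on {0<..<1}. nonneg_def (B x l2 - B x l1)"
    and noint: "\<not> (\<exists>a b. 0 \<le> a \<and> a < b \<and> b \<le> 1 \<and> (\<forall>x\<in>{a..b}. vec.dim (col_space (F x l1) \<inter> col_space (G x)) \<noteq> 0))"
    and x0: "x0 \<in> {0..1}" and k: "0 < \<kappa>"
  shows "\<exists>\<eta>>0. \<forall>x\<in>{0..1}. \<bar>x - x0\<bar> < \<eta> \<longrightarrow>
       (\<forall>h\<in>ker (sform (F x0 l1) (G x0)). h \<noteq> 0 \<longrightarrow>
         (x0 < x \<longrightarrow> (\<exists>q>0. norm (cross_form (F x l1) (G x) h - of_real q) \<le> \<kappa> * q)) \<and>
         (x < x0 \<longrightarrow> (\<exists>q>0. norm (cross_form (F x l1) (G x) h + of_real q) \<le> \<kappa> * q)))"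
proof -
  obtain U where U: "U > 0" "\<And>x l. x \<in> {0..1} \<Longrightarrow> l \<in> {l1..l2} \<Longrightarrow> norm (\<Phi> x l) \<le> U" using bounded by blast
  have "compact ((\<lambda>x. matrix_inv (frame_plus (F x l1))) ` {0..1})"
    by (intro compact_continuous_image continuous_intros F_cont_x l1_in lagrangian_frame_pm(2) F_lagr) auto
  then obtain R where R: "R > 0" "\<And>x. x \<in> {0..1} \<Longrightarrow> norm (matrix_inv (frame_plus (F x l1))) \<le> R"
    by (force dest!: compact_imp_bounded simp: bounded_pos)
  define j where "j = norm (Jmat :: complex ^ ('n + 'n) ^ ('n + 'n))"
  define j1 where "j1 = norm (emb1 :: complex ^ ('n + 'n) ^ (('n + 'n) + ('n + 'n)))"
  \<comment> \<open>The first two terms are the constants of the two errors below, each of the form constant times \<open>q \<delta>\<close>; adding \<open>1\<close>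
    makes the sum positive.\<close>
  define C where "C = U * j * U + 2 * R * j1 * (U * j * U) * U + 1"
  have jj: "0 \<le> j" "0 \<le> j1" by (simp_all add: j_def j1_def)
  have C: "0 < C" unfolding C_def using U(1) R(1) jj by (intro add_nonneg_pos add_nonneg_nonneg mult_nonneg_nonneg) auto
  \<comment> \<open>Adding \<open>1\<close> keeps \<open>\<delta>\<close> positive where \<open>c\<close> vanishes.\<close>
  define \<beta> where "\<beta> x = c x * \<bar>l2 - l1\<bar> + 1" for x
  have bpos: "1 \<le> \<beta> x" for x using c_nonneg by (simp add: \<beta>_def)
  have bint: "\<beta> integrable_on {a..b}" if "0 \<le> a" "b \<le> 1" for a b
    unfolding \<beta>_def using c_integral[OF that] by (intro integrable_add integrable_on_mult_left) auto
  \<comment> \<open>Continuity of the indefinite integral gives \<open>C \<delta> \<le> \<kappa>\<close>, so that errors \<open>C q \<delta>\<close> are at most \<open>\<kappa> q\<close>.\<close>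
  obtain \<eta> where h: "\<eta> > 0" "\<And>x. x \<in> {0..1} \<Longrightarrow> \<bar>x - x0\<bar> < \<eta> \<Longrightarrow>
      \<bar>integral {0..x} \<beta> - integral {0..x0} \<beta>\<bar> < \<kappa> / C"
  proof -
    have "continuous_on {0..1} (\<lambda>x. integral {0..x} \<beta>)" by (intro indefinite_integral_continuous_1 bint) auto
    moreover have "0 < \<kappa> / C" using k C by simp
    ultimately show ?thesis
      using x0 that unfolding continuous_on_iff dist_real_def by blast
  qed
  define dB where "dB x = B x l2 - B x l1" for x
  have main: "\<exists>q>0. norm (of_real (sgn (x - x0)) * cross_form (F x l1) (G x) h - of_real q) \<le> \<kappa> * q"
    if x: "x \<in> {0..1}" "\<bar>x - x0\<bar> < \<eta>" "x \<noteq> x0" and hh: "h \<in> ker (sform (F x0 l1) (G x0))" "h \<noteq> 0" for x h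
  proof -
    define u v where "u = min x x0" and "v = max x x0"
    have uv: "u < v" "0 \<le> u" "v \<le> 1" using x x0 by (auto simp: u_def v_def)
    note F0 = F_lagr[OF l1_in x0] and G0 = G_lagr[OF x0]
    define c0 where "c0 = matrix_inv (frame_plus (F x0 l1)) *v (frame_plus (G x0) *v h)"
    have Fc: "F x0 l1 *v c0 = G x0 *v h" unfolding c0_def by (rule ker_sform_intersection[OF F0 G0 hh(1)])
    note comp = intersection_components[OF Fc x0]
    define a0 where "a0 = A1 *v h"
    define y where "y s = \<Phi> s l2 *v a0" for s
    define D where "D s = \<Phi> s l1 *v c0 - y s" for s
    define W where "W s = sform (F s l1) (G s) *v h" for s
    have W_eq: "W s = adj (\<Phi> s l1) *v (Jmat *v y s) - Jmat *v c0" if "s \<in> {0..1}" for s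
    proof -
      have "W s = adj (\<Phi> s l1) *v (Jmat *v y s) + sgnmat *v (Jmat *v (K0 *v h))"
        unfolding W_def sform_eq[OF that] y_def a0_def
        by (simp add: matrix_vector_mult_add_rdistrib matrix_vector_mul_assoc matrix_mul_assoc)
      also have "sgnmat *v (Jmat *v (K0 *v h)) = (sgnmat ** (Jmat ** (sgnmat ** mat 1))) *v c0"
        unfolding comp(2)[symmetric] by (simp add: matrix_vector_mul_assoc matrix_mul_assoc)
      also have "\<dots> = - (Jmat *v c0)" unfolding sgnmat_Jmat by (simp add: mat_vec_minus_left)
      finally show ?thesis by simp
    qed
    have W0: "W x0 = 0" using hh(1) by (simp add: W_def ker_def)
    have D_eq: "D s = \<Phi> s l1 *v (Jmat *v W s)" if s: "s \<in> {0..1}" for s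
    proof -
      have i: "\<Phi> s l1 ** (Jmat ** (adj (\<Phi> s l1) ** Jmat)) = - mat 1"
        using symplectic_inverse(1)[OF symplectic[OF l1_in s]]
        by (simp add: mat_mult_minus_right matrix_mul_assoc) (metis minus_minus)
      have "\<Phi> s l1 *v (Jmat *v W s) = (\<Phi> s l1 ** (Jmat ** (adj (\<Phi> s l1) ** Jmat))) *v y s - (\<Phi> s l1 ** (Jmat ** Jmat)) *v c0"
        unfolding W_eq[OF s] by (simp add: matrix_vector_mult_diff_distrib matrix_vector_mul_assoc matrix_mul_assoc)
      also have "\<dots> = D s" unfolding i by (simp add: Jmat_sq mat_mult_minus_right mat_vec_minus_left D_def)
      finally show ?thesis by simp
    qed
    define kk where "kk s = adj (\<Phi> s l1) *v (dB s *v y s)" for s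
    have W_int: "(kk has_integral (W t - W s)) {s..t}" if "0 \<le> s" "s \<le> t" "t \<le> 1" for s t
    proof -
      have "((\<lambda>x. (adj (\<Phi> x l1) ** (B x l2 - B x l1) ** \<Phi> x l2) *v a0) has_integral
         (adj (\<Phi> t l1) ** Jmat ** \<Phi> t l2 - adj (\<Phi> s l1) ** Jmat ** \<Phi> s l2) *v a0) {s..t}"
        using has_integral_linear[OF wronskian[OF l1_in l2_in that] bounded_bilinear.bounded_linear_left[OF bounded_bilinear_mat_vec, of a0]]
        by (simp add: o_def)
      moreover have "(adj (\<Phi> t l1) ** Jmat ** \<Phi> t l2 - adj (\<Phi> s l1) ** Jmat ** \<Phi> s l2) *v a0 = W t - W s"
        using that by (simp add: W_eq y_def matrix_vector_mult_diff_rdistrib matrix_vector_mul_assoc matrix_mul_assoc)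
      moreover have "(\<lambda>x. (adj (\<Phi> x l1) ** (B x l2 - B x l1) ** \<Phi> x l2) *v a0) = kk"
        by (simp add: fun_eq_iff kk_def dB_def y_def matrix_vector_mul_assoc matrix_mul_assoc)
      ultimately show ?thesis by simp
    qed
    \<comment> \<open>The absolute value changes \<open>g\<close> on a null set only and makes it non-negative everywhere.\<close>
    define g where "g s = \<bar>Re (cdot (dB s *v y s) (y s))\<bar>" for s
    have AEx: "AE s in lebesgue_on {0<..<1}. s \<in> {0<..<1::real}" by (metis AE_space space_lebesgue_on)
    have good: "AE s in lebesgue_on {0<..<1}. s \<in> {0..1} \<and> norm (dB s) \<le> \<beta> s \<and> cdot (dB s *v y s) (y s) = of_real (g s) \<and>
        (\<forall>\<tau>>0. norm (dB s *v y s) \<le> (\<tau> * \<beta> s + g s / \<tau>) / 2)"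
      using nn lip_pair[OF l1_in l2_in] AEx
    proof eventually_elim
      case (elim s)
      have nb: "norm (dB s) \<le> \<beta> s" "0 < \<beta> s" using elim(2) bpos[of s] by (auto simp: dB_def \<beta>_def)
      have ndB: "nonneg_def (dB s)" using elim(1) by (simp add: dB_def)
      note b = nonneg_def_bound[OF ndB nb, where y = "y s"]
      have gs: "g s = Re (cdot (dB s *v y s) (y s))" using b(1) by (simp add: g_def)
      show ?case using elim(3) nb(1) b(2,3) unfolding gs[symmetric] by (auto simp: gs)
    qed
    have g_int: "g integrable_on {a..b}" if "0 \<le> a" "b \<le> 1" for a b
    proof (rule integrable_lebesgue_on_unit[OF _ that])
      define Y where "Y = U * norm a0"
      have "integrable (lebesgue_on {0<..<1}) (\<lambda>s. \<beta> s * (Y * Y))"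
        unfolding \<beta>_def
        by (intro integrable_mult_left Bochner_Integration.integrable_add c_int
            finite_measure.integrable_const[OF finite_measure_lebesgue_on]) simp
      moreover have "g \<in> borel_measurable (lebesgue_on {0<..<1})"
      proof -
        have my: "y \<in> borel_measurable (lebesgue_on {0<..<1})"
        proof -
          have "continuous_on {0<..<1} y"
            unfolding y_def by (intro continuous_intros continuous_on_subset[OF cont_x[OF l2_in]]) auto
          then show ?thesis by (intro continuous_imp_measurable_on_sets_lebesgue) auto
        qed
        have mB: "dB \<in> borel_measurable (lebesgue_on {0<..<1})"
          unfolding dB_def by (intro borel_measurable_diff meas l1_in l2_in)
        have my2: "(\<lambda>s. dB s *v y s) \<in> borel_measurable (lebesgue_on {0<..<1})"
          by (rule borel_measurable_continuous_Pair[OF mB my]) (intro continuous_intros)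
        have "continuous_on UNIV (\<lambda>p :: (complex ^ ('n + 'n)) \<times> (complex ^ ('n + 'n)). \<bar>Re (cdot (fst p) (snd p))\<bar>)"
          unfolding cdot_def by (intro continuous_intros continuous_on_cnj)
        from borel_measurable_continuous_Pair[OF my2 my this] show ?thesis unfolding g_def .
      qed
      moreover have "AE s in lebesgue_on {0<..<1}. norm (g s) \<le> norm (\<beta> s * (Y * Y))"
        using good
      proof eventually_elim
        case (elim s)
        have yb: "norm (y s) \<le> Y"
          unfolding y_def Y_def using U(2)[of s l2] elim l2_in
          by (intro order_trans[OF norm_mat_vec_le] mult_right_mono) auto
        have "g s \<le> norm (cdot (dB s *v y s) (y s))" unfolding g_def by (rule abs_Re_le_cmod)
        also have "\<dots> \<le> norm (dB s *v y s) * norm (y s)" by (rule norm_cdot_le)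
        also have "\<dots> \<le> (norm (dB s) * norm (y s)) * norm (y s)" by (intro mult_right_mono norm_mat_vec_le norm_ge_zero)
        also have "\<dots> \<le> (\<beta> s * Y) * Y"
          using elim yb bpos[of s] order_trans[OF norm_ge_zero yb] by (intro mult_mono mult_nonneg_nonneg) auto
        finally show ?case using bpos[of s] by (simp add: g_def mult_ac)
      qed
      ultimately show "integrable (lebesgue_on {0<..<1}) g" by (rule Bochner_Integration.integrable_bound)
    qed
    define q where "q = integral {u..v} g"
    define \<delta> where "\<delta> = integral {u..v} \<beta>"
    have bI: "\<beta> integrable_on {u..v}" and gI: "g integrable_on {u..v}" using uv by (auto intro: bint g_int)
    have q0: "0 \<le> q" unfolding q_def by (rule integral_nonneg[OF gI]) (simp add: g_def)
    have "integral {u..v} (\<lambda>x. 1) \<le> \<delta>" unfolding \<delta>_def by (rule integral_le[OF _ bI]) (use bpos in auto)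
    then have d0: "0 < \<delta>" using uv(1) by simp
    have dk: "C * \<delta> \<le> \<kappa>"
    proof -
      have "integral {0..u} \<beta> + \<delta> = integral {0..v} \<beta>"
        unfolding \<delta>_def using uv by (intro Henstock_Kurzweil_Integration.integral_combine bint) auto
      then have "\<delta> = \<bar>integral {0..x} \<beta> - integral {0..x0} \<beta>\<bar>"
        using d0 by (auto simp: u_def v_def min_def max_def split: if_splits)
      then have "\<delta> < \<kappa> / C" using h(2)[OF x(1,2)] by simp
      then show ?thesis using C by (simp add: field_simps)
    qed
    define \<rho> where "\<rho> = sqrt (q * \<delta>)"
    have rho: "0 \<le> \<rho>" "\<rho> * \<rho> = q * \<delta>" using q0 d0 by (auto simp: \<rho>_def)
    have maj: "((\<lambda>s. M * ((\<tau> * \<beta> s + g s / \<tau>) / 2)) has_integral M * ((\<tau> * \<delta> + q / \<tau>) / 2)) {u..v}" for M \<tau>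
      unfolding \<delta>_def q_def
      by (intro has_integral_mult_right has_integral_divide has_integral_add integrable_integral bI gI)
    have Wb: "norm (W s) \<le> U * \<rho>" if s: "s \<in> {u..v}" for s
      unfolding \<rho>_def
    proof (rule geometric_mean_le[OF q0 d0])
      fix \<tau> :: real assume t: "0 < \<tau>"
      define a b where "a = min s x0" and "b = max s x0"
      have ab: "a \<le> b" "u \<le> a" "b \<le> v" using s by (auto simp: a_def b_def u_def v_def)
      have "norm (W s) = norm (W b - W a)" using W0 by (auto simp: a_def b_def min_def max_def norm_minus_commute)
      also have "\<dots> \<le> integral {a..b} (\<lambda>s. U * ((\<tau> * \<beta> s + g s / \<tau>) / 2))"
      proof (rule has_integral_norm_le_ae[OF W_int])
        show "((\<lambda>s. U * ((\<tau> * \<beta> s + g s / \<tau>) / 2)) has_integral integral {a..b} (\<lambda>s. U * ((\<tau> * \<beta> s + g s / \<tau>) / 2))) {a..b}"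
          using ab uv by (intro integrable_integral integrable_on_subinterval[OF has_integral_integrable[OF maj[of U \<tau>]]]) auto
        show "AE s in lebesgue_on {0<..<1}. norm (kk s) \<le> U * ((\<tau> * \<beta> s + g s / \<tau>) / 2)"
          using good
        proof eventually_elim
          case (elim s)
          have "norm (kk s) \<le> norm (adj (\<Phi> s l1)) * norm (dB s *v y s)" unfolding kk_def by (rule norm_mat_vec_le)
          also have "\<dots> \<le> U * ((\<tau> * \<beta> s + g s / \<tau>) / 2)"
            using U(1) U(2)[of s l1] elim l1_in t by (intro mult_mono) auto
          finally show ?case .
        qed
      qed (use ab uv in auto)
      also have "\<dots> \<le> integral {u..v} (\<lambda>s. U * ((\<tau> * \<beta> s + g s / \<tau>) / 2))"
      proof -
        have iuv: "(\<lambda>s. U * ((\<tau> * \<beta> s + g s / \<tau>) / 2)) integrable_on {u..v}" using maj by blast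
        then have iab: "(\<lambda>s. U * ((\<tau> * \<beta> s + g s / \<tau>) / 2)) integrable_on {a..b}"
          by (rule integrable_on_subinterval) (use ab in auto)
        have "0 \<le> U * ((\<tau> * \<beta> s + g s / \<tau>) / 2)" for s
        proof -
          have "0 \<le> \<beta> s" using bpos[of s] by simp
          then show ?thesis using U(1) t by (simp add: g_def)
        qed
        then show ?thesis using ab by (intro integral_subset_le iuv iab) auto
      qed
      also have "\<dots> = U * ((\<tau> * \<delta> + q / \<tau>) / 2)" using maj by (rule integral_unique)
      finally show "norm (W s) \<le> U * ((\<tau> * \<delta> + q / \<tau>) / 2)" .
    qed (use U in simp)
    have in01: "s \<in> {0..1}" if "s \<in> {u..v}" for s using that uv by auto
    have Db: "norm (D s) \<le> U * j * U * \<rho>" if s: "s \<in> {u..v}" for s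
    proof -
      have "norm (D s) \<le> norm (\<Phi> s l1) * (j * norm (W s))"
        unfolding D_eq[OF in01[OF s]] j_def
        by (rule order_trans[OF norm_mat_vec_le]) (intro mult_left_mono norm_mat_vec_le norm_ge_zero)
      also have "\<dots> \<le> U * (j * (U * \<rho>))"
        using U(1) U(2)[OF in01[OF s] l1_in] Wb[OF s] jj rho by (intro mult_mono mult_left_mono) auto
      finally show ?thesis by (simp add: mult_ac)
    qed
    have GF: "G s *v h - F s l1 *v c0 = emb1 *v (- D s)" if s: "s \<in> {0..1}" for s
    proof -
      have "G s *v h = emb1 *v y s + emb0 *v (K0 *v h)"
        by (simp add: G_eq[OF s] y_def a0_def matrix_vector_mult_add_rdistrib matrix_vector_mul_assoc)
      moreover have "F s l1 *v c0 = emb1 *v (\<Phi> s l1 *v c0) + emb0 *v (sgnmat *v c0)"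
        by (simp add: F_def frame3_emb matrix_vector_mult_add_rdistrib matrix_vector_mul_assoc)
      ultimately show ?thesis by (simp add: D_def comp(2) matrix_vector_mult_diff_distrib)
    qed
    have qpos: "0 < q"
    proof (rule ccontr)
      assume "\<not> 0 < q"
      then have "\<rho> = 0" using q0 by (simp add: \<rho>_def)
      have "vec.dim (col_space (F s l1) \<inter> col_space (G s)) \<noteq> 0" if s: "s \<in> {u..v}" for s
      proof -
        have "D s = 0" using Db[OF s] \<open>\<rho> = 0\<close> by simp
        then have "G s *v h = F s l1 *v c0" using GF[OF in01[OF s]] by simp
        then have "G s *v h \<in> col_space (F s l1) \<inter> col_space (G s)"
          unfolding col_space_def span_columns by (metis IntI rangeI)
        moreover have "G s *v h \<noteq> 0" using G_lagr[OF in01[OF s]] hh(2) by (auto simp: lagrangian_frame_def)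
        ultimately show ?thesis by auto
      qed
      then show False using noint uv by blast
    qed
    define \<sigma> where "\<sigma> = sgn (x - x0)"
    have sW: "(kk has_integral (\<sigma> *\<^sub>R W x)) {u..v}"
    proof (cases "x0 < x")
      case True
      then show ?thesis using W_int[of x0 x] W0 x x0 by (simp add: \<sigma>_def u_def v_def)
    next
      case False
      then show ?thesis using W_int[of x x0] W0 x x0 by (simp add: \<sigma>_def u_def v_def)
    qed
    have main1: "norm (cdot (\<sigma> *\<^sub>R W x) c0 - of_real q) \<le> U * j * U * \<rho> * sqrt (q * \<delta>)"
    proof (rule geometric_mean_le[OF q0 d0])
      fix \<tau> :: real assume t: "0 < \<tau>"
      have bl: "bounded_linear (\<lambda>w. cdot w c0)"
      proof (rule bounded_linear_intro[of _ "norm c0"])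
        show "cdot (r *\<^sub>R w) c0 = r *\<^sub>R cdot w c0" for r w
          by (subst cdot_scaleR_left) (simp add: scaleR_conv_of_real)
      qed (auto simp: cdot_add_left norm_cdot_le)
      have "((\<lambda>s. cdot (kk s) c0 - of_real (g s)) has_integral (cdot (\<sigma> *\<^sub>R W x) c0 - of_real q)) {u..v}"
        unfolding q_def using has_integral_linear[OF sW bl]
        by (intro has_integral_diff has_integral_of_real integrable_integral gI) (simp add: o_def)
      then show "norm (cdot (\<sigma> *\<^sub>R W x) c0 - of_real q) \<le> U * j * U * \<rho> * ((\<tau> * \<delta> + q / \<tau>) / 2)"
      proof (rule has_integral_norm_le_ae_on[OF _ maj uv(2,3)])
        show "AE s in lebesgue_on {0<..<1}. s \<in> {u..v} \<longrightarrow> norm (cdot (kk s) c0 - of_real (g s)) \<le> U * j * U * \<rho> * ((\<tau> * \<beta> s + g s / \<tau>) / 2)"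
          using good
        proof eventually_elim
          case (elim s)
          show ?case
          proof
            assume s: "s \<in> {u..v}"
            have "cdot (kk s) c0 = cdot (dB s *v y s) (\<Phi> s l1 *v c0)" by (simp add: kk_def cdot_mat_left)
            also have "\<Phi> s l1 *v c0 = y s + D s" by (simp add: D_def)
            finally have "cdot (kk s) c0 - of_real (g s) = cdot (dB s *v y s) (D s)" using elim by (simp add: cdot_add_right)
            then have "norm (cdot (kk s) c0 - of_real (g s)) \<le> norm (dB s *v y s) * norm (D s)" by (simp add: norm_cdot_le)
            also have "\<dots> \<le> ((\<tau> * \<beta> s + g s / \<tau>) / 2) * (U * j * U * \<rho>)"
              using elim t Db[OF s] bpos[of s] by (intro mult_mono) (auto simp: g_def)
            finally show "norm (cdot (kk s) c0 - of_real (g s)) \<le> U * j * U * \<rho> * ((\<tau> * \<beta> s + g s / \<tau>) / 2)"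
              by (simp add: mult.commute)
          qed
        qed
      qed
    qed (use U jj rho in \<open>intro mult_nonneg_nonneg; simp\<close>)
    define e where "e = matrix_inv (frame_plus (F x l1)) *v (frame_plus (G x) *v h) - c0"
    have xuv: "x \<in> {u..v}" by (auto simp: u_def v_def)
    have eb: "norm e \<le> R * (2 * (j1 * (U * j * U * \<rho>)))"
    proof -
      have inv: "matrix_inv (frame_plus (F x l1)) *v (frame_plus (F x l1) *v c0) = c0"
        using lagrangian_frame_pm(2)[OF F_lagr[OF l1_in x(1)]] by (simp add: matrix_vector_mul_assoc matrix_inv_left)
      have "e = matrix_inv (frame_plus (F x l1)) *v (frame_plus (G x) *v h - frame_plus (F x l1) *v c0)"
        by (simp add: e_def matrix_vector_mult_diff_distrib inv)
      then have "norm e \<le> R * norm (frame_plus (G x) *v h - frame_plus (F x l1) *v c0)"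
        using R(2)[OF x(1)] by (simp add: order_trans[OF norm_mat_vec_le] mult_right_mono)
      also have "norm (frame_plus (G x) *v h - frame_plus (F x l1) *v c0) \<le> 2 * norm (G x *v h - F x l1 *v c0)"
        by (rule norm_complex_combination_le) (simp add: frame_pm_vec algebra_simps)
      also have "norm (G x *v h - F x l1 *v c0) \<le> j1 * norm (D x)"
        unfolding GF[OF x(1)] j1_def using norm_mat_vec_le[of emb1 "- D x"] by simp
      also have "\<dots> \<le> j1 * (U * j * U * \<rho>)" using jj Db[OF xuv] by (intro mult_left_mono)
      finally show ?thesis using R(1) by simp
    qed
    have "cross_form (F x l1) (G x) h = cdot (W x) (c0 + e)" by (simp add: cross_form_def W_def e_def)
    then have "of_real \<sigma> * cross_form (F x l1) (G x) h - of_real q = (cdot (\<sigma> *\<^sub>R W x) c0 - of_real q) + of_real \<sigma> * cdot (W x) e"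
      by (simp add: cdot_scaleR_left cdot_add_right algebra_simps)
    then have "norm (of_real \<sigma> * cross_form (F x l1) (G x) h - of_real q) \<le>
        norm (cdot (\<sigma> *\<^sub>R W x) c0 - of_real q) + norm (of_real \<sigma> * cdot (W x) e)"
      by (simp only:) (rule norm_triangle_ineq)
    also have "norm (of_real \<sigma> * cdot (W x) e) \<le> norm (W x) * norm e"
      using norm_cdot_le[of "W x" e] x(3) by (simp add: norm_mult \<sigma>_def sgn_if)
    also have "\<dots> \<le> (U * \<rho>) * (R * (2 * (j1 * (U * j * U * \<rho>))))"
      using Wb[OF xuv] eb U(1) rho by (intro mult_mono) auto
    also have "(U * \<rho>) * (R * (2 * (j1 * (U * j * U * \<rho>)))) = 2 * R * j1 * (U * j * U) * U * (q * \<delta>)"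
      unfolding rho(2)[symmetric] by (simp add: mult_ac)
    also have "norm (cdot (\<sigma> *\<^sub>R W x) c0 - of_real q) \<le> U * j * U * (q * \<delta>)"
    proof -
      have "U * j * U * \<rho> * sqrt (q * \<delta>) = U * j * U * (\<rho> * \<rho>)"
        unfolding \<rho>_def by (simp only: mult.assoc)
      also have "\<dots> = U * j * U * (q * \<delta>)" by (simp only: rho(2))
      finally show ?thesis using main1 by linarith
    qed
    also have "U * j * U * (q * \<delta>) + 2 * R * j1 * (U * j * U) * U * (q * \<delta>) = (C - 1) * \<delta> * q"
      by (simp add: C_def algebra_simps)
    also have "\<dots> \<le> (C * \<delta>) * q" using d0 q0 by (intro mult_right_mono) auto
    also have "\<dots> \<le> \<kappa> * q" using dk q0 by (intro mult_right_mono) auto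
    finally show ?thesis using qpos by (auto simp: \<sigma>_def)
  qed
  have "(x0 < x \<longrightarrow> (\<exists>q>0. norm (cross_form (F x l1) (G x) y - of_real q) \<le> \<kappa> * q)) \<and>
         (x < x0 \<longrightarrow> (\<exists>q>0. norm (cross_form (F x l1) (G x) y + of_real q) \<le> \<kappa> * q))"
    if x: "x \<in> {0..1}" "\<bar>x - x0\<bar> < \<eta>" and y: "y \<in> ker (sform (F x0 l1) (G x0))" "y \<noteq> 0" for x y
  proof (intro conjI impI)
    assume "x0 < x"
    then show "\<exists>q>0. norm (cross_form (F x l1) (G x) y - of_real q) \<le> \<kappa> * q" using main[OF x _ y] by simp
  next
    assume "x < x0"
    then obtain q where "q > 0" "norm (- cross_form (F x l1) (G x) y - of_real q) \<le> \<kappa> * q" using main[OF x _ y] by auto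
    moreover have "norm (- cross_form (F x l1) (G x) y - of_real q) = norm (cross_form (F x l1) (G x) y + of_real q)"
      by (metis minus_add_distrib norm_minus_cancel uminus_add_conv_diff add.commute)
    ultimately show "\<exists>q>0. norm (cross_form (F x l1) (G x) y + of_real q) \<le> \<kappa> * q" by auto
  qed
  then show ?thesis using h(1) by blast
qed

end

section \<open>Eigenvalues as intersections\<close>

text \<open>
  The conjugate entries of a vector annihilated by \<open>T\<^sup>*\<close> are the coefficients of a linear relation between the rows of
  \<open>T\<close>. A nontrivial relation expresses one row by the others, and the rank drops.
\<close>

lemma full_row_rank_adj_injective:
  fixes T :: "complex ^ 'c ^ 'r"
  assumes rk: "rank T = CARD('r)" and h: "adj T *v h = 0"
  shows "h = 0"
proof (rule ccontr)
  assume "h \<noteq> 0"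
  then obtain k where k: "h $ k \<noteq> 0" by (auto simp: vec_eq_iff)
  have z: "(\<Sum>i\<in>UNIV. cnj (h $ i) *s T $ i) = 0"
  proof -
    have "(\<Sum>i\<in>UNIV. cnj (h $ i) *s T $ i) $ j = cnj ((adj T *v h) $ j)" for j
      by (simp add: matrix_vector_mult_def adj_def mult.commute)
    then show ?thesis by (simp add: vec_eq_iff h)
  qed
  have "cnj (h $ k) *s T $ k + (\<Sum>i\<in>UNIV - {k}. cnj (h $ i) *s T $ i) = 0"
    using z by (subst (asm) sum.remove[of _ k]) auto
  then have "cnj (h $ k) *s T $ k = - (\<Sum>i\<in>UNIV - {k}. cnj (h $ i) *s T $ i)"
    by (simp add: eq_neg_iff_add_eq_0)
  moreover have "(\<Sum>i\<in>UNIV - {k}. cnj (h $ i) *s T $ i) \<in> vec.span ((\<lambda>i. T $ i) ` (UNIV - {k}))"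
    by (intro vec.span_sum vec.span_scale vec.span_base) auto
  ultimately have "cnj (h $ k) *s T $ k \<in> vec.span ((\<lambda>i. T $ i) ` (UNIV - {k}))"
    by (simp only: vec.span_neg)
  then have "inverse (cnj (h $ k)) *s (cnj (h $ k) *s T $ k) \<in> vec.span ((\<lambda>i. T $ i) ` (UNIV - {k}))"
    by (rule vec.span_scale)
  then have Tk: "T $ k \<in> vec.span ((\<lambda>i. T $ i) ` (UNIV - {k}))"
    using k by (simp add: vector_smult_assoc)
  have "rows T \<subseteq> vec.span ((\<lambda>i. T $ i) ` (UNIV - {k}))"
  proof
    fix r assume "r \<in> rows T"
    then obtain i where "r = T $ i" by (auto simp: rows_def row_def vec_lambda_eta)
    then show "r \<in> vec.span ((\<lambda>i. T $ i) ` (UNIV - {k}))"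
      using Tk by (cases "i = k") (auto intro: vec.span_base)
  qed
  then have "vec.dim (rows T) \<le> card ((\<lambda>i. T $ i) ` (UNIV - {k}))" by (intro vec.dim_le_card) auto
  also have "\<dots> \<le> card (UNIV - {k})" by (rule card_image_le) simp
  also have "\<dots> < CARD('r)" by (simp add: card_Diff_singleton)
  finally show False using rk by (simp add: row_rank_def_gen)
qed

text \<open>
  The eigenspaces live in a function space of infinite dimension, whose notion of dimension is connected with that of
  \<open>\<complex>\<^sup>m\<close> through injective linear maps.
\<close>

interpretation vec_cfun: vector_space_pair "(*s) :: complex \<Rightarrow> complex ^ 'k \<Rightarrow> complex ^ 'k"
    "\<lambda>(c::complex) (f::real \<Rightarrow> complex ^ 'm) x. c *s f x"
  ..

definition extend_solution :: "(real \<Rightarrow> complex ^ 'c ^ 'm) \<Rightarrow> complex ^ 'c \<Rightarrow> real \<Rightarrow> complex ^ 'm" where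
  "extend_solution P v = (\<lambda>x. if x \<in> {0..1} then P x *v v else 0)"

lemma extend_solution_0:
  assumes "P 0 = mat 1"
  shows "extend_solution P v = 0 \<longleftrightarrow> v = 0"
proof
  assume "extend_solution P v = 0"
  then have "extend_solution P v 0 = 0" by simp
  then show "v = 0" using assms by (simp add: extend_solution_def)
qed (simp add: extend_solution_def fun_eq_iff)

text \<open>
  Evaluation at \<open>0\<close> recovers the initial vector, so the map is injective.
\<close>

lemma dim_extend_solution:
  fixes P :: "real \<Rightarrow> complex ^ 'm ^ 'm"
  assumes P: "P 0 = mat 1" and K: "vec.subspace K"
  shows "cfun.dim (extend_solution P ` K) = vec.dim K"
proof -
  let ?L = "extend_solution P"
  have lin: "Vector_Spaces.linear (*s) (\<lambda>(c::complex) (f::real \<Rightarrow> complex ^ 'm) x. c *s f x) ?L"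
    unfolding Vector_Spaces.linear_iff
    by (auto simp: vec.vector_space_axioms cfun.vector_space_axioms extend_solution_def fun_eq_iff
        matrix_vector_right_distrib mat_vec_scalar)
  have inj: "inj ?L"
  proof (rule injI)
    fix u v assume "?L u = ?L v"
    then have "?L u 0 = ?L v 0" by simp
    then show "u = v" using P by (simp add: extend_solution_def)
  qed
  obtain C where C: "C \<subseteq> K" "vec.independent C" "K \<subseteq> vec.span C" "card C = vec.dim K"
    using vec.basis_exists by blast
  have KC: "K = vec.span C" using C(1,3) K vec.span_minimal by blast
  have "cfun.independent (?L ` C)"
    using vec_cfun.linear_independent_injective_image[OF lin C(2) inj_on_subset[OF inj subset_UNIV]] .
  moreover have "?L ` K = cfun.span (?L ` C)"
    unfolding KC using vec_cfun.linear_span_image[OF lin, of C] by simp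
  ultimately have "cfun.dim (?L ` K) = card (?L ` C)"
    using cfun.dim_span_eq_card_independent by metis
  also have "\<dots> = card C" by (rule card_image[OF inj_on_subset[OF inj subset_UNIV]])
  finally show ?thesis using C(4) by simp
qed

lemma eigenspace_eq_extend:
  fixes B :: "real \<Rightarrow> real \<Rightarrow> complex ^ ('n::finite + 'n) ^ ('n + 'n)"
  assumes P: "fundamental_solution (\<lambda>x. B x l) P"
  shows "eigenspace B \<Theta> l = extend_solution P ` ker (lblock \<Theta> + rblock \<Theta> ** P 1)"
proof -
  interpret fundamental_solution "\<lambda>x. B x l" P by fact
  have bc: "\<Theta> *v stack v (P 1 *v v) = (lblock \<Theta> + rblock \<Theta> ** P 1) *v v" for v
    by (simp add: mat_vec_stack matrix_vector_mult_add_rdistrib matrix_vector_mul_assoc)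
  show ?thesis
  proof
    show "eigenspace B \<Theta> l \<subseteq> extend_solution P ` ker (lblock \<Theta> + rblock \<Theta> ** P 1)"
    proof
      fix y assume y: "y \<in> eigenspace B \<Theta> l"
      then have vs: "vec_solution (\<lambda>x. B x l) y" by (simp add: eigenspace_def)
      have yP: "y x = P x *v y 0" if "x \<in> {0..1}" for x
        using solution_eq[OF vec_solution_imp_mat_solution[OF vs] that] by (simp add: colmat_mult colmat_inject)
      have "y = extend_solution P (y 0)"
      proof
        fix x
        show "y x = extend_solution P (y 0) x"
        proof (cases "x \<in> {0..1}")
          case True
          then show ?thesis using yP[OF True] by (simp only: extend_solution_def if_True)
        next
          case False
          then have "y x = 0" using y unfolding eigenspace_def by blast
          then show ?thesis using False by (simp only: extend_solution_def if_False)
        qed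
      qed
      moreover have "y 0 \<in> ker (lblock \<Theta> + rblock \<Theta> ** P 1)"
        using y yP[of 1] bc[of "y 0"] by (simp add: eigenspace_def ker_def)
      ultimately show "y \<in> extend_solution P ` ker (lblock \<Theta> + rblock \<Theta> ** P 1)" by blast
    qed
    show "extend_solution P ` ker (lblock \<Theta> + rblock \<Theta> ** P 1) \<subseteq> eigenspace B \<Theta> l"
    proof safe
      fix v assume v: "v \<in> ker (lblock \<Theta> + rblock \<Theta> ** P 1)"
      have "vec_solution (\<lambda>x. B x l) (extend_solution P v)"
        by (rule vec_solution_cong[OF _ mat_solution_vec[OF sol]]) (simp add: extend_solution_def)
      moreover have "\<Theta> *v stack (extend_solution P v 0) (extend_solution P v 1) = 0"
        using v bc[of v] by (simp add: extend_solution_def init ker_def)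
      ultimately show "extend_solution P v \<in> eigenspace B \<Theta> l"
        by (simp add: eigenspace_def extend_solution_def)
    qed
  qed
qed

lemma adj_Jmat_Jmat: "adj Jmat ** (Jmat ** A) = A"
  by (simp add: adj_Jmat mat_mult_minus_left Jmat_left_cancel)

lemma emb_form:
  "adj (emb1 ** R + emb0 ** K) ** Jmat ** (emb1 ** R' + emb0 ** K') = adj R ** (Jmat ** R') + adj K ** (Jmat ** K')"
  by (simp add: adj_add adj_mult mat_algebra matrix_mul_assoc[symmetric] Jmat_emb emb_orthogonal)

text \<open>
  A symplectic transport does not change the form, so isotropy has to be checked at the end point only, where it is
  the condition \<open>\<Theta> calJ \<Theta>\<^sup>* = 0\<close>. There a vector in the kernel is annihilated by \<open>\<Theta>\<^sup>*\<close>, which is injective since \<open>\<Theta>\<close>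
  has full rank.
\<close>

lemma boundary_frame_lagrangian:
  fixes \<Theta> :: "complex ^ (('n::finite + 'n) + ('n + 'n)) ^ ('n + 'n)"
    and P P1 A1 K0 :: "complex ^ ('n + 'n) ^ ('n + 'n)"
  assumes rk: "rank \<Theta> = 2 * CARD('n)" and iso: "\<Theta> ** calJ ** adj \<Theta> = 0"
    and P1: "adj P1 ** Jmat ** P1 = Jmat" and P: "adj P ** Jmat ** P = Jmat"
    and A1: "P1 ** A1 = Jmat ** adj (rblock \<Theta>)" and K0: "K0 = - (sgnmat ** (Jmat ** adj (lblock \<Theta>)))"
  shows "lagrangian_frame (emb1 ** (P ** A1) + emb0 ** K0)"
  unfolding lagrangian_frame_def
proof (intro conjI allI impI)
  let ?X = "emb1 ** (P ** A1) + emb0 ** K0"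
  have "adj (P ** A1) ** (Jmat ** (P ** A1)) = adj A1 ** (adj P ** Jmat ** P) ** A1"
    by (simp add: adj_mult matrix_mul_assoc)
  also have "\<dots> = adj A1 ** (adj P1 ** Jmat ** P1) ** A1" by (simp only: P P1)
  also have "\<dots> = adj (P1 ** A1) ** (Jmat ** (P1 ** A1))"
    by (simp add: adj_mult matrix_mul_assoc)
  also have "\<dots> = rblock \<Theta> ** (Jmat ** adj (rblock \<Theta>))"
    unfolding A1 by (simp add: adj_mult matrix_mul_assoc[symmetric] adj_Jmat_Jmat)
  finally have 1: "adj (P ** A1) ** (Jmat ** (P ** A1)) = rblock \<Theta> ** (Jmat ** adj (rblock \<Theta>))" .
  have 2: "adj K0 ** (Jmat ** K0) = - (lblock \<Theta> ** (Jmat ** adj (lblock \<Theta>)))"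
    unfolding K0
    by (simp add: adj_minus adj_mult mat_mult_minus_left mat_mult_minus_right adj_sgnmat
        matrix_mul_assoc[symmetric] sgnmat_Jmat adj_Jmat_Jmat)
  show "adj ?X ** Jmat ** ?X = 0"
    unfolding emb_form 1 2 using iso unfolding calJ_form by (simp add: matrix_mul_assoc)
  fix h assume h: "?X *v h = 0"
  have "(adj emb1 ** ?X) *v h = 0" "(adj emb0 ** ?X) *v h = 0"
    using h by (simp_all add: matrix_vector_mul_assoc[symmetric])
  then have z: "(P ** A1) *v h = 0" "K0 *v h = 0" by (simp_all add: matrix_add_ldistrib emb_orthogonal)
  have "(- (Jmat ** adj P ** Jmat)) *v (P *v (A1 *v h)) = 0" using z(1) by (simp add: matrix_vector_mul_assoc)
  then have "A1 *v h = 0"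
    unfolding matrix_vector_mul_assoc[of "- (Jmat ** adj P ** Jmat)"] symplectic_inverse(2)[OF P] by simp
  then have "(P1 ** A1) *v h = 0" by (simp add: matrix_vector_mul_assoc[symmetric])
  then have "adj Jmat *v ((Jmat ** adj (rblock \<Theta>)) *v h) = 0" unfolding A1 by simp
  then have r: "adj (rblock \<Theta>) *v h = 0" by (simp add: matrix_vector_mul_assoc adj_Jmat_Jmat)
  have "adj Jmat *v (sgnmat *v (K0 *v h)) = 0" using z(2) by simp
  then have l: "adj (lblock \<Theta>) *v h = 0"
    unfolding K0 by (simp add: matrix_vector_mul_assoc mat_vec_minus_left mat_vec_minus_right mat_mult_minus_right sgnmat_sq
        adj_Jmat_Jmat matrix_mul_assoc[symmetric])
  have "(adj \<Theta> *v h) $ Inl i = (adj (lblock \<Theta>) *v h) $ i" "(adj \<Theta> *v h) $ Inr i = (adj (rblock \<Theta>) *v h) $ i" for i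
    by (simp_all add: matrix_vector_mult_def adj_def lblock_def rblock_def)
  then have "adj \<Theta> *v h = 0" using l r unfolding vec_eq_iff split_sum_all by simp
  then show "h = 0" using rk by (intro full_row_rank_adj_injective[of \<Theta>]) simp_all
qed

text \<open>
  The end value of the moving frame is chosen so that its symplectic product with the frame of the solution space is,
  up to adjoint and sign, the matrix of the boundary condition \<open>\<Theta> (v, P v) = 0\<close> on initial values \<open>v\<close>.
\<close>

lemma boundary_frame_form:
  fixes \<Theta> :: "complex ^ (('n::finite + 'n) + ('n + 'n)) ^ ('n + 'n)"
    and P P1 A1 K0 :: "complex ^ ('n + 'n) ^ ('n + 'n)"
  assumes A1: "P1 ** A1 = Jmat ** adj (rblock \<Theta>)" and K0: "K0 = - (sgnmat ** (Jmat ** adj (lblock \<Theta>)))"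
  shows "adj (sform (frame3 P) (emb1 ** (P1 ** A1) + emb0 ** K0)) = - (lblock \<Theta> + rblock \<Theta> ** P)"
proof -
  have "adj (sform (frame3 P) (emb1 ** (P1 ** A1) + emb0 ** K0)) =
      - (adj (emb1 ** (P1 ** A1) + emb0 ** K0) ** Jmat ** (emb1 ** P + emb0 ** sgnmat))"
    by (simp add: sform_def adj_mult adj_Jmat matrix_mul_assoc mat_mult_minus_left mat_mult_minus_right frame3_emb)
  also have "\<dots> = - (adj (P1 ** A1) ** (Jmat ** P) + adj K0 ** (Jmat ** sgnmat))" unfolding emb_form ..
  also have "adj (P1 ** A1) ** (Jmat ** P) = rblock \<Theta> ** P"
    unfolding A1 by (simp add: adj_mult matrix_mul_assoc[symmetric] adj_Jmat_Jmat)
  also have "adj K0 ** (Jmat ** sgnmat) = lblock \<Theta>"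
  proof -
    have "sgnmat ** (Jmat ** sgnmat) = - (Jmat :: complex ^ ('n + 'n) ^ ('n + 'n))" using sgnmat_Jmat[of "mat 1"] by simp
    then have "adj K0 ** (Jmat ** sgnmat) = lblock \<Theta> ** (adj Jmat ** Jmat)"
      unfolding K0 by (simp add: adj_minus adj_mult adj_sgnmat mat_mult_minus_left mat_mult_minus_right matrix_mul_assoc[symmetric])
    moreover have "adj Jmat ** Jmat = (mat 1 :: complex ^ ('n + 'n) ^ ('n + 'n))" using adj_Jmat_Jmat[of "mat 1"] by simp
    ultimately show ?thesis by simp
  qed
  finally show ?thesis by (simp add: add.commute)
qed

section \<open>The spectral count and the Maslov index\<close>

theorem theorem1p2:
  fixes I :: "real set"
    and B Bl \<Phi> :: "real \<Rightarrow> real \<Rightarrow> complex ^ ('n::finite + 'n) ^ ('n + 'n)"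
    and \<Theta> :: "complex ^ (('n + 'n) + ('n + 'n)) ^ ('n + 'n)"
    and X4 :: "real \<Rightarrow> complex ^ ('n + 'n) ^ (('n + 'n) + ('n + 'n))"
    and l1 l2 :: real
    and X3 :: "real \<Rightarrow> real \<Rightarrow> complex ^ ('n + 'n) ^ (('n + 'n) + ('n + 'n))"
    and L3 :: "real \<Rightarrow> real \<Rightarrow> (complex ^ (('n + 'n) + ('n + 'n))) set"
    and L4 :: "real \<Rightarrow> (complex ^ (('n + 'n) + ('n + 'n))) set"
  defines "X3 \<equiv> \<lambda>x l. frame3 (\<Phi> x l)"
    and "L3 \<equiv> \<lambda>x l. col_space (X3 x l)"
    and "L4 \<equiv> \<lambda>x. col_space (X4 x)"
  assumes "is_interval I"
    and "assumptions_A I B Bl"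
    and "rank \<Theta> = 2 * CARD('n)"
    and "\<Theta> ** calJ ** adj \<Theta> = 0"
    and "l1 \<in> I" "l2 \<in> I" "l1 < l2"
    and "\<And>l. l \<in> I \<Longrightarrow> mat_solution (\<lambda>x. B x l) (\<lambda>x. \<Phi> x l)"
    and "\<And>l. l \<in> I \<Longrightarrow> \<Phi> 0 l = mat 1"
    and "mat_solution (\<lambda>x. calB (B x l2)) X4"
    and "X4 1 = calM ** calJ ** adj \<Theta>"
    and "\<And>l. l \<in> I \<Longrightarrow>
           pos_def (integral\<^sup>L (lebesgue_on {0<..<1}) (\<lambda>x. adj (\<Phi> x l) ** Bl x l ** \<Phi> x l))"
  shows "(finite {l \<in> {l1..<l2}. is_eigenvalue B \<Theta> l} \<and>
          int (spectral_count B \<Theta> {l1..<l2}) = maslov_index (\<lambda>x. L3 x l1) L4 0 1) \<and>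
         ((AE x in lebesgue_on {0<..<1}. nonneg_def (B x l2 - B x l1)) \<and>
          \<not> (\<exists>a b. 0 \<le> a \<and> a < b \<and> b \<le> 1 \<and> (\<forall>x\<in>{a..b}. vec.dim (L3 x l1 \<inter> L4 x) \<noteq> 0))
          \<longrightarrow>
          finite {x \<in> {0<..1}. ker (adj (X3 x l1) ** Jmat ** X4 x) \<noteq> {0}} \<and>
          spectral_count B \<Theta> {l1..<l2} =
            (\<Sum>x | x \<in> {0<..1} \<and> ker (adj (X3 x l1) ** Jmat ** X4 x) \<noteq> {0}.
               vec.dim (ker (adj (X3 x l1) ** Jmat ** X4 x))))"
proof -
  note interval = assms(4) and A = assms(5) and rk = assms(6) and iso = assms(7)
    and l1I = assms(8) and l2I = assms(9) and l12 = assms(10) and sol = assms(11) and init = assms(12)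
    and X4sol = assms(13) and X41 = assms(14) and pd = assms(15)
  have sub: "l \<in> I" if "l \<in> {l1..l2}" for l
    using mem_is_interval_1_I[OF interval l1I l2I] that by simp
  have l1: "l1 \<in> {l1..l2}" and l2: "l2 \<in> {l1..l2}" using l12 by auto
  let ?M = "lebesgue_on {0<..<1::real}"
  have meas: "(\<lambda>x. B x l) \<in> borel_measurable ?M" if "l \<in> I" for l using A that by (simp add: assumptions_A_def)
  have sa: "AE x in ?M. self_adjoint (B x l)" if "l \<in> I" for l using A that by (simp add: assumptions_A_def)
  have der0: "AE x in ?M. \<forall>l\<in>I. (B x has_vector_derivative Bl x l) (at l within I)"
    using A by (simp add: assumptions_A_def)
  have der: "AE x in ?M. \<forall>l\<in>{l1..l2}. (B x has_vector_derivative Bl x l) (at l within {l1..l2})"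
    using der0
  proof eventually_elim
    case (elim x)
    have "{l1..l2} \<subseteq> I" using sub by blast
    then show ?case using elim has_vector_derivative_within_subset by blast
  qed
  obtain b1 where b1: "integrable ?M b1" "\<And>l. l \<in> I \<Longrightarrow> AE x in ?M. op_norm (Bl x l) \<le> b1 x"
    using A unfolding assumptions_A_def by blast
  \<comment> \<open>The absolute value makes \<open>c\<close> non-negative everywhere; the factor passes from operator to Frobenius norms.\<close>
  define c where "c x = real CARD('n + 'n) * \<bar>b1 x\<bar>" for x
  have c_int: "integrable ?M c"
    unfolding c_def by (intro integrable_mult_right integrable_abs b1)
  have c0: "0 \<le> c x" for x by (simp add: c_def)
  have bd: "AE x in ?M. norm (Bl x l) \<le> c x" if "l \<in> {l1..l2}" for l
    using b1(2)[OF sub[OF that]]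
  proof eventually_elim
    case (elim x)
    have "norm (Bl x l) \<le> real CARD('n + 'n) * op_norm (Bl x l)" by (rule norm_le_op_norm)
    also have "\<dots> \<le> c x" unfolding c_def using elim by (intro mult_left_mono) auto
    finally show ?case .
  qed
  have "finite_measure ?M" by (rule finite_measure_lebesgue_on) simp
  then have sf: "sigma_finite_measure ?M" by (rule finite_measure.axioms(1))
  have lip: "AE x in ?M. \<forall>l\<in>{l1..l2}. \<forall>m\<in>{l1..l2}. norm (B x l - B x m) \<le> c x * \<bar>l - m\<bar>"
    by (rule ae_lipschitz[OF sf l12 meas[OF sub] der borel_measurable_integrable[OF c_int] c0 bd])
  have fund: "fundamental_solution (\<lambda>x. B x l) (\<lambda>x. \<Phi> x l)" if "l \<in> {l1..l2}" for l
    using sol init sa sub[OF that] by (simp add: fundamental_solution_def)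
  interpret hf: hamiltonian_family B \<Phi> l1 l2 c
    by (rule hamiltonian_family.intro) (use l12 fund meas sub c_int c0 lip in blast)+
  \<comment> \<open>The two components of \<open>X4\<close> at \<open>0\<close>; only the first one moves.\<close>
  define A1 where "A1 = adj emb1 ** X4 0"
  define K0 where "K0 = adj emb0 ** X4 0"
  have X4_eq: "X4 x = emb1 ** (\<Phi> x l2 ** A1) + emb0 ** K0" if "x \<in> {0..1}" for x
    unfolding A1_def K0_def by (rule calB_solution_eq[OF fund[OF l2] X4sol that])
  have A1: "\<Phi> 1 l2 ** A1 = Jmat ** adj (rblock \<Theta>)" and K0: "K0 = - (sgnmat ** (Jmat ** adj (lblock \<Theta>)))"
  proof -
    have e: "emb1 ** (\<Phi> 1 l2 ** A1) + emb0 ** K0 = emb1 ** (Jmat ** adj (rblock \<Theta>)) - emb0 ** (sgnmat ** (Jmat ** adj (lblock \<Theta>)))"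
      using X4_eq[of 1] X41 by (simp add: calM_calJ_adj)
    from arg_cong[OF e, of "\<lambda>Z. adj emb1 ** Z"] show "\<Phi> 1 l2 ** A1 = Jmat ** adj (rblock \<Theta>)"
      by (simp add: matrix_add_ldistrib mat_mult_diff_right emb_orthogonal)
    from arg_cong[OF e, of "\<lambda>Z. adj emb0 ** Z"] show "K0 = - (sgnmat ** (Jmat ** adj (lblock \<Theta>)))"
      by (simp add: matrix_add_ldistrib mat_mult_diff_right emb_orthogonal)
  qed
  have symp: "adj (\<Phi> x l) ** Jmat ** \<Phi> x l = Jmat" if "x \<in> {0..1}" "l \<in> {l1..l2}" for x l
    using hf.symplectic that by blast
  interpret bf: boundary_frame B \<Phi> l1 l2 c A1 K0 X4
  proof
    show "X4 x = emb1 ** (\<Phi> x l2 ** A1) + emb0 ** K0" if "x \<in> {0..1}" for x by (rule X4_eq[OF that])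
    show "lagrangian_frame (X4 x)" if "x \<in> {0..1}" for x
      unfolding X4_eq[OF that] by (rule boundary_frame_lagrangian[OF rk iso symp symp A1 K0]) (use that l2 in auto)
  qed
  have F: "bf.F x l = X3 x l" for x l by (simp add: bf.F_def X3_def)
  have X3_lagr: "lagrangian_frame (X3 x l)" if "x \<in> {0..1}" "l \<in> {l1..l2}" for x l
    using bf.F_lagr[OF that(2,1)] by (simp add: F)
  have X4_lagr: "lagrangian_frame (X4 x)" if "x \<in> {0..1}" for x by (rule bf.G_lagr[OF that])
  have one: "(1::real) \<in> {0..1}" and zero: "(0::real) \<in> {0..1}" by auto
  define d where "d x l = vec.dim (ker (sform (X3 x l) (X4 x)))" for x l

  have eig: "cfun.dim (eigenspace B \<Theta> l) = d 1 l" "is_eigenvalue B \<Theta> l \<longleftrightarrow> d 1 l \<noteq> 0" if l: "l \<in> {l1..l2}" for l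
  proof -
    let ?K = "ker (lblock \<Theta> + rblock \<Theta> ** \<Phi> 1 l)"
    have "?K = ker (adj (sform (X3 1 l) (X4 1)))"
      unfolding X4_eq[OF one] X3_def boundary_frame_form[OF A1 K0] ker_minus ..
    then have dK: "vec.dim ?K = d 1 l"
      using ker_adj_symplectic_form[OF X3_lagr[OF one l] X4_lagr[OF one]] by (simp add: d_def sform_def)
    have E: "eigenspace B \<Theta> l = extend_solution (\<lambda>x. \<Phi> x l) ` ?K"
      by (rule eigenspace_eq_extend[where B = B and l = l and P = "\<lambda>x. \<Phi> x l", OF fund[OF l]])
    show "cfun.dim (eigenspace B \<Theta> l) = d 1 l"
      unfolding E using dim_extend_solution[where P = "\<lambda>x. \<Phi> x l", OF hf.init[OF l] ker_subspace] dK by metis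
    have "is_eigenvalue B \<Theta> l \<longleftrightarrow> (\<exists>v\<in>?K. v \<noteq> 0)"
      unfolding is_eigenvalue_def E using extend_solution_0[of "\<lambda>x. \<Phi> x l"] hf.init[OF l] by blast
    also have "\<dots> \<longleftrightarrow> ?K \<noteq> {0}" by (auto simp: ker_def)
    finally show "is_eigenvalue B \<Theta> l \<longleftrightarrow> d 1 l \<noteq> 0" unfolding ker_eq_0_iff_dim dK .
  qed

  \<comment> \<open>The flow function \<open>m\<close> is taken on the rectangle and then evaluated at its four corners.\<close>
  define V where "V p = Vmat (X3 (fst p) (snd p)) (X4 (fst p))" for p
  define Q where "Q = {0..1::real} \<times> {l1..l2}"
  have cV: "continuous_on Q V"
    unfolding V_def
  proof (rule continuous_on_Vmat)
    show "continuous_on Q (\<lambda>p. X3 (fst p) (snd p))" using bf.F_joint_continuous by (simp add: F Q_def)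
    show "continuous_on Q (\<lambda>p. X4 (fst p))"
      by (rule continuous_on_compose2[OF bf.G_cont]) (auto simp: Q_def intro!: continuous_intros)
  qed (auto simp: Q_def intro: X3_lagr X4_lagr)
  have uV: "unitary (V p)" if "p \<in> Q" for p
    unfolding V_def by (rule unitary_Vmat[OF X3_lagr X4_lagr]) (use that in \<open>auto simp: Q_def\<close>)
  have "convex Q" unfolding Q_def by (intro convex_Times) auto
  from flow_function_exists[OF this cV uV] obtain m :: "real \<times> real \<Rightarrow> int" where
    m0: "\<forall>S \<epsilon>. S \<subseteq> Q \<and> convex S \<and> 0 < \<epsilon> \<and> \<epsilon> < 2 * pi \<and> (\<forall>p\<in>S. cis \<epsilon> \<notin> spectrum_of (V p)) \<longrightarrow>
      (\<forall>p\<in>S. \<forall>q\<in>S. m p - int (eigcount (V p) {0..<\<epsilon>}) = m q - int (eigcount (V q) {0..<\<epsilon>}))" ..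
  have m: "m p - int (eigcount (V p) {0..<\<epsilon>}) = m q - int (eigcount (V q) {0..<\<epsilon>})"
    if "S \<subseteq> Q" "convex S" "0 < \<epsilon>" "\<epsilon> < 2 * pi" "\<And>p. p \<in> S \<Longrightarrow> cis \<epsilon> \<notin> spectrum_of (V p)" "p \<in> S" "q \<in> S"
    for S \<epsilon> p q
    by (rule m0[rule_format, of S \<epsilon>]) (use that in simp_all)
  have flow_x: "flow_fun (\<lambda>x. Vmat (X3 x l) (X4 x)) 0 1 (\<lambda>x. m (x, l))" if l: "l \<in> {l1..l2}" for l
    unfolding flow_fun_def
  proof (intro allI impI, elim conjE)
    fix a b \<epsilon> assume h: "0 \<le> a" "a \<le> b" "b \<le> 1" "0 < \<epsilon>" "\<epsilon> < 2 * pi"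
      and ns: "\<forall>t\<in>{a..b}. cis \<epsilon> \<notin> spectrum_of (Vmat (X3 t l) (X4 t))"
    have "m (b, l) - int (eigcount (V (b, l)) {0..<\<epsilon>}) = m (a, l) - int (eigcount (V (a, l)) {0..<\<epsilon>})"
      by (rule m[of "{a..b} \<times> {l}"]) (use h l ns in \<open>auto simp: Q_def V_def intro!: convex_Times\<close>)
    then show "m (b, l) - m (a, l) = int (eigcount (Vmat (X3 b l) (X4 b)) {0..<\<epsilon>}) - int (eigcount (Vmat (X3 a l) (X4 a)) {0..<\<epsilon>})"
      by (simp add: V_def)
  qed
  have flow_l: "flow_fun (\<lambda>l. Vmat (X3 x l) (X4 x)) l1 l2 (\<lambda>l. m (x, l))" if x: "x \<in> {0..1}" for x
    unfolding flow_fun_def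
  proof (intro allI impI, elim conjE)
    fix a b \<epsilon> assume h: "l1 \<le> a" "a \<le> b" "b \<le> l2" "0 < \<epsilon>" "\<epsilon> < 2 * pi"
      and ns: "\<forall>t\<in>{a..b}. cis \<epsilon> \<notin> spectrum_of (Vmat (X3 x t) (X4 x))"
    have "m (x, b) - int (eigcount (V (x, b)) {0..<\<epsilon>}) = m (x, a) - int (eigcount (V (x, a)) {0..<\<epsilon>})"
      by (rule m[of "{x} \<times> {a..b}"]) (use h x ns in \<open>auto simp: Q_def V_def intro!: convex_Times\<close>)
    then show "m (x, b) - m (x, a) = int (eigcount (Vmat (X3 x b) (X4 x)) {0..<\<epsilon>}) - int (eigcount (Vmat (X3 x a) (X4 x)) {0..<\<epsilon>})"
      by (simp add: V_def)
  qed
  have cX3x: "continuous_on {0..1} (\<lambda>x. X3 x l)" if "l \<in> {l1..l2}" for l using bf.F_cont_x[OF that] by (simp add: F)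
  have cX3l: "continuous_on {l1..l2} (\<lambda>l. X3 x l)" if "x \<in> {0..1}" for x using bf.F_cont_l[OF that] by (simp add: F)
  \<comment> \<open>Both frames solve the doubled system at \<open>l2\<close>, so their symplectic product is constant.\<close>
  have top: "m (1, l2) = m (0, l2)"
  proof (rule flow_fun_constant_kernel[OF flow_x[OF l2]])
    show "continuous_on {0..1} (\<lambda>x. Vmat (X3 x l2) (X4 x))"
      by (intro continuous_on_Vmat cX3x l2 bf.G_cont X3_lagr X4_lagr)
    show "vec.dim (ker (Vmat (X3 t l2) (X4 t) - mat 1)) = vec.dim (ker (Jmat ** A1 + sgnmat ** Jmat ** K0))" if "t \<in> {0..1}" for t
      using ker_Vmat(2)[OF X3_lagr[OF that l2] X4_lagr[OF that]] bf.sform_l2_const[OF that] by (simp add: F sform_def)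
  qed (use l2 in \<open>auto intro!: unitary_Vmat[OF X3_lagr X4_lagr]\<close>)
  \<comment> \<open>At \<open>x = 0\<close> the frame \<open>X3\<close> does not depend on the parameter.\<close>
  have left: "m (0, l1) = m (0, l2)"
  proof (rule flow_fun_constant_kernel[OF flow_l[OF zero] _ _ _ l1 l2])
    show "continuous_on {l1..l2} (\<lambda>l. Vmat (X3 0 l) (X4 0))"
      by (intro continuous_on_Vmat cX3l zero continuous_on_const X3_lagr X4_lagr)
    show "vec.dim (ker (Vmat (X3 0 t) (X4 0) - mat 1)) = vec.dim (ker (Vmat (X3 0 l1) (X4 0) - mat 1))" if "t \<in> {l1..l2}" for t
      using hf.init[OF that] hf.init[OF l1] by (simp add: X3_def)
  qed (auto intro!: unitary_Vmat[OF X3_lagr[OF zero] X4_lagr[OF zero]])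
  have maslov: "maslov_index (\<lambda>x. L3 x l1) L4 0 1 = m (1, l1) - m (0, l1)"
    unfolding L3_def L4_def
    by (rule maslov_index_flow_fun[OF _ cX3x[OF l1] bf.G_cont _ _ flow_x[OF l1]]) (auto intro: X3_lagr X4_lagr l1)
  \<comment> \<open>As \<open>\<lambda>\<close> grows, eigenvalues leave \<open>1\<close> clockwise; a crossing at \<open>l2\<close> is therefore not counted.\<close>
  have right: "finite {l\<in>{l1..l2}. d 1 l \<noteq> 0}" "m (1, l1) - m (1, l2) = int (\<Sum>l | l \<in> {l1..<l2} \<and> d 1 l \<noteq> 0. d 1 l)"
  proof -
    have cr: "\<exists>\<eta>>0. \<forall>l\<in>{l1..l2}. \<bar>l - l0\<bar> < \<eta> \<longrightarrow>
       (\<forall>h\<in>ker (sform (X3 1 l0) (X4 1)). h \<noteq> 0 \<longrightarrow>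
         (l0 < l \<longrightarrow> (\<exists>q>0. norm (cross_form (X3 1 l) (X4 1) h + of_real q) \<le> \<kappa> * q)) \<and>
         (l < l0 \<longrightarrow> (\<exists>q>0. norm (cross_form (X3 1 l) (X4 1) h - of_real q) \<le> \<kappa> * q)))"
      if l0: "l0 \<in> {l1..l2}" and k: "0 < \<kappa>" for l0 \<kappa>
    proof -
      have "AE x in ?M. (B x has_vector_derivative Bl x l0) (at l0 within {l1..l2})"
        using der by eventually_elim (use l0 in blast)
      from bf.lambda_crossing[OF l0 this pd[OF sub[OF l0]] k] show ?thesis unfolding F .
    qed
    note R = flow_fun_cw_crossings[OF less_imp_le[OF l12] cX3l[OF one] continuous_on_const X3_lagr[OF one] X4_lagr[OF one] flow_l[OF one] cr]
    show "finite {l\<in>{l1..l2}. d 1 l \<noteq> 0}" "m (1, l1) - m (1, l2) = int (\<Sum>l | l \<in> {l1..<l2} \<and> d 1 l \<noteq> 0. d 1 l)"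
      unfolding d_def by (rule R; assumption)+
  qed
  have ev: "{l. l \<in> {l1..<l2} \<and> is_eigenvalue B \<Theta> l} = {l. l \<in> {l1..<l2} \<and> d 1 l \<noteq> 0}" using eig(2) by auto
  have count: "spectral_count B \<Theta> {l1..<l2} = (\<Sum>l | l \<in> {l1..<l2} \<and> d 1 l \<noteq> 0. d 1 l)"
    unfolding spectral_count_def ev by (rule sum.cong) (use eig(1) in auto)
  have fin: "finite {l \<in> {l1..<l2}. is_eigenvalue B \<Theta> l}"
    unfolding ev by (rule finite_subset[OF _ right(1)]) auto
  have first: "int (spectral_count B \<Theta> {l1..<l2}) = m (1, l1) - m (0, l1)" using count right(2) top left by simp
  \<comment> \<open>As \<open>x\<close> grows, eigenvalues arrive at \<open>1\<close> counterclockwise; an intersection at \<open>x = 0\<close> is therefore not counted.\<close>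
  have second: "finite {x \<in> {0<..1}. ker (sform (X3 x l1) (X4 x)) \<noteq> {0}} \<and>
      m (1, l1) - m (0, l1) = int (\<Sum>x | x \<in> {0<..1} \<and> ker (sform (X3 x l1) (X4 x)) \<noteq> {0}. vec.dim (ker (sform (X3 x l1) (X4 x))))"
    if nn: "AE x in ?M. nonneg_def (B x l2 - B x l1)"
      and noint: "\<not> (\<exists>a b. 0 \<le> a \<and> a < b \<and> b \<le> 1 \<and> (\<forall>x\<in>{a..b}. vec.dim (L3 x l1 \<inter> L4 x) \<noteq> 0))"
  proof -
    have noint': "\<not> (\<exists>a b. 0 \<le> a \<and> a < b \<and> b \<le> 1 \<and> (\<forall>x\<in>{a..b}. vec.dim (col_space (bf.F x l1) \<inter> col_space (X4 x)) \<noteq> 0))"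
      using noint unfolding L3_def L4_def F .
    note C = flow_fun_ccw_crossings[OF zero_le_one cX3x[OF l1] bf.G_cont X3_lagr[OF _ l1] X4_lagr flow_x[OF l1]
        bf.x_crossing[OF nn noint', unfolded F]]
    have fC: "finite {x\<in>{0..1}. d x l1 \<noteq> 0}" "m (1, l1) - m (0, l1) = int (\<Sum>x | x \<in> {0<..1} \<and> d x l1 \<noteq> 0. d x l1)"
      unfolding d_def by (rule C; assumption)+
    have s: "{x. x \<in> {0<..1} \<and> ker (sform (X3 x l1) (X4 x)) \<noteq> {0}} = {x. x \<in> {0<..1} \<and> d x l1 \<noteq> 0}"
      unfolding d_def ker_eq_0_iff_dim ..
    have "finite {x. x \<in> {0<..1} \<and> d x l1 \<noteq> 0}" by (rule finite_subset[OF _ fC(1)]) auto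
    then show ?thesis unfolding s using fC(2) by (simp add: d_def)
  qed
  show ?thesis
    using fin first maslov second unfolding sform_def by (metis (no_types, lifting) of_nat_eq_iff)
qed

end
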